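(* Let $R$ be a commutative Gorenstein ring and let $\Lambda$ be a (not necessarily commutative) finite $R$-algebra of finite global dimension $\delta$ such that the canonical map $R\to\Lambda$ is a monomorphism. Suppose that $\Lambda$ is maximal Cohen-Macaulay as an $R$-module. Then, for any finitely generated $R$-module $M$, $$(\underline{\mathrm{ann}}_R\Lambda)^{e+1}\subseteq \underline{\mathrm{ann}}_R\, M_\Lambda^{\mathrm{st}},$$ where $M_\Lambda=M\otimes_R\Lambda$, $M_\Lambda^{\mathrm{st}}$ is its image in $\underline{\mathrm{MCM}}(R)$, and $e$ is the projective dimension of $M_\Lambda$ as a $\Lambda$-module. If, moreover, the map $R\to\Lambda$ is a split monomorphism (of $R$-modules), then $$(\underline{\mathrm{ann}}_R\Lambda)^{\delta+1}\subseteq \mathrm{ca}(R)\subseteq \underline{\mathrm{ann}}_R\Lambda .$$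
   Context: All rings are Noetherian and all modules are finitely generated. A commutative Noetherian ring $R$ is Gorenstein if it has finite injective dimension as a module over itself. For $R$ Gorenstein, an $R$-module $M$ is maximal Cohen-Macaulay if $\mathrm{Ext}^i_R(M,R)=0$ for all $i>0$; $\mathrm{MCM}(R)$ is the full subcategory of such modules. The stable category $\underline{\mathrm{MCM}}(R)$ has the same objects, with morphisms $\underline{\mathrm{Hom}}_R(M,N)=\mathrm{Hom}_R(M,N)/P(M,N)$, where $P(M,N)$ is the submodule of homomorphisms factoring through a projective module; $\underline{\mathrm{End}}_R(M)=\underline{\mathrm{Hom}}_R(M,M)$. For $M\in\mathrm{MCM}(R)$ the stable annihilator is $\underline{\mathrm{ann}}_R(M)=\mathrm{ann}_R\,\underline{\mathrm{End}}_R(M)$. There is an $R$-linear triangulated equivalence $\underline{\mathrm{MCM}}(R)\cong D^b_{sg}(R)=D^b(R)/\mathrm{perf}\,R$ (Verdier quotient of the bounded derived category of finitely generated modules by the perfect complexes). For a finitely generated $R$-module $X$, $X^{\mathrm{st}}\in\underline{\mathrm{MCM}}(R)$ denotes the object corresponding to $X\in D^b_{sg}(R)$ under this equivalence (its maximal Cohen-Macaulay approximation, or stabilization). Here $M_\Lambda$ is regarded as an $R$-module when forming $M_\Lambda^{\mathrm{st}}$. The cohomology annihilator of $R$ is $\mathrm{ca}(R)=\bigcup_{n\ge 0}\mathrm{ca}^n(R)$, where $\mathrm{ca}^n(R)=\bigcap_{M,N}\mathrm{ann}_R\mathrm{Ext}_R^n(M,N)$ over all finitely generated $R$-modules $M,N$.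 *)

theory Defs
  imports "HOL-Library.Extended_Nat" "HOL-Algebra.Ideal_Product" "HOL-Algebra.Ring_Divisibility"
    "HOL-Algebra.Module"
begin

section \<open>Modules over a not necessarily commutative ring\<close>

text \<open>
  The library locale \<open>module\<close> asks for a commutative ring of scalars.  The locale below has
  the same axioms over an arbitrary ring and uses the same record type, so that the two
  notions coincide over a commutative ring.  A right \<open>A\<close>-module is a left module over
  \<open>opposite_ring A\<close>.
\<close>

locale left_module = A?: ring A + M?: abelian_group M
  for A :: "('a, 'r) ring_scheme" (structure) and M :: "('a, 'm) module" (structure) +
  assumes lm_smult_closed:
      "\<lbrakk>a \<in> carrier A; x \<in> carrier M\<rbrakk> \<Longrightarrow> a \<odot>\<^bsub>M\<^esub> x \<in> carrier M"
    and lm_smult_l_distr: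
      "\<lbrakk>a \<in> carrier A; b \<in> carrier A; x \<in> carrier M\<rbrakk> \<Longrightarrow>
        (a \<oplus>\<^bsub>A\<^esub> b) \<odot>\<^bsub>M\<^esub> x = a \<odot>\<^bsub>M\<^esub> x \<oplus>\<^bsub>M\<^esub> b \<odot>\<^bsub>M\<^esub> x"
    and lm_smult_r_distr:
      "\<lbrakk>a \<in> carrier A; x \<in> carrier M; y \<in> carrier M\<rbrakk> \<Longrightarrow>
        a \<odot>\<^bsub>M\<^esub> (x \<oplus>\<^bsub>M\<^esub> y) = a \<odot>\<^bsub>M\<^esub> x \<oplus>\<^bsub>M\<^esub> a \<odot>\<^bsub>M\<^esub> y"
    and lm_smult_assoc:
      "\<lbrakk>a \<in> carrier A; b \<in> carrier A; x \<in> carrier M\<rbrakk> \<Longrightarrow>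
        (a \<otimes>\<^bsub>A\<^esub> b) \<odot>\<^bsub>M\<^esub> x = a \<odot>\<^bsub>M\<^esub> (b \<odot>\<^bsub>M\<^esub> x)"
    and lm_smult_one:
      "x \<in> carrier M \<Longrightarrow> \<one>\<^bsub>A\<^esub> \<odot>\<^bsub>M\<^esub> x = x"

lemma left_module_iff_module:
  assumes "cring R"
  shows "left_module R M \<longleftrightarrow> module R M"
proof
  assume "left_module R M"
  then interpret left_module R M .
  show "module R M"
    by (intro moduleI assms abelian_group_axioms lm_smult_closed lm_smult_l_distr
        lm_smult_r_distr lm_smult_assoc lm_smult_one)
next
  assume "module R M"
  then interpret module R M .
  show "left_module R M"
    by (intro left_module.intro left_module_axioms.intro)
      (simp_all add: R.ring_axioms M.abelian_group_axioms smult_l_distr smult_r_distr smult_assoc1)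
qed

definition opposite_ring :: "('a, 'r) ring_scheme \<Rightarrow> ('a, 'r) ring_scheme" where
  "opposite_ring A = A\<lparr>monoid.mult := \<lambda>x y. y \<otimes>\<^bsub>A\<^esub> x\<rparr>"

text \<open>The fields \<open>mult\<close> and \<open>one\<close> of a module record carry no meaning for the module.\<close>

definition regular_module :: "('a, 'r) ring_scheme \<Rightarrow> ('a, 'a) module" where
  "regular_module A = \<lparr>carrier = carrier A, monoid.mult = monoid.mult A, one = one A, ring.zero = ring.zero A,
     ring.add = ring.add A, smult = monoid.mult A\<rparr>"

definition restrict_scalars :: "('a \<Rightarrow> 'l) \<Rightarrow> ('l, 'm) module \<Rightarrow> ('a, 'm) module" where
  "restrict_scalars \<phi> M = \<lparr>carrier = carrier M, monoid.mult = monoid.mult M, one = one M, ring.zero = ring.zero M,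
     ring.add = ring.add M, smult = \<lambda>r x. \<phi> r \<odot>\<^bsub>M\<^esub> x\<rparr>"

definition fg_module :: "('a, 'r) ring_scheme \<Rightarrow> ('a, 'm) module \<Rightarrow> bool" where
  "fg_module A M \<longleftrightarrow> left_module A M \<and>
     (\<exists>S. finite S \<and> S \<subseteq> carrier M \<and>
       (\<forall>N. submodule N A M \<and> S \<subseteq> N \<longrightarrow> N = carrier M))"

text \<open>
  HOL cannot quantify over types inside a definition, so quantification over ``all modules''
  is quantification over the modules whose carrier lies in the following type.  Up to
  isomorphism these comprise all finitely generated modules over a ring with elements
  in \<open>'a\<close>: such a module is \<open>A\<^sup>n / K\<close>, and its elements are cosets of \<open>K\<close>, which
  are sets of (finitely supported) families \<open>nat \<Rightarrow> 'a\<close>.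
\<close>

type_synonym 'a univ = "(nat \<Rightarrow> 'a) set"

definition module_hom :: "('a, 'r) ring_scheme \<Rightarrow> ('a, 'm) module \<Rightarrow> ('a, 'n) module \<Rightarrow>
    ('m \<Rightarrow> 'n) set" where
  "module_hom A M N = {f \<in> carrier M \<rightarrow> carrier N.
     (\<forall>x\<in>carrier M. \<forall>y\<in>carrier M. f (x \<oplus>\<^bsub>M\<^esub> y) = f x \<oplus>\<^bsub>N\<^esub> f y) \<and>
     (\<forall>a\<in>carrier A. \<forall>x\<in>carrier M. f (a \<odot>\<^bsub>M\<^esub> x) = a \<odot>\<^bsub>N\<^esub> f x)}"

definition quotient_module :: "('a, 'm) module \<Rightarrow> 'm set \<Rightarrow> ('a, 'm set) module" where
  "quotient_module M N = \<lparr>carrier = a_rcosets\<^bsub>M\<^esub> N, monoid.mult = \<lambda>_ _. undefined, one = undefined,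
     ring.zero = N, ring.add = set_add M, smult = \<lambda>r X. \<Union>x\<in>X. N +>\<^bsub>M\<^esub> (r \<odot>\<^bsub>M\<^esub> x)\<rparr>"

definition annihilator :: "('a, 'r) ring_scheme \<Rightarrow> ('a, 'm) module \<Rightarrow> 'a set" where
  "annihilator R M = {r \<in> carrier R. \<forall>x\<in>carrier M. r \<odot>\<^bsub>M\<^esub> x = \<zero>\<^bsub>M\<^esub>}"


section \<open>Projective and injective modules, homological dimensions\<close>

text \<open>
  Lifting is tested against surjections in \<open>'a univ\<close> only.  For finitely generated \<open>P\<close>
  this is projectivity, since a surjection from a free module of finite rank onto \<open>P\<close> is
  isomorphic to one in \<open>'a univ\<close>.
\<close>

definition fg_projective :: "('a, 'r) ring_scheme \<Rightarrow> ('a, 'm) module \<Rightarrow> bool" where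
  "fg_projective A P \<longleftrightarrow> fg_module A P \<and>
     (\<forall>(B :: ('a, 'a univ) module) (C :: ('a, 'a univ) module) g f.
        left_module A B \<and> left_module A C \<and>
        g \<in> module_hom A B C \<and> g ` carrier B = carrier C \<and> f \<in> module_hom A P C \<longrightarrow>
        (\<exists>h\<in>module_hom A P B. \<forall>x\<in>carrier P. g (h x) = f x))"

text \<open>
  Extension is tested against monomorphisms in \<open>'a univ\<close>, among which are (copies of) the
  inclusions of the left ideals of \<open>A\<close>; by Baer's criterion this is injectivity.
\<close>

definition injective_module :: "('a, 'r) ring_scheme \<Rightarrow> ('a, 'm) module \<Rightarrow> bool" where
  "injective_module A I \<longleftrightarrow> left_module A I \<and>
     (\<forall>(B :: ('a, 'a univ) module) (C :: ('a, 'a univ) module) g f.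
        left_module A B \<and> left_module A C \<and>
        g \<in> module_hom A B C \<and> inj_on g (carrier B) \<and> f \<in> module_hom A B I \<longrightarrow>
        (\<exists>h\<in>module_hom A C I. \<forall>x\<in>carrier B. h (g x) = f x))"

text \<open>\<open>\<dots> \<rightarrow> P 1 \<rightarrow> P 0 \<rightarrow> M \<rightarrow> 0\<close> with \<open>d i : P (i + 1) \<rightarrow> P i\<close> and augmentation \<open>\<epsilon> : P 0 \<rightarrow> M\<close>.\<close>

definition projective_resolution ::
    "('a, 'r) ring_scheme \<Rightarrow> ('a, 'm) module \<Rightarrow>
     (nat \<Rightarrow> ('a, 'a univ) module) \<Rightarrow> (nat \<Rightarrow> 'a univ \<Rightarrow> 'a univ) \<Rightarrow> ('a univ \<Rightarrow> 'm) \<Rightarrow> bool" where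
  "projective_resolution A M P d \<epsilon> \<longleftrightarrow>
     (\<forall>i. fg_projective A (P i)) \<and>
     (\<forall>i. d i \<in> module_hom A (P (Suc i)) (P i)) \<and>
     \<epsilon> \<in> module_hom A (P 0) M \<and>
     \<epsilon> ` carrier (P 0) = carrier M \<and>
     d 0 ` carrier (P 1) = {x \<in> carrier (P 0). \<epsilon> x = \<zero>\<^bsub>M\<^esub>} \<and>
     (\<forall>i. d (Suc i) ` carrier (P (Suc (Suc i))) =
          {x \<in> carrier (P (Suc i)). d i x = \<zero>\<^bsub>P i\<^esub>})"

definition proj_dim :: "('a, 'r) ring_scheme \<Rightarrow> ('a, 'm) module \<Rightarrow> enat" where
  "proj_dim A M = Inf {enat n | n. \<exists>P d \<epsilon>. projective_resolution A M P d \<epsilon> \<and>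
     (\<forall>i>n. carrier (P i) = {\<zero>\<^bsub>P i\<^esub>})}"

definition gl_dim :: "('a, 'r) ring_scheme \<Rightarrow> enat" where
  "gl_dim A = Sup {proj_dim A M | M :: ('a, 'a univ) module. fg_module A M}"

text \<open>
  \<open>0 \<rightarrow> M \<rightarrow> I 0 \<rightarrow> I 1 \<rightarrow> \<dots>\<close>  Injective modules are rarely finitely generated, but over a
  Noetherian ring the terms of the minimal injective resolution of a finitely generated
  module have cardinality at most that of \<open>nat \<Rightarrow> 'a\<close> (unless the ring is zero, when they are zero),
  so they too have isomorphic copies in \<open>'a univ\<close>.
\<close>

definition injective_resolution ::
    "('a, 'r) ring_scheme \<Rightarrow> ('a, 'm) module \<Rightarrow>
     (nat \<Rightarrow> ('a, 'a univ) module) \<Rightarrow> (nat \<Rightarrow> 'a univ \<Rightarrow> 'a univ) \<Rightarrow> ('m \<Rightarrow> 'a univ) \<Rightarrow> bool" where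
  "injective_resolution A M I d \<eta> \<longleftrightarrow>
     (\<forall>i. injective_module A (I i)) \<and>
     (\<forall>i. d i \<in> module_hom A (I i) (I (Suc i))) \<and>
     \<eta> \<in> module_hom A M (I 0) \<and>
     inj_on \<eta> (carrier M) \<and>
     \<eta> ` carrier M = {x \<in> carrier (I 0). d 0 x = \<zero>\<^bsub>I 1\<^esub>} \<and>
     (\<forall>i. d i ` carrier (I i) =
          {x \<in> carrier (I (Suc i)). d (Suc i) x = \<zero>\<^bsub>I (Suc (Suc i))\<^esub>})"

definition inj_dim :: "('a, 'r) ring_scheme \<Rightarrow> ('a, 'm) module \<Rightarrow> enat" where
  "inj_dim A M = Inf {enat n | n. \<exists>I d \<eta>. injective_resolution A M I d \<eta> \<and>
     (\<forall>i>n. carrier (I i) = {\<zero>\<^bsub>I i\<^esub>})}"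

definition gorenstein :: "('a, 'r) ring_scheme \<Rightarrow> bool" where
  "gorenstein R \<longleftrightarrow> cring R \<and> noetherian_ring R \<and> inj_dim R (regular_module R) < \<infinity>"


section \<open>Ext, maximal Cohen-Macaulay modules, the cohomology annihilator\<close>

text \<open>
  From here on the ring \<open>R\<close> is meant to be commutative, so that \<open>Hom\<close> and \<open>Ext\<close> are \<open>R\<close>-modules.
  Elements of \<open>Hom\<close> are made extensional so that a homomorphism is determined by its
  values on the carrier.
\<close>

definition Hom_module :: "('a, 'r) ring_scheme \<Rightarrow> ('a, 'm) module \<Rightarrow> ('a, 'n) module \<Rightarrow>
    ('a, 'm \<Rightarrow> 'n) module" where
  "Hom_module R M N = \<lparr>carrier = module_hom R M N \<inter> extensional (carrier M),
     monoid.mult = \<lambda>_ _. undefined, one = undefined,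
     ring.zero = (\<lambda>x\<in>carrier M. \<zero>\<^bsub>N\<^esub>),
     ring.add = (\<lambda>f g. \<lambda>x\<in>carrier M. f x \<oplus>\<^bsub>N\<^esub> g x),
     smult = (\<lambda>r f. \<lambda>x\<in>carrier M. r \<odot>\<^bsub>N\<^esub> f x)\<rparr>"

text \<open>The \<open>n\<close>-th cohomology module of the complex \<open>Hom(P, N)\<close>.\<close>

definition Hom_cocycles :: "('a, 'r) ring_scheme \<Rightarrow> (nat \<Rightarrow> ('a, 'p) module) \<Rightarrow>
    (nat \<Rightarrow> 'p \<Rightarrow> 'p) \<Rightarrow> ('a, 'n) module \<Rightarrow> nat \<Rightarrow> ('p \<Rightarrow> 'n) set" where
  "Hom_cocycles R P d N n =
     {f \<in> carrier (Hom_module R (P n) N). \<forall>x\<in>carrier (P (Suc n)). f (d n x) = \<zero>\<^bsub>N\<^esub>}"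

definition Hom_coboundaries :: "('a, 'r) ring_scheme \<Rightarrow> (nat \<Rightarrow> ('a, 'p) module) \<Rightarrow>
    (nat \<Rightarrow> 'p \<Rightarrow> 'p) \<Rightarrow> ('a, 'n) module \<Rightarrow> nat \<Rightarrow> ('p \<Rightarrow> 'n) set" where
  "Hom_coboundaries R P d N n = (case n of
       0 \<Rightarrow> {\<zero>\<^bsub>Hom_module R (P 0) N\<^esub>}
     | Suc k \<Rightarrow> (\<lambda>g. \<lambda>x\<in>carrier (P (Suc k)). g (d k x)) ` carrier (Hom_module R (P k) N))"

definition Hom_cohomology :: "('a, 'r) ring_scheme \<Rightarrow> (nat \<Rightarrow> ('a, 'p) module) \<Rightarrow>
    (nat \<Rightarrow> 'p \<Rightarrow> 'p) \<Rightarrow> ('a, 'n) module \<Rightarrow> nat \<Rightarrow> ('a, ('p \<Rightarrow> 'n) set) module" where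
  "Hom_cohomology R P d N n =
     quotient_module ((Hom_module R (P n) N)\<lparr>carrier := Hom_cocycles R P d N n\<rparr>)
       (Hom_coboundaries R P d N n)"

text \<open>
  A choice of resolution, as usual; another choice gives an isomorphic module.  Over a
  Noetherian ring every finitely generated module has such a resolution.
\<close>

definition Ext :: "('a, 'r) ring_scheme \<Rightarrow> nat \<Rightarrow> ('a, 'm) module \<Rightarrow> ('a, 'n) module \<Rightarrow>
    ('a, ('a univ \<Rightarrow> 'n) set) module" where
  "Ext R n M N = (case (SOME (P, d). \<exists>\<epsilon>. projective_resolution R M P d \<epsilon>) of
     (P, d) \<Rightarrow> Hom_cohomology R P d N n)"

definition mcm :: "('a, 'r) ring_scheme \<Rightarrow> ('a, 'm) module \<Rightarrow> bool" where
  "mcm R M \<longleftrightarrow> fg_module R M \<and>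
     (\<forall>i>0. carrier (Ext R i M (regular_module R)) = {\<zero>\<^bsub>Ext R i M (regular_module R)\<^esub>})"

definition ca_n :: "('a, 'r) ring_scheme \<Rightarrow> nat \<Rightarrow> 'a set" where
  "ca_n R n = {r \<in> carrier R. \<forall>(M :: ('a, 'a univ) module) (N :: ('a, 'a univ) module).
     fg_module R M \<and> fg_module R N \<longrightarrow> r \<in> annihilator R (Ext R n M N)}"

definition ca :: "('a, 'r) ring_scheme \<Rightarrow> 'a set" where
  "ca R = (\<Union>n. ca_n R n)"


section \<open>Stable homomorphisms and the stable annihilator\<close>

definition projective_homs :: "('a, 'r) ring_scheme \<Rightarrow> ('a, 'm) module \<Rightarrow> ('a, 'n) module \<Rightarrow>
    ('m \<Rightarrow> 'n) set" where
  "projective_homs R M N = {f \<in> carrier (Hom_module R M N).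
     \<exists>(P :: ('a, 'a univ) module) g h. fg_projective R P \<and>
       g \<in> module_hom R M P \<and> h \<in> module_hom R P N \<and> (\<forall>x\<in>carrier M. f x = h (g x))}"

definition stable_Hom :: "('a, 'r) ring_scheme \<Rightarrow> ('a, 'm) module \<Rightarrow> ('a, 'n) module \<Rightarrow>
    ('a, ('m \<Rightarrow> 'n) set) module" where
  "stable_Hom R M N = quotient_module (Hom_module R M N) (projective_homs R M N)"

definition stable_ann :: "('a, 'r) ring_scheme \<Rightarrow> ('a, 'm) module \<Rightarrow> 'a set" where
  "stable_ann R M = annihilator R (stable_Hom R M M)"


section \<open>The singularity category\<close>

text \<open>
  Complexes are graded cohomologically: \<open>cdiff C i\<close> maps \<open>cterm C i\<close> to \<open>cterm C (i + 1)\<close>.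
\<close>

record ('a, 'm) cochain_complex =
  cterm :: "int \<Rightarrow> ('a, 'm) module"
  cdiff :: "int \<Rightarrow> 'm \<Rightarrow> 'm"

definition bounded_complex :: "('a, 'r) ring_scheme \<Rightarrow> ('a, 'm) cochain_complex \<Rightarrow> bool" where
  "bounded_complex R C \<longleftrightarrow>
     (\<forall>i. fg_module R (cterm C i)) \<and>
     (\<forall>i. cdiff C i \<in> module_hom R (cterm C i) (cterm C (i + 1))) \<and>
     (\<forall>i. \<forall>x\<in>carrier (cterm C i). cdiff C (i + 1) (cdiff C i x) = \<zero>\<^bsub>cterm C (i + 1 + 1)\<^esub>) \<and>
     (\<exists>n. \<forall>i. \<bar>i\<bar> > n \<longrightarrow> carrier (cterm C i) = {\<zero>\<^bsub>cterm C i\<^esub>})"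

definition chain_map :: "('a, 'r) ring_scheme \<Rightarrow> ('a, 'm) cochain_complex \<Rightarrow>
    ('a, 'n) cochain_complex \<Rightarrow> (int \<Rightarrow> 'm \<Rightarrow> 'n) \<Rightarrow> bool" where
  "chain_map R C D f \<longleftrightarrow>
     (\<forall>i. f i \<in> module_hom R (cterm C i) (cterm D i)) \<and>
     (\<forall>i. \<forall>x\<in>carrier (cterm C i). f (i + 1) (cdiff C i x) = cdiff D i (f i x))"

definition chain_comp :: "(int \<Rightarrow> 'n \<Rightarrow> 'p) \<Rightarrow> (int \<Rightarrow> 'm \<Rightarrow> 'n) \<Rightarrow> (int \<Rightarrow> 'm \<Rightarrow> 'p)"
    (infixl \<open>\<circ>\<^sub>c\<close> 55) where
  "g \<circ>\<^sub>c f = (\<lambda>i. g i \<circ> f i)"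

definition chain_homotopic :: "('a, 'r) ring_scheme \<Rightarrow> ('a, 'm) cochain_complex \<Rightarrow>
    ('a, 'n) cochain_complex \<Rightarrow> (int \<Rightarrow> 'm \<Rightarrow> 'n) \<Rightarrow> (int \<Rightarrow> 'm \<Rightarrow> 'n) \<Rightarrow> bool" where
  "chain_homotopic R C D f g \<longleftrightarrow>
     (\<exists>h. (\<forall>i. h i \<in> module_hom R (cterm C i) (cterm D (i - 1))) \<and>
          (\<forall>i. \<forall>x\<in>carrier (cterm C i).
             f i x = g i x \<oplus>\<^bsub>cterm D i\<^esub>
               (cdiff D (i - 1) (h i x) \<oplus>\<^bsub>cterm D i\<^esub> h (i + 1) (cdiff C i x))))"

definition cocycles :: "('a, 'm) cochain_complex \<Rightarrow> int \<Rightarrow> 'm set" where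
  "cocycles C i = {x \<in> carrier (cterm C i). cdiff C i x = \<zero>\<^bsub>cterm C (i + 1)\<^esub>}"

definition coboundaries :: "('a, 'm) cochain_complex \<Rightarrow> int \<Rightarrow> 'm set" where
  "coboundaries C i = cdiff C (i - 1) ` carrier (cterm C (i - 1))"

text \<open>The last two conjuncts are injectivity and surjectivity of the maps induced on cohomology.\<close>

definition quasi_isomorphism :: "('a, 'r) ring_scheme \<Rightarrow> ('a, 'm) cochain_complex \<Rightarrow>
    ('a, 'n) cochain_complex \<Rightarrow> (int \<Rightarrow> 'm \<Rightarrow> 'n) \<Rightarrow> bool" where
  "quasi_isomorphism R C D f \<longleftrightarrow> chain_map R C D f \<and>
     (\<forall>i. \<forall>x\<in>cocycles C i. f i x \<in> coboundaries D i \<longrightarrow> x \<in> coboundaries C i) \<and>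
     (\<forall>i. \<forall>y\<in>cocycles D i. \<exists>x\<in>cocycles C i. y \<ominus>\<^bsub>cterm D i\<^esub> f i x \<in> coboundaries D i)"

definition perfect_complex :: "('a, 'r) ring_scheme \<Rightarrow> ('a, 'm) cochain_complex \<Rightarrow> bool" where
  "perfect_complex R C \<longleftrightarrow> bounded_complex R C \<and>
     (\<exists>(P :: ('a, 'a univ) cochain_complex) f. bounded_complex R P \<and>
        (\<forall>i. fg_projective R (cterm P i)) \<and> quasi_isomorphism R P C f)"

definition direct_sum_module :: "('a, 'm) module \<Rightarrow> ('a, 'n) module \<Rightarrow> ('a, 'm \<times> 'n) module" where
  "direct_sum_module M N = \<lparr>carrier = carrier M \<times> carrier N,
     monoid.mult = \<lambda>_ _. undefined, one = undefined, ring.zero = (\<zero>\<^bsub>M\<^esub>, \<zero>\<^bsub>N\<^esub>),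
     ring.add = (\<lambda>(x, y) (x', y'). (x \<oplus>\<^bsub>M\<^esub> x', y \<oplus>\<^bsub>N\<^esub> y')),
     smult = (\<lambda>r (x, y). (r \<odot>\<^bsub>M\<^esub> x, r \<odot>\<^bsub>N\<^esub> y))\<rparr>"

definition mapping_cone :: "('a, 'm) cochain_complex \<Rightarrow> ('a, 'n) cochain_complex \<Rightarrow>
    (int \<Rightarrow> 'm \<Rightarrow> 'n) \<Rightarrow> ('a, 'm \<times> 'n) cochain_complex" where
  "mapping_cone C D f = \<lparr>
     cterm = (\<lambda>i. direct_sum_module (cterm C (i + 1)) (cterm D i)),
     cdiff = (\<lambda>i (x, y). (\<ominus>\<^bsub>cterm C (i + 1 + 1)\<^esub> cdiff C (i + 1) x,
                          f (i + 1) x \<oplus>\<^bsub>cterm D (i + 1)\<^esub> cdiff D i y))\<rparr>"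

text \<open>
  \<open>D\<^sup>b(R) / perf R\<close> is the Verdier quotient of the homotopy category of bounded complexes of
  finitely generated modules by the subcategory of perfect complexes (which contains the
  acyclic ones, so that \<open>D\<^sup>b(R)\<close> need not be formed first).  It is described by the calculus of
  fractions: the denominators are the chain maps with perfect cone, and a morphism from \<open>X\<close>
  to \<open>Y\<close> is a class of roofs \<open>X \<leftarrow> W \<rightarrow> Y\<close> with legs \<open>s\<close> (a denominator) and \<open>f\<close>, standing for
  \<open>f s\<^sup>-\<^sup>1\<close>.
\<close>

definition sg_denominator :: "('a, 'r) ring_scheme \<Rightarrow> ('a, 'm) cochain_complex \<Rightarrow>
    ('a, 'n) cochain_complex \<Rightarrow> (int \<Rightarrow> 'm \<Rightarrow> 'n) \<Rightarrow> bool" where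
  "sg_denominator R C D s \<longleftrightarrow> chain_map R C D s \<and> perfect_complex R (mapping_cone C D s)"

definition sg_roof :: "('a, 'r) ring_scheme \<Rightarrow> ('a, 'm) cochain_complex \<Rightarrow>
    ('a, 'n) cochain_complex \<Rightarrow> ('a, 'a univ) cochain_complex \<Rightarrow>
    (int \<Rightarrow> 'a univ \<Rightarrow> 'm) \<Rightarrow> (int \<Rightarrow> 'a univ \<Rightarrow> 'n) \<Rightarrow> bool" where
  "sg_roof R X Y W s f \<longleftrightarrow> bounded_complex R W \<and> sg_denominator R W X s \<and> chain_map R W Y f"

text \<open>
  The composite of \<open>f s\<^sup>-\<^sup>1 : X \<rightarrow> Y\<close> (roof over \<open>W\<close>) with \<open>g t\<^sup>-\<^sup>1 : Y \<rightarrow> X\<close> (roof over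
  \<open>W'\<close>) is the identity of \<open>X\<close>.  For \<open>f u \<simeq> t v\<close> with a denominator \<open>u\<close> the composite is
  \<open>(g v) (s u)\<^sup>-\<^sup>1\<close>, and equality with the identity means \<open>g v \<simeq> s u\<close> after precomposition with
  a further denominator, which is absorbed into \<open>u\<close> and \<open>v\<close>.
\<close>

definition sg_composite_is_id :: "('a, 'r) ring_scheme \<Rightarrow> ('a, 'm) cochain_complex \<Rightarrow>
    ('a, 'n) cochain_complex \<Rightarrow>
    ('a, 'a univ) cochain_complex \<Rightarrow> (int \<Rightarrow> 'a univ \<Rightarrow> 'm) \<Rightarrow> (int \<Rightarrow> 'a univ \<Rightarrow> 'n) \<Rightarrow>
    ('a, 'a univ) cochain_complex \<Rightarrow> (int \<Rightarrow> 'a univ \<Rightarrow> 'n) \<Rightarrow> (int \<Rightarrow> 'a univ \<Rightarrow> 'm) \<Rightarrow> bool" where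
  "sg_composite_is_id R X Y W s f W' t g \<longleftrightarrow>
     (\<exists>(V :: ('a, 'a univ) cochain_complex) u v.
        bounded_complex R V \<and> sg_denominator R V W u \<and> chain_map R V W' v \<and>
        chain_homotopic R V Y (f \<circ>\<^sub>c u) (t \<circ>\<^sub>c v) \<and>
        chain_homotopic R V X (g \<circ>\<^sub>c v) (s \<circ>\<^sub>c u))"

definition sg_isomorphic :: "('a, 'r) ring_scheme \<Rightarrow> ('a, 'm) cochain_complex \<Rightarrow>
    ('a, 'n) cochain_complex \<Rightarrow> bool" where
  "sg_isomorphic R X Y \<longleftrightarrow> bounded_complex R X \<and> bounded_complex R Y \<and>
     (\<exists>W s f W' t g. sg_roof R X Y W s f \<and> sg_roof R Y X W' t g \<and>
        sg_composite_is_id R X Y W s f W' t g \<and>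
        sg_composite_is_id R Y X W' t g W s f)"

definition stalk_complex :: "('a, 'm) module \<Rightarrow> ('a, 'm) cochain_complex" where
  "stalk_complex M = \<lparr>
     cterm = (\<lambda>i. if i = 0 then M else M\<lparr>carrier := {\<zero>\<^bsub>M\<^esub>}\<rparr>),
     cdiff = (\<lambda>_ _. \<zero>\<^bsub>M\<^esub>)\<rparr>"

text \<open>
  The equivalence between the stable category and \<open>D\<^sup>b(R) / perf R\<close> sends a maximal Cohen-Macaulay
  module to itself, viewed as a complex.  So \<open>X\<^sup>s\<^sup>t\<close>, which is determined only up to
  isomorphism in the stable category, is any maximal Cohen-Macaulay module \<open>Z\<close> isomorphic to \<open>X\<close>
  in the quotient.
\<close>

definition is_stabilization :: "('a, 'r) ring_scheme \<Rightarrow> ('a, 'm) module \<Rightarrow> ('a, 'n) module \<Rightarrow>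
    bool" where
  "is_stabilization R X Z \<longleftrightarrow> mcm R Z \<and> sg_isomorphic R (stalk_complex Z) (stalk_complex X)"


section \<open>Finite algebras and base change\<close>

definition algebra_module :: "('a \<Rightarrow> 'l) \<Rightarrow> ('l, 's) ring_scheme \<Rightarrow> ('a, 'l) module" where
  "algebra_module \<phi> L = restrict_scalars \<phi> (regular_module L)"

definition finite_algebra :: "('a, 'r) ring_scheme \<Rightarrow> ('a \<Rightarrow> 'l) \<Rightarrow> ('l, 's) ring_scheme \<Rightarrow>
    bool" where
  "finite_algebra R \<phi> L \<longleftrightarrow> cring R \<and> ring L \<and> \<phi> \<in> ring_hom R L \<and>
     (\<forall>r\<in>carrier R. \<forall>x\<in>carrier L. \<phi> r \<otimes>\<^bsub>L\<^esub> x = x \<otimes>\<^bsub>L\<^esub> \<phi> r) \<and>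
     fg_module R (algebra_module \<phi> L)"

text \<open>
  Elements of a tensor product over \<open>R\<close> are classes of lists \<open>[(m\<^sub>1, n\<^sub>1), \<dots>]\<close>, read as
  \<open>m\<^sub>1 \<otimes> n\<^sub>1 + \<dots>\<close>, under the congruence generated by the usual relations.
  The class of \<open>[(\<ominus> m, n)]\<close> is the negative of that of \<open>[(m, n)]\<close>.
\<close>

inductive tensor_eq :: "('a, 'r) ring_scheme \<Rightarrow> ('a, 'm) module \<Rightarrow> ('a, 'n) module \<Rightarrow>
    ('m \<times> 'n) list \<Rightarrow> ('m \<times> 'n) list \<Rightarrow> bool"
  for R :: "('a, 'r) ring_scheme" and M :: "('a, 'm) module" and N :: "('a, 'n) module" where
  refl: "set xs \<subseteq> carrier M \<times> carrier N \<Longrightarrow> tensor_eq R M N xs xs"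
| sym: "tensor_eq R M N xs ys \<Longrightarrow> tensor_eq R M N ys xs"
| trans: "tensor_eq R M N xs ys \<Longrightarrow> tensor_eq R M N ys zs \<Longrightarrow> tensor_eq R M N xs zs"
| append: "tensor_eq R M N xs ys \<Longrightarrow> tensor_eq R M N us vs \<Longrightarrow>
    tensor_eq R M N (xs @ us) (ys @ vs)"
| commute: "set xs \<subseteq> carrier M \<times> carrier N \<Longrightarrow> set ys \<subseteq> carrier M \<times> carrier N \<Longrightarrow>
    tensor_eq R M N (xs @ ys) (ys @ xs)"
| zero: "n \<in> carrier N \<Longrightarrow> tensor_eq R M N [(\<zero>\<^bsub>M\<^esub>, n)] []"
| add_left: "m \<in> carrier M \<Longrightarrow> m' \<in> carrier M \<Longrightarrow> n \<in> carrier N \<Longrightarrow>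
    tensor_eq R M N [(m \<oplus>\<^bsub>M\<^esub> m', n)] [(m, n), (m', n)]"
| add_right: "m \<in> carrier M \<Longrightarrow> n \<in> carrier N \<Longrightarrow> n' \<in> carrier N \<Longrightarrow>
    tensor_eq R M N [(m, n \<oplus>\<^bsub>N\<^esub> n')] [(m, n), (m, n')]"
| balanced: "r \<in> carrier R \<Longrightarrow> m \<in> carrier M \<Longrightarrow> n \<in> carrier N \<Longrightarrow>
    tensor_eq R M N [(r \<odot>\<^bsub>M\<^esub> m, n)] [(m, r \<odot>\<^bsub>N\<^esub> n)]"

definition tensor_class :: "('a, 'r) ring_scheme \<Rightarrow> ('a, 'm) module \<Rightarrow> ('a, 'n) module \<Rightarrow>
    ('m \<times> 'n) list \<Rightarrow> ('m \<times> 'n) list set" where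
  "tensor_class R M N xs = {ys. tensor_eq R M N xs ys}"

text \<open>
  \<open>M \<otimes>\<^sub>R \<Lambda>\<close> as a right \<open>\<Lambda>\<close>-module, that is, a module over \<open>opposite_ring L\<close>, with
  \<open>(m \<otimes> x) a = m \<otimes> x a\<close>.
\<close>

definition base_change :: "('a, 'r) ring_scheme \<Rightarrow> ('a \<Rightarrow> 'l) \<Rightarrow> ('l, 's) ring_scheme \<Rightarrow>
    ('a, 'm) module \<Rightarrow> ('l, ('m \<times> 'l) list set) module" where
  "base_change R \<phi> L M = (let N = algebra_module \<phi> L in
     \<lparr>carrier = tensor_class R M N ` {xs. set xs \<subseteq> carrier M \<times> carrier L},
      monoid.mult = \<lambda>_ _. undefined, one = undefined,
      ring.zero = tensor_class R M N [],
      ring.add = (\<lambda>X Y. \<Union>xs\<in>X. \<Union>ys\<in>Y. tensor_class R M N (xs @ ys)),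
      smult = (\<lambda>a X. \<Union>xs\<in>X. tensor_class R M N (map (\<lambda>(m, x). (m, x \<otimes>\<^bsub>L\<^esub> a)) xs))\<rparr>)"

definition split_mono :: "('a, 'r) ring_scheme \<Rightarrow> ('a, 'm) module \<Rightarrow> ('a, 'n) module \<Rightarrow>
    ('m \<Rightarrow> 'n) \<Rightarrow> bool" where
  "split_mono R M N f \<longleftrightarrow> f \<in> module_hom R M N \<and>
     (\<exists>g\<in>module_hom R N M. \<forall>x\<in>carrier M. g (f x) = x)"

end

theory Submission
  imports Defs
begin

text \<open>
  A homomorphism factors through a finitely generated projective module iff it is a finite sum of
  maps \<open>x \<mapsto> p x \<odot> y\<close> with \<open>p\<close> a functional; so \<open>r\<close> lies in the stable annihilator of \<open>X\<close> iff
  multiplication by \<open>r\<close> on \<open>X\<close> has finite rank in this sense.  A projective \<open>\<Lambda>\<close>-module \<open>P\<close>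
  inherits the finite rank of \<open>r\<close> from \<open>\<Lambda>\<close>, so a \<open>\<Lambda>\<close>-projective resolution of length \<open>n\<close> breaks a
  module into \<open>n + 1\<close> pieces on which the stable annihilator of \<open>\<Lambda>\<close> acts by finite rank maps.

  First inclusion.  For \<open>Z\<close> maximal Cohen-Macaulay, splice a projective resolution of \<open>Z\<close> with the dual
  of one of \<open>Hom(Z, R)\<close> to a complex \<open>T\<close> of projectives with \<open>Hom(T, R)\<close> exact.  Maps from \<open>T\<close> to
  perfect complexes are null-homotopic, so maps from \<open>T\<close> lift uniquely along the denominators of
  \<open>D\<^sup>b(R) / perf R\<close>.  Hence if \<open>a\<close> kills the maps from \<open>T\<close> to \<open>M\<^sub>\<Lambda>\<close> up to homotopy, it kills
  \<open>T \<rightarrow> Z\<close>, and then \<open>a\<close> has finite rank on \<open>Z\<close>.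

  Second inclusion.  A splitting makes \<open>M\<close> an \<open>R\<close>-retract of a \<open>\<Lambda>\<close>-module; along its resolution the
  pieces combine to show that \<open>(\<delta> + 1)\<close>-fold products have finite rank on a high syzygy of \<open>M\<close>, that is,
  kill a high Ext.  Third inclusion.  An element that kills \<open>Ext\<close> in degree \<open>n + 1\<close> has finite rank on
  the \<open>n\<close>-th syzygy of \<open>\<Lambda>\<close>, and finite rank descends from a syzygy because functionals extend when
  \<open>Ext(\<Lambda>, R)\<close> vanishes.
\<close>

section \<open>Modules over a ring\<close>


text \<open>Finite sums of maps \<open>p x \<odot> y\<close> replace factorizations through a
  projective for two reasons: no module has to be chosen inside a fixed type, so sources and targets
  may have any types, and each claim becomes an induction over one functional and one vector at a
  time. Lifting acts on the vectors, extension on the functionals. The exponents count the terms of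
  a resolution, one more than its length. In a short exact sequence the annihilators of the two ends
  multiply in the middle, but the last module is reached from the first two only after a rotation,
  which costs a syzygy. So in the second inclusion products have finite rank on a syzygy of M, and
  the degree of Ext grows by two per term. The first inclusion allows no such loss. There all
  degrees of Hom(T, -) are treated at once, with T extending in both directions, so that connecting
  maps stay inside the family. Exactness of Hom(T, R) works against bounded complexes of
  projectives, projectivity of the terms of T against bounded acyclic complexes, and a perfect
  complex is assembled from these two by a mapping cone.\<close>

context left_module
begin

lemma smult_l_null [simp]: "x \<in> carrier M \<Longrightarrow> \<zero>\<^bsub>A\<^esub> \<odot>\<^bsub>M\<^esub> x = \<zero>\<^bsub>M\<^esub>"
proof -
  assume x: "x \<in> carrier M"
  have "\<zero>\<^bsub>A\<^esub> \<odot>\<^bsub>M\<^esub> x \<oplus>\<^bsub>M\<^esub> \<zero>\<^bsub>A\<^esub> \<odot>\<^bsub>M\<^esub> x = \<zero>\<^bsub>A\<^esub> \<odot>\<^bsub>M\<^esub> x"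
    using lm_smult_l_distr[of "\<zero>\<^bsub>A\<^esub>" "\<zero>\<^bsub>A\<^esub>" x] x by simp
  then show ?thesis
    using M.add.r_cancel_one x lm_smult_closed by simp
qed

lemma smult_r_null [simp]: "a \<in> carrier A \<Longrightarrow> a \<odot>\<^bsub>M\<^esub> \<zero>\<^bsub>M\<^esub> = \<zero>\<^bsub>M\<^esub>"
proof -
  assume a: "a \<in> carrier A"
  have "a \<odot>\<^bsub>M\<^esub> \<zero>\<^bsub>M\<^esub> \<oplus>\<^bsub>M\<^esub> a \<odot>\<^bsub>M\<^esub> \<zero>\<^bsub>M\<^esub> = a \<odot>\<^bsub>M\<^esub> \<zero>\<^bsub>M\<^esub>"
    using lm_smult_r_distr[of a "\<zero>\<^bsub>M\<^esub>" "\<zero>\<^bsub>M\<^esub>"] a by simp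
  then show ?thesis
    using M.add.r_cancel_one a lm_smult_closed by simp
qed

lemma smult_r_minus:
  assumes a: "a \<in> carrier A" and x: "x \<in> carrier M"
  shows "a \<odot>\<^bsub>M\<^esub> (\<ominus>\<^bsub>M\<^esub> x) = \<ominus>\<^bsub>M\<^esub> (a \<odot>\<^bsub>M\<^esub> x)"
proof -
  have "a \<odot>\<^bsub>M\<^esub> (\<ominus>\<^bsub>M\<^esub> x) \<oplus>\<^bsub>M\<^esub> a \<odot>\<^bsub>M\<^esub> x = \<zero>\<^bsub>M\<^esub>"
    using lm_smult_r_distr[of a "\<ominus>\<^bsub>M\<^esub> x" x] a x by (simp add: M.l_neg)
  then show ?thesis
    using M.minus_equality a x lm_smult_closed by simp
qed

lemma smult_l_minus:
  assumes a: "a \<in> carrier A" and x: "x \<in> carrier M"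
  shows "(\<ominus>\<^bsub>A\<^esub> a) \<odot>\<^bsub>M\<^esub> x = \<ominus>\<^bsub>M\<^esub> (a \<odot>\<^bsub>M\<^esub> x)"
proof -
  have "(\<ominus>\<^bsub>A\<^esub> a) \<odot>\<^bsub>M\<^esub> x \<oplus>\<^bsub>M\<^esub> a \<odot>\<^bsub>M\<^esub> x = \<zero>\<^bsub>M\<^esub>"
    using lm_smult_l_distr[of "\<ominus>\<^bsub>A\<^esub> a" a x] a x by (simp add: A.l_neg)
  then show ?thesis
    using M.minus_equality a x lm_smult_closed by simp
qed

declare lm_smult_closed [simp, intro]

lemma diff_eq_zero_iff [simp]:
  "x \<in> carrier M \<Longrightarrow> y \<in> carrier M \<Longrightarrow> x \<ominus>\<^bsub>M\<^esub> y = \<zero>\<^bsub>M\<^esub> \<longleftrightarrow> x = y"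
  by (metis M.minus_closed M.minus_equality M.minus_minus M.r_neg a_minus_def M.a_inv_closed)

lemma diff_add_cancel [simp]:
  "x \<in> carrier M \<Longrightarrow> y \<in> carrier M \<Longrightarrow> (x \<ominus>\<^bsub>M\<^esub> y) \<oplus>\<^bsub>M\<^esub> y = x"
  by (simp add: a_minus_def M.a_assoc M.l_neg)

lemma add_diff_cancel [simp]:
  "x \<in> carrier M \<Longrightarrow> y \<in> carrier M \<Longrightarrow> (x \<oplus>\<^bsub>M\<^esub> y) \<ominus>\<^bsub>M\<^esub> y = x"
  by (simp add: a_minus_def M.a_assoc M.r_neg)

lemma add_diff_cancel_left [simp]:
  "x \<in> carrier M \<Longrightarrow> y \<in> carrier M \<Longrightarrow> y \<oplus>\<^bsub>M\<^esub> (x \<ominus>\<^bsub>M\<^esub> y) = x"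
  by (metis M.a_comm M.minus_closed diff_add_cancel)

lemma smult_r_diff:
  "a \<in> carrier A \<Longrightarrow> x \<in> carrier M \<Longrightarrow> y \<in> carrier M \<Longrightarrow>
    a \<odot>\<^bsub>M\<^esub> (x \<ominus>\<^bsub>M\<^esub> y) = a \<odot>\<^bsub>M\<^esub> x \<ominus>\<^bsub>M\<^esub> a \<odot>\<^bsub>M\<^esub> y"
  by (simp add: a_minus_def lm_smult_r_distr smult_r_minus)

lemma neg_zero [simp]: "\<ominus>\<^bsub>M\<^esub> \<zero>\<^bsub>M\<^esub> = \<zero>\<^bsub>M\<^esub>"
  by (simp add: a_inv_def)

lemma add_neg_cancel [simp]: "x \<in> carrier M \<Longrightarrow> y \<in> carrier M \<Longrightarrow> x \<oplus>\<^bsub>M\<^esub> (y \<oplus>\<^bsub>M\<^esub> \<ominus>\<^bsub>M\<^esub> x) = y"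
  by (metis M.a_inv_closed M.a_comm M.r_neg2)

lemma neg_inject: "x \<in> carrier M \<Longrightarrow> y \<in> carrier M \<Longrightarrow> \<ominus>\<^bsub>M\<^esub> x = \<ominus>\<^bsub>M\<^esub> y \<Longrightarrow> x = y"
  by (metis M.minus_minus)

end

lemma left_module_abelian_group: "left_module A M \<Longrightarrow> abelian_group M"
  by (simp add: left_module_def)

lemma left_moduleI:
  assumes "ring A" "abelian_group M"
    "\<And>a x. a \<in> carrier A \<Longrightarrow> x \<in> carrier M \<Longrightarrow> a \<odot>\<^bsub>M\<^esub> x \<in> carrier M"
    "\<And>a b x. a \<in> carrier A \<Longrightarrow> b \<in> carrier A \<Longrightarrow> x \<in> carrier M \<Longrightarrow>
        (a \<oplus>\<^bsub>A\<^esub> b) \<odot>\<^bsub>M\<^esub> x = a \<odot>\<^bsub>M\<^esub> x \<oplus>\<^bsub>M\<^esub> b \<odot>\<^bsub>M\<^esub> x"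
    "\<And>a x y. a \<in> carrier A \<Longrightarrow> x \<in> carrier M \<Longrightarrow> y \<in> carrier M \<Longrightarrow>
        a \<odot>\<^bsub>M\<^esub> (x \<oplus>\<^bsub>M\<^esub> y) = a \<odot>\<^bsub>M\<^esub> x \<oplus>\<^bsub>M\<^esub> a \<odot>\<^bsub>M\<^esub> y"
    "\<And>a b x. a \<in> carrier A \<Longrightarrow> b \<in> carrier A \<Longrightarrow> x \<in> carrier M \<Longrightarrow>
        (a \<otimes>\<^bsub>A\<^esub> b) \<odot>\<^bsub>M\<^esub> x = a \<odot>\<^bsub>M\<^esub> (b \<odot>\<^bsub>M\<^esub> x)"
    "\<And>x. x \<in> carrier M \<Longrightarrow> \<one>\<^bsub>A\<^esub> \<odot>\<^bsub>M\<^esub> x = x"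
  shows "left_module A M"
  using assms by (simp add: left_module_def left_module_axioms_def)

lemma left_module_regular: "ring A \<Longrightarrow> left_module A (regular_module A)"
proof -
  assume "ring A"
  then interpret ring A .
  show ?thesis
    by (rule left_moduleI[OF \<open>ring A\<close>])
      (auto intro!: abelian_groupI simp: regular_module_def l_distr r_distr m_assoc a_ac
        intro: add.l_inv_ex)
qed

lemma regular_module_simps [simp]:
  "carrier (regular_module A) = carrier A"
  "\<zero>\<^bsub>regular_module A\<^esub> = \<zero>\<^bsub>A\<^esub>"
  "x \<oplus>\<^bsub>regular_module A\<^esub> y = x \<oplus>\<^bsub>A\<^esub> y"
  "x \<odot>\<^bsub>regular_module A\<^esub> y = x \<otimes>\<^bsub>A\<^esub> y"
  by (simp_all add: regular_module_def)

subsection \<open>Submodules and spans\<close>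

text \<open>Closure under negation is left out: it follows from scaling by -1, see
  \<open>submod_minus\<close>.\<close>

definition submod :: "('a, 'r) ring_scheme \<Rightarrow> ('a, 'm) module \<Rightarrow> 'm set \<Rightarrow> bool" where
  "submod A M H \<longleftrightarrow> H \<subseteq> carrier M \<and> \<zero>\<^bsub>M\<^esub> \<in> H \<and> (\<forall>x\<in>H. \<forall>y\<in>H. x \<oplus>\<^bsub>M\<^esub> y \<in> H) \<and>
     (\<forall>a\<in>carrier A. \<forall>x\<in>H. a \<odot>\<^bsub>M\<^esub> x \<in> H)"

lemma submodD:
  assumes "submod A M H"
  shows "x \<in> H \<Longrightarrow> x \<in> carrier M" "\<zero>\<^bsub>M\<^esub> \<in> H" "x \<in> H \<Longrightarrow> y \<in> H \<Longrightarrow> x \<oplus>\<^bsub>M\<^esub> y \<in> H"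
    "a \<in> carrier A \<Longrightarrow> x \<in> H \<Longrightarrow> a \<odot>\<^bsub>M\<^esub> x \<in> H"
  using assms by (auto simp: submod_def)

lemma submod_minus:
  assumes "left_module A M" "submod A M H" "x \<in> H"
  shows "\<ominus>\<^bsub>M\<^esub> x \<in> H"
proof -
  interpret left_module A M by fact
  have "x \<in> carrier M" using assms by (auto simp: submod_def)
  then have "\<ominus>\<^bsub>M\<^esub> x = (\<ominus>\<^bsub>A\<^esub> \<one>\<^bsub>A\<^esub>) \<odot>\<^bsub>M\<^esub> x"
    by (simp add: smult_l_minus lm_smult_one)
  then show ?thesis using assms by (auto simp: submod_def)
qed

lemma submod_diff:
  assumes "left_module A M" "submod A M H" "x \<in> H" "y \<in> H"
  shows "x \<ominus>\<^bsub>M\<^esub> y \<in> H"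
  using submodD(3)[OF assms(2,3)] submod_minus[OF assms(1,2,4)] by (simp add: a_minus_def)

lemma submodule_iff_submod:
  assumes "left_module A M"
  shows "submodule H A M \<longleftrightarrow> submod A M H"
proof
  interpret left_module A M by fact
  assume "submodule H A M"
  then interpret H: submodule H A M .
  show "submod A M H"
    unfolding submod_def using H.subset H.one_closed H.m_closed by auto
next
  interpret left_module A M by fact
  assume H: "submod A M H"
  show "submodule H A M"
  proof (intro submodule.intro subgroup.intro submodule_axioms.intro)
    show "inv\<^bsub>add_monoid M\<^esub> x \<in> H" if "x \<in> H" for x
      using submod_minus[OF assms H that] by (simp add: a_inv_def)
  qed (use H in \<open>auto simp: submod_def\<close>)
qed

lemma left_module_submod:
  assumes M: "left_module A M" and H: "submod A M H"
  shows "left_module A (M\<lparr>carrier := H\<rparr>)"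
proof -
  interpret left_module A M by fact
  note HD = submodD[OF H]
  show ?thesis
  proof (rule left_moduleI)
    show "abelian_group (M\<lparr>carrier := H\<rparr>)"
    proof (rule abelian_groupI)
      show "\<exists>y\<in>carrier (M\<lparr>carrier := H\<rparr>). y \<oplus>\<^bsub>M\<lparr>carrier := H\<rparr>\<^esub> x = \<zero>\<^bsub>M\<lparr>carrier := H\<rparr>\<^esub>"
        if "x \<in> carrier (M\<lparr>carrier := H\<rparr>)" for x
        using submod_minus[OF M H, of x] that HD(1)[of x]
        by (intro bexI[of _ "\<ominus>\<^bsub>M\<^esub> x"]) (auto simp: M.l_neg)
    qed (use HD in \<open>auto simp: M.a_ac\<close>)
  qed (use HD in \<open>auto simp: A.ring_axioms lm_smult_l_distr lm_smult_r_distr lm_smult_assoc lm_smult_one\<close>)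
qed

text \<open>Sums are built one term at a time, so that an induction meets a single generator per
  step; closure under sums and multiples is proved in \<open>submod_lspan\<close>.\<close>

inductive_set lspan :: "('a, 'r) ring_scheme \<Rightarrow> ('a, 'm) module \<Rightarrow> 'm set \<Rightarrow> 'm set"
  for A :: "('a, 'r) ring_scheme" and M :: "('a, 'm) module" and S :: "'m set" where
  zero: "\<zero>\<^bsub>M\<^esub> \<in> lspan A M S"
| add: "a \<in> carrier A \<Longrightarrow> s \<in> S \<Longrightarrow> x \<in> lspan A M S \<Longrightarrow> a \<odot>\<^bsub>M\<^esub> s \<oplus>\<^bsub>M\<^esub> x \<in> lspan A M S"

lemma lspan_carrier:
  assumes "left_module A M" "S \<subseteq> carrier M" "x \<in> lspan A M S"
  shows "x \<in> carrier M"
proof -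
  interpret left_module A M by fact
  show ?thesis using assms(3) by induct (use assms(2) in auto)
qed

lemma submod_lspan:
  assumes "left_module A M" "S \<subseteq> carrier M"
  shows "submod A M (lspan A M S)"
proof -
  interpret left_module A M by fact
  have c: "x \<in> carrier M" if "x \<in> lspan A M S" for x
    using lspan_carrier[OF assms that] .
  have 1: "x \<oplus>\<^bsub>M\<^esub> y \<in> lspan A M S" if "x \<in> lspan A M S" "y \<in> lspan A M S" for x y
    using that(1)
  proof induct
    case zero then show ?case using that c by simp
  next
    case (add a s x)
    have "a \<odot>\<^bsub>M\<^esub> s \<oplus>\<^bsub>M\<^esub> (x \<oplus>\<^bsub>M\<^esub> y) \<in> lspan A M S"
      by (rule lspan.add) (use add in auto)
    then show ?case using add c that(2) assms(2) by (subst M.a_assoc) auto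
  qed
  have 2: "b \<odot>\<^bsub>M\<^esub> x \<in> lspan A M S" if "b \<in> carrier A" "x \<in> lspan A M S" for b x
    using that(2)
  proof induct
    case zero then show ?case using that by (simp add: lspan.zero)
  next
    case (add a s x)
    have "(b \<otimes>\<^bsub>A\<^esub> a) \<odot>\<^bsub>M\<^esub> s \<oplus>\<^bsub>M\<^esub> b \<odot>\<^bsub>M\<^esub> x \<in> lspan A M S"
      by (rule lspan.add) (use add that in auto)
    then show ?case using add c that assms(2)
      by (subst lm_smult_r_distr) (auto simp: lm_smult_assoc subset_iff)
  qed
  show ?thesis unfolding submod_def using 1 2 c by (auto intro: lspan.zero)
qed

lemma lspan_minimal:
  assumes "submod A M H" "S \<subseteq> H"
  shows "lspan A M S \<subseteq> H"
proof
  fix x assume "x \<in> lspan A M S"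
  then show "x \<in> H" by induct (use assms in \<open>auto simp: submod_def\<close>)
qed

lemma lspan_superset:
  assumes "left_module A M" "S \<subseteq> carrier M"
  shows "S \<subseteq> lspan A M S"
proof
  interpret left_module A M by fact
  fix s assume "s \<in> S"
  then have "\<one>\<^bsub>A\<^esub> \<odot>\<^bsub>M\<^esub> s \<oplus>\<^bsub>M\<^esub> \<zero>\<^bsub>M\<^esub> \<in> lspan A M S"
    by (intro lspan.intros) auto
  then show "s \<in> lspan A M S" using \<open>s \<in> S\<close> assms(2) by (auto simp: lm_smult_one subset_iff)
qed

lemma fg_module_iff_lspan:
  "fg_module A M \<longleftrightarrow> left_module A M \<and> (\<exists>S. finite S \<and> S \<subseteq> carrier M \<and> lspan A M S = carrier M)"
proof (cases "left_module A M")
  case True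
  have "(\<forall>N. submodule N A M \<and> S \<subseteq> N \<longrightarrow> N = carrier M) \<longleftrightarrow> lspan A M S = carrier M"
    if "S \<subseteq> carrier M" for S
    using submod_lspan[OF True that] lspan_superset[OF True that] lspan_minimal[of A M _ S]
    by (simp add: submodule_iff_submod[OF True]) (metis submod_def subset_antisym)
  then show ?thesis
    unfolding fg_module_def using True by blast
qed (simp add: fg_module_def)

lemma fg_module_left_module: "fg_module A M \<Longrightarrow> left_module A M"
  by (simp add: fg_module_def)

subsection \<open>Homomorphisms\<close>

lemma module_homI:
  assumes "\<And>x. x \<in> carrier M \<Longrightarrow> f x \<in> carrier N"
    "\<And>x y. x \<in> carrier M \<Longrightarrow> y \<in> carrier M \<Longrightarrow> f (x \<oplus>\<^bsub>M\<^esub> y) = f x \<oplus>\<^bsub>N\<^esub> f y"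
    "\<And>a x. a \<in> carrier A \<Longrightarrow> x \<in> carrier M \<Longrightarrow> f (a \<odot>\<^bsub>M\<^esub> x) = a \<odot>\<^bsub>N\<^esub> f x"
  shows "f \<in> module_hom A M N"
  using assms by (simp add: module_hom_def)

lemma module_homD:
  assumes "f \<in> module_hom A M N"
  shows hom_closed: "x \<in> carrier M \<Longrightarrow> f x \<in> carrier N"
    and hom_add: "x \<in> carrier M \<Longrightarrow> y \<in> carrier M \<Longrightarrow> f (x \<oplus>\<^bsub>M\<^esub> y) = f x \<oplus>\<^bsub>N\<^esub> f y"
    and hom_smult: "a \<in> carrier A \<Longrightarrow> x \<in> carrier M \<Longrightarrow> f (a \<odot>\<^bsub>M\<^esub> x) = a \<odot>\<^bsub>N\<^esub> f x"
  using assms by (auto simp: module_hom_def)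

lemma hom_zero:
  assumes "left_module A M" "left_module A N" "f \<in> module_hom A M N"
  shows "f \<zero>\<^bsub>M\<^esub> = \<zero>\<^bsub>N\<^esub>"
proof -
  interpret M: left_module A M by fact
  interpret N: left_module A N by fact
  have "f (\<zero>\<^bsub>A\<^esub> \<odot>\<^bsub>M\<^esub> \<zero>\<^bsub>M\<^esub>) = \<zero>\<^bsub>A\<^esub> \<odot>\<^bsub>N\<^esub> f \<zero>\<^bsub>M\<^esub>"
    by (rule hom_smult[OF assms(3)]) auto
  then show ?thesis using hom_closed[OF assms(3)] by simp
qed

lemma hom_minus:
  assumes "left_module A M" "left_module A N" "f \<in> module_hom A M N" "x \<in> carrier M"
  shows "f (\<ominus>\<^bsub>M\<^esub> x) = \<ominus>\<^bsub>N\<^esub> f x"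
proof -
  interpret M: left_module A M by fact
  interpret N: left_module A N by fact
  have "f (\<ominus>\<^bsub>M\<^esub> x) \<oplus>\<^bsub>N\<^esub> f x = f (\<ominus>\<^bsub>M\<^esub> x \<oplus>\<^bsub>M\<^esub> x)"
    using assms by (simp add: hom_add)
  also have "\<dots> = \<zero>\<^bsub>N\<^esub>" using assms by (simp add: M.M.l_neg hom_zero)
  finally show ?thesis using N.M.minus_equality assms by (simp add: hom_closed)
qed

lemma hom_diff:
  assumes "left_module A M" "left_module A N" "f \<in> module_hom A M N" "x \<in> carrier M" "y \<in> carrier M"
  shows "f (x \<ominus>\<^bsub>M\<^esub> y) = f x \<ominus>\<^bsub>N\<^esub> f y"
proof -
  interpret M: left_module A M by fact
  show ?thesis using assms by (simp add: a_minus_def hom_add hom_minus)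
qed

lemma hom_cong:
  assumes "f \<in> module_hom A M N" "left_module A M" "\<And>x. x \<in> carrier M \<Longrightarrow> g x = f x"
  shows "g \<in> module_hom A M N"
proof -
  interpret M: left_module A M by fact
  show ?thesis using assms by (intro module_homI) (simp_all add: module_homD)
qed

lemma hom_comp:
  assumes "f \<in> module_hom A M N" "g \<in> module_hom A N K"
  shows "(\<lambda>x. g (f x)) \<in> module_hom A M K"
  using assms by (intro module_homI) (simp_all add: module_homD)

lemma hom_id: "(\<lambda>x. x) \<in> module_hom A M M"
  by (auto intro: module_homI)

lemma hom_zero_map:
  assumes "left_module A N"
  shows "(\<lambda>x. \<zero>\<^bsub>N\<^esub>) \<in> module_hom A M N"
proof -
  interpret N: left_module A N by fact
  show ?thesis by (intro module_homI) auto
qed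

lemma hom_plus:
  assumes "left_module A N" "f \<in> module_hom A M N" "g \<in> module_hom A M N"
  shows "(\<lambda>x. f x \<oplus>\<^bsub>N\<^esub> g x) \<in> module_hom A M N"
proof -
  interpret N: left_module A N by fact
  show ?thesis using assms
    by (intro module_homI) (auto simp: module_homD N.lm_smult_r_distr N.M.a_ac)
qed

lemma hom_uminus:
  assumes "left_module A N" "f \<in> module_hom A M N"
  shows "(\<lambda>x. \<ominus>\<^bsub>N\<^esub> f x) \<in> module_hom A M N"
proof -
  interpret N: left_module A N by fact
  show ?thesis using assms
    by (intro module_homI) (auto simp: module_homD N.smult_r_minus N.M.minus_add)
qed

lemma hom_minus_map:
  assumes "left_module A N" "f \<in> module_hom A M N" "g \<in> module_hom A M N"
  shows "(\<lambda>x. f x \<ominus>\<^bsub>N\<^esub> g x) \<in> module_hom A M N"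
  unfolding a_minus_def using assms by (intro hom_plus hom_uminus)

lemma hom_scale:
  assumes "cring A" "left_module A N" "f \<in> module_hom A M N" "r \<in> carrier A"
  shows "(\<lambda>x. r \<odot>\<^bsub>N\<^esub> f x) \<in> module_hom A M N"
proof -
  interpret A: cring A by fact
  interpret N: left_module A N by fact
  show ?thesis
  proof (intro module_homI)
    fix a x assume "a \<in> carrier A" "x \<in> carrier M"
    then show "r \<odot>\<^bsub>N\<^esub> f (a \<odot>\<^bsub>M\<^esub> x) = a \<odot>\<^bsub>N\<^esub> (r \<odot>\<^bsub>N\<^esub> f x)"
      using assms by (simp add: module_homD A.m_comm flip: N.lm_smult_assoc)
  qed (use assms in \<open>auto simp: module_homD N.lm_smult_r_distr\<close>)
qed

lemma hom_submod:
  assumes "f \<in> module_hom A M N" "\<And>x. x \<in> carrier M \<Longrightarrow> f x \<in> H"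
  shows "f \<in> module_hom A M (N\<lparr>carrier := H\<rparr>)"
  using assms by (intro module_homI) (auto simp: module_homD)

lemma hom_from_submod:
  assumes "f \<in> module_hom A M N" "H \<subseteq> carrier M"
  shows "f \<in> module_hom A (M\<lparr>carrier := H\<rparr>) N"
  using assms by (intro module_homI) (auto simp: module_homD subset_iff)

lemma hom_to_ambient:
  assumes "f \<in> module_hom A M (N\<lparr>carrier := H\<rparr>)" "H \<subseteq> carrier N"
  shows "f \<in> module_hom A M N"
  using assms by (auto simp: module_hom_def)

definition hker :: "('a, 'm) module \<Rightarrow> ('a, 'n) module \<Rightarrow> ('m \<Rightarrow> 'n) \<Rightarrow> 'm set" where
  "hker M N f = {x \<in> carrier M. f x = \<zero>\<^bsub>N\<^esub>}"

lemma submod_hker: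
  assumes "left_module A M" "left_module A N" "f \<in> module_hom A M N"
  shows "submod A M (hker M N f)"
proof -
  interpret M: left_module A M by fact
  interpret N: left_module A N by fact
  show ?thesis using assms by (auto simp: submod_def hker_def module_homD hom_zero)
qed

lemma submod_image:
  assumes "left_module A M" "left_module A N" "f \<in> module_hom A M N"
  shows "submod A N (f ` carrier M)"
proof -
  interpret M: left_module A M by fact
  interpret N: left_module A N by fact
  show ?thesis unfolding submod_def
  proof (intro conjI ballI)
    show "\<zero>\<^bsub>N\<^esub> \<in> f ` carrier M"
      using hom_zero[OF assms] by (metis M.M.zero_closed imageI)
    show "x \<oplus>\<^bsub>N\<^esub> y \<in> f ` carrier M" if "x \<in> f ` carrier M" "y \<in> f ` carrier M" for x y
      using that by (auto simp flip: hom_add[OF assms(3)])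
    show "a \<odot>\<^bsub>N\<^esub> x \<in> f ` carrier M" if "a \<in> carrier A" "x \<in> f ` carrier M" for a x
      using that by (auto simp flip: hom_smult[OF assms(3)])
  qed (use assms in \<open>auto simp: module_homD\<close>)
qed

text \<open>Since f kills the kernel of p it is constant on the fibres of p, so f composed with any
  set-theoretic section of p is linear.\<close>

lemma hom_factor:
  assumes M: "left_module A P" "left_module A X" "left_module A Y"
    and p: "p \<in> module_hom A P X" "p ` carrier P = carrier X"
    and f: "f \<in> module_hom A P Y"
    and k: "\<And>x. x \<in> carrier P \<Longrightarrow> p x = \<zero>\<^bsub>X\<^esub> \<Longrightarrow> f x = \<zero>\<^bsub>Y\<^esub>"
  shows "\<exists>g\<in>module_hom A X Y. \<forall>x\<in>carrier P. g (p x) = f x"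
proof -
  interpret P: left_module A P by fact
  interpret X: left_module A X by fact
  interpret Y: left_module A Y by fact
  have eq: "f x = f y" if "x \<in> carrier P" "y \<in> carrier P" "p x = p y" for x y
  proof -
    have "p (x \<ominus>\<^bsub>P\<^esub> y) = \<zero>\<^bsub>X\<^esub>"
      using that p M hom_closed[OF p(1) that(2)] by (simp add: hom_diff[OF M(1,2) p(1)])
    then have "f x \<ominus>\<^bsub>Y\<^esub> f y = \<zero>\<^bsub>Y\<^esub>"
      using k[of "x \<ominus>\<^bsub>P\<^esub> y"] that f M by (simp add: hom_diff)
    then show ?thesis using that f by (simp add: hom_closed)
  qed
  define g where "g = (\<lambda>z. f (inv_into (carrier P) p z))"
  have inv: "inv_into (carrier P) p z \<in> carrier P" "p (inv_into (carrier P) p z) = z"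
    if "z \<in> carrier X" for z
    using that p(2) by (auto intro: inv_into_into f_inv_into_f)
  have gp: "g (p x) = f x" if "x \<in> carrier P" for x
    unfolding g_def using that p(1) by (intro eq) (simp_all add: inv hom_closed)
  have "g \<in> module_hom A X Y"
  proof (rule module_homI)
    show "g x \<in> carrier Y" if "x \<in> carrier X" for x
      unfolding g_def using inv[OF that] f by (simp add: hom_closed)
    show "g (x \<oplus>\<^bsub>X\<^esub> y) = g x \<oplus>\<^bsub>Y\<^esub> g y" if xy: "x \<in> carrier X" "y \<in> carrier X" for x y
    proof -
      obtain x' y' where "x' \<in> carrier P" "p x' = x" "y' \<in> carrier P" "p y' = y"
        using inv xy by metis
      then show ?thesis
        using gp[of "x' \<oplus>\<^bsub>P\<^esub> y'"] gp[of x'] gp[of y'] p f by (simp add: hom_add)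
    qed
    show "g (a \<odot>\<^bsub>X\<^esub> x) = a \<odot>\<^bsub>Y\<^esub> g x" if ax: "a \<in> carrier A" "x \<in> carrier X" for a x
    proof -
      obtain x' where "x' \<in> carrier P" "p x' = x"
        using inv ax by metis
      then show ?thesis
        using gp[of "a \<odot>\<^bsub>P\<^esub> x'"] gp[of x'] p f ax by (simp add: hom_smult)
    qed
  qed
  then show ?thesis using gp by blast
qed

lemma fg_module_image:
  assumes "fg_module A M" "left_module A N" "f \<in> module_hom A M N" "f ` carrier M = carrier N"
  shows "fg_module A N"
proof -
  obtain S where S: "finite S" "S \<subseteq> carrier M" "lspan A M S = carrier M"
    using assms(1) by (auto simp: fg_module_iff_lspan)
  interpret M: left_module A M using assms(1) by (rule fg_module_left_module)
  have fS: "f ` S \<subseteq> carrier N" using S(2) assms(3) by (auto simp: hom_closed subset_iff)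
  have "f x \<in> lspan A N (f ` S)" if "x \<in> lspan A M S" for x
    using that
  proof induct
    case zero
    then show ?case using hom_zero[OF _ assms(2,3)] M.left_module_axioms by (simp add: lspan.zero)
  next
    case (add a s x)
    then show ?case using S assms(3)
      by (auto simp: module_homD subset_iff intro!: lspan.add)
  qed
  then have "lspan A N (f ` S) = carrier N"
    using S(3) assms(4) lspan_carrier[OF assms(2) fS] by (metis image_subset_iff subsetI subset_antisym)
  then show ?thesis using S(1) fS assms(2) by (auto simp: fg_module_iff_lspan)
qed

subsection \<open>Homomorphisms of finite rank\<close>

text \<open>The image in Hom(X, Y) of the tensor product of the dual of X with Y. The ring may be
  noncommutative: functionals take values in the left regular module, so x \<mapsto>
  \<open>p x \<odot> y\<close> is linear. Both clauses constrain values on the carrier only.\<close>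

inductive fin_rank :: "('a, 'r) ring_scheme \<Rightarrow> ('a, 'm) module \<Rightarrow> ('a, 'n) module \<Rightarrow> ('m \<Rightarrow> 'n) \<Rightarrow> bool"
  for A :: "('a, 'r) ring_scheme" and X :: "('a, 'm) module" and Y :: "('a, 'n) module" where
  zero: "(\<And>x. x \<in> carrier X \<Longrightarrow> g x = \<zero>\<^bsub>Y\<^esub>) \<Longrightarrow> fin_rank A X Y g"
| step: "fin_rank A X Y g \<Longrightarrow> p \<in> module_hom A X (regular_module A) \<Longrightarrow> y \<in> carrier Y \<Longrightarrow>
    (\<And>x. x \<in> carrier X \<Longrightarrow> g' x = g x \<oplus>\<^bsub>Y\<^esub> p x \<odot>\<^bsub>Y\<^esub> y) \<Longrightarrow> fin_rank A X Y g'"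

text \<open>The dual basis criterion, taken as a definition; \<open>fg_projective_iff\<close>
  compares it with the lifting property.\<close>

definition fproj :: "('a, 'r) ring_scheme \<Rightarrow> ('a, 'm) module \<Rightarrow> bool" where
  "fproj A P \<longleftrightarrow> left_module A P \<and> fin_rank A P P (\<lambda>x. x)"

lemma fproj_left_module: "fproj A P \<Longrightarrow> left_module A P"
  by (simp add: fproj_def)

lemma fin_rank_hom:
  assumes "left_module A X" "left_module A Y" "fin_rank A X Y g"
  shows "g \<in> module_hom A X Y"
  using assms(3)
proof induct
  case (zero g)
  then show ?case using assms hom_cong[OF hom_zero_map[OF assms(2)] assms(1)] by blast
next
  case (step g p y g')
  interpret Y: left_module A Y by fact
  have "(\<lambda>x. p x \<odot>\<^bsub>Y\<^esub> y) \<in> module_hom A X Y"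
  proof (rule module_homI)
    show "p x \<odot>\<^bsub>Y\<^esub> y \<in> carrier Y" if "x \<in> carrier X" for x
      using hom_closed[OF step(3) that] step(4) by simp
    show "p (x \<oplus>\<^bsub>X\<^esub> x') \<odot>\<^bsub>Y\<^esub> y = p x \<odot>\<^bsub>Y\<^esub> y \<oplus>\<^bsub>Y\<^esub> p x' \<odot>\<^bsub>Y\<^esub> y"
      if "x \<in> carrier X" "x' \<in> carrier X" for x x'
      using hom_closed[OF step(3)] that step(4) by (simp add: hom_add[OF step(3)] Y.lm_smult_l_distr)
    show "p (a \<odot>\<^bsub>X\<^esub> x) \<odot>\<^bsub>Y\<^esub> y = a \<odot>\<^bsub>Y\<^esub> (p x \<odot>\<^bsub>Y\<^esub> y)"
      if "a \<in> carrier A" "x \<in> carrier X" for a x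
      using hom_closed[OF step(3)] that step(4) by (simp add: hom_smult[OF step(3)] Y.lm_smult_assoc)
  qed
  from hom_plus[OF assms(2) step(2) this] show ?case
    by (rule hom_cong) (use step assms in auto)
qed

lemma fin_rank_cong:
  assumes "fin_rank A X Y g" "left_module A X" "left_module A Y" "\<And>x. x \<in> carrier X \<Longrightarrow> g' x = g x"
  shows "fin_rank A X Y g'"
proof -
  interpret X: left_module A X by fact
  interpret Y: left_module A Y by fact
  \<comment> \<open>A term with zero functional and zero vector is added: the last premise of
    \<open>fin_rank.step\<close> then allows any change of values off the carrier.\<close>
  show ?thesis
    by (rule fin_rank.step[OF assms(1) hom_zero_map[OF left_module_regular], of "\<zero>\<^bsub>Y\<^esub>"])
      (use assms fin_rank_hom[OF assms(2,3,1)] in \<open>auto simp: X.A.ring_axioms hom_closed\<close>)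
qed

lemma fin_rank_comp_right:
  assumes "fin_rank A X Y g" "j \<in> module_hom A X' X"
  shows "fin_rank A X' Y (\<lambda>x. g (j x))"
  using assms(1)
proof induct
  case (zero g)
  then show ?case by (intro fin_rank.zero) (simp add: hom_closed[OF assms(2)])
next
  case (step g p y g')
  show ?case
    by (rule fin_rank.step[OF step(2) hom_comp[OF assms(2) step(3)] step(4)])
      (simp add: step hom_closed[OF assms(2)])
qed

lemma fin_rank_comp_left:
  assumes "fin_rank A X Y g" "k \<in> module_hom A Y Y'" "left_module A X" "left_module A Y" "left_module A Y'"
  shows "fin_rank A X Y' (\<lambda>x. k (g x))"
  using assms(1)
proof induct
  case (zero g)
  then show ?case by (intro fin_rank.zero) (simp add: hom_zero[OF assms(4,5,2)])
next
  case (step g p y g')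
  interpret Y: left_module A Y by fact
  show ?case
  proof (rule fin_rank.step[OF step(2,3) hom_closed[OF assms(2) step(4)]])
    fix x assume x: "x \<in> carrier X"
    have "g x \<in> carrier Y" "p x \<in> carrier A"
      using fin_rank_hom[OF assms(3,4) step(1)] step(3) x by (auto dest: hom_closed)
    then show "k (g' x) = k (g x) \<oplus>\<^bsub>Y'\<^esub> p x \<odot>\<^bsub>Y'\<^esub> k y"
      using step x by (simp add: hom_add[OF assms(2)] hom_smult[OF assms(2)])
  qed
qed

lemma fin_rank_add:
  assumes "fin_rank A X Y f" "fin_rank A X Y g" "left_module A X" "left_module A Y"
  shows "fin_rank A X Y (\<lambda>x. f x \<oplus>\<^bsub>Y\<^esub> g x)"
  using assms(2)
proof induct
  case (zero g)
  interpret Y: left_module A Y by fact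
  show ?case
    by (rule fin_rank_cong[OF assms(1,3,4)])
      (use zero hom_closed[OF fin_rank_hom[OF assms(3,4,1)]] in simp)
next
  case (step g p y g')
  interpret Y: left_module A Y by fact
  show ?case
  proof (rule fin_rank.step[OF step(2,3,4)])
    fix x assume x: "x \<in> carrier X"
    have "f x \<in> carrier Y" "g x \<in> carrier Y" "p x \<in> carrier A"
      using fin_rank_hom[OF assms(3,4,1)] fin_rank_hom[OF assms(3,4) step(1)] step(3) x
      by (auto dest: hom_closed)
    then show "f x \<oplus>\<^bsub>Y\<^esub> g' x = f x \<oplus>\<^bsub>Y\<^esub> g x \<oplus>\<^bsub>Y\<^esub> p x \<odot>\<^bsub>Y\<^esub> y"
      using step x by (simp add: Y.M.a_assoc)
  qed
qed

lemma fin_rank_uminus: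
  assumes "fin_rank A X Y g" "left_module A X" "left_module A Y"
  shows "fin_rank A X Y (\<lambda>x. \<ominus>\<^bsub>Y\<^esub> g x)"
  using fin_rank_comp_left[OF assms(1) hom_uminus[OF assms(3) hom_id] assms(2,3,3)] .

lemma fin_rank_fproj_source:
  assumes "fproj A P" "k \<in> module_hom A P Y" "left_module A Y"
  shows "fin_rank A P Y k"
  using assms fin_rank_comp_left[of A P P "\<lambda>x. x" k Y] by (simp add: fproj_def)

lemma fin_rank_fproj_target:
  assumes "fproj A P" "k \<in> module_hom A X P"
  shows "fin_rank A X P k"
  using assms fin_rank_comp_right[of A P P "\<lambda>x. x" k X] by (simp add: fproj_def)

text \<open>Only the vectors y of the terms are lifted, one by one, while the functionals stay. No
  projectivity is involved, and the lift is again of finite rank. With the identity of a projective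
  module for g this becomes \<open>fproj_lift\<close>.\<close>

lemma fin_rank_lift:
  assumes "fin_rank A X Z g" and e: "e \<in> module_hom A Z Y" and q: "q \<in> module_hom A B Y"
    and im: "\<And>z. z \<in> carrier Z \<Longrightarrow> e z \<in> q ` carrier B"
    and M: "left_module A X" "left_module A Z" "left_module A Y" "left_module A B"
  shows "\<exists>h. fin_rank A X B h \<and> (\<forall>x\<in>carrier X. q (h x) = e (g x))"
  using assms(1)
proof induct
  case (zero g)
  then show ?case
    using M by (intro exI[of _ "\<lambda>x. \<zero>\<^bsub>B\<^esub>"]) (auto intro: fin_rank.zero simp: hom_zero[OF M(4,3) q] hom_zero[OF M(2,3) e])
next
  case (step g p y g')
  interpret B: left_module A B by fact
  from step obtain h where h: "fin_rank A X B h" "\<forall>x\<in>carrier X. q (h x) = e (g x)" by blast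
  obtain b where b: "b \<in> carrier B" "q b = e y" using im[OF step(4)] by auto
  have "fin_rank A X B (\<lambda>x. h x \<oplus>\<^bsub>B\<^esub> p x \<odot>\<^bsub>B\<^esub> b)"
    by (rule fin_rank.step[OF h(1) step(3) b(1)]) simp
  moreover have "q (h x \<oplus>\<^bsub>B\<^esub> p x \<odot>\<^bsub>B\<^esub> b) = e (g' x)" if x: "x \<in> carrier X" for x
  proof -
    interpret Z: left_module A Z by fact
    have "h x \<in> carrier B" "g x \<in> carrier Z" "p x \<in> carrier A"
      using x step(3) fin_rank_hom[OF M(1,4) h(1)] fin_rank_hom[OF M(1,2) step(1)]
      by (auto dest: hom_closed)
    then show ?thesis
      using x b h(2) step by (simp add: hom_add[OF q] hom_add[OF e] hom_smult[OF q] hom_smult[OF e])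
  qed
  ultimately show ?case by blast
qed

lemma fproj_lift:
  assumes P: "fproj A P" and e: "e \<in> module_hom A P Y" and q: "q \<in> module_hom A B Y"
    and im: "\<And>z. z \<in> carrier P \<Longrightarrow> e z \<in> q ` carrier B"
    and M: "left_module A Y" "left_module A B"
  shows "\<exists>h\<in>module_hom A P B. \<forall>x\<in>carrier P. q (h x) = e x"
proof -
  have P': "left_module A P" "fin_rank A P P (\<lambda>x. x)" using P by (auto simp: fproj_def)
  obtain h where "fin_rank A P B h" "\<forall>x\<in>carrier P. q (h x) = e x"
    using fin_rank_lift[OF P'(2) e q im P'(1) P'(1) M] by blast
  then show ?thesis using fin_rank_hom[OF P'(1) M(2)] by blast
qed

lemma fproj_retract:
  assumes "fproj A P" "left_module A Q" "i \<in> module_hom A Q P" "p \<in> module_hom A P Q"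
    "\<And>x. x \<in> carrier Q \<Longrightarrow> p (i x) = x"
  shows "fproj A Q"
proof -
  have "fin_rank A Q Q (\<lambda>x. p (i x))"
    using fin_rank_comp_left[OF fin_rank_fproj_target[OF assms(1,3)] assms(4)] assms
    by (simp add: fproj_def)
  then show ?thesis using assms by (auto simp: fproj_def intro: fin_rank_cong)
qed

subsection \<open>Images under a congruence\<close>

text \<open>The operations are computed on representatives; for injective \<open>k\<close> this is transport of structure.\<close>

definition image_module :: "('m \<Rightarrow> 'n) \<Rightarrow> ('a, 'm) module \<Rightarrow> ('a, 'n) module" where
  "image_module k M = (let r = inv_into (carrier M) k in
     \<lparr>carrier = k ` carrier M, monoid.mult = \<lambda>_ _. undefined, one = undefined,
      ring.zero = k \<zero>\<^bsub>M\<^esub>, ring.add = (\<lambda>u v. k (r u \<oplus>\<^bsub>M\<^esub> r v)), smult = (\<lambda>a u. k (a \<odot>\<^bsub>M\<^esub> r u))\<rparr>)"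

text \<open>The parameter S covers both uses: S = 0 is transport along an injection, and a general S
  gives the quotient by S in \<open>left_module_quotient\<close>.\<close>

lemma image_module:
  assumes M: "left_module A M" and S: "submod A M S"
    and k: "\<And>x y. x \<in> carrier M \<Longrightarrow> y \<in> carrier M \<Longrightarrow> k x = k y \<longleftrightarrow> x \<ominus>\<^bsub>M\<^esub> y \<in> S"
  shows left_module_image_module: "left_module A (image_module k M)"
    and image_module_hom: "k \<in> module_hom A M (image_module k M)"
proof -
  interpret left_module A M by fact
  let ?N = "image_module k M"
  define r where "r = inv_into (carrier M) k"
  have r: "r (k x) \<in> carrier M" "k (r (k x)) = k x" if "x \<in> carrier M" for x
    using that by (auto simp: r_def inv_into_into f_inv_into_f)
  have car: "carrier ?N = k ` carrier M" and zer: "\<zero>\<^bsub>?N\<^esub> = k \<zero>\<^bsub>M\<^esub>"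
    by (simp_all add: image_module_def Let_def)
  have add: "k x \<oplus>\<^bsub>?N\<^esub> k y = k (x \<oplus>\<^bsub>M\<^esub> y)" if xy: "x \<in> carrier M" "y \<in> carrier M" for x y
  proof -
    have "r (k x) \<ominus>\<^bsub>M\<^esub> x \<in> S" "r (k y) \<ominus>\<^bsub>M\<^esub> y \<in> S"
      using r xy k by blast+
    then have "(r (k x) \<ominus>\<^bsub>M\<^esub> x) \<oplus>\<^bsub>M\<^esub> (r (k y) \<ominus>\<^bsub>M\<^esub> y) \<in> S"
      using submodD(3)[OF S] by blast
    also have "(r (k x) \<ominus>\<^bsub>M\<^esub> x) \<oplus>\<^bsub>M\<^esub> (r (k y) \<ominus>\<^bsub>M\<^esub> y)
        = (r (k x) \<oplus>\<^bsub>M\<^esub> r (k y)) \<ominus>\<^bsub>M\<^esub> (x \<oplus>\<^bsub>M\<^esub> y)"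
      using r xy by (simp add: a_minus_def M.minus_add M.a_ac)
    finally have "k (r (k x) \<oplus>\<^bsub>M\<^esub> r (k y)) = k (x \<oplus>\<^bsub>M\<^esub> y)"
      using r xy k by (metis M.a_closed)
    then show ?thesis by (simp add: image_module_def Let_def r_def)
  qed
  have smu: "a \<odot>\<^bsub>?N\<^esub> k x = k (a \<odot>\<^bsub>M\<^esub> x)" if ax: "a \<in> carrier A" "x \<in> carrier M" for a x
  proof -
    have "a \<odot>\<^bsub>M\<^esub> (r (k x) \<ominus>\<^bsub>M\<^esub> x) \<in> S"
      using r ax k submodD(4)[OF S] by blast
    then have "a \<odot>\<^bsub>M\<^esub> r (k x) \<ominus>\<^bsub>M\<^esub> a \<odot>\<^bsub>M\<^esub> x \<in> S"
      using r ax by (simp add: smult_r_diff)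
    then have "k (a \<odot>\<^bsub>M\<^esub> r (k x)) = k (a \<odot>\<^bsub>M\<^esub> x)"
      using r ax k by (metis lm_smult_closed)
    then show ?thesis by (simp add: image_module_def Let_def r_def)
  qed
  show "left_module A ?N"
  proof (rule left_moduleI)
    show "abelian_group ?N"
    proof (rule abelian_groupI)
      show "\<exists>y\<in>carrier ?N. y \<oplus>\<^bsub>?N\<^esub> x = \<zero>\<^bsub>?N\<^esub>" if x: "x \<in> carrier ?N" for x
      proof -
        obtain x' where "x' \<in> carrier M" "x = k x'" using x car by auto
        then show ?thesis
          by (intro bexI[of _ "k (\<ominus>\<^bsub>M\<^esub> x')"]) (auto simp: car zer add M.l_neg)
      qed
    qed (auto simp: car zer add M.a_ac)
  qed (auto simp: car add smu A.ring_axioms lm_smult_l_distr lm_smult_r_distr lm_smult_assoc lm_smult_one)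
  show "k \<in> module_hom A M ?N"
    by (rule module_homI) (auto simp: car add smu)
qed

lemma carrier_image_module [simp]: "carrier (image_module k M) = k ` carrier M"
  by (simp add: image_module_def Let_def)

definition module_iso :: "('a, 'r) ring_scheme \<Rightarrow> ('a, 'm) module \<Rightarrow> ('a, 'n) module \<Rightarrow>
    ('m \<Rightarrow> 'n) \<Rightarrow> ('n \<Rightarrow> 'm) \<Rightarrow> bool" where
  "module_iso A M N f g \<longleftrightarrow> left_module A M \<and> left_module A N \<and> f \<in> module_hom A M N \<and> g \<in> module_hom A N M \<and>
     (\<forall>x\<in>carrier M. g (f x) = x) \<and> (\<forall>y\<in>carrier N. f (g y) = y)"

lemma module_isoD:
  assumes "module_iso A M N f g"
  shows "left_module A M" "left_module A N" "f \<in> module_hom A M N" "g \<in> module_hom A N M"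
    "x \<in> carrier M \<Longrightarrow> g (f x) = x" "y \<in> carrier N \<Longrightarrow> f (g y) = y" "f ` carrier M = carrier N"
proof -
  show "f ` carrier M = carrier N"
    using assms unfolding module_iso_def by (metis (no_types, lifting) hom_closed image_iff subsetI subset_antisym)
qed (use assms in \<open>auto simp: module_iso_def\<close>)

lemma module_iso_transport:
  assumes M: "left_module A M" and inj: "inj_on k (carrier M)"
  shows "module_iso A M (image_module k M) k (inv_into (carrier M) k)"
proof -
  interpret left_module A M by fact
  have S: "submod A M {\<zero>\<^bsub>M\<^esub>}" by (auto simp: submod_def)
  have k: "k x = k y \<longleftrightarrow> x \<ominus>\<^bsub>M\<^esub> y \<in> {\<zero>\<^bsub>M\<^esub>}" if "x \<in> carrier M" "y \<in> carrier M" for x y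
    using that inj by (auto dest: inj_onD)
  note N = image_module[OF M S k]
  have "inv_into (carrier M) k \<in> module_hom A (image_module k M) M"
  proof (rule module_homI)
    fix x y assume "x \<in> carrier (image_module k M)" "y \<in> carrier (image_module k M)"
    then obtain x' y' where "x' \<in> carrier M" "x = k x'" "y' \<in> carrier M" "y = k y'" by auto
    then show "inv_into (carrier M) k (x \<oplus>\<^bsub>image_module k M\<^esub> y) =
        inv_into (carrier M) k x \<oplus>\<^bsub>M\<^esub> inv_into (carrier M) k y"
      using inj by (simp add: inv_into_f_f flip: hom_add[OF N(2)])
  next
    fix a x assume "a \<in> carrier A" "x \<in> carrier (image_module k M)"
    then obtain x' where "x' \<in> carrier M" "x = k x'" by auto
    then show "inv_into (carrier M) k (a \<odot>\<^bsub>image_module k M\<^esub> x) = a \<odot>\<^bsub>M\<^esub> inv_into (carrier M) k x"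
      using inj \<open>a \<in> carrier A\<close> by (simp add: inv_into_f_f flip: hom_smult[OF N(2)])
  qed (use inj in auto)
  then show ?thesis
    using N M inj by (auto simp: module_iso_def)
qed

lemma fg_module_iso:
  assumes "module_iso A M N f g" "fg_module A M"
  shows "fg_module A N"
  using fg_module_image[OF assms(2)] module_isoD[OF assms(1)] by blast

lemma module_iso_sym: "module_iso A M N f g \<Longrightarrow> module_iso A N M g f"
  by (simp add: module_iso_def)

lemma fproj_iso:
  assumes "module_iso A M N f g" "fproj A M"
  shows "fproj A N"
  using fproj_retract[OF assms(2)] module_isoD[OF assms(1)] by blast

subsection \<open>Free modules\<close>

text \<open>Families are indexed by all of \<open>nat\<close> and vanish from n on. Thus the type
  does not depend on n, and sets of such families are elements of \<open>'a univ\<close>, where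
  copies of finitely generated modules have to live.\<close>

definition free_module :: "('a, 'r) ring_scheme \<Rightarrow> nat \<Rightarrow> ('a, nat \<Rightarrow> 'a) module" where
  "free_module A n = \<lparr>carrier = {v. (\<forall>i. v i \<in> carrier A) \<and> (\<forall>i\<ge>n. v i = \<zero>\<^bsub>A\<^esub>)},
     monoid.mult = \<lambda>_ _. undefined, one = undefined, ring.zero = (\<lambda>_. \<zero>\<^bsub>A\<^esub>),
     ring.add = (\<lambda>v w i. v i \<oplus>\<^bsub>A\<^esub> w i), smult = (\<lambda>a v i. a \<otimes>\<^bsub>A\<^esub> v i)\<rparr>"

lemma free_module_simps [simp]:
  "v \<in> carrier (free_module A n) \<longleftrightarrow> (\<forall>i. v i \<in> carrier A) \<and> (\<forall>i\<ge>n. v i = \<zero>\<^bsub>A\<^esub>)"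
  "\<zero>\<^bsub>free_module A n\<^esub> = (\<lambda>_. \<zero>\<^bsub>A\<^esub>)"
  "v \<oplus>\<^bsub>free_module A n\<^esub> w = (\<lambda>i. v i \<oplus>\<^bsub>A\<^esub> w i)"
  "a \<odot>\<^bsub>free_module A n\<^esub> v = (\<lambda>i. a \<otimes>\<^bsub>A\<^esub> v i)"
  by (simp_all add: free_module_def)

lemma left_module_free:
  assumes "ring A" shows "left_module A (free_module A n)"
proof -
  interpret ring A by fact
  show ?thesis
  proof (rule left_moduleI[OF assms])
    show "abelian_group (free_module A n)"
    proof (rule abelian_groupI)
      show "\<exists>y\<in>carrier (free_module A n). y \<oplus>\<^bsub>free_module A n\<^esub> x = \<zero>\<^bsub>free_module A n\<^esub>"
        if "x \<in> carrier (free_module A n)" for x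
        using that by (intro bexI[of _ "\<lambda>i. \<ominus>\<^bsub>A\<^esub> x i"]) (auto simp: l_neg)
    qed (auto simp: a_ac)
  qed (auto simp: l_distr r_distr m_assoc)
qed

lemma fproj_free:
  assumes "ring A" shows "fproj A (free_module A n)"
proof -
  interpret ring A by fact
  let ?F = "free_module A n"
  \<comment> \<open>Truncation to the first m coordinates: each further coordinate contributes one
    functional and one basis vector.\<close>
  have "fin_rank A ?F ?F (\<lambda>v i. if i < m then v i else \<zero>\<^bsub>A\<^esub>)" if "m \<le> n" for m
    using that
  proof (induct m)
    case 0
    then show ?case by (intro fin_rank.zero) simp
  next
    case (Suc m)
    have "(\<lambda>v. v m) \<in> module_hom A ?F (regular_module A)"
      by (rule module_homI) auto
    from Suc(1)[OF Suc_leD[OF Suc(2)]] this show ?case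
      by (rule fin_rank.step[where y = "\<lambda>i. if i = m then \<one>\<^bsub>A\<^esub> else \<zero>\<^bsub>A\<^esub>"])
        (use Suc in \<open>auto simp: fun_eq_iff less_Suc_eq\<close>)
  qed
  from this[of n] have "fin_rank A ?F ?F (\<lambda>v. v)"
    by (rule fin_rank_cong) (auto simp: left_module_free[OF assms] fun_eq_iff not_less)
  then show ?thesis using left_module_free[OF assms] by (simp add: fproj_def)
qed

primrec lincomb :: "('a, 'm) module \<Rightarrow> (nat \<Rightarrow> 'a) \<Rightarrow> (nat \<Rightarrow> 'm) \<Rightarrow> nat \<Rightarrow> 'm" where
  "lincomb M v x 0 = \<zero>\<^bsub>M\<^esub>"
| "lincomb M v x (Suc n) = lincomb M v x n \<oplus>\<^bsub>M\<^esub> v n \<odot>\<^bsub>M\<^esub> x n"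

lemma lincomb_hom:
  assumes "left_module A M" "\<And>i. x i \<in> carrier M"
  shows "(\<lambda>v. lincomb M v x n) \<in> module_hom A (free_module A k) M"
proof -
  interpret left_module A M by fact
  have c: "lincomb M v x n \<in> carrier M" if "\<And>i. v i \<in> carrier A" for v n
    by (induct n) (use that assms in auto)
  have a: "lincomb M (\<lambda>i. v i \<oplus>\<^bsub>A\<^esub> w i) x n = lincomb M v x n \<oplus>\<^bsub>M\<^esub> lincomb M w x n"
    if "\<And>i. v i \<in> carrier A" "\<And>i. w i \<in> carrier A" for v w n
    by (induct n) (use that assms c in \<open>auto simp: lm_smult_l_distr M.a_ac\<close>)
  have s: "lincomb M (\<lambda>i. a \<otimes>\<^bsub>A\<^esub> v i) x n = a \<odot>\<^bsub>M\<^esub> lincomb M v x n"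
    if "a \<in> carrier A" "\<And>i. v i \<in> carrier A" for a v n
    by (induct n) (use that assms c in \<open>auto simp: lm_smult_r_distr lm_smult_assoc\<close>)
  show ?thesis by (rule module_homI) (auto simp: c a s)
qed

lemma fg_module_generators:
  assumes "fg_module A M"
  shows "\<exists>n x. (\<forall>i. x i \<in> carrier M) \<and>
    (\<lambda>v. lincomb M v x n) ` carrier (free_module A n) = carrier M"
proof -
  interpret left_module A M using assms by (rule fg_module_left_module)
  obtain S where S: "finite S" "S \<subseteq> carrier M" "lspan A M S = carrier M"
    using assms by (auto simp: fg_module_iff_lspan)
  obtain xs where xs: "set xs = S" using finite_list[OF S(1)] by blast
  define n where "n = length xs"
  define x where "x i = (if i < n then xs ! i else \<zero>\<^bsub>M\<^esub>)" for i
  have x: "x i \<in> carrier M" for i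
    using xs S(2) by (auto simp: x_def n_def)
  note h = lincomb_hom[of A M x, OF left_module_axioms x]
  let ?e = "\<lambda>j i. if i = j then \<one>\<^bsub>A\<^esub> else \<zero>\<^bsub>A\<^esub>"
  have ez: "lincomb M (?e j) x m = (if j < m then x j else \<zero>\<^bsub>M\<^esub>)" for j m
    by (induct m) (auto simp: x lm_smult_one less_Suc_eq)
  have "\<exists>v\<in>carrier (free_module A n). lincomb M v x n = z" if "z \<in> lspan A M S" for z
    using that
  proof induct
    case zero
    show ?case using hom_zero[OF left_module_free left_module_axioms h[of n n]] A.ring_axioms
      by (intro bexI[of _ "\<zero>\<^bsub>free_module A n\<^esub>"]) auto
  next
    case (add a s z)
    from add obtain v where v: "v \<in> carrier (free_module A n)" "lincomb M v x n = z" by blast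
    obtain j where j: "j < n" "s = x j"
      using add(2) xs by (auto simp: n_def x_def in_set_conv_nth)
    have e: "?e j \<in> carrier (free_module A n)" using j by auto
    interpret F: left_module A "free_module A n" by (rule left_module_free[OF A.ring_axioms])
    have "lincomb M (a \<odot>\<^bsub>free_module A n\<^esub> ?e j \<oplus>\<^bsub>free_module A n\<^esub> v) x n = a \<odot>\<^bsub>M\<^esub> s \<oplus>\<^bsub>M\<^esub> z"
      using hom_add[OF h[of n n] F.lm_smult_closed[OF add(1) e] v(1)] hom_smult[OF h[of n n] add(1) e] ez[of j n] v j
      by simp
    moreover have "a \<odot>\<^bsub>free_module A n\<^esub> ?e j \<oplus>\<^bsub>free_module A n\<^esub> v \<in> carrier (free_module A n)"
      using e v(1) add(1) by blast
    ultimately show ?case by blast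
  qed
  then have "(\<lambda>v. lincomb M v x n) ` carrier (free_module A n) = carrier M"
    using S(3) hom_closed[OF h[of n n]] by (fastforce simp: image_iff)
  then show ?thesis using x by blast
qed

lemma fg_module_free:
  assumes "ring A" shows "fg_module A (free_module A n)"
proof -
  interpret ring A by fact
  note F = left_module_free[OF assms, of n]
  let ?e = "\<lambda>j i. if i = j then \<one>\<^bsub>A\<^esub> else \<zero>\<^bsub>A\<^esub>"
  have e: "?e ` {..<n} \<subseteq> carrier (free_module A n)" by auto
  have tr: "(\<lambda>i. if i < m then v i else \<zero>\<^bsub>A\<^esub>) \<in> lspan A (free_module A n) (?e ` {..<n})"
    if v: "v \<in> carrier (free_module A n)" "m \<le> n" for v m
    using v(2)
  proof (induct m)
    case 0
    then show ?case using lspan.zero[of "free_module A n"] by simp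
  next
    case (Suc m)
    have "v m \<odot>\<^bsub>free_module A n\<^esub> ?e m \<oplus>\<^bsub>free_module A n\<^esub> (\<lambda>i. if i < m then v i else \<zero>\<^bsub>A\<^esub>)
        \<in> lspan A (free_module A n) (?e ` {..<n})"
      by (rule lspan.add) (use Suc v in auto)
    also have "v m \<odot>\<^bsub>free_module A n\<^esub> ?e m \<oplus>\<^bsub>free_module A n\<^esub> (\<lambda>i. if i < m then v i else \<zero>\<^bsub>A\<^esub>)
        = (\<lambda>i. if i < Suc m then v i else \<zero>\<^bsub>A\<^esub>)"
      using v by (auto simp: fun_eq_iff less_Suc_eq)
    finally show ?case .
  qed
  have "v \<in> lspan A (free_module A n) (?e ` {..<n})" if v: "v \<in> carrier (free_module A n)" for v
  proof -
    have eq: "(\<lambda>i. if i < n then v i else \<zero>\<^bsub>A\<^esub>) = v" using v by (auto simp: fun_eq_iff)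
    show ?thesis using tr[OF v order_refl] unfolding eq .
  qed
  then have "lspan A (free_module A n) (?e ` {..<n}) = carrier (free_module A n)"
    using lspan_carrier[OF F e] by (intro subset_antisym subsetI)
  moreover have "finite (?e ` {..<n})" by simp
  ultimately show ?thesis using F e
    unfolding fg_module_iff_lspan by (intro conjI exI[of _ "?e ` {..<n}"])
qed

lemma free_cover:
  fixes A :: "('a, 'r) ring_scheme"
  assumes "fg_module A M"
  shows "\<exists>(F :: ('a, 'a univ) module) p. fg_module A F \<and> fproj A F \<and>
     p \<in> module_hom A F M \<and> p ` carrier F = carrier M"
proof -
  interpret left_module A M using assms by (rule fg_module_left_module)
  obtain n x where x: "\<And>i. x i \<in> carrier M"
    "(\<lambda>v. lincomb M v x n) ` carrier (free_module A n) = carrier M"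
    using fg_module_generators[OF assms] by blast
  \<comment> \<open>Singletons carry the free module into \<open>'a univ\<close>.\<close>
  define k :: "(nat \<Rightarrow> 'a) \<Rightarrow> 'a univ" where "k v = {v}" for v
  have iso: "module_iso A (free_module A n) (image_module k (free_module A n)) k
      (inv_into (carrier (free_module A n)) k)"
    by (rule module_iso_transport) (auto simp: left_module_free A.ring_axioms k_def inj_on_def)
  define p where "p = (\<lambda>u. lincomb M (inv_into (carrier (free_module A n)) k u) x n)"
  have "p \<in> module_hom A (image_module k (free_module A n)) M"
    unfolding p_def by (rule hom_comp[OF module_isoD(4)[OF iso] lincomb_hom[of A M x, OF left_module_axioms x(1)]])
  moreover have "p ` carrier (image_module k (free_module A n)) = carrier M"
    unfolding p_def x(2)[symmetric] using module_isoD(5)[OF iso] by (force simp: image_image simp del: free_module_simps)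
  ultimately show ?thesis
    using fg_module_iso[OF iso fg_module_free[OF A.ring_axioms]] fproj_iso[OF iso fproj_free[OF A.ring_axioms]]
    by blast
qed

lemma fg_module_copy:
  fixes A :: "('a, 'r) ring_scheme"
  assumes "fg_module A M"
  shows "\<exists>(N :: ('a, 'a univ) module) f g. module_iso A M N f g"
proof -
  interpret left_module A M using assms by (rule fg_module_left_module)
  obtain n x where x: "(\<lambda>v. lincomb M v x n) ` carrier (free_module A n) = carrier M"
    using fg_module_generators[OF assms] by blast
  \<comment> \<open>The fibre over z in the free module, a coset of the kernel; nonempty fibres over
    distinct points are distinct.\<close>
  define k where "k z = {v \<in> carrier (free_module A n). lincomb M v x n = z}" for z
  have "inj_on k (carrier M)"
  proof (rule inj_onI)
    fix y z assume "y \<in> carrier M" "z \<in> carrier M" "k y = k z"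
    then show "y = z" unfolding x[symmetric] k_def by blast
  qed
  from module_iso_transport[OF left_module_axioms this] show ?thesis by blast
qed

lemma fg_projective_iff:
  fixes A :: "('a, 'r) ring_scheme"
  shows "fg_projective A P \<longleftrightarrow> fg_module A P \<and> fproj A P"
proof
  assume P: "fg_projective A P"
  then have fg: "fg_module A P" by (simp add: fg_projective_def)
  note lm = fg_module_left_module[OF fg]
  obtain F :: "('a, 'a univ) module" and p where F: "fproj A F"
     "p \<in> module_hom A F P" "p ` carrier F = carrier P" using free_cover[OF fg] by blast
  \<comment> \<open>The lifting property may be tested only against modules in
    \<open>'a univ\<close>, whereas P has an arbitrary type. So the isomorphism of P with a copy C
    is lifted in place of the identity of P.\<close>
  obtain C :: "('a, 'a univ) module" and f g where iso: "module_iso A P C f g"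
    using fg_module_copy[OF fg] by blast
  note iso = module_isoD[OF iso]
  have "\<exists>h\<in>module_hom A P F. \<forall>x\<in>carrier P. f (p (h x)) = f x"
  proof -
    have "(\<lambda>x. f (p x)) \<in> module_hom A F C" "(\<lambda>x. f (p x)) ` carrier F = carrier C"
      using F(2) iso(3,7) hom_comp F(3) by (auto simp flip: image_image)
    then show ?thesis using P fproj_left_module[OF F(1)] iso(2,3) unfolding fg_projective_def by blast
  qed
  then obtain h where h: "h \<in> module_hom A P F" "\<And>x. x \<in> carrier P \<Longrightarrow> f (p (h x)) = f x" by blast
  have "p (h x) = x" if "x \<in> carrier P" for x
    using h(2)[OF that] iso(5) that hom_closed[OF F(2) hom_closed[OF h(1) that]] by metis
  then show "fg_module A P \<and> fproj A P"
    using fproj_retract[OF F(1) lm h(1) F(2)] fg by blast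
next
  assume P: "fg_module A P \<and> fproj A P"
  show "fg_projective A P"
    unfolding fg_projective_def
  proof (intro conjI allI impI, use P in simp)
    fix B C :: "('a, 'a univ) module" and g f
    assume *: "left_module A B \<and> left_module A C \<and> g \<in> module_hom A B C \<and>
      g ` carrier B = carrier C \<and> f \<in> module_hom A P C"
    then show "\<exists>h\<in>module_hom A P B. \<forall>x\<in>carrier P. g (h x) = f x"
      using fproj_lift[of A P f C g B] P by (auto simp: hom_closed)
  qed
qed

subsection \<open>Noetherian rings\<close>

lemma lspan_insert:
  assumes "left_module A M" "insert s S \<subseteq> carrier M" "z \<in> lspan A M (insert s S)"
  shows "\<exists>a\<in>carrier A. \<exists>y\<in>lspan A M S. z = a \<odot>\<^bsub>M\<^esub> s \<oplus>\<^bsub>M\<^esub> y"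
  using assms(3)
proof induct
  case zero
  interpret left_module A M by fact
  show ?case using assms(2)
    by (intro bexI[of _ "\<zero>\<^bsub>A\<^esub>"] bexI[of _ "\<zero>\<^bsub>M\<^esub>"]) (auto intro: lspan.zero)
next
  case (add b t z)
  interpret left_module A M by fact
  have S: "S \<subseteq> carrier M" and s: "s \<in> carrier M" using assms by auto
  from add obtain a y where ay: "a \<in> carrier A" "y \<in> lspan A M S" "z = a \<odot>\<^bsub>M\<^esub> s \<oplus>\<^bsub>M\<^esub> y" by blast
  note y = lspan_carrier[OF assms(1) S ay(2)]
  show ?case
  proof (cases "t = s")
    case True
    then have "b \<odot>\<^bsub>M\<^esub> t \<oplus>\<^bsub>M\<^esub> z = (b \<oplus>\<^bsub>A\<^esub> a) \<odot>\<^bsub>M\<^esub> s \<oplus>\<^bsub>M\<^esub> y"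
      using ay y s add by (simp add: lm_smult_l_distr M.a_assoc)
    then show ?thesis using ay add by blast
  next
    case False
    then have t: "t \<in> S" using add by auto
    then have "t \<in> carrier M" using S by blast
    then have "b \<odot>\<^bsub>M\<^esub> t \<oplus>\<^bsub>M\<^esub> z = a \<odot>\<^bsub>M\<^esub> s \<oplus>\<^bsub>M\<^esub> (b \<odot>\<^bsub>M\<^esub> t \<oplus>\<^bsub>M\<^esub> y)"
      unfolding ay(3) using ay(1) y s add(1) by (simp add: M.a_lcomm)
    then show ?thesis using lspan.add[OF add(1) t ay(2)] ay(1) by blast
  qed
qed

text \<open>Induction on the generators. Modulo the span of S, what H contributes is the set of
  coefficients at s of its elements; this is an ideal, finitely generated because R is Noetherian.
  Lifts of its generators together with generators of the intersection of H with the span of S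
  generate H.\<close>

lemma submod_fg:
  assumes N: "noetherian_ring R" "cring R" and M: "left_module R M" and "finite S" "S \<subseteq> carrier M"
    and "submod R M H" "H \<subseteq> lspan R M S"
  shows "\<exists>T. finite T \<and> T \<subseteq> H \<and> lspan R M T = H"
  using assms(4-)
proof (induct S arbitrary: H)
  case empty
  have "x = \<zero>\<^bsub>M\<^esub>" if "x \<in> lspan R M {}" for x
    using that by induct auto
  then have "H = {\<zero>\<^bsub>M\<^esub>}" using empty by (auto simp: submod_def)
  moreover have "lspan R M {} = {\<zero>\<^bsub>M\<^esub>}"
    using \<open>\<And>x. x \<in> lspan R M {} \<Longrightarrow> x = \<zero>\<^bsub>M\<^esub>\<close> lspan.zero by auto
  ultimately show ?case by (intro exI[of _ "{}"]) auto
next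
  case (insert s S)
  interpret R: noetherian_ring R by fact
  interpret R: cring R by fact
  interpret left_module R M by fact
  have S: "S \<subseteq> carrier M" and s: "s \<in> carrier M" using insert by auto
  note H = submodD[OF insert(5)]
  note spS = submod_lspan[OF M S]
  have sc: "y \<in> carrier M" if "y \<in> lspan R M S" for y using lspan_carrier[OF M S that] .
  \<comment> \<open>The ideal of coefficients at s. It is formed for every submodule K, because it
    is needed both for H and for the span of the proposed generators.\<close>
  define J where "J K = {a \<in> carrier R. \<exists>z\<in>K. \<exists>y\<in>lspan R M S. z = a \<odot>\<^bsub>M\<^esub> s \<oplus>\<^bsub>M\<^esub> y}" for K
  have idJ: "ideal (J K) R" if K: "submod R M K" for K
  proof (rule idealI)
    show "ring R" by (rule R.ring_axioms)
    note K' = submodD[OF K]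
    have add: "a \<oplus>\<^bsub>R\<^esub> b \<in> J K" if "a \<in> J K" "b \<in> J K" for a b
    proof -
      from that obtain z y z' y' where *: "a \<in> carrier R" "b \<in> carrier R" "z \<in> K" "z' \<in> K"
        "y \<in> lspan R M S" "y' \<in> lspan R M S" "z = a \<odot>\<^bsub>M\<^esub> s \<oplus>\<^bsub>M\<^esub> y" "z' = b \<odot>\<^bsub>M\<^esub> s \<oplus>\<^bsub>M\<^esub> y'"
        unfolding J_def by blast
      then have "z \<oplus>\<^bsub>M\<^esub> z' = (a \<oplus>\<^bsub>R\<^esub> b) \<odot>\<^bsub>M\<^esub> s \<oplus>\<^bsub>M\<^esub> (y \<oplus>\<^bsub>M\<^esub> y')"
        using s sc by (simp add: lm_smult_l_distr M.a_ac)
      then show ?thesis unfolding J_def using * K'(3) submodD(3)[OF spS] by blast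
    qed
    have mul: "b \<otimes>\<^bsub>R\<^esub> a \<in> J K" if "a \<in> J K" "b \<in> carrier R" for a b
    proof -
      from that obtain z y where *: "a \<in> carrier R" "z \<in> K"
        "y \<in> lspan R M S" "z = a \<odot>\<^bsub>M\<^esub> s \<oplus>\<^bsub>M\<^esub> y"
        unfolding J_def by blast
      then have "b \<odot>\<^bsub>M\<^esub> z = (b \<otimes>\<^bsub>R\<^esub> a) \<odot>\<^bsub>M\<^esub> s \<oplus>\<^bsub>M\<^esub> b \<odot>\<^bsub>M\<^esub> y"
        using s sc that by (simp add: lm_smult_r_distr lm_smult_assoc)
      moreover have "b \<odot>\<^bsub>M\<^esub> z \<in> K" "b \<odot>\<^bsub>M\<^esub> y \<in> lspan R M S" "b \<otimes>\<^bsub>R\<^esub> a \<in> carrier R"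
        using * that K'(4) submodD(4)[OF spS] by auto
      ultimately show ?thesis unfolding J_def by blast
    qed
    have Jc: "J K \<subseteq> carrier R" by (auto simp: J_def)
    show "subgroup (J K) (add_monoid R)"
    proof (rule subgroup.intro)
      show "\<one>\<^bsub>add_monoid R\<^esub> \<in> J K"
        unfolding J_def using K'(2) lspan.zero[of M R S] s
        by simp (metis M.l_zero M.zero_closed smult_l_null)
      show "inv\<^bsub>add_monoid R\<^esub> x \<in> J K" if "x \<in> J K" for x
      proof -
        have "inv\<^bsub>add_monoid R\<^esub> x = (\<ominus>\<^bsub>R\<^esub> \<one>\<^bsub>R\<^esub>) \<otimes>\<^bsub>R\<^esub> x"
          using that Jc by (simp add: a_inv_def[symmetric] R.l_minus subset_iff)
        then show ?thesis using mul[OF that] by simp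
      qed
    qed (use Jc add in auto)
    show "b \<otimes>\<^bsub>R\<^esub> a \<in> J K" if "a \<in> J K" "b \<in> carrier R" for a b using mul[OF that] .
    show "a \<otimes>\<^bsub>R\<^esub> b \<in> J K" if "a \<in> J K" "b \<in> carrier R" for a b
      using mul[OF that] that Jc by (simp add: R.m_comm subset_iff)
  qed
  obtain B where B: "B \<subseteq> carrier R" "finite B" "J H = Idl\<^bsub>R\<^esub> B"
    using R.finetely_gen[OF idJ[OF insert(5)]] by blast
  have "\<forall>b\<in>B. \<exists>z. z \<in> H \<and> (\<exists>y\<in>lspan R M S. z = b \<odot>\<^bsub>M\<^esub> s \<oplus>\<^bsub>M\<^esub> y)"
    using R.genideal_self[OF B(1)] B(3) unfolding J_def by blast
  then obtain z where z: "\<And>b. b \<in> B \<Longrightarrow> z b \<in> H \<and> (\<exists>y\<in>lspan R M S. z b = b \<odot>\<^bsub>M\<^esub> s \<oplus>\<^bsub>M\<^esub> y)"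
    by metis
  have HS: "submod R M (H \<inter> lspan R M S)"
    using insert(5) spS by (auto simp: submod_def)
  then obtain T where T: "finite T" "T \<subseteq> H \<inter> lspan R M S" "lspan R M T = H \<inter> lspan R M S"
    using insert(3)[OF S HS Int_lower2] by (elim exE conjE)
  let ?U = "z ` B \<union> T"
  have UH: "?U \<subseteq> H" using z T by auto
  then have Uc: "?U \<subseteq> carrier M" using H(1) by blast
  note spU = submodD[OF submod_lspan[OF M Uc]]
  have TU: "lspan R M T \<subseteq> lspan R M ?U"
    using lspan_minimal[OF submod_lspan[OF M Uc]] lspan_superset[OF M Uc] by blast
  have UH': "lspan R M ?U \<subseteq> H" by (rule lspan_minimal[OF insert(5) UH])
  have "B \<subseteq> J (lspan R M ?U)"
  proof
    fix b assume b: "b \<in> B"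
    then have "z b \<in> lspan R M ?U" using lspan_superset[OF M Uc] by blast
    then show "b \<in> J (lspan R M ?U)" unfolding J_def using z[OF b] b B by blast
  qed
  then have J: "J H \<subseteq> J (lspan R M ?U)"
    unfolding B(3) by (rule R.genideal_minimal[OF idJ[OF submod_lspan[OF M Uc]]])
  have "H \<subseteq> lspan R M ?U"
  proof
    fix h assume h: "h \<in> H"
    then obtain a y where ay: "a \<in> carrier R" "y \<in> lspan R M S" "h = a \<odot>\<^bsub>M\<^esub> s \<oplus>\<^bsub>M\<^esub> y"
      using lspan_insert[OF M insert(4)] insert(6) by blast
    then have "a \<in> J H" unfolding J_def using h by blast
    \<comment> \<open>w lies in the span of the proposed generators and has the same coefficient at
      s as h, so the difference falls into the part of H generated by T.\<close>
    then obtain w y' where w: "w \<in> lspan R M ?U" "y' \<in> lspan R M S" "w = a \<odot>\<^bsub>M\<^esub> s \<oplus>\<^bsub>M\<^esub> y'"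
      using J unfolding J_def by blast
    have wH: "w \<in> H" using w UH' by blast
    have c: "h \<in> carrier M" "w \<in> carrier M" "y \<in> carrier M" "y' \<in> carrier M"
      using h wH H(1) sc ay w by auto
    have "h \<ominus>\<^bsub>M\<^esub> w = y \<ominus>\<^bsub>M\<^esub> y'"
      using ay w c s by (simp add: a_minus_def M.minus_add M.a_ac M.r_neg1 M.r_neg)
    then have "h \<ominus>\<^bsub>M\<^esub> w \<in> H \<inter> lspan R M S"
      using submod_diff[OF M insert(5) h wH] submod_diff[OF M spS ay(2) w(2)] by simp
    then have "h \<ominus>\<^bsub>M\<^esub> w \<in> lspan R M ?U" using T TU by blast
    then have "(h \<ominus>\<^bsub>M\<^esub> w) \<oplus>\<^bsub>M\<^esub> w \<in> lspan R M ?U" using w(1) spU(3) by blast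
    then show "h \<in> lspan R M ?U" using c by simp
  qed
  then show ?case using UH UH' T(1) B(2) by (intro exI[of _ ?U]) auto
qed

lemma lspan_submod:
  assumes "T \<subseteq> H"
  shows "lspan A (M\<lparr>carrier := H\<rparr>) T = lspan A M T"
proof
  show "lspan A (M\<lparr>carrier := H\<rparr>) T \<subseteq> lspan A M T"
  proof
    fix x assume "x \<in> lspan A (M\<lparr>carrier := H\<rparr>) T"
    then show "x \<in> lspan A M T" by induct (auto intro: lspan.intros)
  qed
  show "lspan A M T \<subseteq> lspan A (M\<lparr>carrier := H\<rparr>) T"
  proof
    fix x assume "x \<in> lspan A M T"
    then show "x \<in> lspan A (M\<lparr>carrier := H\<rparr>) T"
      using lspan.zero[of "M\<lparr>carrier := H\<rparr>"] lspan.add[of _ A _ T _ "M\<lparr>carrier := H\<rparr>"]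
      by induct auto
  qed
qed

lemma fg_module_submod:
  assumes "noetherian_ring R" "cring R" "fg_module R M" "submod R M H"
  shows "fg_module R (M\<lparr>carrier := H\<rparr>)"
proof -
  obtain S where S: "finite S" "S \<subseteq> carrier M" "lspan R M S = carrier M" and M: "left_module R M"
    using assms(3) by (auto simp: fg_module_iff_lspan)
  have "H \<subseteq> lspan R M S" using S assms(4) by (auto simp: submod_def)
  then obtain T where "finite T" "T \<subseteq> H" "lspan R M T = H"
    using submod_fg[OF assms(1,2) M S(1,2) assms(4)] by blast
  then show ?thesis
    using left_module_submod[OF M assms(4)] lspan_submod[of T H]
    unfolding fg_module_iff_lspan by (intro conjI exI[of _ T]) auto
qed

lemma projective_resolution_exists:
  fixes R :: "('a, 'r) ring_scheme"
  assumes N: "noetherian_ring R" "cring R" and M: "fg_module R M"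
  shows "\<exists>P d \<epsilon>. projective_resolution R M P d \<epsilon>"
proof -
  have cover: "\<exists>(F :: ('a, 'a univ) module) p. fg_projective R F \<and> p \<in> module_hom R F Q \<and> p ` carrier F = H"
    if Q: "fg_module R Q" "submod R Q H" for Q :: "('a, 'a univ) module" and H
  proof -
    obtain F :: "('a, 'a univ) module" and p where F: "fg_module R F" "fproj R F"
      "p \<in> module_hom R F (Q\<lparr>carrier := H\<rparr>)" "p ` carrier F = H"
      using free_cover[OF fg_module_submod[OF N Q]] by auto
    then show ?thesis
      using hom_to_ambient[OF F(3)] Q(2) by (auto simp: fg_projective_iff submod_def)
  qed
  obtain F0 :: "('a, 'a univ) module" and \<epsilon> where F0: "fg_projective R F0"
      "\<epsilon> \<in> module_hom R F0 M" "\<epsilon> ` carrier F0 = carrier M"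
    using free_cover[OF M] by (auto simp: fg_projective_iff)
  \<comment> \<open>A state consists of a term of the resolution, the map from it to the preceding
    term, and the submodule that the next term has to cover.\<close>
  define good where "good s \<longleftrightarrow> fg_projective R (fst s) \<and> submod R (fst s) (snd (snd s))"
    for s :: "('a, 'a univ) module \<times> ('a univ \<Rightarrow> 'a univ) \<times> 'a univ set"
  define step where "step s s' \<longleftrightarrow> (let (P, _, K) = s; (P', p, K') = s' in
      p \<in> module_hom R P' P \<and> p ` carrier P' = K \<and> K' = hker P' P p)"
    for s s' :: "('a, 'a univ) module \<times> ('a univ \<Rightarrow> 'a univ) \<times> 'a univ set"
  have lm: "fg_module R (fst s)" "left_module R (fst s)" if "good s" for s
    using that fg_module_left_module by (auto simp: good_def fg_projective_iff)
  have "\<exists>s'. good s' \<and> step s s'" if "good s" for s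
  proof -
    note gs = that
    obtain P q K where s: "s = (P, q, K)" by (cases s)
    have PK: "fg_module R P" "submod R P K" using gs lm(1)[OF gs] s by (auto simp: good_def)
    then obtain P' :: "('a, 'a univ) module" and p where P': "fg_projective R P'" "p \<in> module_hom R P' P" "p ` carrier P' = K"
      using cover[OF PK] by blast
    have "good (P', p, hker P' P p)"
      using P' lm[OF gs] s by (auto simp: good_def fg_projective_iff fproj_left_module intro!: submod_hker)
    then show ?thesis using P' s by (intro exI[of _ "(P', p, hker P' P p)"]) (auto simp: step_def)
  qed
  note next_exists = this
  \<comment> \<open>The augmentation ends in M, whose type may differ from that of the terms, so the
    initial state records only its kernel.\<close>
  have g0: "good (F0, undefined, hker F0 M \<epsilon>)"
    using F0 fg_module_left_module[OF M]
    by (auto simp: good_def fg_projective_iff fproj_left_module intro!: submod_hker)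
  have "\<exists>f. \<forall>n. (good (f n) \<and> (n = 0 \<longrightarrow> f n = (F0, undefined, hker F0 M \<epsilon>))) \<and> step (f n) (f (Suc n))"
    by (rule dependent_nat_choice) (use g0 next_exists in auto)
  then obtain f where f: "f 0 = (F0, undefined, hker F0 M \<epsilon>)" "\<And>n. good (f n)" "\<And>n. step (f n) (f (Suc n))"
    by blast
  define P where "P n = fst (f n)" for n
  define d where "d n = fst (snd (f (Suc n)))" for n
  define K where "K n = snd (snd (f n))" for n
  have st: "d n \<in> module_hom R (P (Suc n)) (P n)" "d n ` carrier (P (Suc n)) = K n"
     "K (Suc n) = hker (P (Suc n)) (P n) (d n)" for n
    using f(3)[of n] by (auto simp: step_def P_def d_def K_def Let_def split: prod.splits)
  have z: "P 0 = F0" "K 0 = hker F0 M \<epsilon>" using f(1) by (auto simp: P_def K_def)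
  have "projective_resolution R M P d \<epsilon>"
    unfolding projective_resolution_def
  proof (intro conjI allI)
    show "fg_projective R (P i)" for i using f(2)[of i] by (simp add: good_def P_def)
    show "d 0 ` carrier (P 1) = {x \<in> carrier (P 0). \<epsilon> x = \<zero>\<^bsub>M\<^esub>}"
      using st(2)[of 0] z by (simp add: hker_def)
    show "d (Suc i) ` carrier (P (Suc (Suc i))) = {x \<in> carrier (P (Suc i)). d i x = \<zero>\<^bsub>P i\<^esub>}" for i
      using st(2)[of "Suc i"] st(3)[of i] by (simp add: hker_def)
  qed (use st(1) z F0 in auto)
  then show ?thesis by blast
qed

subsection \<open>Annihilators of subquotients of Hom\<close>

text \<open>In \<open>quotient_module\<close> a multiple of a coset is a union of cosets. It is N
  exactly when r sends the representatives into N, and since r preserves N one representative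
  decides this.\<close>

lemma quotient_module_annihilator:
  assumes G: "abelian_group M" and S: "\<And>x. x \<in> N \<Longrightarrow> x \<in> carrier M" "\<zero>\<^bsub>M\<^esub> \<in> N"
    "\<And>x y. x \<in> N \<Longrightarrow> y \<in> N \<Longrightarrow> x \<oplus>\<^bsub>M\<^esub> y \<in> N" "\<And>x. x \<in> N \<Longrightarrow> \<ominus>\<^bsub>M\<^esub> x \<in> N"
    and sm: "\<And>x. x \<in> carrier M \<Longrightarrow> r \<odot>\<^bsub>M\<^esub> x \<in> carrier M"
    and sa: "\<And>x y. x \<in> N \<Longrightarrow> y \<in> carrier M \<Longrightarrow> r \<odot>\<^bsub>M\<^esub> (x \<oplus>\<^bsub>M\<^esub> y) = r \<odot>\<^bsub>M\<^esub> x \<oplus>\<^bsub>M\<^esub> r \<odot>\<^bsub>M\<^esub> y"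
    and sN: "\<And>x. x \<in> N \<Longrightarrow> r \<odot>\<^bsub>M\<^esub> x \<in> N"
    and r: "r \<in> carrier R"
  shows "r \<in> annihilator R (quotient_module M N) \<longleftrightarrow> (\<forall>x\<in>carrier M. r \<odot>\<^bsub>M\<^esub> x \<in> N)"
proof -
  interpret abelian_group M by fact
  have coset: "N +>\<^bsub>M\<^esub> x = {n \<oplus>\<^bsub>M\<^esub> x | n. n \<in> N}" for x
    by (auto simp: a_r_coset_def r_coset_def)
  have mem: "x \<in> N +>\<^bsub>M\<^esub> x" if "x \<in> carrier M" for x
    unfolding coset using S(2) that l_zero by (metis (mono_tags, lifting) mem_Collect_eq)
  have triv: "N +>\<^bsub>M\<^esub> x = N" if "x \<in> N" for x
  proof
    show "N \<subseteq> N +>\<^bsub>M\<^esub> x"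
    proof
      fix n assume n: "n \<in> N"
      then have "n = (n \<oplus>\<^bsub>M\<^esub> \<ominus>\<^bsub>M\<^esub> x) \<oplus>\<^bsub>M\<^esub> x"
        using that S(1) by (simp add: a_assoc l_neg)
      then show "n \<in> N +>\<^bsub>M\<^esub> x" unfolding coset using n that S by blast
    qed
  qed (use that S coset in auto)
  have car: "carrier (quotient_module M N) = {N +>\<^bsub>M\<^esub> x | x. x \<in> carrier M}"
    by (auto simp: quotient_module_def A_RCOSETS_def RCOSETS_def a_r_coset_def)
  have eq: "(\<Union>x\<in>N +>\<^bsub>M\<^esub> y. N +>\<^bsub>M\<^esub> (r \<odot>\<^bsub>M\<^esub> x)) = N \<longleftrightarrow> r \<odot>\<^bsub>M\<^esub> y \<in> N" if y: "y \<in> carrier M" for y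
  proof
    assume *: "(\<Union>x\<in>N +>\<^bsub>M\<^esub> y. N +>\<^bsub>M\<^esub> (r \<odot>\<^bsub>M\<^esub> x)) = N"
    have "r \<odot>\<^bsub>M\<^esub> y \<in> (\<Union>x\<in>N +>\<^bsub>M\<^esub> y. N +>\<^bsub>M\<^esub> (r \<odot>\<^bsub>M\<^esub> x))"
      using mem[OF y] mem[OF sm[OF y]] by blast
    then show "r \<odot>\<^bsub>M\<^esub> y \<in> N" using * by simp
  next
    assume *: "r \<odot>\<^bsub>M\<^esub> y \<in> N"
    have "N +>\<^bsub>M\<^esub> (r \<odot>\<^bsub>M\<^esub> x) = N" if x: "x \<in> N +>\<^bsub>M\<^esub> y" for x
    proof -
      obtain n where "n \<in> N" "x = n \<oplus>\<^bsub>M\<^esub> y" using x unfolding coset[of y] by blast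
      then have "r \<odot>\<^bsub>M\<^esub> x \<in> N" using sa[of n y] S(3)[OF sN *] y by simp
      then show ?thesis by (rule triv)
    qed
    then show "(\<Union>x\<in>N +>\<^bsub>M\<^esub> y. N +>\<^bsub>M\<^esub> (r \<odot>\<^bsub>M\<^esub> x)) = N" using mem[OF y] by auto
  qed
  show ?thesis
    unfolding annihilator_def car using r eq by (auto simp: quotient_module_def)
qed

lemma quotient_module_zero:
  assumes "abelian_group M" "carrier (quotient_module M N) = {\<zero>\<^bsub>quotient_module M N\<^esub>}"
    "\<zero>\<^bsub>M\<^esub> \<in> N" "x \<in> carrier M"
  shows "x \<in> N"
proof -
  interpret abelian_group M by fact
  have "N +>\<^bsub>M\<^esub> x \<in> carrier (quotient_module M N)"
    using assms(4) by (auto simp: quotient_module_def A_RCOSETS_def RCOSETS_def a_r_coset_def)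
  then have "N +>\<^bsub>M\<^esub> x = N" using assms(2) by (simp add: quotient_module_def)
  moreover have "\<zero>\<^bsub>M\<^esub> \<oplus>\<^bsub>M\<^esub> x \<in> N +>\<^bsub>M\<^esub> x"
    using assms(3) by (auto simp: a_r_coset_def r_coset_def)
  ultimately show ?thesis using assms(4) by simp
qed

lemma carrier_Hom_module:
  "f \<in> carrier (Hom_module R M N) \<longleftrightarrow> f \<in> module_hom R M N \<and> f \<in> extensional (carrier M)"
  by (auto simp: Hom_module_def)

lemma Hom_module_simps:
  "\<zero>\<^bsub>Hom_module R M N\<^esub> = (\<lambda>x\<in>carrier M. \<zero>\<^bsub>N\<^esub>)"
  "f \<oplus>\<^bsub>Hom_module R M N\<^esub> g = (\<lambda>x\<in>carrier M. f x \<oplus>\<^bsub>N\<^esub> g x)"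
  "r \<odot>\<^bsub>Hom_module R M N\<^esub> f = (\<lambda>x\<in>carrier M. r \<odot>\<^bsub>N\<^esub> f x)"
  by (simp_all add: Hom_module_def)

lemma restrict_hom:
  assumes "f \<in> module_hom R M N" "left_module R M"
  shows "(\<lambda>x\<in>carrier M. f x) \<in> carrier (Hom_module R M N)"
  using hom_cong[OF assms] by (simp add: carrier_Hom_module)

lemma left_module_Hom:
  assumes R: "cring R" and M: "left_module R M" "left_module R N"
  shows "left_module R (Hom_module R M N)"
proof -
  interpret R: cring R by fact
  interpret M: left_module R M by fact
  interpret N: left_module R N by fact
  let ?H = "Hom_module R M N"
  have c: "f x \<in> carrier N" if "f \<in> carrier ?H" "x \<in> carrier M" for f x
    using that by (auto simp: carrier_Hom_module hom_closed)
  have ext: "f = g" if "f \<in> carrier ?H" "g \<in> carrier ?H" "\<And>x. x \<in> carrier M \<Longrightarrow> f x = g x" for f g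
    using that by (auto simp: carrier_Hom_module intro: extensionalityI)
  have h: "f \<in> module_hom R M N" if "f \<in> carrier ?H" for f using that by (simp add: carrier_Hom_module)
  have zero: "\<zero>\<^bsub>?H\<^esub> \<in> carrier ?H"
    unfolding Hom_module_simps by (rule restrict_hom[OF hom_zero_map[OF M(2)] M(1)])
  have add: "f \<oplus>\<^bsub>?H\<^esub> g \<in> carrier ?H" if "f \<in> carrier ?H" "g \<in> carrier ?H" for f g
    unfolding Hom_module_simps by (rule restrict_hom[OF hom_plus[OF M(2) h h] M(1)]) (use that in auto)
  have smu: "a \<odot>\<^bsub>?H\<^esub> f \<in> carrier ?H" if "a \<in> carrier R" "f \<in> carrier ?H" for a f
    unfolding Hom_module_simps by (rule restrict_hom[OF hom_scale[OF R M(2) h] M(1)]) (use that in auto)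
  show ?thesis
  proof (rule left_moduleI[OF R.ring_axioms])
    show "abelian_group ?H"
    proof (rule abelian_groupI)
      show "\<exists>g\<in>carrier ?H. g \<oplus>\<^bsub>?H\<^esub> f = \<zero>\<^bsub>?H\<^esub>" if f: "f \<in> carrier ?H" for f
      proof (rule bexI)
        show m: "(\<lambda>x\<in>carrier M. \<ominus>\<^bsub>N\<^esub> f x) \<in> carrier ?H"
          by (rule restrict_hom[OF hom_uminus[OF M(2) h[OF f]] M(1)])
        show "(\<lambda>x\<in>carrier M. \<ominus>\<^bsub>N\<^esub> f x) \<oplus>\<^bsub>?H\<^esub> f = \<zero>\<^bsub>?H\<^esub>"
          using c[OF f] by (auto simp: Hom_module_simps N.M.l_neg)
      qed
      show "\<zero>\<^bsub>?H\<^esub> \<oplus>\<^bsub>?H\<^esub> x = x" if "x \<in> carrier ?H" for x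
        by (rule ext[OF add[OF zero that] that]) (use c[OF that] in \<open>simp add: Hom_module_simps\<close>)
    qed (use zero add c in \<open>auto simp: Hom_module_simps N.M.a_ac intro!: restrict_ext\<close>)
    show "\<one>\<^bsub>R\<^esub> \<odot>\<^bsub>?H\<^esub> x = x" if "x \<in> carrier ?H" for x
      by (rule ext[OF smu[OF R.one_closed that] that]) (use c[OF that] in \<open>simp add: Hom_module_simps N.lm_smult_one\<close>)
  qed (use smu c in \<open>auto simp: Hom_module_simps N.lm_smult_l_distr N.lm_smult_r_distr N.lm_smult_assoc
        intro!: restrict_ext\<close>)
qed

lemma Hom_module_uminus:
  assumes R: "cring R" and M: "left_module R M" "left_module R N" and f: "f \<in> carrier (Hom_module R M N)"
  shows "\<ominus>\<^bsub>Hom_module R M N\<^esub> f = (\<lambda>x\<in>carrier M. \<ominus>\<^bsub>N\<^esub> f x)"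
proof -
  interpret H: left_module R "Hom_module R M N" by (rule left_module_Hom[OF R M])
  interpret N: left_module R N by fact
  have f': "f \<in> module_hom R M N" using f by (simp add: carrier_Hom_module)
  have "(\<lambda>x\<in>carrier M. \<ominus>\<^bsub>N\<^esub> f x) \<oplus>\<^bsub>Hom_module R M N\<^esub> f = \<zero>\<^bsub>Hom_module R M N\<^esub>"
    using hom_closed[OF f'] by (auto simp: Hom_module_simps N.M.l_neg)
  then show ?thesis
    using H.M.minus_equality f restrict_hom[OF hom_uminus[OF M(2) f'] M(1)] by simp
qed

definition fr_ann :: "('a, 'r) ring_scheme \<Rightarrow> ('a, 'm) module \<Rightarrow> 'a set" where
  "fr_ann R X = {r \<in> carrier R. fin_rank R X X (\<lambda>x. r \<odot>\<^bsub>X\<^esub> x)}"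

text \<open>A map through a projective P has finite rank because the identity of P does. Conversely
  a map of finite rank lifts to a free cover of N in \<open>'a univ\<close>, by
  \<open>fin_rank_lift\<close>, and so factors through it.\<close>

lemma projective_homs_eq:
  fixes R :: "('a, 'r) ring_scheme"
  assumes "cring R" "left_module R M" "fg_module R N"
  shows "projective_homs R M N = {f \<in> carrier (Hom_module R M N). fin_rank R M N f}"
proof -
  note N = fg_module_left_module[OF assms(3)]
  have "(\<exists>(P :: ('a, 'a univ) module) g h. fg_projective R P \<and>
       g \<in> module_hom R M P \<and> h \<in> module_hom R P N \<and> (\<forall>x\<in>carrier M. f x = h (g x))) \<longleftrightarrow> fin_rank R M N f"
    if f: "f \<in> carrier (Hom_module R M N)" for f
  proof
    assume "\<exists>(P :: ('a, 'a univ) module) g h. fg_projective R P \<and>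
       g \<in> module_hom R M P \<and> h \<in> module_hom R P N \<and> (\<forall>x\<in>carrier M. f x = h (g x))"
    then obtain P :: "('a, 'a univ) module" and g h where P: "fproj R P"
       "g \<in> module_hom R M P" "h \<in> module_hom R P N" "\<And>x. x \<in> carrier M \<Longrightarrow> f x = h (g x)"
      by (auto simp: fg_projective_iff)
    show "fin_rank R M N f"
      by (rule fin_rank_cong[OF fin_rank_comp_right[OF fin_rank_fproj_source[OF P(1,3) N] P(2)] assms(2) N P(4)])
  next
    assume fr: "fin_rank R M N f"
    obtain F :: "('a, 'a univ) module" and p where F: "fg_module R F" "fproj R F"
       "p \<in> module_hom R F N" "p ` carrier F = carrier N"
      using free_cover[OF assms(3)] by blast
    obtain h where h: "fin_rank R M F h" "\<forall>x\<in>carrier M. p (h x) = f x"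
      using fin_rank_lift[OF fr hom_id F(3) _ assms(2) N N fproj_left_module[OF F(2)]] F(4) by auto
    show "\<exists>(P :: ('a, 'a univ) module) g h. fg_projective R P \<and>
       g \<in> module_hom R M P \<and> h \<in> module_hom R P N \<and> (\<forall>x\<in>carrier M. f x = h (g x))"
      using F h fin_rank_hom[OF assms(2) fproj_left_module[OF F(2)] h(1)]
      by (intro exI[of _ F] exI[of _ h] exI[of _ p]) (auto simp: fg_projective_iff)
  qed
  then show ?thesis unfolding projective_homs_def by blast
qed

text \<open>Finite rank maps absorb composition, so r annihilates every stable endomorphism as soon
  as it annihilates the class of the identity.\<close>

lemma stable_ann_eq:
  assumes R: "cring R" and Z: "fg_module R Z"
  shows "stable_ann R Z = fr_ann R Z"
proof (rule Set.set_eqI)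
  fix r
  note lZ = fg_module_left_module[OF Z]
  interpret R: cring R by fact
  interpret Z: left_module R Z by fact
  let ?H = "Hom_module R Z Z"
  interpret H: left_module R ?H by (rule left_module_Hom[OF R lZ lZ])
  let ?N = "{f \<in> carrier ?H. fin_rank R Z Z f}"
  have hom: "f \<in> module_hom R Z Z" if "f \<in> carrier ?H" for f using that by (simp add: carrier_Hom_module)
  have cong: "fin_rank R Z Z (\<lambda>x\<in>carrier Z. f x)" if "fin_rank R Z Z f" for f
    by (rule fin_rank_cong[OF that lZ lZ]) simp
  show "r \<in> stable_ann R Z \<longleftrightarrow> r \<in> fr_ann R Z"
  proof (cases "r \<in> carrier R")
    case r: True
    have smul: "fin_rank R Z Z (\<lambda>x. r \<odot>\<^bsub>Z\<^esub> f x)" if "fin_rank R Z Z f" for f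
      using fin_rank_comp_left[OF that hom_scale[OF R lZ hom_id r] lZ lZ lZ] .
    have "r \<in> annihilator R (quotient_module ?H ?N) \<longleftrightarrow> (\<forall>x\<in>carrier ?H. r \<odot>\<^bsub>?H\<^esub> x \<in> ?N)"
    proof (rule quotient_module_annihilator)
      show "\<zero>\<^bsub>?H\<^esub> \<in> ?N"
        using H.M.zero_closed by (auto simp: Hom_module_simps intro: fin_rank.zero)
      show "x \<oplus>\<^bsub>?H\<^esub> y \<in> ?N" if "x \<in> ?N" "y \<in> ?N" for x y
        using that H.M.a_closed[of x y] cong[OF fin_rank_add[OF _ _ lZ lZ, of x y]]
        by (simp add: Hom_module_simps)
      show "\<ominus>\<^bsub>?H\<^esub> x \<in> ?N" if "x \<in> ?N" for x
        using that H.M.a_inv_closed[of x] cong[OF fin_rank_uminus[OF _ lZ lZ, of x]]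
        by (simp add: Hom_module_uminus[OF R lZ lZ])
      show "r \<odot>\<^bsub>?H\<^esub> x \<in> ?N" if "x \<in> ?N" for x
        using that H.lm_smult_closed[OF r, of x] cong[OF smul, of x] by (simp add: Hom_module_simps)
    qed (use r H.lm_smult_r_distr H.M.abelian_group_axioms in auto)
    also have "\<dots> \<longleftrightarrow> fin_rank R Z Z (\<lambda>x. r \<odot>\<^bsub>Z\<^esub> x)"
    proof
      assume *: "\<forall>x\<in>carrier ?H. r \<odot>\<^bsub>?H\<^esub> x \<in> ?N"
      have "(\<lambda>x\<in>carrier Z. x) \<in> carrier ?H" by (rule restrict_hom[OF hom_id lZ])
      then have "r \<odot>\<^bsub>?H\<^esub> (\<lambda>x\<in>carrier Z. x) \<in> ?N" using * by blast
      then have "fin_rank R Z Z (\<lambda>x\<in>carrier Z. r \<odot>\<^bsub>Z\<^esub> (\<lambda>x\<in>carrier Z. x) x)"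
        by (simp add: Hom_module_simps)
      then show "fin_rank R Z Z (\<lambda>x. r \<odot>\<^bsub>Z\<^esub> x)"
        by (rule fin_rank_cong) (simp_all add: lZ)
    next
      assume *: "fin_rank R Z Z (\<lambda>x. r \<odot>\<^bsub>Z\<^esub> x)"
      show "\<forall>f\<in>carrier ?H. r \<odot>\<^bsub>?H\<^esub> f \<in> ?N"
      proof
        fix f assume f: "f \<in> carrier ?H"
        show "r \<odot>\<^bsub>?H\<^esub> f \<in> ?N"
          using H.lm_smult_closed[OF r f] cong[OF fin_rank_comp_right[OF * hom[OF f]]]
          by (simp add: Hom_module_simps)
      qed
    qed
    finally show ?thesis
      using r by (simp add: stable_ann_def stable_Hom_def projective_homs_eq[OF R lZ Z] fr_ann_def)
  qed (simp add: stable_ann_def annihilator_def fr_ann_def)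
qed

subsection \<open>Ext computed from a resolution\<close>

text \<open>Names the choice made inside \<open>Ext\<close>, so that its resolution can be obtained
  once and compared between isomorphic modules.\<close>

definition ext_resolution where
  "ext_resolution R M = (SOME (P, d). \<exists>\<epsilon>. projective_resolution R M P d \<epsilon>)"

lemma ext_resolution:
  assumes "noetherian_ring R" "cring R" "fg_module R M"
  shows "\<exists>P d \<epsilon>. ext_resolution R M = (P, d) \<and> projective_resolution R M P d \<epsilon>"
proof -
  have "\<exists>q. case q of (P, d) \<Rightarrow> \<exists>\<epsilon>. projective_resolution R M P d \<epsilon>"
    using projective_resolution_exists[OF assms] by auto
  from someI_ex[OF this] show ?thesis
    by (cases "ext_resolution R M") (auto simp: ext_resolution_def)
qed

lemma Ext_eq: "ext_resolution R M = (P, d) \<Longrightarrow> Ext R n M N = Hom_cohomology R P d N n"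
  by (simp add: Ext_def ext_resolution_def)

text \<open>Replaces cosets of extensional maps by plain homomorphisms: being killed by r means that
  r times each cocycle is a coboundary. The vanishing form serves the Ext condition on maximal
  Cohen-Macaulay modules. Degree 0 stands apart because zero is its only coboundary.\<close>

lemma Hom_cohomology_ann:
  assumes R: "cring R" and P: "\<And>i. left_module R (P i)" and N: "left_module R N"
    and d: "\<And>i. d i \<in> module_hom R (P (Suc i)) (P i)"
      "\<And>i x. x \<in> carrier (P (Suc (Suc i))) \<Longrightarrow> d i (d (Suc i) x) = \<zero>\<^bsub>P i\<^esub>"
    and r: "r \<in> carrier R"
  shows Hom_cohomology_ann_Suc: "r \<in> annihilator R (Hom_cohomology R P d N (Suc k)) \<longleftrightarrow>
      (\<forall>f\<in>module_hom R (P (Suc k)) N. (\<forall>x\<in>carrier (P (Suc (Suc k))). f (d (Suc k) x) = \<zero>\<^bsub>N\<^esub>) \<longrightarrow>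
        (\<exists>g\<in>module_hom R (P k) N. \<forall>x\<in>carrier (P (Suc k)). r \<odot>\<^bsub>N\<^esub> f x = g (d k x)))"
      (is "?L \<longleftrightarrow> ?R")
    and Hom_cohomology_zero_Suc: "carrier (Hom_cohomology R P d N (Suc k)) = {\<zero>\<^bsub>Hom_cohomology R P d N (Suc k)\<^esub>} \<Longrightarrow>
      f \<in> module_hom R (P (Suc k)) N \<Longrightarrow> (\<And>x. x \<in> carrier (P (Suc (Suc k))) \<Longrightarrow> f (d (Suc k) x) = \<zero>\<^bsub>N\<^esub>) \<Longrightarrow>
        \<exists>g\<in>module_hom R (P k) N. \<forall>x\<in>carrier (P (Suc k)). f x = g (d k x)"
    and Hom_cohomology_ann_0: "r \<in> annihilator R (Hom_cohomology R P d N 0) \<Longrightarrow>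
      f \<in> module_hom R (P 0) N \<Longrightarrow> (\<And>x. x \<in> carrier (P (Suc 0)) \<Longrightarrow> f (d 0 x) = \<zero>\<^bsub>N\<^esub>) \<Longrightarrow>
      x \<in> carrier (P 0) \<Longrightarrow> r \<odot>\<^bsub>N\<^esub> f x = \<zero>\<^bsub>N\<^esub>"
proof -
  interpret R: cring R by fact
  interpret N: left_module R N by fact
  have lH: "left_module R (Hom_module R (P n) N)" for n by (rule left_module_Hom[OF R P N])
  let ?Z = "Hom_cocycles R P d N"
  let ?B = "Hom_coboundaries R P d N"
  have Zmem: "f \<in> ?Z n \<longleftrightarrow> f \<in> module_hom R (P n) N \<and> f \<in> extensional (carrier (P n)) \<and>
      (\<forall>x\<in>carrier (P (Suc n)). f (d n x) = \<zero>\<^bsub>N\<^esub>)" for f n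
    by (auto simp: Hom_cocycles_def carrier_Hom_module)
  have dc: "d n x \<in> carrier (P n)" if "x \<in> carrier (P (Suc n))" for n x
    using hom_closed[OF d(1) that] .
  have subZ: "submod R (Hom_module R (P n) N) (?Z n)" for n
  proof -
    interpret H: left_module R "Hom_module R (P n) N" by (rule lH)
    show ?thesis
      unfolding submod_def Hom_cocycles_def
      using H.M.zero_closed H.M.a_closed H.lm_smult_closed dc by (auto simp: Hom_module_simps)
  qed
  note lZ = left_module_submod[OF lH subZ]
  have pull: "(\<lambda>x\<in>carrier (P (Suc k)). g (d k x)) \<in> ?Z (Suc k)" if "g \<in> module_hom R (P k) N" for g k
    using restrict_hom[OF hom_comp[OF d(1) that] P] that dc d(2) hom_zero[OF P N that]
    by (auto simp: Zmem carrier_Hom_module)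
  have Bmem: "f \<in> ?B (Suc k) \<longleftrightarrow> f \<in> extensional (carrier (P (Suc k))) \<and>
     (\<exists>g\<in>module_hom R (P k) N. \<forall>x\<in>carrier (P (Suc k)). f x = g (d k x))" for f k
  proof
    assume "f \<in> ?B (Suc k)"
    then show "f \<in> extensional (carrier (P (Suc k))) \<and>
       (\<exists>g\<in>module_hom R (P k) N. \<forall>x\<in>carrier (P (Suc k)). f x = g (d k x))"
      by (auto simp: Hom_coboundaries_def carrier_Hom_module)
  next
    assume *: "f \<in> extensional (carrier (P (Suc k))) \<and>
       (\<exists>g\<in>module_hom R (P k) N. \<forall>x\<in>carrier (P (Suc k)). f x = g (d k x))"
    then obtain g where g: "g \<in> module_hom R (P k) N" "\<forall>x\<in>carrier (P (Suc k)). f x = g (d k x)" by blast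
    have "f = (\<lambda>x\<in>carrier (P (Suc k)). (\<lambda>x\<in>carrier (P k). g x) (d k x))"
      using * g(2) dc by (intro extensionalityI[of f "carrier (P (Suc k))"]) auto
    then show "f \<in> ?B (Suc k)"
      using imageI[OF restrict_hom[OF g(1) P], of "\<lambda>g. \<lambda>x\<in>carrier (P (Suc k)). g (d k x)"]
      by (simp add: Hom_coboundaries_def del: restrict_apply)
  qed
  have BmemE: "\<exists>g\<in>module_hom R (P k) N. \<forall>x\<in>carrier (P (Suc k)). f x = g (d k x)"
    if "f \<in> ?B (Suc k)" for f k
    using conjunct2[OF iffD1[OF Bmem that]] .
  have subB: "submod R ((Hom_module R (P n) N)\<lparr>carrier := ?Z n\<rparr>) (?B n)" for n
  proof (cases n)
    case 0
    interpret H: left_module R "(Hom_module R (P 0) N)\<lparr>carrier := ?Z 0\<rparr>" by (rule lZ)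
    show ?thesis using H.M.zero_closed H.M.l_zero H.smult_r_null 0
      by (auto simp: submod_def Hom_coboundaries_def)
  next
    case (Suc k)
    have "?B (Suc k) \<subseteq> ?Z (Suc k)"
    proof
      fix f assume f: "f \<in> ?B (Suc k)"
      obtain g where g: "g \<in> module_hom R (P k) N" "\<forall>x\<in>carrier (P (Suc k)). f x = g (d k x)"
        by (rule bexE[OF BmemE[OF f]])
      have e: "f \<in> extensional (carrier (P (Suc k)))" by (rule conjunct1[OF iffD1[OF Bmem f]])
      have "f = (\<lambda>x\<in>carrier (P (Suc k)). g (d k x))"
        using g(2) e by (intro extensionalityI[of f "carrier (P (Suc k))"]) auto
      then show "f \<in> ?Z (Suc k)" using pull[OF g(1)] by simp
    qed
    moreover have "(\<lambda>x\<in>carrier (P (Suc k)). \<zero>\<^bsub>N\<^esub>) \<in> ?B (Suc k)"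
      unfolding Bmem using hom_zero_map[OF N, of "P k"] by (auto intro!: bexI[of _ "\<lambda>x. \<zero>\<^bsub>N\<^esub>"])
    moreover have "(\<lambda>x\<in>carrier (P (Suc k)). f x \<oplus>\<^bsub>N\<^esub> f' x) \<in> ?B (Suc k)"
      if ff: "f \<in> ?B (Suc k)" "f' \<in> ?B (Suc k)" for f f'
    proof -
      obtain g where g: "g \<in> module_hom R (P k) N" "\<forall>x\<in>carrier (P (Suc k)). f x = g (d k x)"
        by (rule bexE[OF BmemE[OF ff(1)]])
      obtain g' where g': "g' \<in> module_hom R (P k) N" "\<forall>x\<in>carrier (P (Suc k)). f' x = g' (d k x)"
        by (rule bexE[OF BmemE[OF ff(2)]])
      show ?thesis unfolding Bmem using g(2) g'(2)
        by (intro conjI bexI[OF _ hom_plus[OF N g(1) g'(1)]]) auto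
    qed
    moreover have "(\<lambda>x\<in>carrier (P (Suc k)). a \<odot>\<^bsub>N\<^esub> f x) \<in> ?B (Suc k)"
      if f: "f \<in> ?B (Suc k)" and a: "a \<in> carrier R" for f a
    proof -
      obtain g where g: "g \<in> module_hom R (P k) N" "\<forall>x\<in>carrier (P (Suc k)). f x = g (d k x)"
        by (rule bexE[OF BmemE[OF f]])
      show ?thesis unfolding Bmem using g(2) by (intro conjI bexI[OF _ hom_scale[OF R N g(1) a]]) auto
    qed
    ultimately show ?thesis
      using Suc by (auto simp: submod_def Hom_module_simps)
  qed
  let ?C = "\<lambda>n. (Hom_module R (P n) N)\<lparr>carrier := ?Z n\<rparr>"
  have ann: "r \<in> annihilator R (Hom_cohomology R P d N n) \<longleftrightarrow> (\<forall>f\<in>?Z n. (\<lambda>x\<in>carrier (P n). r \<odot>\<^bsub>N\<^esub> f x) \<in> ?B n)" for n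
  proof -
    interpret C: left_module R "?C n" by (rule lZ)
    note sB = submodD[OF subB[of n]]
    have "r \<in> annihilator R (quotient_module (?C n) (?B n)) \<longleftrightarrow> (\<forall>x\<in>carrier (?C n). r \<odot>\<^bsub>?C n\<^esub> x \<in> ?B n)"
      by (rule quotient_module_annihilator[OF C.M.abelian_group_axioms sB(1,2,3) submod_minus[OF lZ subB]])
        (use r sB C.lm_smult_closed C.lm_smult_r_distr in auto)
    then show ?thesis by (simp add: Hom_cohomology_def Hom_module_simps)
  qed
  show "?L \<longleftrightarrow> ?R"
  proof
    assume L: ?L
    show ?R
    proof (intro ballI impI)
      fix f assume f: "f \<in> module_hom R (P (Suc k)) N" "\<forall>x\<in>carrier (P (Suc (Suc k))). f (d (Suc k) x) = \<zero>\<^bsub>N\<^esub>"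
      have "(\<lambda>x\<in>carrier (P (Suc k)). f x) \<in> ?Z (Suc k)"
        using restrict_hom[OF f(1) P] f(2) dc by (auto simp: Zmem carrier_Hom_module)
      then have "(\<lambda>x\<in>carrier (P (Suc k)). r \<odot>\<^bsub>N\<^esub> (\<lambda>x\<in>carrier (P (Suc k)). f x) x) \<in> ?B (Suc k)"
        using L ann by blast
      then show "\<exists>g\<in>module_hom R (P k) N. \<forall>x\<in>carrier (P (Suc k)). r \<odot>\<^bsub>N\<^esub> f x = g (d k x)"
        unfolding Bmem by auto
    qed
  next
    assume R': ?R
    show ?L unfolding ann Bmem
    proof
      fix f assume "f \<in> ?Z (Suc k)"
      then obtain g where "g\<in>module_hom R (P k) N" "\<forall>x\<in>carrier (P (Suc k)). r \<odot>\<^bsub>N\<^esub> f x = g (d k x)"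
        using R' unfolding Zmem by blast
      then show "(\<lambda>x\<in>carrier (P (Suc k)). r \<odot>\<^bsub>N\<^esub> f x) \<in> extensional (carrier (P (Suc k))) \<and>
         (\<exists>g\<in>module_hom R (P k) N. \<forall>x\<in>carrier (P (Suc k)). (\<lambda>x\<in>carrier (P (Suc k)). r \<odot>\<^bsub>N\<^esub> f x) x = g (d k x))"
        by auto
    qed
  qed
  show "\<exists>g\<in>module_hom R (P k) N. \<forall>x\<in>carrier (P (Suc k)). f x = g (d k x)"
    if c: "carrier (Hom_cohomology R P d N (Suc k)) = {\<zero>\<^bsub>Hom_cohomology R P d N (Suc k)\<^esub>}"
      and f: "f \<in> module_hom R (P (Suc k)) N" "\<And>x. x \<in> carrier (P (Suc (Suc k))) \<Longrightarrow> f (d (Suc k) x) = \<zero>\<^bsub>N\<^esub>"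
  proof -
    have "(\<lambda>x\<in>carrier (P (Suc k)). f x) \<in> ?Z (Suc k)"
      using restrict_hom[OF f(1) P] f(2) dc by (auto simp: Zmem carrier_Hom_module)
    then have "(\<lambda>x\<in>carrier (P (Suc k)). f x) \<in> ?B (Suc k)"
      using quotient_module_zero[OF left_module_abelian_group[OF lZ] c[unfolded Hom_cohomology_def]] submodD(2)[OF subB[of "Suc k"]]
      by auto
    then show ?thesis unfolding Bmem by auto
  qed
  show "r \<odot>\<^bsub>N\<^esub> f x = \<zero>\<^bsub>N\<^esub>"
    if a: "r \<in> annihilator R (Hom_cohomology R P d N 0)"
      and f: "f \<in> module_hom R (P 0) N" "\<And>x. x \<in> carrier (P (Suc 0)) \<Longrightarrow> f (d 0 x) = \<zero>\<^bsub>N\<^esub>"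
      and x: "x \<in> carrier (P 0)"
  proof -
    have "(\<lambda>x\<in>carrier (P 0). f x) \<in> ?Z 0"
      using restrict_hom[OF f(1) P] f(2) dc by (auto simp: Zmem carrier_Hom_module)
    then have "(\<lambda>x\<in>carrier (P 0). r \<odot>\<^bsub>N\<^esub> (\<lambda>x\<in>carrier (P 0). f x) x) = (\<lambda>x\<in>carrier (P 0). \<zero>\<^bsub>N\<^esub>)"
      using a ann[of 0] by (auto simp: Hom_coboundaries_def Hom_module_simps)
    from fun_cong[OF this, of x] x show ?thesis by simp
  qed
qed

subsection \<open>Stable retracts and short exact sequences\<close>

lemma fr_annD: "r \<in> fr_ann R X \<Longrightarrow> r \<in> carrier R" "r \<in> fr_ann R X \<Longrightarrow> fin_rank R X X (\<lambda>x. r \<odot>\<^bsub>X\<^esub> x)"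
  by (simp_all add: fr_ann_def)

lemma fin_rank_scale:
  assumes "cring R" "left_module R X" "left_module R Y" "fin_rank R X Y g" "r \<in> carrier R"
  shows "fin_rank R X Y (\<lambda>x. r \<odot>\<^bsub>Y\<^esub> g x)"
  using fin_rank_comp_left[OF assms(4) hom_scale[OF assms(1,3) hom_id assms(5)] assms(2,3,3)] .

lemma fr_ann_add:
  assumes "left_module R X" "r \<in> fr_ann R X" "s \<in> fr_ann R X"
  shows "r \<oplus>\<^bsub>R\<^esub> s \<in> fr_ann R X"
proof -
  interpret left_module R X by fact
  have "fin_rank R X X (\<lambda>x. (r \<oplus>\<^bsub>R\<^esub> s) \<odot>\<^bsub>X\<^esub> x)"
    by (rule fin_rank_cong[OF fin_rank_add[OF fr_annD(2)[OF assms(2)] fr_annD(2)[OF assms(3)]]])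
      (use assms in \<open>auto simp: fr_ann_def lm_smult_l_distr\<close>)
  then show ?thesis using assms by (auto simp: fr_ann_def)
qed

text \<open>The defect t is allowed because strict retracts are not stable under syzygies: lifts of
  i and p to chosen covers compose to the identity only up to a map through a projective.\<close>

definition stable_retract :: "('a, 'r) ring_scheme \<Rightarrow> ('a, 'm) module \<Rightarrow> ('a, 'n) module \<Rightarrow> bool" where
  "stable_retract R X Y \<longleftrightarrow> (\<exists>i\<in>module_hom R X Y. \<exists>p\<in>module_hom R Y X. \<exists>t. fin_rank R X X t \<and>
     (\<forall>x\<in>carrier X. x = p (i x) \<oplus>\<^bsub>X\<^esub> t x))"

lemma stable_retract_strict:
  assumes "left_module R X" "i \<in> module_hom R X Y" "p \<in> module_hom R Y X" "\<And>x. x \<in> carrier X \<Longrightarrow> p (i x) = x"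
  shows "stable_retract R X Y"
proof -
  interpret left_module R X by fact
  show ?thesis unfolding stable_retract_def
    by (rule bexI[OF _ assms(2)], rule bexI[OF _ assms(3)], rule exI[of _ "\<lambda>x. \<zero>\<^bsub>X\<^esub>"])
      (use assms in \<open>auto intro: fin_rank.zero\<close>)
qed

lemma stable_retract_refl: "left_module R X \<Longrightarrow> stable_retract R X X"
  by (rule stable_retract_strict[OF _ hom_id hom_id]) simp_all

lemma stable_retract_fr_ann:
  assumes R: "cring R" and M: "left_module R X" "left_module R Y"
    and "stable_retract R X Y" and r: "r \<in> fr_ann R Y"
  shows "r \<in> fr_ann R X"
proof -
  interpret X: left_module R X by fact
  obtain i p t where h: "i \<in> module_hom R X Y" "p \<in> module_hom R Y X" "fin_rank R X X t"
     "\<And>x. x \<in> carrier X \<Longrightarrow> x = p (i x) \<oplus>\<^bsub>X\<^esub> t x"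
    using assms(4) unfolding stable_retract_def by blast
  note rc = fr_annD(1)[OF r]
  have "fin_rank R X X (\<lambda>x. p (r \<odot>\<^bsub>Y\<^esub> i x) \<oplus>\<^bsub>X\<^esub> r \<odot>\<^bsub>X\<^esub> t x)"
    by (intro fin_rank_add fin_rank_scale R M h rc
        fin_rank_comp_left[OF fin_rank_comp_right[OF fr_annD(2)[OF r] h(1)] h(2)])
  then have "fin_rank R X X (\<lambda>x. r \<odot>\<^bsub>X\<^esub> x)"
  proof (rule fin_rank_cong[OF _ M(1) M(1)])
    fix x assume x: "x \<in> carrier X"
    have c: "i x \<in> carrier Y" "p (i x) \<in> carrier X" "t x \<in> carrier X"
      using h(1,2) fin_rank_hom[OF M(1) M(1) h(3)] x by (auto simp: hom_closed)
    have "r \<odot>\<^bsub>X\<^esub> x = r \<odot>\<^bsub>X\<^esub> (p (i x) \<oplus>\<^bsub>X\<^esub> t x)" using h(4)[OF x] by simp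
    then show "r \<odot>\<^bsub>X\<^esub> x = p (r \<odot>\<^bsub>Y\<^esub> i x) \<oplus>\<^bsub>X\<^esub> r \<odot>\<^bsub>X\<^esub> t x"
      using c rc by (simp add: X.lm_smult_r_distr hom_smult[OF h(2)])
  qed
  then show ?thesis using rc by (simp add: fr_ann_def)
qed

abbreviation kermod where "kermod P X p \<equiv> P\<lparr>carrier := hker P X p\<rparr>"

lemma left_module_kermod:
  assumes "left_module R P" "left_module R X" "p \<in> module_hom R P X"
  shows "left_module R (kermod P X p)"
  using left_module_submod[OF assms(1) submod_hker[OF assms]] .

text \<open>Lift i, s and t to the covers and compare with the identity of P. The covers are
  independent of each other, so for X = Y this contains the content of Schanuel's lemma.\<close>

lemma stable_retract_syzygy:
  assumes R: "cring R" and M: "left_module R X" "left_module R Y" and "stable_retract R X Y"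
    and P: "fproj R P" "p \<in> module_hom R P X" "p ` carrier P = carrier X"
    and Q: "fproj R Q" "q \<in> module_hom R Q Y" "q ` carrier Q = carrier Y"
  shows "stable_retract R (kermod P X p) (kermod Q Y q)"
proof -
  note lP = fproj_left_module[OF P(1)] and lQ = fproj_left_module[OF Q(1)]
  interpret X: left_module R X by fact
  interpret P: left_module R P by (rule lP)
  obtain i s t where h: "i \<in> module_hom R X Y" "s \<in> module_hom R Y X" "fin_rank R X X t"
     "\<And>x. x \<in> carrier X \<Longrightarrow> x = s (i x) \<oplus>\<^bsub>X\<^esub> t x"
    using assms(4) unfolding stable_retract_def by blast
  obtain i' where i': "i' \<in> module_hom R P Q" "\<And>x. x \<in> carrier P \<Longrightarrow> q (i' x) = i (p x)"
    using fproj_lift[OF P(1) hom_comp[OF P(2) h(1)] Q(2) _ M(2) lQ] Q(3) h(1) P(2)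
    by (auto simp: hom_closed)
  obtain s' where s': "s' \<in> module_hom R Q P" "\<And>x. x \<in> carrier Q \<Longrightarrow> p (s' x) = s (q x)"
    using fproj_lift[OF Q(1) hom_comp[OF Q(2) h(2)] P(2) _ M(1) lP] P(3) h(2) Q(2)
    by (auto simp: hom_closed)
  obtain t' where t': "fin_rank R X P t'" "\<And>x. x \<in> carrier X \<Longrightarrow> p (t' x) = t x"
    using fin_rank_lift[OF h(3) hom_id P(2) _ M(1) M(1) M(1) lP] P(3) by auto
  note t'h = fin_rank_hom[OF M(1) lP t'(1)]
  \<comment> \<open>The error of the lifts. It sends all of P into the kernel of p, hence its
    restriction to that kernel factors through the projective P and has finite rank; on the kernel
    the term with t' vanishes.\<close>
  define u where "u x = x \<ominus>\<^bsub>P\<^esub> (s' (i' x) \<oplus>\<^bsub>P\<^esub> t' (p x))" for x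
  have u: "u \<in> module_hom R P P"
    unfolding u_def by (intro hom_minus_map hom_plus hom_id lP hom_comp[OF i'(1) s'(1)] hom_comp[OF P(2) t'h])
  have uk: "u x \<in> hker P X p" if x: "x \<in> carrier P" for x
  proof -
    have c: "i' x \<in> carrier Q" "s' (i' x) \<in> carrier P" "p x \<in> carrier X" "t' (p x) \<in> carrier P" "t (p x) \<in> carrier X"
        "s (i (p x)) \<in> carrier X"
      using x i'(1) s'(1) P(2) t'h fin_rank_hom[OF M(1) M(1) h(3)] h(1,2) by (auto simp: hom_closed)
    have "p (u x) = p x \<ominus>\<^bsub>X\<^esub> (s (i (p x)) \<oplus>\<^bsub>X\<^esub> t (p x))"
      using c x by (simp add: u_def hom_diff[OF lP M(1) P(2)] hom_add[OF P(2)] s'(2) i'(2) t'(2))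
    also have "\<dots> = p x \<ominus>\<^bsub>X\<^esub> p x" using h(4)[OF c(3)] by simp
    finally show ?thesis using c(3) hom_closed[OF u x] by (simp add: hker_def)
  qed
  have lK: "left_module R (kermod P X p)" by (rule left_module_kermod[OF lP M(1) P(2)])
  have sub: "hker P X p \<subseteq> carrier P" "hker Q Y q \<subseteq> carrier Q" by (auto simp: hker_def)
  have "i' \<in> module_hom R (kermod P X p) (kermod Q Y q)"
    by (intro hom_submod hom_from_submod i' sub)
      (use i' hom_zero[OF M h(1)] hom_closed[OF i'(1)] in \<open>auto simp: hker_def\<close>)
  moreover have "s' \<in> module_hom R (kermod Q Y q) (kermod P X p)"
    by (intro hom_submod hom_from_submod s' sub)
      (use s' hom_zero[OF M(2,1) h(2)] hom_closed[OF s'(1)] in \<open>auto simp: hker_def\<close>)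
  moreover have "fin_rank R (kermod P X p) (kermod P X p) u"
    by (rule fin_rank_comp_right[OF fin_rank_fproj_source[OF P(1) hom_submod[OF u uk] lK]
         hom_from_submod[OF hom_id sub(1)]])
  moreover have "x = s' (i' x) \<oplus>\<^bsub>P\<^esub> u x" if "x \<in> hker P X p" for x
  proof -
    have x: "x \<in> carrier P" "p x = \<zero>\<^bsub>X\<^esub>" using that by (auto simp: hker_def)
    have c: "s' (i' x) \<in> carrier P" using x i'(1) s'(1) by (auto simp: hom_closed)
    show ?thesis using x c hom_zero[OF M(1) lP t'h] by (simp add: u_def)
  qed
  ultimately show ?thesis unfolding stable_retract_def by (auto intro!: bexI exI)
qed

lemma fr_ann_lift:
  assumes "r \<in> fr_ann R X" "p \<in> module_hom R P X" "p ` carrier P = carrier X"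
    and M: "left_module R X" "left_module R P"
  obtains s where "fin_rank R X P s" "s \<in> module_hom R X P" "\<And>x. x \<in> carrier X \<Longrightarrow> p (s x) = r \<odot>\<^bsub>X\<^esub> x"
proof -
  obtain s where "fin_rank R X P s" "\<forall>x\<in>carrier X. p (s x) = r \<odot>\<^bsub>X\<^esub> x"
    using fin_rank_lift[OF fr_annD(2)[OF assms(1)] hom_id assms(2) _ M(1) M(1) M] assms(3) by auto
  then show thesis using that fin_rank_hom[OF M] by blast
qed

text \<open>If s lifts multiplication by r on X to P, then r - s p maps P into the kernel of p and
  agrees with r there. So multiplication by r on the kernel factors through P.\<close>

lemma fr_ann_syzygy:
  assumes R: "cring R" and M: "left_module R X"
    and P: "fproj R P" "p \<in> module_hom R P X" "p ` carrier P = carrier X" and r: "r \<in> fr_ann R X"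
  shows "r \<in> fr_ann R (kermod P X p)"
proof -
  note lP = fproj_left_module[OF P(1)]
  interpret X: left_module R X by fact
  interpret P: left_module R P by (rule lP)
  note rc = fr_annD(1)[OF r]
  obtain s where s: "fin_rank R X P s" "s \<in> module_hom R X P" "\<And>x. x \<in> carrier X \<Longrightarrow> p (s x) = r \<odot>\<^bsub>X\<^esub> x"
    using fr_ann_lift[OF r P(2,3) M lP] by blast
  define u where "u x = r \<odot>\<^bsub>P\<^esub> x \<ominus>\<^bsub>P\<^esub> s (p x)" for x
  have u: "u \<in> module_hom R P P"
    unfolding u_def by (intro hom_minus_map hom_scale hom_id R rc lP hom_comp[OF P(2) s(2)])
  have uk: "u x \<in> hker P X p" if x: "x \<in> carrier P" for x
  proof -
    have c: "p x \<in> carrier X" "s (p x) \<in> carrier P"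
      using x P(2) s(2) by (auto simp: hom_closed)
    have "p (u x) = r \<odot>\<^bsub>X\<^esub> p x \<ominus>\<^bsub>X\<^esub> r \<odot>\<^bsub>X\<^esub> p x"
      using c x rc by (simp add: u_def hom_diff[OF lP M(1) P(2)] hom_smult[OF P(2)] s(3))
    then show ?thesis using c(1) rc hom_closed[OF u x] by (simp add: hker_def)
  qed
  have sub: "hker P X p \<subseteq> carrier P" by (auto simp: hker_def)
  have lK: "left_module R (kermod P X p)" by (rule left_module_kermod[OF lP M(1) P(2)])
  have "fin_rank R (kermod P X p) (kermod P X p) u"
    by (rule fin_rank_comp_right[OF fin_rank_fproj_source[OF P(1) hom_submod[OF u uk] lK]
         hom_from_submod[OF hom_id sub(1)]])
  then have "fin_rank R (kermod P X p) (kermod P X p) (\<lambda>x. r \<odot>\<^bsub>P\<^esub> x)"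
    by (rule fin_rank_cong[OF _ lK lK])
      (use rc hom_zero[OF M lP s(2)] in \<open>auto simp: hker_def u_def a_minus_def\<close>)
  then show ?thesis using rc by (simp add: fr_ann_def)
qed

definition ses where
  "ses R X Y Z i p \<longleftrightarrow> left_module R X \<and> left_module R Y \<and> left_module R Z \<and>
     i \<in> module_hom R X Y \<and> inj_on i (carrier X) \<and> p \<in> module_hom R Y Z \<and> p ` carrier Y = carrier Z \<and>
     i ` carrier X = hker Y Z p"

lemma sesD:
  assumes "ses R X Y Z i p"
  shows "left_module R X" "left_module R Y" "left_module R Z" "i \<in> module_hom R X Y" "inj_on i (carrier X)"
    "p \<in> module_hom R Y Z" "p ` carrier Y = carrier Z" "i ` carrier X = hker Y Z p"
  using assms by (auto simp: ses_def)

lemma hom_corestrict_inj: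
  assumes M: "left_module R X" "left_module R Y" "left_module R W"
    and i: "i \<in> module_hom R X Y" "inj_on i (carrier X)"
    and f: "f \<in> module_hom R W Y" "\<And>w. w \<in> carrier W \<Longrightarrow> f w \<in> i ` carrier X"
  shows "\<exists>g\<in>module_hom R W X. \<forall>w\<in>carrier W. i (g w) = f w"
proof -
  interpret X: left_module R X by fact
  interpret W: left_module R W by fact
  define g where "g w = inv_into (carrier X) i (f w)" for w
  have g: "g w \<in> carrier X" "i (g w) = f w" if "w \<in> carrier W" for w
    using f(2)[OF that] by (auto simp: g_def inv_into_into f_inv_into_f)
  have "g \<in> module_hom R W X"
  proof (rule module_homI)
    fix x y assume "x \<in> carrier W" "y \<in> carrier W"
    then show "g (x \<oplus>\<^bsub>W\<^esub> y) = g x \<oplus>\<^bsub>X\<^esub> g y"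
      by (intro inj_onD[OF i(2)]) (simp_all add: g hom_add[OF i(1)] hom_add[OF f(1)])
  next
    fix a x assume "a \<in> carrier R" "x \<in> carrier W"
    then show "g (a \<odot>\<^bsub>W\<^esub> x) = a \<odot>\<^bsub>X\<^esub> g x"
      by (intro inj_onD[OF i(2)]) (simp_all add: g hom_smult[OF i(1)] hom_smult[OF f(1)])
  qed (rule g)
  then show ?thesis using g by blast
qed

text \<open>On Y, r' differs from the finite rank map s p by a map that lands in the image of X.
  That difference factors as i k, and r makes it finite rank because it does so on X. Each end costs
  one factor.\<close>

lemma fr_ann_ses:
  assumes R: "cring R" and E: "ses R X Y Z i p" and r: "r \<in> fr_ann R X" and r': "r' \<in> fr_ann R Z"
  shows "r \<otimes>\<^bsub>R\<^esub> r' \<in> fr_ann R Y"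
proof -
  note E = sesD[OF E]
  interpret R: cring R by fact
  interpret X: left_module R X by (rule E)
  interpret Y: left_module R Y by (rule E)
  interpret Z: left_module R Z by (rule E)
  note rc = fr_annD(1)[OF r] fr_annD(1)[OF r']
  obtain s where s: "fin_rank R Z Y s" "s \<in> module_hom R Z Y" "\<And>x. x \<in> carrier Z \<Longrightarrow> p (s x) = r' \<odot>\<^bsub>Z\<^esub> x"
    using fr_ann_lift[OF r' E(6,7) E(3,2)] by blast
  define u where "u y = r' \<odot>\<^bsub>Y\<^esub> y \<ominus>\<^bsub>Y\<^esub> s (p y)" for y
  have u: "u \<in> module_hom R Y Y"
    unfolding u_def by (intro hom_minus_map hom_scale hom_id R rc E hom_comp[OF E(6) s(2)])
  have "u y \<in> i ` carrier X" if y: "y \<in> carrier Y" for y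
  proof -
    have c: "p y \<in> carrier Z" "s (p y) \<in> carrier Y"
      using y E(6) s(2) by (auto simp: hom_closed)
    have "p (u y) = r' \<odot>\<^bsub>Z\<^esub> p y \<ominus>\<^bsub>Z\<^esub> r' \<odot>\<^bsub>Z\<^esub> p y"
      using c y rc by (simp add: u_def hom_diff[OF E(2,3,6)] hom_smult[OF E(6)] s(3))
    then show ?thesis unfolding E(8) using c(1) rc hom_closed[OF u y] by (simp add: hker_def)
  qed
  then obtain k where k: "k \<in> module_hom R Y X" "\<And>y. y \<in> carrier Y \<Longrightarrow> i (k y) = u y"
    using hom_corestrict_inj[OF E(1,2,2,4,5) u] by blast
  have "fin_rank R Y Y (\<lambda>y. r \<odot>\<^bsub>Y\<^esub> s (p y) \<oplus>\<^bsub>Y\<^esub> i (r \<odot>\<^bsub>X\<^esub> k y))"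
    by (intro fin_rank_add fin_rank_scale R E rc fin_rank_comp_right[OF s(1) E(6)]
        fin_rank_comp_left[OF fin_rank_comp_right[OF fr_annD(2)[OF r] k(1)] E(4)])
  then have "fin_rank R Y Y (\<lambda>y. (r \<otimes>\<^bsub>R\<^esub> r') \<odot>\<^bsub>Y\<^esub> y)"
  proof (rule fin_rank_cong[OF _ E(2,2)])
    fix y assume y: "y \<in> carrier Y"
    have c: "s (p y) \<in> carrier Y" "k y \<in> carrier X" "u y \<in> carrier Y"
      using y E(6) s(2) k(1) u by (auto simp: hom_closed)
    have "s (p y) \<oplus>\<^bsub>Y\<^esub> u y = r' \<odot>\<^bsub>Y\<^esub> y" using c y rc by (simp add: u_def)
    then show "(r \<otimes>\<^bsub>R\<^esub> r') \<odot>\<^bsub>Y\<^esub> y = r \<odot>\<^bsub>Y\<^esub> s (p y) \<oplus>\<^bsub>Y\<^esub> i (r \<odot>\<^bsub>X\<^esub> k y)"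
      using c y rc by (simp add: Y.lm_smult_assoc hom_smult[OF E(4)] k(2) flip: Y.lm_smult_r_distr)
  qed
  then show ?thesis using rc by (simp add: fr_ann_def)
qed

lemma ses_kermod:
  assumes "left_module R P" "left_module R X" "p \<in> module_hom R P X" "p ` carrier P = carrier X"
  shows "ses R (kermod P X p) P X (\<lambda>x. x) p"
  unfolding ses_def using assms left_module_kermod[OF assms(1-3)]
  by (auto simp: hker_def intro: hom_from_submod hom_id)

text \<open>One module Q covers both Y and Z. The kernel of Q \<rightarrow> Y lies in that of Q
  \<rightarrow> Z, and the quotient is the kernel of Y \<rightarrow> Z, which is X. In the stable
  category this is the rotation of a triangle.\<close>

lemma ses_rotate:
  assumes E: "ses R X Y Z i p" and Q: "left_module R Q" "q \<in> module_hom R Q Y" "q ` carrier Q = carrier Y"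
  shows "\<exists>k. ses R (kermod Q Y q) (kermod Q Z (\<lambda>x. p (q x))) X (\<lambda>x. x) k"
proof -
  note E = sesD[OF E]
  note pq = hom_comp[OF Q(2) E(6)]
  have sub: "hker Q Z (\<lambda>x. p (q x)) \<subseteq> carrier Q" "hker Q Y q \<subseteq> hker Q Z (\<lambda>x. p (q x))"
    using hom_zero[OF E(2,3,6)] by (auto simp: hker_def)
  have l: "left_module R (kermod Q Y q)" "left_module R (kermod Q Z (\<lambda>x. p (q x)))"
    using left_module_kermod[OF Q(1) E(2) Q(2)] left_module_kermod[OF Q(1) E(3) pq] by auto
  obtain k where k: "k \<in> module_hom R (kermod Q Z (\<lambda>x. p (q x))) X"
      "\<And>x. x \<in> hker Q Z (\<lambda>x. p (q x)) \<Longrightarrow> i (k x) = q x"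
    using hom_corestrict_inj[OF E(1,2) l(2) E(4,5) hom_from_submod[OF Q(2) sub(1)]] hom_closed[OF Q(2)]
    by (auto simp: E(8) hker_def)
  have "k ` hker Q Z (\<lambda>x. p (q x)) = carrier X"
  proof
    show "k ` hker Q Z (\<lambda>x. p (q x)) \<subseteq> carrier X" using hom_closed[OF k(1)] by auto
    show "carrier X \<subseteq> k ` hker Q Z (\<lambda>x. p (q x))"
    proof
      fix x assume x: "x \<in> carrier X"
      have ix: "i x \<in> hker Y Z p" using E(8) x by blast
      then obtain y where y: "y \<in> carrier Q" "q y = i x" using Q(3) by (auto simp: hker_def dest!: equalityD2 subsetD)
      then have yk: "y \<in> hker Q Z (\<lambda>x. p (q x))" using ix by (auto simp: hker_def)
      moreover have "k y = x"
        using inj_onD[OF E(5), of "k y" x] k(2)[OF yk] y x hom_closed[OF k(1), of y] yk by simp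
      ultimately show "x \<in> k ` hker Q Z (\<lambda>x. p (q x))" by blast
    qed
  qed
  moreover have "hker Q Y q = hker (kermod Q Z (\<lambda>x. p (q x))) X k"
  proof -
    have "k x = \<zero>\<^bsub>X\<^esub> \<longleftrightarrow> q x = \<zero>\<^bsub>Y\<^esub>" if x: "x \<in> hker Q Z (\<lambda>x. p (q x))" for x
    proof -
      interpret X: left_module R X by (rule E)
      show ?thesis
        using k(2)[OF x] hom_zero[OF E(1,2,4)] inj_onD[OF E(5), of "k x" "\<zero>\<^bsub>X\<^esub>"] hom_closed[OF k(1), of x] x
        by auto
    qed
    then show ?thesis using sub by (auto simp: hker_def)
  qed
  moreover have "(\<lambda>x. x) \<in> module_hom R (kermod Q Y q) (kermod Q Z (\<lambda>x. p (q x)))"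
    using sub by (intro module_homI) auto
  ultimately show ?thesis using E l k unfolding ses_def by (auto simp: hker_def)
qed

subsection \<open>Annihilators of iterated syzygies\<close>

text \<open>The elements with finite rank on an n-th syzygy. Some cover is asked for at each stage,
  which makes membership easy to prove; \<open>syz_ann_SucD\<close> shows that the choice of cover
  does not matter for finitely generated modules.\<close>

fun syz_ann :: "('a, 'r) ring_scheme \<Rightarrow> nat \<Rightarrow> ('a, 'a univ) module \<Rightarrow> 'a set" where
  "syz_ann R 0 X = fr_ann R X"
| "syz_ann R (Suc n) X = {r. \<exists>(P :: ('a, 'a univ) module) p. fg_projective R P \<and>
     p \<in> module_hom R P X \<and> p ` carrier P = carrier X \<and> r \<in> syz_ann R n (kermod P X p)}"

context
  fixes R :: "('a, 'r) ring_scheme"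
  assumes N: "noetherian_ring R" and R: "cring R"
begin

lemma fg_kermod:
  assumes "fg_projective R P" "left_module R X" "p \<in> module_hom R P X"
  shows "fg_module R (kermod P X p)"
  using assms fg_module_submod[OF N R _ submod_hker]
  by (metis fg_projective_iff fproj_left_module)

lemma fg_cover:
  assumes "fg_module R X"
  obtains P :: "('a, 'a univ) module" and p where "fg_projective R P" "p \<in> module_hom R P X" "p ` carrier P = carrier X"
  using free_cover[OF assms] that by (auto simp: fg_projective_iff)

lemma syz_ann_stable_retract:
  assumes "fg_module R X" "fg_module R Y" "stable_retract R X Y" "r \<in> syz_ann R n Y"
  shows "r \<in> syz_ann R n X"
  using assms
proof (induct n arbitrary: X Y)
  case 0
  then show ?case using stable_retract_fr_ann[OF R] fg_module_left_module by (metis syz_ann.simps(1))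
next
  case (Suc n)
  obtain Q :: "('a, 'a univ) module" and q where Q: "fg_projective R Q" "q \<in> module_hom R Q Y"
     "q ` carrier Q = carrier Y" "r \<in> syz_ann R n (kermod Q Y q)"
    using Suc(5) by auto
  obtain P :: "('a, 'a univ) module" and p where P: "fg_projective R P" "p \<in> module_hom R P X" "p ` carrier P = carrier X"
    using fg_cover[OF Suc(2)] .
  note l = fg_module_left_module[OF Suc(2)] fg_module_left_module[OF Suc(3)]
  have "stable_retract R (kermod P X p) (kermod Q Y q)"
    by (rule stable_retract_syzygy[OF R l Suc(4) _ P(2,3) _ Q(2,3)]) (use P(1) Q(1) in \<open>auto simp: fg_projective_iff\<close>)
  then have "r \<in> syz_ann R n (kermod P X p)"
    using Suc(1)[OF fg_kermod[OF P(1) l(1) P(2)] fg_kermod[OF Q(1) l(2) Q(2)] _ Q(4)] by blast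
  then show ?case using P by auto
qed

text \<open>The kernels of two covers of X are stable retracts of each other, and
  \<open>syz_ann\<close> passes to stable retracts.\<close>

lemma syz_ann_SucD:
  assumes "fg_module R X" "r \<in> syz_ann R (Suc n) X"
    and P: "fg_projective R P" "p \<in> module_hom R P X" "p ` carrier P = carrier X"
  shows "r \<in> syz_ann R n (kermod P X p)"
proof -
  obtain Q :: "('a, 'a univ) module" and q where Q: "fg_projective R Q" "q \<in> module_hom R Q X"
     "q ` carrier Q = carrier X" "r \<in> syz_ann R n (kermod Q X q)"
    using assms(2) by auto
  note l = fg_module_left_module[OF assms(1)]
  have "stable_retract R (kermod P X p) (kermod Q X q)"
    by (rule stable_retract_syzygy[OF R l l stable_retract_refl[OF l] _ P(2,3) _ Q(2,3)])
      (use P(1) Q(1) in \<open>auto simp: fg_projective_iff\<close>)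
  then show ?thesis
    using syz_ann_stable_retract[OF fg_kermod[OF P(1) l P(2)] fg_kermod[OF Q(1) l Q(2)] _ Q(4)] by blast
qed

lemma syz_ann_SucI:
  fixes P :: "('a, 'a univ) module"
  assumes "fg_projective R P" "p \<in> module_hom R P X" "p ` carrier P = carrier X"
    "r \<in> syz_ann R n (kermod P X p)"
  shows "r \<in> syz_ann R (Suc n) X"
  using assms by auto

lemma syz_ann_Suc:
  assumes "fg_module R X" "r \<in> syz_ann R n X"
  shows "r \<in> syz_ann R (Suc n) X"
  using assms
proof (induct n arbitrary: X)
  case 0
  obtain P :: "('a, 'a univ) module" and p where P: "fg_projective R P" "p \<in> module_hom R P X" "p ` carrier P = carrier X"
    using fg_cover[OF 0(1)] .
  have "r \<in> fr_ann R (kermod P X p)"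
    by (rule fr_ann_syzygy[OF R fg_module_left_module[OF 0(1)] _ P(2,3)]) (use P(1) 0 in \<open>auto simp: fg_projective_iff\<close>)
  then show ?case by (intro syz_ann_SucI[OF P]) simp
next
  case (Suc n)
  obtain P :: "('a, 'a univ) module" and p where P: "fg_projective R P" "p \<in> module_hom R P X" "p ` carrier P = carrier X"
    using fg_cover[OF Suc(2)] .
  have "r \<in> syz_ann R (Suc n) (kermod P X p)"
    by (rule Suc(1)[OF fg_kermod[OF P(1) _ P(2)] syz_ann_SucD[OF Suc(2,3) P]])
      (rule fg_module_left_module[OF Suc(2)])
  then show ?case by (rule syz_ann_SucI[OF P])
qed

lemma syz_ann_mono:
  assumes "fg_module R X" "r \<in> syz_ann R m X" "m \<le> n"
  shows "r \<in> syz_ann R n X"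
  using assms(3) by (induct rule: dec_induct) (use assms syz_ann_Suc in auto)

lemma syz_ann_add:
  assumes "fg_module R X" "r \<in> syz_ann R n X" "s \<in> syz_ann R n X"
  shows "r \<oplus>\<^bsub>R\<^esub> s \<in> syz_ann R n X"
  using assms
proof (induct n arbitrary: X)
  case 0
  then show ?case using fr_ann_add fg_module_left_module by (metis syz_ann.simps(1))
next
  case (Suc n)
  obtain P :: "('a, 'a univ) module" and p where P: "fg_projective R P" "p \<in> module_hom R P X" "p ` carrier P = carrier X"
    using fg_cover[OF Suc(2)] .
  note l = fg_module_left_module[OF Suc(2)]
  show ?case
    by (rule syz_ann_SucI[OF P Suc(1)[OF fg_kermod[OF P(1) l P(2)]
        syz_ann_SucD[OF Suc(2,3) P] syz_ann_SucD[OF Suc(2,4) P]]])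
qed

text \<open>Three rotations of a short exact sequence give a short exact sequence of second syzygies.\<close>

lemma syz_ann_ses:
  assumes "ses R X Y Z i p" "fg_module R X" "fg_module R Y" "fg_module R Z"
    and "r \<in> syz_ann R (2 * m) X" "r' \<in> syz_ann R (2 * m) Z"
  shows "r \<otimes>\<^bsub>R\<^esub> r' \<in> syz_ann R (2 * m) Y"
  using assms
proof (induct m arbitrary: X Y Z i p)
  case 0
  then show ?case using fr_ann_ses[OF R] by auto
next
  case (Suc m)
  note E = sesD[OF Suc(2)]
  obtain Q1 :: "('a, 'a univ) module" and q1 where Q1: "fg_projective R Q1" "q1 \<in> module_hom R Q1 Y" "q1 ` carrier Q1 = carrier Y"
    using fg_cover[OF Suc(4)] .
  have Q1': "(\<lambda>x. p (q1 x)) \<in> module_hom R Q1 Z" "(\<lambda>x. p (q1 x)) ` carrier Q1 = carrier Z"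
    using hom_comp[OF Q1(2) E(6)] E(7) Q1(3) by (auto simp flip: image_image)
  let ?Y1 = "kermod Q1 Y q1" and ?Z1 = "kermod Q1 Z (\<lambda>x. p (q1 x))"
  obtain k1 where E1: "ses R ?Y1 ?Z1 X (\<lambda>x. x) k1"
    using ses_rotate[OF Suc(2) _ Q1(2,3)] Q1(1) by (auto simp: fg_projective_iff fproj_left_module)
  have fg1: "fg_module R ?Y1" "fg_module R ?Z1"
    using fg_kermod[OF Q1(1) E(2) Q1(2)] fg_kermod[OF Q1(1) E(3) Q1'(1)] by auto
  obtain Q2 :: "('a, 'a univ) module" and q2 where Q2: "fg_projective R Q2" "q2 \<in> module_hom R Q2 ?Z1" "q2 ` carrier Q2 = carrier ?Z1"
    using fg_cover[OF fg1(2)] .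
  note D1 = sesD[OF E1]
  have Q2': "(\<lambda>x. k1 (q2 x)) \<in> module_hom R Q2 X" "(\<lambda>x. k1 (q2 x)) ` carrier Q2 = carrier X"
    using hom_comp[OF Q2(2) D1(6)] D1(7) Q2(3) by (auto simp flip: image_image)
  let ?Z2 = "kermod Q2 ?Z1 q2" and ?X1 = "kermod Q2 X (\<lambda>x. k1 (q2 x))"
  obtain k2 where E2: "ses R ?Z2 ?X1 ?Y1 (\<lambda>x. x) k2"
    using ses_rotate[OF E1 _ Q2(2,3)] Q2(1) by (auto simp: fg_projective_iff fproj_left_module)
  have fg2: "fg_module R ?Z2" "fg_module R ?X1"
    using fg_kermod[OF Q2(1) D1(2) Q2(2)] fg_kermod[OF Q2(1) D1(3) Q2'(1)] by auto
  obtain Q3 :: "('a, 'a univ) module" and q3 where Q3: "fg_projective R Q3" "q3 \<in> module_hom R Q3 ?X1" "q3 ` carrier Q3 = carrier ?X1"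
    using fg_cover[OF fg2(2)] .
  note D2 = sesD[OF E2]
  have Q3': "(\<lambda>x. k2 (q3 x)) \<in> module_hom R Q3 ?Y1" "(\<lambda>x. k2 (q3 x)) ` carrier Q3 = carrier ?Y1"
    using hom_comp[OF Q3(2) D2(6)] D2(7) Q3(3) by (auto simp flip: image_image)
  let ?X2 = "kermod Q3 ?X1 q3" and ?Y2 = "kermod Q3 ?Y1 (\<lambda>x. k2 (q3 x))"
  obtain k3 where E3: "ses R ?X2 ?Y2 ?Z2 (\<lambda>x. x) k3"
    using ses_rotate[OF E2 _ Q3(2,3)] Q3(1) by (auto simp: fg_projective_iff fproj_left_module)
  have fg3: "fg_module R ?X2" "fg_module R ?Y2"
    using fg_kermod[OF Q3(1) D2(2) Q3(2)] fg_kermod[OF Q3(1) D2(3) Q3'(1)] by auto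
  \<comment> \<open>Each cover serves two modules: Q1 for Y and Z, Q2 for \<open>?Z1\<close> and X,
    Q3 for \<open>?X1\<close> and \<open>?Y1\<close>. So all three second syzygies are available,
    and the ends of the sequence are back in their original order.\<close>
  have "r \<in> syz_ann R (2 * m) ?X2"
    using syz_ann_SucD[OF fg2(2) syz_ann_SucD[OF Suc(3) _ Q2(1) Q2'] Q3] Suc(6) by simp
  moreover have "r' \<in> syz_ann R (2 * m) ?Z2"
    using syz_ann_SucD[OF fg1(2) syz_ann_SucD[OF Suc(5) _ Q1(1) Q1'] Q2] Suc(7) by simp
  ultimately have "r \<otimes>\<^bsub>R\<^esub> r' \<in> syz_ann R (2 * m) ?Y2"
    by (rule Suc(1)[OF E3 fg3 fg2(1)])
  then have "r \<otimes>\<^bsub>R\<^esub> r' \<in> syz_ann R (Suc (Suc (2 * m))) Y"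
    by (intro syz_ann_SucI[OF Q1 syz_ann_SucI[OF Q3(1) Q3']])
  then show ?case by simp
qed

text \<open>One rotation puts a syzygy of Z in the middle, between a syzygy of Y and X, where
  \<open>syz_ann_ses\<close> applies. The second syzygy in the index is spent only to keep it even,
  as that lemma requires.\<close>

lemma syz_ann_tower:
  fixes X Y Z :: "('a, 'a univ) module"
  assumes E: "ses R X Y Z i p" and fg: "fg_module R X" "fg_module R Y" "fg_module R Z"
    and r: "r \<in> fr_ann R Y" and r': "r' \<in> syz_ann R (2 * m) X"
  shows "r \<otimes>\<^bsub>R\<^esub> r' \<in> syz_ann R (2 * Suc m) Z"
proof -
  note D = sesD[OF E]
  obtain Q1 :: "('a, 'a univ) module" and q1 where Q1: "fg_projective R Q1" "q1 \<in> module_hom R Q1 Y" "q1 ` carrier Q1 = carrier Y"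
    using fg_cover[OF fg(2)] .
  have Q1': "(\<lambda>x. p (q1 x)) \<in> module_hom R Q1 Z" "(\<lambda>x. p (q1 x)) ` carrier Q1 = carrier Z"
    using hom_comp[OF Q1(2) D(6)] D(7) Q1(3) by (auto simp flip: image_image)
  let ?Y1 = "kermod Q1 Y q1" and ?Z1 = "kermod Q1 Z (\<lambda>x. p (q1 x))"
  obtain k1 where E1: "ses R ?Y1 ?Z1 X (\<lambda>x. x) k1"
    using ses_rotate[OF E _ Q1(2,3)] Q1(1) by (auto simp: fg_projective_iff fproj_left_module)
  have fg1: "fg_module R ?Y1" "fg_module R ?Z1"
    using fg_kermod[OF Q1(1) D(2) Q1(2)] fg_kermod[OF Q1(1) D(3) Q1'(1)] by auto
  have "r \<in> fr_ann R ?Y1"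
    by (rule fr_ann_syzygy[OF R D(2) _ Q1(2,3) r]) (use Q1(1) in \<open>simp add: fg_projective_iff\<close>)
  then have "r \<in> syz_ann R (2 * m) ?Y1" using syz_ann_mono[OF fg1(1), of r 0] by simp
  then have "r \<otimes>\<^bsub>R\<^esub> r' \<in> syz_ann R (2 * m) ?Z1"
    by (rule syz_ann_ses[OF E1 fg1 fg(1) _ r'])
  then have "r \<otimes>\<^bsub>R\<^esub> r' \<in> syz_ann R (Suc (2 * m)) Z"
    by (rule syz_ann_SucI[OF Q1(1) Q1'])
  from syz_ann_Suc[OF fg(3) this] show ?thesis by simp
qed

end

subsection \<open>Annihilators of Ext\<close>

lemma projective_resolutionD:
  assumes "projective_resolution R M P d \<epsilon>"
  shows "fg_projective R (P i)" "left_module R (P i)" "fproj R (P i)"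
    "d i \<in> module_hom R (P (Suc i)) (P i)" "\<epsilon> \<in> module_hom R (P 0) M" "\<epsilon> ` carrier (P 0) = carrier M"
    "d 0 ` carrier (P (Suc 0)) = hker (P 0) M \<epsilon>"
    "d (Suc i) ` carrier (P (Suc (Suc i))) = hker (P (Suc i)) (P i) (d i)"
    "x \<in> carrier (P (Suc (Suc i))) \<Longrightarrow> d i (d (Suc i) x) = \<zero>\<^bsub>P i\<^esub>"
    "x \<in> carrier (P (Suc 0)) \<Longrightarrow> \<epsilon> (d 0 x) = \<zero>\<^bsub>M\<^esub>"
proof -
  note * = assms[unfolded projective_resolution_def]
  show "fg_projective R (P i)" "d i \<in> module_hom R (P (Suc i)) (P i)" "\<epsilon> \<in> module_hom R (P 0) M"
    "\<epsilon> ` carrier (P 0) = carrier M" and e0: "d 0 ` carrier (P (Suc 0)) = hker (P 0) M \<epsilon>"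
    and eS: "d (Suc i) ` carrier (P (Suc (Suc i))) = hker (P (Suc i)) (P i) (d i)"
    using * by (auto simp: hker_def)
  show "left_module R (P i)" "fproj R (P i)"
    using * by (auto simp: fg_projective_iff fproj_left_module)
  show "d i (d (Suc i) x) = \<zero>\<^bsub>P i\<^esub>" if "x \<in> carrier (P (Suc (Suc i)))"
    using eS that by (auto simp: hker_def)
  show "\<epsilon> (d 0 x) = \<zero>\<^bsub>M\<^esub>" if "x \<in> carrier (P (Suc 0))"
    using e0 that by (auto simp: hker_def)
qed

lemma projective_resolution_shift:
  assumes "projective_resolution R M P d \<epsilon>"
  shows "projective_resolution R (kermod (P 0) M \<epsilon>) (\<lambda>i. P (Suc i)) (\<lambda>i. d (Suc i)) (d 0)"
proof -
  note D = projective_resolutionD[OF assms]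
  have "d 0 \<in> module_hom R (P (Suc 0)) (kermod (P 0) M \<epsilon>)"
    by (rule hom_submod[OF D(4)]) (use D(7) in auto)
  then show ?thesis
    unfolding projective_resolution_def
  proof (intro conjI allI)
    show "d 0 ` carrier (P (Suc 0)) = carrier (kermod (P 0) M \<epsilon>)" using D(7) by simp
    show "d (Suc 0) ` carrier (P (Suc 1)) = {x \<in> carrier (P (Suc 0)). d 0 x = \<zero>\<^bsub>kermod (P 0) M \<epsilon>\<^esub>}"
      using D(8)[of 0] by (simp add: hker_def)
    show "d (Suc (Suc i)) ` carrier (P (Suc (Suc (Suc i)))) =
        {x \<in> carrier (P (Suc (Suc i))). d (Suc i) x = \<zero>\<^bsub>P (Suc i)\<^esub>}" for i
      using D(8)[of "Suc i"] by (simp add: hker_def)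
  qed (rule D(1,4))+
qed

context
  fixes R :: "('a, 'r) ring_scheme"
  assumes N: "noetherian_ring R" and R: "cring R"
begin

text \<open>For k = 0 a cocycle is a map f' on the first syzygy. If s lifts multiplication by r on M
  to P 0, then r - s \<epsilon> maps P 0 into the syzygy and restricts to r, so r f' extends to P 0
  and becomes a coboundary. The rest is dimension shifting.\<close>

lemma syz_ann_ext:
  fixes M :: "('a, 'a univ) module"
  assumes "fg_module R M" "projective_resolution R M P d \<epsilon>" "r \<in> syz_ann R k M" and Y: "left_module R Y"
    and f: "f \<in> module_hom R (P (Suc k)) Y" "\<And>x. x \<in> carrier (P (Suc (Suc k))) \<Longrightarrow> f (d (Suc k) x) = \<zero>\<^bsub>Y\<^esub>"
  shows "\<exists>g\<in>module_hom R (P k) Y. \<forall>x\<in>carrier (P (Suc k)). r \<odot>\<^bsub>Y\<^esub> f x = g (d k x)"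
  using assms(1-3) f
proof (induct k arbitrary: M P d \<epsilon>)
  case 0
  note D = projective_resolutionD[OF 0(2)]
  note M = fg_module_left_module[OF 0(1)]
  interpret M: left_module R M by (rule M)
  interpret P0: left_module R "P 0" by (rule D)
  have r: "r \<in> fr_ann R M" using 0 by simp
  note rc = fr_annD(1)[OF r]
  obtain s where s: "fin_rank R M (P 0) s" "s \<in> module_hom R M (P 0)" "\<And>x. x \<in> carrier M \<Longrightarrow> \<epsilon> (s x) = r \<odot>\<^bsub>M\<^esub> x"
    using fr_ann_lift[OF r D(5,6) M D(2)] by blast
  define u where "u x = r \<odot>\<^bsub>P 0\<^esub> x \<ominus>\<^bsub>P 0\<^esub> s (\<epsilon> x)" for x
  have u: "u \<in> module_hom R (P 0) (P 0)"
    unfolding u_def by (intro hom_minus_map hom_scale hom_id R rc D hom_comp[OF D(5) s(2)])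
  have uk: "u x \<in> hker (P 0) M \<epsilon>" if x: "x \<in> carrier (P 0)" for x
  proof -
    have c: "\<epsilon> x \<in> carrier M" "s (\<epsilon> x) \<in> carrier (P 0)"
      using x D(5) s(2) by (auto simp: hom_closed)
    have "\<epsilon> (u x) = r \<odot>\<^bsub>M\<^esub> \<epsilon> x \<ominus>\<^bsub>M\<^esub> r \<odot>\<^bsub>M\<^esub> \<epsilon> x"
      using c x rc by (simp add: u_def hom_diff[OF D(2) M D(5)] hom_smult[OF D(5)] s(3))
    then show ?thesis using c(1) rc hom_closed[OF u x] by (simp add: hker_def)
  qed
  have lK: "left_module R (kermod (P 0) M \<epsilon>)" by (rule left_module_kermod[OF D(2) M D(5)])
  have d0: "d 0 \<in> module_hom R (P (Suc 0)) (kermod (P 0) M \<epsilon>)" "d 0 ` carrier (P (Suc 0)) = carrier (kermod (P 0) M \<epsilon>)"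
    using hom_submod[OF D(4)] D(7) by auto
  have "f x = \<zero>\<^bsub>Y\<^esub>" if "x \<in> carrier (P (Suc 0))" "d 0 x = \<zero>\<^bsub>P 0\<^esub>" for x
  proof -
    have "x \<in> d (Suc 0) ` carrier (P (Suc (Suc 0)))" using D(8)[of 0] that by (auto simp: hker_def)
    then show ?thesis using 0(5) by auto
  qed
  then obtain f' where f': "f' \<in> module_hom R (kermod (P 0) M \<epsilon>) Y" "\<And>x. x \<in> carrier (P (Suc 0)) \<Longrightarrow> f' (d 0 x) = f x"
    using hom_factor[OF D(2) lK Y d0 0(4)] by auto
  show ?case
  proof (intro bexI ballI)
    show "(\<lambda>x. f' (u x)) \<in> module_hom R (P 0) Y"
      by (rule hom_comp[OF hom_submod[OF u uk] f'(1)])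
    fix x assume x: "x \<in> carrier (P (Suc 0))"
    have c: "d 0 x \<in> carrier (P 0)" "d 0 x \<in> hker (P 0) M \<epsilon>" using hom_closed[OF D(4) x] D(7) x by auto
    have "u (d 0 x) = r \<odot>\<^bsub>P 0\<^esub> d 0 x"
      using c(1) D(10)[OF x] rc hom_zero[OF M D(2) s(2)] by (simp add: u_def a_minus_def)
    then show "r \<odot>\<^bsub>Y\<^esub> f x = f' (u (d 0 x))"
      using hom_smult[OF f'(1) rc, of "d 0 x"] c f'(2)[OF x] by simp
  qed
next
  case (Suc k)
  note D = projective_resolutionD[OF Suc(3)]
  note M = fg_module_left_module[OF Suc(2)]
  show ?case
    by (rule Suc(1)[OF fg_kermod[OF N R D(1) M D(5)] projective_resolution_shift[OF Suc(3)]
        syz_ann_SucD[OF N R Suc(2,4) D(1,5,6)] Suc(5,6)])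
qed

text \<open>The map r - g vanishes on the kernel of p, hence descends to s from M to P. As g takes
  values in the kernel, p s is multiplication by r, factored through a projective.\<close>

lemma fr_ann_of_retraction:
  assumes M: "left_module R M" and P: "fproj R P" "p \<in> module_hom R P M" "p ` carrier P = carrier M"
    and r: "r \<in> carrier R" and g: "g \<in> module_hom R P (kermod P M p)" "\<And>x. x \<in> hker P M p \<Longrightarrow> g x = r \<odot>\<^bsub>P\<^esub> x"
  shows "r \<in> fr_ann R M"
proof -
  note lP = fproj_left_module[OF P(1)]
  interpret M: left_module R M by (rule M)
  interpret P: left_module R P by (rule lP)
  have g': "g \<in> module_hom R P P" by (rule hom_to_ambient[OF g(1)]) (auto simp: hker_def)
  define u where "u x = r \<odot>\<^bsub>P\<^esub> x \<ominus>\<^bsub>P\<^esub> g x" for x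
  have u: "u \<in> module_hom R P P"
    unfolding u_def by (intro hom_minus_map hom_scale hom_id R r lP g')
  have "u x = \<zero>\<^bsub>P\<^esub>" if "x \<in> carrier P" "p x = \<zero>\<^bsub>M\<^esub>" for x
    using g(2)[of x] that r by (simp add: u_def hker_def)
  then obtain s where s: "s \<in> module_hom R M P" "\<And>x. x \<in> carrier P \<Longrightarrow> s (p x) = u x"
    using hom_factor[OF lP M lP P(2,3) u] by blast
  have "fin_rank R M M (\<lambda>x. p (s x))"
    by (rule fin_rank_comp_left[OF fin_rank_fproj_target[OF P(1) s(1)] P(2) M lP M])
  then have "fin_rank R M M (\<lambda>x. r \<odot>\<^bsub>M\<^esub> x)"
  proof (rule fin_rank_cong[OF _ M M])
    fix x assume "x \<in> carrier M"
    then obtain y where y: "y \<in> carrier P" "x = p y" using P(3) by auto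
    have "p (g y) = \<zero>\<^bsub>M\<^esub>" "g y \<in> carrier P" using hom_closed[OF g(1) y(1)] by (auto simp: hker_def)
    then have "p (u y) = r \<odot>\<^bsub>M\<^esub> p y \<ominus>\<^bsub>M\<^esub> \<zero>\<^bsub>M\<^esub>"
      using y r by (simp add: u_def hom_diff[OF lP M P(2)] hom_smult[OF P(2)])
    then show "r \<odot>\<^bsub>M\<^esub> x = p (s x)"
      using y r hom_closed[OF P(2) y(1)] s(2)[OF y(1)] by (simp add: a_minus_def)
  qed
  then show ?thesis using r by (simp add: fr_ann_def)
qed

text \<open>The counterpart of \<open>fin_rank_lift\<close>: here the functionals are extended and
  the vectors stay.\<close>

lemma fin_rank_extend:
  assumes M: "left_module R K" "left_module R P" "left_module R Y" and KP: "carrier K \<subseteq> carrier P"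
    and ext: "\<And>q. q \<in> module_hom R K (regular_module R) \<Longrightarrow>
       \<exists>q'\<in>module_hom R P (regular_module R). \<forall>x\<in>carrier K. q' x = q x"
    and "fin_rank R K Y g"
  shows "\<exists>g'\<in>module_hom R P Y. \<forall>x\<in>carrier K. g' x = g x"
  using assms(6)
proof induct
  case (zero g)
  then show ?case by (intro bexI[OF _ hom_zero_map[OF M(3)]]) auto
next
  case (step g p y g')
  from step obtain h where h: "h\<in>module_hom R P Y" "\<forall>x\<in>carrier K. h x = g x" by blast
  obtain p' where p': "p'\<in>module_hom R P (regular_module R)" "\<forall>x\<in>carrier K. p' x = p x"
    using ext[OF step(3)] by blast
  have "fin_rank R P Y (\<lambda>x. \<zero>\<^bsub>Y\<^esub> \<oplus>\<^bsub>Y\<^esub> p' x \<odot>\<^bsub>Y\<^esub> y)"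
    by (rule fin_rank.step[OF fin_rank.zero p'(1) step(4)]) auto
  from hom_plus[OF M(3) h(1) fin_rank_hom[OF M(2,3) this]]
  show ?case
  proof (rule bexI[rotated], intro ballI)
    fix x assume x: "x \<in> carrier K"
    interpret Y: left_module R Y by (rule M)
    have "p' x \<in> carrier R" using hom_closed[OF p'(1), of x] x KP by auto
    then show "h x \<oplus>\<^bsub>Y\<^esub> (\<zero>\<^bsub>Y\<^esub> \<oplus>\<^bsub>Y\<^esub> p' x \<odot>\<^bsub>Y\<^esub> y) = g' x"
      using x step(4,5) h(2) p'(2) by simp
  qed
qed

lemma ext_ann_fr_ann:
  fixes M :: "('a, 'a univ) module"
  assumes "fg_module R M" "projective_resolution R M P d \<epsilon>" and r: "r \<in> carrier R"
    and "\<And>(Y :: ('a, 'a univ) module) f. fg_module R Y \<Longrightarrow> f \<in> module_hom R (P (Suc k)) Y \<Longrightarrow>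
      (\<And>x. x \<in> carrier (P (Suc (Suc k))) \<Longrightarrow> f (d (Suc k) x) = \<zero>\<^bsub>Y\<^esub>) \<Longrightarrow>
      \<exists>g\<in>module_hom R (P k) Y. \<forall>x\<in>carrier (P (Suc k)). r \<odot>\<^bsub>Y\<^esub> f x = g (d k x)"
    and "\<And>i q. q \<in> module_hom R (P (Suc i)) (regular_module R) \<Longrightarrow>
      (\<And>x. x \<in> carrier (P (Suc (Suc i))) \<Longrightarrow> q (d (Suc i) x) = \<zero>\<^bsub>R\<^esub>) \<Longrightarrow>
      \<exists>g\<in>module_hom R (P i) (regular_module R). \<forall>x\<in>carrier (P (Suc i)). q x = g (d i x)"
  shows "r \<in> fr_ann R M"
  using assms(1,2,4,5)
proof (induct k arbitrary: M P d \<epsilon>)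
  case 0
  note D = projective_resolutionD[OF 0(2)]
  note M = fg_module_left_module[OF 0(1)]
  have fgK: "fg_module R (kermod (P 0) M \<epsilon>)" by (rule fg_kermod[OF N R D(1) M D(5)])
  have d0: "d 0 \<in> module_hom R (P (Suc 0)) (kermod (P 0) M \<epsilon>)"
    using hom_submod[OF D(4)] D(7) by auto
  \<comment> \<open>The decisive class is d 0 itself, seen as a map onto the first syzygy: that r
    kills it means that multiplication by r on the syzygy extends to P 0.\<close>
  obtain g where g: "g\<in>module_hom R (P 0) (kermod (P 0) M \<epsilon>)"
      "\<And>x. x\<in>carrier (P (Suc 0)) \<Longrightarrow> r \<odot>\<^bsub>P 0\<^esub> d 0 x = g (d 0 x)"
    using 0(3)[OF fgK d0] D(9) by auto
  show ?case
  proof (rule fr_ann_of_retraction[OF M D(3,5,6) r g(1)])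
    fix x assume "x \<in> hker (P 0) M \<epsilon>"
    then obtain y where "y \<in> carrier (P (Suc 0))" "x = d 0 y" unfolding D(7)[symmetric] by blast
    then show "g x = r \<odot>\<^bsub>P 0\<^esub> x" using g(2) by simp
  qed
next
  case (Suc k)
  note D = projective_resolutionD[OF Suc(3)]
  note M = fg_module_left_module[OF Suc(2)]
  let ?K = "kermod (P 0) M \<epsilon>"
  have fgK: "fg_module R ?K" by (rule fg_kermod[OF N R D(1) M D(5)])
  note lK = fg_module_left_module[OF fgK]
  interpret R: cring R by (rule R)
  have lR: "left_module R (regular_module R)" by (rule left_module_regular[OF R.ring_axioms])
  have d0: "d 0 \<in> module_hom R (P (Suc 0)) ?K" using hom_submod[OF D(4)] D(7) by auto
  have "r \<in> fr_ann R ?K"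
    by (rule Suc(1)[OF fgK projective_resolution_shift[OF Suc(3)] Suc(4) Suc(5)])
  then have fr: "fin_rank R ?K ?K (\<lambda>x. r \<odot>\<^bsub>P 0\<^esub> x)" by (auto dest: fr_annD)
  \<comment> \<open>Descent from the syzygy to M: multiplication by r on the syzygy is a finite sum,
    and its functionals extend to P 0 by the vanishing hypothesis.\<close>
  have "\<exists>g\<in>module_hom R (P 0) ?K. \<forall>x\<in>carrier ?K. g x = r \<odot>\<^bsub>P 0\<^esub> x"
  proof (rule fin_rank_extend[OF lK D(2) lK _ _ fr])
    fix q assume q: "q \<in> module_hom R ?K (regular_module R)"
    obtain g where g: "g\<in>module_hom R (P 0) (regular_module R)" "\<forall>x\<in>carrier (P (Suc 0)). q (d 0 x) = g (d 0 x)"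
      using Suc(5)[OF hom_comp[OF d0 q]] D(9) hom_zero[OF lK lR q] by auto
    then show "\<exists>q'\<in>module_hom R (P 0) (regular_module R). \<forall>x\<in>carrier ?K. q' x = q x"
      by (intro bexI[OF _ g(1)]) (simp flip: D(7))
  qed (auto simp: hker_def)
  then show ?case
    using fr_ann_of_retraction[OF M D(3,5,6) r] by auto
qed

end

subsection \<open>Restriction of scalars along a finite algebra\<close>

lemma restrict_scalars_simps [simp]:
  "carrier (restrict_scalars \<phi> M) = carrier M"
  "\<zero>\<^bsub>restrict_scalars \<phi> M\<^esub> = \<zero>\<^bsub>M\<^esub>"
  "x \<oplus>\<^bsub>restrict_scalars \<phi> M\<^esub> y = x \<oplus>\<^bsub>M\<^esub> y"
  "r \<odot>\<^bsub>restrict_scalars \<phi> M\<^esub> x = \<phi> r \<odot>\<^bsub>M\<^esub> x"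
  by (simp_all add: restrict_scalars_def)

lemma opposite_ring_simps [simp]:
  "carrier (opposite_ring L) = carrier L"
  "\<zero>\<^bsub>opposite_ring L\<^esub> = \<zero>\<^bsub>L\<^esub>"
  "\<one>\<^bsub>opposite_ring L\<^esub> = \<one>\<^bsub>L\<^esub>"
  "x \<oplus>\<^bsub>opposite_ring L\<^esub> y = x \<oplus>\<^bsub>L\<^esub> y"
  "x \<otimes>\<^bsub>opposite_ring L\<^esub> y = y \<otimes>\<^bsub>L\<^esub> x"
  by (simp_all add: opposite_ring_def)

lemma ring_opposite_ring:
  assumes "ring L" shows "ring (opposite_ring L)"
proof -
  interpret ring L by fact
  show ?thesis
    by (rule ringI, rule abelian_groupI, auto intro!: monoidI simp: a_ac l_distr r_distr m_assoc add.l_inv_ex)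
qed

lemma kermod_restrict_scalars:
  "kermod (restrict_scalars \<phi> P) (restrict_scalars \<phi> X) p = restrict_scalars \<phi> (kermod P X p)"
  by (simp add: restrict_scalars_def hker_def)

text \<open>The elements of the quotient are again sets over the type of M, so a quotient of a free
  module lands in the universe type. Vanishing in the quotient is all that is used of its
  construction.\<close>

lemma left_module_quotient:
  fixes M :: "('a, 'm) module"
  assumes M: "left_module A M" and S: "submod A M S"
  obtains k :: "'m \<Rightarrow> 'm set" where "left_module A (image_module k M)"
    "k \<in> module_hom A M (image_module k M)"
    "\<And>x. x \<in> carrier M \<Longrightarrow> k x = \<zero>\<^bsub>image_module k M\<^esub> \<longleftrightarrow> x \<in> S"
proof -
  interpret left_module A M by fact
  define k where "k v = {w \<in> carrier M. w \<ominus>\<^bsub>M\<^esub> v \<in> S}" for v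
  have k: "k x = k y \<longleftrightarrow> x \<ominus>\<^bsub>M\<^esub> y \<in> S" if xy: "x \<in> carrier M" "y \<in> carrier M" for x y
  proof
    assume "k x = k y"
    moreover have "x \<in> k x" using xy submodD(2)[OF S] by (simp add: k_def a_minus_def M.r_neg)
    ultimately show "x \<ominus>\<^bsub>M\<^esub> y \<in> S" by (simp add: k_def)
  next
    assume d: "x \<ominus>\<^bsub>M\<^esub> y \<in> S"
    have "w \<ominus>\<^bsub>M\<^esub> x \<in> S \<longleftrightarrow> w \<ominus>\<^bsub>M\<^esub> y \<in> S" if w: "w \<in> carrier M" for w
    proof
      have e: "w \<ominus>\<^bsub>M\<^esub> y = (w \<ominus>\<^bsub>M\<^esub> x) \<oplus>\<^bsub>M\<^esub> (x \<ominus>\<^bsub>M\<^esub> y)"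
        using w xy by (simp add: a_minus_def M.a_assoc M.r_neg1)
      show "w \<ominus>\<^bsub>M\<^esub> y \<in> S" if "w \<ominus>\<^bsub>M\<^esub> x \<in> S"
        using submodD(3)[OF S that d] e by simp
      have e': "w \<ominus>\<^bsub>M\<^esub> x = (w \<ominus>\<^bsub>M\<^esub> y) \<ominus>\<^bsub>M\<^esub> (x \<ominus>\<^bsub>M\<^esub> y)"
        using e w xy by simp
      show "w \<ominus>\<^bsub>M\<^esub> x \<in> S" if "w \<ominus>\<^bsub>M\<^esub> y \<in> S"
        using submod_diff[OF M S that d] e' by simp
    qed
    then show "k x = k y" by (auto simp: k_def)
  qed
  note im = image_module[OF M S k]
  have "k x = \<zero>\<^bsub>image_module k M\<^esub> \<longleftrightarrow> x \<in> S" if "x \<in> carrier M" for x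
    using k[OF that M.zero_closed] hom_zero[OF M im] that M.add.inv_one by (simp add: a_minus_def a_inv_def)
  with im show thesis using that by blast
qed

context
  fixes R :: "('a, 'r) ring_scheme" and \<phi> :: "'a \<Rightarrow> 'l" and L :: "('l, 's) ring_scheme"
  assumes fin: "finite_algebra R \<phi> L"
begin

lemma finite_algebraD:
  "cring R" "ring L" "\<phi> \<in> ring_hom R L" "r \<in> carrier R \<Longrightarrow> x \<in> carrier L \<Longrightarrow> \<phi> r \<otimes>\<^bsub>L\<^esub> x = x \<otimes>\<^bsub>L\<^esub> \<phi> r"
  "fg_module R (algebra_module \<phi> L)" "ring R" "ring (opposite_ring L)"
  using fin by (auto simp: finite_algebra_def cring_def ring_opposite_ring)

lemma phi_simps:
  "r \<in> carrier R \<Longrightarrow> \<phi> r \<in> carrier L"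
  "r \<in> carrier R \<Longrightarrow> s \<in> carrier R \<Longrightarrow> \<phi> (r \<oplus>\<^bsub>R\<^esub> s) = \<phi> r \<oplus>\<^bsub>L\<^esub> \<phi> s"
  "r \<in> carrier R \<Longrightarrow> s \<in> carrier R \<Longrightarrow> \<phi> (r \<otimes>\<^bsub>R\<^esub> s) = \<phi> r \<otimes>\<^bsub>L\<^esub> \<phi> s"
  "\<phi> \<one>\<^bsub>R\<^esub> = \<one>\<^bsub>L\<^esub>" "\<phi> \<zero>\<^bsub>R\<^esub> = \<zero>\<^bsub>L\<^esub>"
  using finite_algebraD(3) ring_hom_zero[OF finite_algebraD(3,6,2)]
  by (auto simp: ring_hom_closed ring_hom_add ring_hom_mult ring_hom_one)

lemma left_module_restrict_scalars:
  assumes "left_module (opposite_ring L) M"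
  shows "left_module R (restrict_scalars \<phi> M)"
proof -
  interpret left_module "opposite_ring L" M by fact
  have "abelian_group (restrict_scalars \<phi> M)"
    by (rule abelian_groupI) (auto simp: M.a_ac intro: M.add.l_inv_ex)
  then show ?thesis
  proof (rule left_moduleI[OF finite_algebraD(6)])
    \<comment> \<open>Over the opposite ring the product acts in reversed order; centrality of the
      image of \<phi> restores it.\<close>
    fix a b x assume *: "a \<in> carrier R" "b \<in> carrier R" "x \<in> carrier (restrict_scalars \<phi> M)"
    then show "(a \<otimes>\<^bsub>R\<^esub> b) \<odot>\<^bsub>restrict_scalars \<phi> M\<^esub> x =
        a \<odot>\<^bsub>restrict_scalars \<phi> M\<^esub> (b \<odot>\<^bsub>restrict_scalars \<phi> M\<^esub> x)"
      using lm_smult_assoc[of "\<phi> a" "\<phi> b" x] finite_algebraD(4)[OF *(1) phi_simps(1)[OF *(2)]]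
      by (simp add: phi_simps)
  qed (use lm_smult_l_distr lm_smult_r_distr lm_smult_one lm_smult_closed in \<open>auto simp: phi_simps\<close>)
qed

lemma hom_restrict_scalars:
  "f \<in> module_hom (opposite_ring L) M N \<Longrightarrow> f \<in> module_hom R (restrict_scalars \<phi> M) (restrict_scalars \<phi> N)"
  by (rule module_homI) (auto simp: module_homD phi_simps)

lemma left_module_algebra: "left_module R (algebra_module \<phi> L)"
  using finite_algebraD(5) by (rule fg_module_left_module)

lemma algebra_module_simps [simp]:
  "carrier (algebra_module \<phi> L) = carrier L"
  "\<zero>\<^bsub>algebra_module \<phi> L\<^esub> = \<zero>\<^bsub>L\<^esub>"
  "x \<oplus>\<^bsub>algebra_module \<phi> L\<^esub> y = x \<oplus>\<^bsub>L\<^esub> y"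
  "r \<odot>\<^bsub>algebra_module \<phi> L\<^esub> x = \<phi> r \<otimes>\<^bsub>L\<^esub> x"
  by (simp_all add: algebra_module_def)

lemma hom_from_algebra:
  assumes "left_module (opposite_ring L) M" "y \<in> carrier M"
  shows "(\<lambda>l. l \<odot>\<^bsub>M\<^esub> y) \<in> module_hom R (algebra_module \<phi> L) (restrict_scalars \<phi> M)"
proof -
  interpret left_module "opposite_ring L" M by fact
  show ?thesis
  proof (rule module_homI)
    fix a x assume a: "a \<in> carrier R" "x \<in> carrier (algebra_module \<phi> L)"
    then show "(a \<odot>\<^bsub>algebra_module \<phi> L\<^esub> x) \<odot>\<^bsub>M\<^esub> y = a \<odot>\<^bsub>restrict_scalars \<phi> M\<^esub> (x \<odot>\<^bsub>M\<^esub> y)"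
      using lm_smult_assoc[of "\<phi> a" x y] assms by (simp add: phi_simps finite_algebraD(4))
  qed (use assms lm_smult_l_distr lm_smult_closed in auto)
qed

lemma fg_module_restrict_scalars:
  assumes "fg_module (opposite_ring L) M"
  shows "fg_module R (restrict_scalars \<phi> M)"
proof -
  note M = fg_module_left_module[OF assms]
  interpret left_module "opposite_ring L" M by (rule M)
  note lR = left_module_restrict_scalars[OF M]
  obtain S where S: "finite S" "S \<subseteq> carrier M" "lspan (opposite_ring L) M S = carrier M"
    using assms by (auto simp: fg_module_iff_lspan)
  obtain T where T: "finite T" "T \<subseteq> carrier L" "lspan R (algebra_module \<phi> L) T = carrier L"
    using finite_algebraD(5) by (auto simp: fg_module_iff_lspan)
  \<comment> \<open>Products of R-generators of the algebra with generators of M.\<close>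
  let ?U = "(\<lambda>(t, s). t \<odot>\<^bsub>M\<^esub> s) ` (T \<times> S)"
  let ?M = "restrict_scalars \<phi> M"
  have smc: "a \<odot>\<^bsub>M\<^esub> x \<in> carrier M" if "a \<in> carrier L" "x \<in> carrier M" for a x
    using that lm_smult_closed by simp
  have U: "?U \<subseteq> carrier ?M" using S(2) T(2) by (auto intro!: smc)
  note sp = submodD[OF submod_lspan[OF lR U]]
  have 1: "a \<odot>\<^bsub>M\<^esub> s \<in> lspan R ?M ?U" if s: "s \<in> S" and a: "a \<in> lspan R (algebra_module \<phi> L) T" for a s
  proof -
    have sM: "s \<in> carrier M" using s S by auto
    note h = hom_from_algebra[OF M sM]
    show ?thesis using a
    proof induct
      case zero
      then show ?case using hom_zero[OF left_module_algebra lR h] lspan.zero[of ?M] by simp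
    next
      case (add b t x)
      have c: "t \<in> carrier L" "x \<in> carrier L"
        using add T lspan_carrier[OF left_module_algebra, of T x] by auto
      have "(b \<odot>\<^bsub>algebra_module \<phi> L\<^esub> t \<oplus>\<^bsub>algebra_module \<phi> L\<^esub> x) \<odot>\<^bsub>M\<^esub> s = b \<odot>\<^bsub>?M\<^esub> (t \<odot>\<^bsub>M\<^esub> s) \<oplus>\<^bsub>?M\<^esub> x \<odot>\<^bsub>M\<^esub> s"
        using hom_add[OF h, of "b \<odot>\<^bsub>algebra_module \<phi> L\<^esub> t" x] hom_smult[OF h add(1), of t] c add(1)
          left_module.lm_smult_closed[OF left_module_algebra add(1), of t]
        by simp
      also have "\<dots> \<in> lspan R ?M ?U"
        by (rule lspan.add) (use add s in auto)
      finally show ?case .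
    qed
  qed
  have "x \<in> lspan R ?M ?U" if "x \<in> lspan (opposite_ring L) M S" for x
    using that
  proof induct
    case zero
    then show ?case using lspan.zero[of ?M] by simp
  next
    case (add a s x)
    then show ?case using sp(3)[OF 1 add(4), of s a] T by simp
  qed
  then have "lspan R ?M ?U = carrier ?M"
    using S lspan_carrier[OF lR U] by (intro subset_antisym subsetI) auto
  moreover have "finite ?U" using S T by simp
  ultimately show ?thesis using lR U unfolding fg_module_iff_lspan by blast
qed

text \<open>Each term x \<mapsto> \<open>p x \<odot> y\<close> of the identity of P passes through
  the algebra by R-linear maps, and multiplication by r on the algebra has finite rank over
  R.\<close>

lemma fr_ann_restrict_fproj:
  assumes P: "fproj (opposite_ring L) P" and r: "r \<in> fr_ann R (algebra_module \<phi> L)"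
  shows "r \<in> fr_ann R (restrict_scalars \<phi> P)"
proof -
  let ?P = "restrict_scalars \<phi> P"
  note lP = fproj_left_module[OF P]
  interpret left_module "opposite_ring L" P by (rule lP)
  note rP = left_module_restrict_scalars[OF lP]
  interpret P: left_module R ?P by (rule rP)
  note rc = fr_annD(1)[OF r]
  \<comment> \<open>Stated for every g of finite rank over the algebra, so that the induction can
    run over the terms; the identity is the case of interest.\<close>
  have "fin_rank R ?P ?P (\<lambda>x. r \<odot>\<^bsub>?P\<^esub> g x)" if "fin_rank (opposite_ring L) P P g" for g
    using that
  proof induct
    case (zero g)
    then show ?case using P.smult_r_null[OF rc] by (intro fin_rank.zero) simp
  next
    case (step g p y g')
    have p: "p \<in> module_hom R ?P (algebra_module \<phi> L)"
      by (rule module_homI) (auto simp: module_homD[OF step(3)] phi_simps finite_algebraD(4)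
         hom_closed[OF step(3), simplified])
    have "fin_rank R ?P ?P (\<lambda>x. (r \<odot>\<^bsub>algebra_module \<phi> L\<^esub> p x) \<odot>\<^bsub>P\<^esub> y)"
      by (rule fin_rank_comp_left[OF fin_rank_comp_right[OF fr_annD(2)[OF r] p] hom_from_algebra[OF lP step(4)]
            rP left_module_algebra rP])
    from fin_rank_add[OF step(2) this rP rP]
    show ?case
    proof (rule fin_rank_cong[OF _ rP rP])
      fix x assume x: "x \<in> carrier ?P"
      have c: "p x \<in> carrier L" "g x \<in> carrier P"
        using x hom_closed[OF step(3)] hom_closed[OF fin_rank_hom[OF lP lP step(1)]] by auto
      show "r \<odot>\<^bsub>?P\<^esub> g' x = r \<odot>\<^bsub>?P\<^esub> g x \<oplus>\<^bsub>?P\<^esub> (r \<odot>\<^bsub>algebra_module \<phi> L\<^esub> p x) \<odot>\<^bsub>P\<^esub> y"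
        using x c step(4,5) rc hom_smult[OF hom_from_algebra[OF lP step(4)] rc, of "p x"]
        by (simp add: lm_smult_r_distr phi_simps)
    qed
  qed
  then have "fin_rank R ?P ?P (\<lambda>x. r \<odot>\<^bsub>?P\<^esub> x)"
    using P unfolding fproj_def by blast
  then show ?thesis using rc by (simp add: fr_ann_def)
qed

text \<open>
  If \<open>M = R\<^sup>n / K\<close>, then \<open>X = \<Lambda>\<^sup>n / K\<Lambda>\<close> (a copy of \<open>M \<otimes> \<Lambda>\<close>), and a splitting \<open>g\<close> of \<open>\<phi>\<close>, applied to
  the coordinates, retracts \<open>X\<close> onto \<open>M\<close>.
\<close>

lemma split_retract:
  assumes split: "split_mono R (regular_module R) (algebra_module \<phi> L) \<phi>" and fgM: "fg_module R M"
  shows "\<exists>X :: ('l, 'l univ) module. fg_module (opposite_ring L) X \<and> stable_retract R M (restrict_scalars \<phi> X)"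
proof -
  let ?A = "opposite_ring L"
  note M = fg_module_left_module[OF fgM]
  interpret M: left_module R M by (rule M)
  interpret R: cring R by (rule finite_algebraD)
  obtain g where g: "g \<in> module_hom R (algebra_module \<phi> L) (regular_module R)"
     "\<And>r. r \<in> carrier R \<Longrightarrow> g (\<phi> r) = r"
    using split by (auto simp: split_mono_def)
  have gc: "g x \<in> carrier R" if "x \<in> carrier L" for x using hom_closed[OF g(1)] that by simp
  have g0: "g \<zero>\<^bsub>L\<^esub> = \<zero>\<^bsub>R\<^esub>" using hom_zero[OF left_module_algebra left_module_regular[OF finite_algebraD(6)] g(1)] by simp
  obtain n x where x: "\<And>i. x i \<in> carrier M" "(\<lambda>v. lincomb M v x n) ` carrier (free_module R n) = carrier M"
    using fg_module_generators[OF fgM] by blast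
  let ?F = "free_module R n" and ?G = "free_module ?A n"
  define p where "p v = lincomb M v x n" for v
  have p: "p \<in> module_hom R ?F M" "p ` carrier ?F = carrier M"
    using lincomb_hom[of R M x, OF M x(1)] x(2) by (simp_all add: p_def[abs_def])
  note F = left_module_free[OF finite_algebraD(6), of n]
  note G = left_module_free[OF finite_algebraD(7), of n]
  note G' = left_module_restrict_scalars[OF G]
  have emb: "(\<lambda>v i. \<phi> (v i)) \<in> module_hom R ?F (restrict_scalars \<phi> ?G)"
  proof (rule module_homI)
    fix a v assume a: "a \<in> carrier R" and v: "v \<in> carrier ?F"
    show "(\<lambda>i. \<phi> ((a \<odot>\<^bsub>?F\<^esub> v) i)) = a \<odot>\<^bsub>restrict_scalars \<phi> ?G\<^esub> (\<lambda>i. \<phi> (v i))"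
    proof
      fix i
      have "v i \<in> carrier R" using v by auto
      then show "\<phi> ((a \<odot>\<^bsub>?F\<^esub> v) i) = (a \<odot>\<^bsub>restrict_scalars \<phi> ?G\<^esub> (\<lambda>i. \<phi> (v i))) i"
        using finite_algebraD(4)[OF a phi_simps(1)[of "v i"]] a by (simp add: phi_simps)
    qed
  qed (auto simp: phi_simps)
  have coord: "(\<lambda>w i. g (w i)) \<in> module_hom R (restrict_scalars \<phi> ?G) ?F"
  proof (rule module_homI)
    fix w w' assume "w \<in> carrier (restrict_scalars \<phi> ?G)" "w' \<in> carrier (restrict_scalars \<phi> ?G)"
    then show "(\<lambda>i. g ((w \<oplus>\<^bsub>restrict_scalars \<phi> ?G\<^esub> w') i)) = (\<lambda>i. g (w i)) \<oplus>\<^bsub>?F\<^esub> (\<lambda>i. g (w' i))"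
      using hom_add[OF g(1)] by auto
  next
    fix a w assume a: "a \<in> carrier R" and w: "w \<in> carrier (restrict_scalars \<phi> ?G)"
    show "(\<lambda>i. g ((a \<odot>\<^bsub>restrict_scalars \<phi> ?G\<^esub> w) i)) = a \<odot>\<^bsub>?F\<^esub> (\<lambda>i. g (w i))"
    proof
      fix i
      have wi: "w i \<in> carrier L" using w by auto
      then show "g ((a \<odot>\<^bsub>restrict_scalars \<phi> ?G\<^esub> w) i) = (a \<odot>\<^bsub>?F\<^esub> (\<lambda>i. g (w i))) i"
        using hom_smult[OF g(1) a, of "w i"] finite_algebraD(4)[OF a wi] by simp
    qed
  qed (auto simp: gc g0)
  note pc = hom_comp[OF coord p(1)]
  let ?E = "(\<lambda>v i. \<phi> (v i)) ` hker ?F M p"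
  have E: "?E \<subseteq> carrier ?G" using hom_closed[OF emb] by (auto simp: hker_def simp del: free_module_simps)
  note S = submod_lspan[OF G E]
  have kill: "p (\<lambda>i. g (w i)) = \<zero>\<^bsub>M\<^esub>" if "w \<in> lspan ?A ?G ?E" for w
    using that
  proof induct
    case zero
    then show ?case using hom_zero[OF G' M pc] by simp
  next
    case (add a s w)
    obtain v where v: "v \<in> hker ?F M p" "s = (\<lambda>i. \<phi> (v i))" using add(2) by auto
    have vc: "v \<in> carrier ?F" and vp: "p v = \<zero>\<^bsub>M\<^esub>" using v(1) by (auto simp: hker_def)
    have a: "a \<in> carrier L" using add(1) by simp
    have wG: "w \<in> carrier ?G" using lspan_carrier[OF G E add(3)] .
    have asG: "a \<odot>\<^bsub>?G\<^esub> s \<in> carrier ?G"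
      using left_module.lm_smult_closed[OF G add(1)] E add(2) by blast
    \<comment> \<open>g is only R-linear, not linear over the algebra. But the coordinates of s come
      from R, so they can be pulled out of g, and a multiple of the relation v by \<open>g a\<close>
      is left.\<close>
    have "(\<lambda>i. g ((a \<odot>\<^bsub>?G\<^esub> s) i)) = g a \<odot>\<^bsub>?F\<^esub> v"
    proof
      fix i
      have vi: "v i \<in> carrier R" using vc by auto
      then show "g ((a \<odot>\<^bsub>?G\<^esub> s) i) = (g a \<odot>\<^bsub>?F\<^esub> v) i"
        using hom_smult[OF g(1) vi, of a] a gc[OF a] by (simp add: v(2) R.m_comm)
    qed
    then have "p (\<lambda>i. g ((a \<odot>\<^bsub>?G\<^esub> s) i)) = \<zero>\<^bsub>M\<^esub>"
      using hom_smult[OF p(1) gc[OF a] vc] vp gc[OF a] by simp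
    then show ?case
      using hom_add[OF pc, of "a \<odot>\<^bsub>?G\<^esub> s" w] asG wG add(4) by simp
  qed
  obtain k :: "(nat \<Rightarrow> 'l) \<Rightarrow> 'l univ" where k: "left_module ?A (image_module k ?G)"
    "k \<in> module_hom ?A ?G (image_module k ?G)"
    "\<And>x. x \<in> carrier ?G \<Longrightarrow> k x = \<zero>\<^bsub>image_module k ?G\<^esub> \<longleftrightarrow> x \<in> lspan ?A ?G ?E"
    using left_module_quotient[OF G S] by blast
  let ?X = "image_module k ?G"
  have fgX: "fg_module ?A ?X"
    by (rule fg_module_image[OF fg_module_free[OF finite_algebraD(7)] k(1,2)]) simp
  note X' = left_module_restrict_scalars[OF k(1)] and k' = hom_restrict_scalars[OF k(2)]
  have "\<exists>i\<in>module_hom R M (restrict_scalars \<phi> ?X). \<forall>v\<in>carrier ?F. i (p v) = k (\<lambda>i. \<phi> (v i))"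
  proof (rule hom_factor[OF F M X' p hom_comp[OF emb k']])
    fix v assume v: "v \<in> carrier ?F" "p v = \<zero>\<^bsub>M\<^esub>"
    then have "(\<lambda>i. \<phi> (v i)) \<in> ?E" by (auto simp: hker_def simp del: free_module_simps)
    then show "k (\<lambda>i. \<phi> (v i)) = \<zero>\<^bsub>restrict_scalars \<phi> ?X\<^esub>"
      using k(3)[of "\<lambda>i. \<phi> (v i)"] lspan_superset[OF G E] E by (auto simp del: free_module_simps)
  qed
  then obtain i where i: "i\<in>module_hom R M (restrict_scalars \<phi> ?X)" "\<forall>v\<in>carrier ?F. i (p v) = k (\<lambda>i. \<phi> (v i))" by blast
  have "\<exists>q\<in>module_hom R (restrict_scalars \<phi> ?X) M. \<forall>w\<in>carrier (restrict_scalars \<phi> ?G). q (k w) = p (\<lambda>i. g (w i))"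
  proof (rule hom_factor[OF G' X' M k' _ pc])
    fix w assume "w \<in> carrier (restrict_scalars \<phi> ?G)" "k w = \<zero>\<^bsub>restrict_scalars \<phi> ?X\<^esub>"
    then show "p (\<lambda>i. g (w i)) = \<zero>\<^bsub>M\<^esub>"
      using k(3)[of w] kill by (simp del: free_module_simps)
  qed (simp del: free_module_simps)
  then obtain q where q: "q\<in>module_hom R (restrict_scalars \<phi> ?X) M"
     "\<forall>w\<in>carrier (restrict_scalars \<phi> ?G). q (k w) = p (\<lambda>i. g (w i))" by blast
  have "stable_retract R M (restrict_scalars \<phi> ?X)"
  proof (rule stable_retract_strict[OF M i(1) q(1)])
    fix m assume "m \<in> carrier M"
    then obtain v where v: "v \<in> carrier ?F" "m = p v" using p(2) by (auto simp del: free_module_simps)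
    then have "q (i m) = p (\<lambda>j. g (\<phi> (v j)))"
      using i(2) q(2) hom_closed[OF emb v(1)] by (simp del: free_module_simps)
    also have "(\<lambda>j. g (\<phi> (v j))) = v" using v(1) g(2) by auto
    finally show "q (i m) = m" using v by simp
  qed
  then show ?thesis using fgX by blast
qed

end

section \<open>Powers of ideals, and resolutions over the algebra restricted to R\<close>

lemma ideals_pow_0: "I [^]\<^bsub>ideals_set R\<^esub> (0 :: nat) = carrier R"
  by (simp add: ideals_set_def nat_pow_def)

lemma ideals_pow_Suc: "I [^]\<^bsub>ideals_set R\<^esub> (Suc n) = ideal_prod R (I [^]\<^bsub>ideals_set R\<^esub> n) I"
  by (simp add: ideals_set_def nat_pow_def)

lemma ideals_pow_carrier:
  assumes "ring R" "I \<subseteq> carrier R" "a \<in> I [^]\<^bsub>ideals_set R\<^esub> (n :: nat)"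
  shows "a \<in> carrier R"
  using assms(3)
proof (induct n arbitrary: a)
  case 0
  then show ?case unfolding ideals_pow_0 .
next
  case (Suc n)
  interpret ring R by fact
  show ?case using Suc(2) unfolding ideals_pow_Suc
    by (induct rule: ideal_prod.induct) (use Suc(1) assms(2) in auto)
qed

text \<open>Needed because resolutions over the algebra live in \<open>'l univ\<close>, whereas
  \<open>syz_ann\<close> is formed in \<open>'a univ\<close>.\<close>

lemma ses_iso:
  assumes E: "ses R X Y Z i p" and I: "module_iso R X X' f f'" "module_iso R Y Y' g g'" "module_iso R Z Z' h h'"
  shows "ses R X' Y' Z' (\<lambda>x. g (i (f' x))) (\<lambda>y. h (p (g' y)))"
proof -
  note E = sesD[OF E] and X = module_isoD[OF I(1)] and Y = module_isoD[OF I(2)] and Z = module_isoD[OF I(3)]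
  have c: "f' x \<in> carrier X" if "x \<in> carrier X'" for x using hom_closed[OF X(4) that] .
  have c': "g' y \<in> carrier Y" if "y \<in> carrier Y'" for y using hom_closed[OF Y(4) that] .
  have ci: "i x \<in> carrier Y" if "x \<in> carrier X" for x using hom_closed[OF E(4) that] .
  have cp: "p y \<in> carrier Z" if "y \<in> carrier Y" for y using hom_closed[OF E(6) that] .
  have "inj_on (\<lambda>x. g (i (f' x))) (carrier X')"
  proof (rule inj_onI)
    fix x y assume *: "x \<in> carrier X'" "y \<in> carrier X'" "g (i (f' x)) = g (i (f' y))"
    then have "i (f' x) = i (f' y)" using Y(5) ci c by metis
    then have "f' x = f' y" using inj_onD[OF E(5)] c * by blast
    then show "x = y" using X(6) * by metis
  qed
  moreover have "(\<lambda>y. h (p (g' y))) ` carrier Y' = carrier Z'"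
    using Z(7) E(7) module_isoD(7)[OF module_iso_sym[OF I(2)]] by (metis (no_types, lifting) image_cong image_image)
  moreover have "(\<lambda>x. g (i (f' x))) ` carrier X' = hker Y' Z' (\<lambda>y. h (p (g' y)))"
  proof -
    have "(\<lambda>x. g (i (f' x))) ` carrier X' = g ` hker Y Z p"
      using E(8) module_isoD(7)[OF module_iso_sym[OF I(1)]] by (metis (no_types, lifting) image_cong image_image)
    also have "\<dots> = hker Y' Z' (\<lambda>y. h (p (g' y)))"
    proof (intro subset_antisym subsetI)
      fix y assume "y \<in> g ` hker Y Z p"
      then show "y \<in> hker Y' Z' (\<lambda>y. h (p (g' y)))"
        using Y(5) hom_closed[OF Y(3)] hom_zero[OF Z(1,2,3)] by (auto simp: hker_def)
    next
      fix y assume y: "y \<in> hker Y' Z' (\<lambda>y. h (p (g' y)))"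
      then have yc: "y \<in> carrier Y'" and "h (p (g' y)) = \<zero>\<^bsub>Z'\<^esub>" by (auto simp: hker_def)
      then have "p (g' y) = \<zero>\<^bsub>Z\<^esub>" using Z(5)[OF cp[OF c'[OF yc]]] hom_zero[OF Z(2,1,4)] by simp
      then have "g' y \<in> hker Y Z p" using c'[OF yc] by (simp add: hker_def)
      then show "y \<in> g ` hker Y Z p" using Y(6)[OF yc] by (metis imageI)
    qed
    finally show ?thesis .
  qed
  ultimately show ?thesis
    unfolding ses_def using X Y Z E hom_comp[OF hom_comp[OF X(4) E(4)] Y(3)] hom_comp[OF hom_comp[OF Y(4) E(6)] Z(3)]
    by blast
qed

lemma fr_ann_iso:
  assumes "cring R" "module_iso R X Y f g" "r \<in> fr_ann R X"
  shows "r \<in> fr_ann R Y"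
  using stable_retract_fr_ann[OF assms(1) _ _ stable_retract_strict assms(3), of Y g f] module_isoD[OF assms(2)] by blast

text \<open>n bounds the number of nonzero terms rather than the length: for n = 0 the module is
  zero and the zeroth power is the whole ring. Each term adds one factor and, through
  \<open>syz_ann_tower\<close>, two syzygies, whence 2 * n.\<close>

lemma projective_resolution_syz_ann:
  fixes R :: "('a, 'r) ring_scheme" and X :: "('l, 'l univ) module" and X' :: "('a, 'a univ) module"
  assumes fin: "finite_algebra R \<phi> L" and N: "noetherian_ring R"
    and "left_module R (restrict_scalars \<phi> X)" and "projective_resolution (opposite_ring L) X P d \<epsilon>"
    and "\<And>i. i \<ge> n \<Longrightarrow> carrier (P i) = {\<zero>\<^bsub>P i\<^esub>}"
    and "module_iso R (restrict_scalars \<phi> X) X' f g"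
    and "a \<in> fr_ann R (algebra_module \<phi> L) [^]\<^bsub>ideals_set R\<^esub> n"
  shows "a \<in> syz_ann R (2 * n) X'"
  using assms(3-)
proof (induct n arbitrary: X P d \<epsilon> X' f g a)
  case 0
  note R = finite_algebraD(1)[OF fin]
  interpret R: cring R by (rule R)
  note D = projective_resolutionD[OF 0(2)]
  note iso = module_isoD[OF 0(4)]
  interpret X: left_module R "restrict_scalars \<phi> X" by (rule iso)
  interpret X': left_module R X' by (rule iso)
  have "carrier X = {\<epsilon> \<zero>\<^bsub>P 0\<^esub>}" using D(6) 0(3)[of 0] by simp
  then have "carrier X = {\<zero>\<^bsub>X\<^esub>}" using X.M.zero_closed by auto
  then have "carrier X' = {\<zero>\<^bsub>X'\<^esub>}" using iso(7) hom_zero[OF iso(1-3)] by simp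
  moreover have "a \<in> carrier R" using 0(5) unfolding ideals_pow_0 .
  ultimately show ?case by (auto simp: fr_ann_def intro!: fin_rank.zero)
next
  case (Suc n)
  note R = finite_algebraD(1)[OF fin]
  note D = projective_resolutionD[OF Suc(3)]
  let ?I = "fr_ann R (algebra_module \<phi> L)" and ?K = "kermod (P 0) X \<epsilon>"
  let ?rK = "restrict_scalars \<phi> ?K" and ?rP = "restrict_scalars \<phi> (P 0)" and ?rX = "restrict_scalars \<phi> X"
  have fgP: "fg_module R ?rP" using D(1)[of 0] by (auto simp: fg_projective_iff intro: fg_module_restrict_scalars[OF fin])
  note lP = fg_module_left_module[OF fgP]
  have e: "\<epsilon> \<in> module_hom R ?rP ?rX" "\<epsilon> ` carrier ?rP = carrier ?rX"
    using hom_restrict_scalars[OF fin D(5)] D(6) by auto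
  have E: "ses R ?rK ?rP ?rX (\<lambda>x. x) \<epsilon>"
    using ses_kermod[OF lP Suc(2) e] by (simp add: kermod_restrict_scalars)
  have fgX: "fg_module R ?rX" by (rule fg_module_image[OF fgP Suc(2) e])
  have fgK: "fg_module R ?rK"
    using fg_module_submod[OF N R fgP submod_hker[OF lP Suc(2) e(1)]] by (simp add: kermod_restrict_scalars)
  obtain K' :: "('a, 'a univ) module" and fK gK where K': "module_iso R ?rK K' fK gK"
    using fg_module_copy[OF fgK] by blast
  obtain P' :: "('a, 'a univ) module" and fP gP where P': "module_iso R ?rP P' fP gP"
    using fg_module_copy[OF fgP] by blast
  note E' = ses_iso[OF E K' P' Suc(5)]
  note fgs = fg_module_iso[OF K' fgK] fg_module_iso[OF P' fgP] fg_module_iso[OF Suc(5) fgX]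
  have 1: "s \<in> syz_ann R (2 * n) K'" if "s \<in> ?I [^]\<^bsub>ideals_set R\<^esub> n" for s
    by (rule Suc(1)[OF fg_module_left_module[OF fgK] projective_resolution_shift[OF Suc(3)] Suc(4) K' that]) simp
  have 2: "t \<in> fr_ann R P'" if "t \<in> ?I" for t
    by (rule fr_ann_iso[OF R P' fr_ann_restrict_fproj[OF fin D(3) that]])
  interpret R: cring R by (rule R)
  have "a \<in> ideal_prod R (?I [^]\<^bsub>ideals_set R\<^esub> n) ?I" using Suc(6) unfolding ideals_pow_Suc .
  then show ?case
  proof induct
    case (prod s t)
    have "s \<in> carrier R" "t \<in> carrier R"
      using ideals_pow_carrier[OF R.ring_axioms _ prod(1)] prod(2) by (auto simp: fr_ann_def)
    then show ?case using syz_ann_tower[OF N R E' fgs 2[OF prod(2)] 1[OF prod(1)]] by (simp add: R.m_comm)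
  next
    case (sum s t)
    then show ?case using syz_ann_add[OF N R fgs(3)] by blast
  qed
qed

subsection \<open>Complexes and homotopies\<close>

text \<open>\<open>bounded_complex\<close> without finite generation and without bounds, as the
  complex T of projectives extends in both directions.\<close>

definition cplx :: "('a, 'r) ring_scheme \<Rightarrow> ('a, 'm) cochain_complex \<Rightarrow> bool" where
  "cplx R C \<longleftrightarrow> (\<forall>i. left_module R (cterm C i)) \<and>
     (\<forall>i. cdiff C i \<in> module_hom R (cterm C i) (cterm C (i + 1))) \<and>
     (\<forall>i. \<forall>x\<in>carrier (cterm C i). cdiff C (i + 1) (cdiff C i x) = \<zero>\<^bsub>cterm C (i + 1 + 1)\<^esub>)"

lemma cplxD:
  assumes "cplx R C"
  shows "left_module R (cterm C i)" "cdiff C i \<in> module_hom R (cterm C i) (cterm C (i + 1))"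
    "cdiff C (i - 1) \<in> module_hom R (cterm C (i - 1)) (cterm C i)"
    "x \<in> carrier (cterm C i) \<Longrightarrow> cdiff C (i + 1) (cdiff C i x) = \<zero>\<^bsub>cterm C (i + 1 + 1)\<^esub>"
    "x \<in> carrier (cterm C (i - 1)) \<Longrightarrow> cdiff C i (cdiff C (i - 1) x) = \<zero>\<^bsub>cterm C (i + 1)\<^esub>"
proof -
  have *: "cdiff C j \<in> module_hom R (cterm C j) (cterm C (j + 1))"
    "x \<in> carrier (cterm C j) \<Longrightarrow> cdiff C (j + 1) (cdiff C j x) = \<zero>\<^bsub>cterm C (j + 1 + 1)\<^esub>" for j x
    using assms by (auto simp: cplx_def)
  show "left_module R (cterm C i)" using assms by (simp add: cplx_def)
  show "cdiff C i \<in> module_hom R (cterm C i) (cterm C (i + 1))" by (rule *)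
  show "cdiff C (i - 1) \<in> module_hom R (cterm C (i - 1)) (cterm C i)" using *(1)[of "i - 1"] by simp
  show "cdiff C (i + 1) (cdiff C i x) = \<zero>\<^bsub>cterm C (i + 1 + 1)\<^esub>" if "x \<in> carrier (cterm C i)"
    using * that by blast
  show "cdiff C i (cdiff C (i - 1) x) = \<zero>\<^bsub>cterm C (i + 1)\<^esub>" if "x \<in> carrier (cterm C (i - 1))"
    using *(2)[of x "i - 1"] that by simp
qed

lemma bounded_complex_cplx: "bounded_complex R C \<Longrightarrow> cplx R C"
  by (auto simp: bounded_complex_def cplx_def fg_module_left_module)

lemma bounded_complex_bound:
  assumes "bounded_complex R C"
  obtains n where "\<And>i. \<bar>i\<bar> > n \<Longrightarrow> carrier (cterm C i) = {\<zero>\<^bsub>cterm C i\<^esub>}"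
  using assms by (auto simp: bounded_complex_def)

lemma chain_mapD:
  assumes "chain_map R C D f"
  shows "f i \<in> module_hom R (cterm C i) (cterm D i)"
    "x \<in> carrier (cterm C i) \<Longrightarrow> f (i + 1) (cdiff C i x) = cdiff D i (f i x)"
    "x \<in> carrier (cterm C (i - 1)) \<Longrightarrow> f i (cdiff C (i - 1) x) = cdiff D (i - 1) (f (i - 1) x)"
proof -
  have *: "x \<in> carrier (cterm C i) \<Longrightarrow> f (i + 1) (cdiff C i x) = cdiff D i (f i x)" for i x
    using assms by (auto simp: chain_map_def)
  show "f i \<in> module_hom R (cterm C i) (cterm D i)" using assms by (auto simp: chain_map_def)
  show "x \<in> carrier (cterm C i) \<Longrightarrow> f (i + 1) (cdiff C i x) = cdiff D i (f i x)" by (rule *)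
  show "x \<in> carrier (cterm C (i - 1)) \<Longrightarrow> f i (cdiff C (i - 1) x) = cdiff D (i - 1) (f (i - 1) x)"
    using *[of x "i - 1"] by simp
qed

lemma chain_mapI:
  assumes "\<And>i. f i \<in> module_hom R (cterm C i) (cterm D i)"
    "\<And>i x. x \<in> carrier (cterm C i) \<Longrightarrow> f (i + 1) (cdiff C i x) = cdiff D i (f i x)"
  shows "chain_map R C D f"
  using assms by (auto simp: chain_map_def)

lemma chain_map_comp:
  assumes "chain_map R B C f" "chain_map R C D g"
  shows "chain_map R B D (g \<circ>\<^sub>c f)"
proof (rule chain_mapI)
  show "(g \<circ>\<^sub>c f) i \<in> module_hom R (cterm B i) (cterm D i)" for i
    using hom_comp[OF chain_mapD(1)[OF assms(1)] chain_mapD(1)[OF assms(2)]]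
    by (simp add: chain_comp_def comp_def)
  show "(g \<circ>\<^sub>c f) (i + 1) (cdiff B i x) = cdiff D i ((g \<circ>\<^sub>c f) i x)" if "x \<in> carrier (cterm B i)" for i x
    using chain_mapD(2)[OF assms(1) that] chain_mapD(2)[OF assms(2), of "f i x" i]
      hom_closed[OF chain_mapD(1)[OF assms(1)] that]
    by (simp add: chain_comp_def)
qed

definition chain_scale where
  "chain_scale C a = (\<lambda>i x. a \<odot>\<^bsub>cterm C i\<^esub> x)"

lemma chain_map_scale:
  assumes "cring R" "cplx R C" "a \<in> carrier R"
  shows "chain_map R C C (chain_scale C a)"
  using hom_scale[OF assms(1) cplxD(1)[OF assms(2)] hom_id assms(3)] hom_smult[OF cplxD(2)[OF assms(2)] assms(3)]
  by (auto simp: chain_scale_def intro!: chain_mapI)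

lemma chain_homotopicI:
  assumes "\<And>i. h i \<in> module_hom R (cterm C i) (cterm D (i - 1))"
    "\<And>i x. x \<in> carrier (cterm C i) \<Longrightarrow>
             f i x = g i x \<oplus>\<^bsub>cterm D i\<^esub> (cdiff D (i - 1) (h i x) \<oplus>\<^bsub>cterm D i\<^esub> h (i + 1) (cdiff C i x))"
  shows "chain_homotopic R C D f g"
  using assms unfolding chain_homotopic_def by blast

lemma chain_homotopicE:
  assumes "chain_homotopic R C D f g"
  obtains h where "\<And>i. h i \<in> module_hom R (cterm C i) (cterm D (i - 1))"
    "\<And>i. h (i + 1) \<in> module_hom R (cterm C (i + 1)) (cterm D i)"
    "\<And>i x. x \<in> carrier (cterm C i) \<Longrightarrow>
             f i x = g i x \<oplus>\<^bsub>cterm D i\<^esub> (cdiff D (i - 1) (h i x) \<oplus>\<^bsub>cterm D i\<^esub> h (i + 1) (cdiff C i x))"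
proof -
  obtain h where h: "\<And>i. h i \<in> module_hom R (cterm C i) (cterm D (i - 1))"
    "\<And>i x. x \<in> carrier (cterm C i) \<Longrightarrow>
             f i x = g i x \<oplus>\<^bsub>cterm D i\<^esub> (cdiff D (i - 1) (h i x) \<oplus>\<^bsub>cterm D i\<^esub> h (i + 1) (cdiff C i x))"
    using assms unfolding chain_homotopic_def by blast
  show thesis by (rule that[OF h(1) _ h(2)]) (use h(1)[of "_ + 1"] in simp_all)
qed

text \<open>Maps that agree on the carriers need not be equal as functions, so their agreement is
  recorded as a homotopy, given by zero maps.\<close>

lemma homotopic_cong:
  assumes C: "cplx R C" "cplx R D" and f: "\<And>i. f i \<in> module_hom R (cterm C i) (cterm D i)"
    and eq: "\<And>i x. x \<in> carrier (cterm C i) \<Longrightarrow> f i x = g i x"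
  shows "chain_homotopic R C D f g"
proof (rule chain_homotopicI)
  show "(\<lambda>x. \<zero>\<^bsub>cterm D (i - 1)\<^esub>) \<in> module_hom R (cterm C i) (cterm D (i - 1))" for i
    by (rule hom_zero_map[OF cplxD(1)[OF C(2)]])
  fix i x assume x: "x \<in> carrier (cterm C i)"
  interpret D: left_module R "cterm D i" by (rule cplxD(1)[OF C(2)])
  show "f i x = g i x \<oplus>\<^bsub>cterm D i\<^esub> (cdiff D (i - 1) \<zero>\<^bsub>cterm D (i - 1)\<^esub> \<oplus>\<^bsub>cterm D i\<^esub> \<zero>\<^bsub>cterm D (i + 1 - 1)\<^esub>)"
    using hom_zero[OF cplxD(1)[OF C(2)] cplxD(1)[OF C(2)] cplxD(3)[OF C(2)], of i]
      hom_closed[OF f x] eq[OF x] by simp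
qed

lemma homotopic_sym:
  assumes C: "cplx R C" "cplx R D" and g: "\<And>i. g i \<in> module_hom R (cterm C i) (cterm D i)"
    and fg: "chain_homotopic R C D f g"
  shows "chain_homotopic R C D g f"
proof -
  obtain h where h: "\<And>i. h i \<in> module_hom R (cterm C i) (cterm D (i - 1))"
    "\<And>i. h (i + 1) \<in> module_hom R (cterm C (i + 1)) (cterm D i)"
    "\<And>i x. x \<in> carrier (cterm C i) \<Longrightarrow>
             f i x = g i x \<oplus>\<^bsub>cterm D i\<^esub> (cdiff D (i - 1) (h i x) \<oplus>\<^bsub>cterm D i\<^esub> h (i + 1) (cdiff C i x))"
    by (rule chain_homotopicE[OF fg]) rule
  show ?thesis
  proof (rule chain_homotopicI)
    show "(\<lambda>x. \<ominus>\<^bsub>cterm D (i - 1)\<^esub> h i x) \<in> module_hom R (cterm C i) (cterm D (i - 1))" for i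
      by (rule hom_uminus[OF cplxD(1)[OF C(2)] h(1)])
    fix i x assume x: "x \<in> carrier (cterm C i)"
    interpret D: left_module R "cterm D i" by (rule cplxD(1)[OF C(2)])
    have c: "h i x \<in> carrier (cterm D (i - 1))" "h (i + 1) (cdiff C i x) \<in> carrier (cterm D i)"
      "cdiff D (i - 1) (h i x) \<in> carrier (cterm D i)" "g i x \<in> carrier (cterm D i)"
      using hom_closed[OF h(1) x] hom_closed[OF h(2)] hom_closed[OF cplxD(2)[OF C(1)] x]
        hom_closed[OF cplxD(3)[OF C(2)]] hom_closed[OF g x] by auto
    show "g i x = f i x \<oplus>\<^bsub>cterm D i\<^esub> (cdiff D (i - 1) (\<ominus>\<^bsub>cterm D (i - 1)\<^esub> h i x) \<oplus>\<^bsub>cterm D i\<^esub>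
        \<ominus>\<^bsub>cterm D (i + 1 - 1)\<^esub> h (i + 1) (cdiff C i x))"
      using c by (simp add: h(3)[OF x] hom_minus[OF cplxD(1)[OF C(2)] cplxD(1)[OF C(2)] cplxD(3)[OF C(2)]]
          D.M.a_assoc D.M.r_neg flip: D.M.minus_add)
  qed
qed

lemma homotopic_trans:
  assumes C: "cplx R C" "cplx R D" and k: "\<And>i. k i \<in> module_hom R (cterm C i) (cterm D i)"
    and fg: "chain_homotopic R C D f g" and gk: "chain_homotopic R C D g k"
  shows "chain_homotopic R C D f k"
proof -
  obtain h where h: "\<And>i. h i \<in> module_hom R (cterm C i) (cterm D (i - 1))"
    "\<And>i. h (i + 1) \<in> module_hom R (cterm C (i + 1)) (cterm D i)"
    "\<And>i x. x \<in> carrier (cterm C i) \<Longrightarrow>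
             f i x = g i x \<oplus>\<^bsub>cterm D i\<^esub> (cdiff D (i - 1) (h i x) \<oplus>\<^bsub>cterm D i\<^esub> h (i + 1) (cdiff C i x))"
    by (rule chain_homotopicE[OF fg]) rule
  obtain h' where h': "\<And>i. h' i \<in> module_hom R (cterm C i) (cterm D (i - 1))"
    "\<And>i. h' (i + 1) \<in> module_hom R (cterm C (i + 1)) (cterm D i)"
    "\<And>i x. x \<in> carrier (cterm C i) \<Longrightarrow>
             g i x = k i x \<oplus>\<^bsub>cterm D i\<^esub> (cdiff D (i - 1) (h' i x) \<oplus>\<^bsub>cterm D i\<^esub> h' (i + 1) (cdiff C i x))"
    by (rule chain_homotopicE[OF gk]) rule
  show ?thesis
  proof (rule chain_homotopicI)
    show "(\<lambda>x. h i x \<oplus>\<^bsub>cterm D (i - 1)\<^esub> h' i x) \<in> module_hom R (cterm C i) (cterm D (i - 1))" for i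
      by (rule hom_plus[OF cplxD(1)[OF C(2)] h(1) h'(1)])
    fix i x assume x: "x \<in> carrier (cterm C i)"
    interpret D: left_module R "cterm D i" by (rule cplxD(1)[OF C(2)])
    have c: "h i x \<in> carrier (cterm D (i - 1))" "h (i + 1) (cdiff C i x) \<in> carrier (cterm D i)"
      "cdiff D (i - 1) (h i x) \<in> carrier (cterm D i)" "k i x \<in> carrier (cterm D i)"
      "h' i x \<in> carrier (cterm D (i - 1))" "h' (i + 1) (cdiff C i x) \<in> carrier (cterm D i)"
      "cdiff D (i - 1) (h' i x) \<in> carrier (cterm D i)"
      using hom_closed[OF h(1) x] hom_closed[OF h(2)] hom_closed[OF cplxD(2)[OF C(1)] x]
        hom_closed[OF cplxD(3)[OF C(2)]] hom_closed[OF k x] hom_closed[OF h'(1) x] hom_closed[OF h'(2)] by auto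
    show "f i x = k i x \<oplus>\<^bsub>cterm D i\<^esub> (cdiff D (i - 1) (h i x \<oplus>\<^bsub>cterm D (i - 1)\<^esub> h' i x) \<oplus>\<^bsub>cterm D i\<^esub>
        (h (i + 1) (cdiff C i x) \<oplus>\<^bsub>cterm D (i + 1 - 1)\<^esub> h' (i + 1) (cdiff C i x)))"
      using c by (simp add: h(3)[OF x] h'(3)[OF x] hom_add[OF cplxD(3)[OF C(2)]] D.M.a_ac)
  qed
qed

lemma homotopic_post:
  assumes C: "cplx R B" "cplx R C" "cplx R D" and k: "chain_map R C D k"
    and g: "\<And>i. g i \<in> module_hom R (cterm B i) (cterm C i)"
    and fg: "chain_homotopic R B C f g"
  shows "chain_homotopic R B D (k \<circ>\<^sub>c f) (k \<circ>\<^sub>c g)"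
proof -
  obtain h where h: "\<And>i. h i \<in> module_hom R (cterm B i) (cterm C (i - 1))"
    "\<And>i. h (i + 1) \<in> module_hom R (cterm B (i + 1)) (cterm C i)"
    "\<And>i x. x \<in> carrier (cterm B i) \<Longrightarrow>
             f i x = g i x \<oplus>\<^bsub>cterm C i\<^esub> (cdiff C (i - 1) (h i x) \<oplus>\<^bsub>cterm C i\<^esub> h (i + 1) (cdiff B i x))"
    by (rule chain_homotopicE[OF fg]) rule
  show ?thesis
  proof (rule chain_homotopicI)
    show "(\<lambda>x. k (i - 1) (h i x)) \<in> module_hom R (cterm B i) (cterm D (i - 1))" for i
      by (rule hom_comp[OF h(1) chain_mapD(1)[OF k]])
    fix i x assume x: "x \<in> carrier (cterm B i)"
    interpret C: left_module R "cterm C i" by (rule cplxD(1)[OF C(2)])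
    have c: "h i x \<in> carrier (cterm C (i - 1))" "h (i + 1) (cdiff B i x) \<in> carrier (cterm C i)"
      "cdiff C (i - 1) (h i x) \<in> carrier (cterm C i)" "g i x \<in> carrier (cterm C i)"
      using hom_closed[OF h(1) x] hom_closed[OF h(2)] hom_closed[OF cplxD(2)[OF C(1)] x]
        hom_closed[OF cplxD(3)[OF C(2)]] hom_closed[OF g x] by auto
    show "(k \<circ>\<^sub>c f) i x = (k \<circ>\<^sub>c g) i x \<oplus>\<^bsub>cterm D i\<^esub> (cdiff D (i - 1) (k (i - 1) (h i x)) \<oplus>\<^bsub>cterm D i\<^esub>
        k (i + 1 - 1) (h (i + 1) (cdiff B i x)))"
      using c by (simp add: chain_comp_def h(3)[OF x] hom_add[OF chain_mapD(1)[OF k]] chain_mapD(3)[OF k])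
  qed
qed

lemma homotopic_pre:
  assumes C: "cplx R B" "cplx R C" and k: "chain_map R B C k"
    and fg: "chain_homotopic R C D f g"
  shows "chain_homotopic R B D (f \<circ>\<^sub>c k) (g \<circ>\<^sub>c k)"
proof -
  obtain h where h: "\<And>i. h i \<in> module_hom R (cterm C i) (cterm D (i - 1))"
    "\<And>i. h (i + 1) \<in> module_hom R (cterm C (i + 1)) (cterm D i)"
    "\<And>i x. x \<in> carrier (cterm C i) \<Longrightarrow>
             f i x = g i x \<oplus>\<^bsub>cterm D i\<^esub> (cdiff D (i - 1) (h i x) \<oplus>\<^bsub>cterm D i\<^esub> h (i + 1) (cdiff C i x))"
    by (rule chain_homotopicE[OF fg]) rule
  show ?thesis
  proof (rule chain_homotopicI)
    show "(\<lambda>x. h i (k i x)) \<in> module_hom R (cterm B i) (cterm D (i - 1))" for i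
      by (rule hom_comp[OF chain_mapD(1)[OF k] h(1)])
    show "(f \<circ>\<^sub>c k) i x = (g \<circ>\<^sub>c k) i x \<oplus>\<^bsub>cterm D i\<^esub> (cdiff D (i - 1) (h i (k i x)) \<oplus>\<^bsub>cterm D i\<^esub>
        h (i + 1) (k (i + 1) (cdiff B i x)))" if x: "x \<in> carrier (cterm B i)" for i x
      using h(3)[OF hom_closed[OF chain_mapD(1)[OF k] x]] chain_mapD(2)[OF k x] by (simp add: chain_comp_def)
  qed
qed

abbreviation null_homotopic where
  "null_homotopic R C D f \<equiv> chain_homotopic R C D f (\<lambda>i x. \<zero>\<^bsub>cterm D i\<^esub>)"

lemma null_homotopicI:
  assumes C: "cplx R C" "cplx R D" and h: "\<And>i. h i \<in> module_hom R (cterm C i) (cterm D (i - 1))"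
    and eq: "\<And>i x. x \<in> carrier (cterm C i) \<Longrightarrow>
             f i x = cdiff D (i - 1) (h i x) \<oplus>\<^bsub>cterm D i\<^esub> h (i + 1) (cdiff C i x)"
  shows "null_homotopic R C D f"
proof (rule chain_homotopicI[OF h])
  fix i x assume x: "x \<in> carrier (cterm C i)"
  interpret D: left_module R "cterm D i" by (rule cplxD(1)[OF C(2)])
  have "h (i + 1) (cdiff C i x) \<in> carrier (cterm D i)" "cdiff D (i - 1) (h i x) \<in> carrier (cterm D i)"
    using hom_closed[OF h x] hom_closed[OF h[of "i + 1"]] hom_closed[OF cplxD(2)[OF C(1)] x]
        hom_closed[OF cplxD(3)[OF C(2)]] by auto
  then show "f i x = \<zero>\<^bsub>cterm D i\<^esub> \<oplus>\<^bsub>cterm D i\<^esub> (cdiff D (i - 1) (h i x) \<oplus>\<^bsub>cterm D i\<^esub> h (i + 1) (cdiff C i x))"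
    using eq[OF x] by simp
qed

lemma null_homotopicE:
  assumes C: "cplx R C" "cplx R D" and n: "null_homotopic R C D f"
  obtains h where "\<And>i. h i \<in> module_hom R (cterm C i) (cterm D (i - 1))"
    "\<And>i. h (i + 1) \<in> module_hom R (cterm C (i + 1)) (cterm D i)"
    "\<And>i x. x \<in> carrier (cterm C i) \<Longrightarrow>
             f i x = cdiff D (i - 1) (h i x) \<oplus>\<^bsub>cterm D i\<^esub> h (i + 1) (cdiff C i x)"
proof -
  obtain h where h: "\<And>i. h i \<in> module_hom R (cterm C i) (cterm D (i - 1))"
    "\<And>i. h (i + 1) \<in> module_hom R (cterm C (i + 1)) (cterm D i)"
    "\<And>i x. x \<in> carrier (cterm C i) \<Longrightarrow>
             f i x = \<zero>\<^bsub>cterm D i\<^esub> \<oplus>\<^bsub>cterm D i\<^esub> (cdiff D (i - 1) (h i x) \<oplus>\<^bsub>cterm D i\<^esub> h (i + 1) (cdiff C i x))"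
    by (rule chain_homotopicE[OF n]) rule
  have "f i x = cdiff D (i - 1) (h i x) \<oplus>\<^bsub>cterm D i\<^esub> h (i + 1) (cdiff C i x)" if x: "x \<in> carrier (cterm C i)" for i x
  proof -
    interpret D: left_module R "cterm D i" by (rule cplxD(1)[OF C(2)])
    have "h (i + 1) (cdiff C i x) \<in> carrier (cterm D i)" "cdiff D (i - 1) (h i x) \<in> carrier (cterm D i)"
      using hom_closed[OF h(1) x] hom_closed[OF h(2)] hom_closed[OF cplxD(2)[OF C(1)] x]
        hom_closed[OF cplxD(3)[OF C(2)]] by auto
    then show ?thesis using h(3)[OF x] by simp
  qed
  then show thesis using that h(1,2) by blast
qed

lemma null_homotopic_post:
  fixes B :: "('a, 'm) cochain_complex"
  assumes C: "cplx R B" "cplx R C" "cplx R D" and k: "chain_map R C D k"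
    and f: "null_homotopic R B C f"
  shows "null_homotopic R B D (k \<circ>\<^sub>c f)"
proof -
  have z: "(\<lambda>x. \<zero>\<^bsub>cterm C i\<^esub>) \<in> module_hom R (cterm B i) (cterm C i)" for i
    by (rule hom_zero_map[OF cplxD(1)[OF C(2)]])
  have "(k \<circ>\<^sub>c (\<lambda>i (x :: 'm). \<zero>\<^bsub>cterm C i\<^esub>)) = (\<lambda>i x. \<zero>\<^bsub>cterm D i\<^esub>)"
    by (rule ext, rule ext) (simp add: chain_comp_def hom_zero[OF cplxD(1)[OF C(2)] cplxD(1)[OF C(3)] chain_mapD(1)[OF k]])
  then show ?thesis using homotopic_post[OF C k z f] by simp
qed

subsection \<open>Complexes of projectives with exact dual\<close>

text \<open>The two conditions serve the two halves of \<open>null_to_perfect\<close>: the exact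
  dual gives \<open>null_to_projective\<close>, the projective terms give
  \<open>null_to_acyclic\<close>.\<close>

locale coacyclic =
  fixes R :: "('a, 'r) ring_scheme" and T :: "('a, 'u) cochain_complex"
  assumes R: "cring R" and T: "cplx R T" and fproj_T: "fproj R (cterm T i)"
    and dual_exact: "q \<in> module_hom R (cterm T i) (regular_module R) \<Longrightarrow>
      (\<And>x. x \<in> carrier (cterm T (i - 1)) \<Longrightarrow> q (cdiff T (i - 1) x) = \<zero>\<^bsub>R\<^esub>) \<Longrightarrow>
      \<exists>q'\<in>module_hom R (cterm T (i + 1)) (regular_module R). \<forall>x\<in>carrier (cterm T i). q x = q' (cdiff T i x)"
begin

text \<open>Exactness of the dual is applied to the functionals p f, one for each term of g: each of
  them kills boundaries and so factors through the differential.\<close>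

lemma fin_rank_exact:
  assumes "fin_rank R X Y g" and X: "left_module R X" "left_module R Y"
    and f: "f \<in> module_hom R (cterm T i) X"
    "\<And>x. x \<in> carrier (cterm T (i - 1)) \<Longrightarrow> f (cdiff T (i - 1) x) = \<zero>\<^bsub>X\<^esub>"
  shows "\<exists>h\<in>module_hom R (cterm T (i + 1)) Y. \<forall>x\<in>carrier (cterm T i). g (f x) = h (cdiff T i x)"
  using assms(1)
proof induct
  case (zero g)
  then show ?case
    by (intro bexI[OF _ hom_zero_map[OF X(2)]]) (simp add: hom_closed[OF f(1)])
next
  case (step g p y g')
  interpret R: cring R by (rule R)
  note lR = left_module_regular[OF R.ring_axioms]
  from step obtain h where h: "h \<in> module_hom R (cterm T (i + 1)) Y" "\<forall>x\<in>carrier (cterm T i). g (f x) = h (cdiff T i x)"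
    by blast
  obtain q where q: "q \<in> module_hom R (cterm T (i + 1)) (regular_module R)"
    "\<forall>x\<in>carrier (cterm T i). p (f x) = q (cdiff T i x)"
    using dual_exact[OF hom_comp[OF f(1) step(3)]] f(2) hom_zero[OF X(1) lR step(3)] by auto
  have "fin_rank R (cterm T (i + 1)) Y (\<lambda>x. \<zero>\<^bsub>Y\<^esub> \<oplus>\<^bsub>Y\<^esub> q x \<odot>\<^bsub>Y\<^esub> y)"
    by (rule fin_rank.step[OF fin_rank.zero q(1) step(4)]) auto
  from hom_plus[OF X(2) h(1) fin_rank_hom[OF cplxD(1)[OF T] X(2) this]]
  show ?case
  proof (rule bexI[rotated], intro ballI)
    fix x assume x: "x \<in> carrier (cterm T i)"
    interpret Y: left_module R Y by (rule X)
    have "q (cdiff T i x) \<in> carrier R" using hom_closed[OF q(1) hom_closed[OF cplxD(2)[OF T] x]] by simp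
    then show "g' (f x) = h (cdiff T i x) \<oplus>\<^bsub>Y\<^esub> (\<zero>\<^bsub>Y\<^esub> \<oplus>\<^bsub>Y\<^esub> q (cdiff T i x) \<odot>\<^bsub>Y\<^esub> y)"
      using x step(4) step(5)[OF hom_closed[OF f(1) x]] h(2) q(2) by simp
  qed
qed

text \<open>The homotopy h is built upwards from degree m, below which C is zero. In degree i the
  map f - d h kills the boundaries of T, and as the identity of \<open>cterm C i\<close> has finite
  rank it factors through the differential of T; the factor is the next component.\<close>

lemma null_to_projective:
  assumes C: "cplx R C" and P: "\<And>i. fproj R (cterm C i)" and b: "\<And>i. i < m \<Longrightarrow> carrier (cterm C i) = {\<zero>\<^bsub>cterm C i\<^esub>}"
    and f: "chain_map R T C f"
  shows "null_homotopic R T C f"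
proof -
  note C1 = cplxD[OF C] and T1 = cplxD[OF T] and f1 = chain_mapD[OF f]
  \<comment> \<open>\<open>good i g\<close> admits g as the component of the homotopy in degree i: f
    - d g vanishes on boundaries. \<open>nxt\<close> is the homotopy equation in degree i, with g'
    as the component in degree i + 1.\<close>
  define good where "good i g \<longleftrightarrow> g \<in> module_hom R (cterm T i) (cterm C (i - 1)) \<and>
     (\<forall>x\<in>carrier (cterm T (i - 1)). f i (cdiff T (i - 1) x) = cdiff C (i - 1) (g (cdiff T (i - 1) x)))" for i g
  define nxt where "nxt i g g' \<longleftrightarrow> (\<forall>x\<in>carrier (cterm T i).
      f i x = cdiff C (i - 1) (g x) \<oplus>\<^bsub>cterm C i\<^esub> g' (cdiff T i x))" for i g g'
  have step: "\<exists>g'. good (i + 1) g' \<and> nxt i g g'" if g: "good i g" for i g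
  proof -
    interpret C: left_module R "cterm C i" by (rule C1)
    have g1: "g \<in> module_hom R (cterm T i) (cterm C (i - 1))"
      "\<And>x. x\<in>carrier (cterm T (i - 1)) \<Longrightarrow> f i (cdiff T (i - 1) x) = cdiff C (i - 1) (g (cdiff T (i - 1) x))"
      using g by (auto simp: good_def)
    have dg: "(\<lambda>x. cdiff C (i - 1) (g x)) \<in> module_hom R (cterm T i) (cterm C i)"
      by (rule hom_comp[OF g1(1) C1(3)])
    note e = hom_minus_map[OF C1(1) f1(1) dg]
    have "f i (cdiff T (i - 1) x) \<ominus>\<^bsub>cterm C i\<^esub> cdiff C (i - 1) (g (cdiff T (i - 1) x)) = \<zero>\<^bsub>cterm C i\<^esub>"
      if x: "x \<in> carrier (cterm T (i - 1))" for x
      using g1(2)[OF x] hom_closed[OF f1(1) hom_closed[OF T1(3) x]] by (simp add: a_minus_def C.M.r_neg)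
    then obtain g' where g': "g' \<in> module_hom R (cterm T (i + 1)) (cterm C i)"
       "\<And>x. x \<in> carrier (cterm T i) \<Longrightarrow> f i x \<ominus>\<^bsub>cterm C i\<^esub> cdiff C (i - 1) (g x) = g' (cdiff T i x)"
      using fin_rank_exact[OF _ C1(1) C1(1) e] P[of i] unfolding fproj_def by blast
    have n: "f i x = cdiff C (i - 1) (g x) \<oplus>\<^bsub>cterm C i\<^esub> g' (cdiff T i x)" if x: "x \<in> carrier (cterm T i)" for x
      using hom_closed[OF f1(1) x] hom_closed[OF dg x] by (simp flip: g'(2)[OF x])
    have "f (i + 1) (cdiff T i x) = cdiff C i (g' (cdiff T i x))" if x: "x \<in> carrier (cterm T i)" for x
    proof -
      interpret C': left_module R "cterm C (i + 1)" by (rule C1)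
      have c: "g x \<in> carrier (cterm C (i - 1))" "cdiff C (i - 1) (g x) \<in> carrier (cterm C i)"
        "g' (cdiff T i x) \<in> carrier (cterm C i)"
        using hom_closed[OF g1(1) x] hom_closed[OF dg x] hom_closed[OF g'(1) hom_closed[OF T1(2) x]] by auto
      have "f (i + 1) (cdiff T i x) = cdiff C i (f i x)" using f1(2)[OF x] .
      also have "\<dots> = cdiff C i (g' (cdiff T i x))"
        using c hom_closed[OF C1(2) c(3)] by (simp add: n[OF x] hom_add[OF C1(2)] C1(5))
      finally show ?thesis .
    qed
    then have "good (i + 1) g'" using g'(1) by (simp add: good_def)
    then show ?thesis using n by (auto simp: nxt_def)
  qed
  have "good m (\<lambda>x. \<zero>\<^bsub>cterm C (m - 1)\<^esub>)"
    unfolding good_def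
  proof (intro conjI ballI)
    fix x assume x: "x \<in> carrier (cterm T (m - 1))"
    have "f (m - 1) x = \<zero>\<^bsub>cterm C (m - 1)\<^esub>" using hom_closed[OF f1(1) x] b[of "m - 1"] by simp
    then show "f m (cdiff T (m - 1) x) = cdiff C (m - 1) \<zero>\<^bsub>cterm C (m - 1)\<^esub>" using f1(3)[OF x] by simp
  qed (rule hom_zero_map[OF C1(1)])
  then have "\<exists>H. \<forall>k. good (m + int k) (H k) \<and> nxt (m + int k) (H k) (H (Suc k))"
    by (intro dependent_nat_choice) (use step[of "m + int _"] in \<open>auto simp: ac_simps\<close>)
  then obtain H where H: "\<And>k. good (m + int k) (H k)" "\<And>k. nxt (m + int k) (H k) (H (Suc k))" by blast
  define h where "h i = (if i < m then (\<lambda>x. \<zero>\<^bsub>cterm C (i - 1)\<^esub>) else H (nat (i - m)))" for i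
  have hh: "h i \<in> module_hom R (cterm T i) (cterm C (i - 1))" for i
    using H(1)[of "nat (i - m)"] hom_zero_map[OF C1(1)] by (auto simp: h_def good_def)
  show ?thesis
  proof (rule null_homotopicI[OF T C hh])
    fix i x assume x: "x \<in> carrier (cterm T i)"
    show "f i x = cdiff C (i - 1) (h i x) \<oplus>\<^bsub>cterm C i\<^esub> h (i + 1) (cdiff T i x)"
    proof (cases "i < m")
      case True
      interpret C: left_module R "cterm C i" by (rule C1)
      have "f i x \<in> carrier (cterm C i)" "cdiff C (i - 1) (h i x) \<oplus>\<^bsub>cterm C i\<^esub> h (i + 1) (cdiff T i x) \<in> carrier (cterm C i)"
        using hom_closed[OF f1(1) x] hom_closed[OF C1(3) hom_closed[OF hh x]] hom_closed[OF hh hom_closed[OF T1(2) x]] by auto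
      then show ?thesis using b[OF True] by simp
    next
      case False
      then have "nat (i + 1 - m) = Suc (nat (i - m))" "m + int (nat (i - m)) = i" by auto
      then show ?thesis using H(2)[of "nat (i - m)"] x False by (simp add: nxt_def h_def)
    qed
  qed
qed

text \<open>Here the homotopy is built downwards from the degree above which C is zero. The map f -
  h d takes values in cocycles, which are boundaries in C, and lifts along the differential of C
  because the terms of T are projective.\<close>

lemma null_to_acyclic:
  assumes C: "cplx R C" and P: "\<And>i x. x \<in> carrier (cterm C i) \<Longrightarrow> cdiff C i x = \<zero>\<^bsub>cterm C (i + 1)\<^esub> \<Longrightarrow>
       x \<in> cdiff C (i - 1) ` carrier (cterm C (i - 1))"
    and b: "\<And>i. i > m \<Longrightarrow> carrier (cterm C i) = {\<zero>\<^bsub>cterm C i\<^esub>}"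
    and f: "chain_map R T C f"
  shows "null_homotopic R T C f"
proof -
  note C1 = cplxD[OF C] and T1 = cplxD[OF T] and f1 = chain_mapD[OF f]
  define good where "good i g \<longleftrightarrow> g \<in> module_hom R (cterm T (i + 1)) (cterm C i) \<and>
     (\<forall>x\<in>carrier (cterm T i). cdiff C i (f i x \<ominus>\<^bsub>cterm C i\<^esub> g (cdiff T i x)) = \<zero>\<^bsub>cterm C (i + 1)\<^esub>)" for i g
  define nxt where "nxt i g g' \<longleftrightarrow> (\<forall>x\<in>carrier (cterm T i).
      f i x = cdiff C (i - 1) (g' x) \<oplus>\<^bsub>cterm C i\<^esub> g (cdiff T i x))" for i g g'
  have step: "\<exists>g'. good (i - 1) g' \<and> nxt i g g'" if g: "good i g" for i g
  proof -
    interpret C: left_module R "cterm C i" by (rule C1)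
    have g1: "g \<in> module_hom R (cterm T (i + 1)) (cterm C i)"
      "\<And>x. x\<in>carrier (cterm T i) \<Longrightarrow> cdiff C i (f i x \<ominus>\<^bsub>cterm C i\<^esub> g (cdiff T i x)) = \<zero>\<^bsub>cterm C (i + 1)\<^esub>"
      using g by (auto simp: good_def)
    have gd: "(\<lambda>x. g (cdiff T i x)) \<in> module_hom R (cterm T i) (cterm C i)"
      by (rule hom_comp[OF T1(2) g1(1)])
    note e = hom_minus_map[OF C1(1) f1(1) gd]
    obtain g' where g': "g' \<in> module_hom R (cterm T i) (cterm C (i - 1))"
       "\<And>x. x \<in> carrier (cterm T i) \<Longrightarrow> cdiff C (i - 1) (g' x) = f i x \<ominus>\<^bsub>cterm C i\<^esub> g (cdiff T i x)"
      using fproj_lift[OF fproj_T e C1(3) _ C1(1) C1(1)] P[OF hom_closed[OF e] g1(2)] by blast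
    have n: "f i x = cdiff C (i - 1) (g' x) \<oplus>\<^bsub>cterm C i\<^esub> g (cdiff T i x)" if x: "x \<in> carrier (cterm T i)" for x
      using hom_closed[OF f1(1) x] hom_closed[OF gd x] by (simp add: g'(2)[OF x])
    have "cdiff C (i - 1) (f (i - 1) x \<ominus>\<^bsub>cterm C (i - 1)\<^esub> g' (cdiff T (i - 1) x)) = \<zero>\<^bsub>cterm C i\<^esub>"
      if x: "x \<in> carrier (cterm T (i - 1))" for x
    proof -
      have dx: "cdiff T (i - 1) x \<in> carrier (cterm T i)" using hom_closed[OF T1(3) x] .
      have c: "f (i - 1) x \<in> carrier (cterm C (i - 1))" "g' (cdiff T (i - 1) x) \<in> carrier (cterm C (i - 1))"
        "cdiff C (i - 1) (f (i - 1) x) \<in> carrier (cterm C i)" "cdiff C (i - 1) (g' (cdiff T (i - 1) x)) \<in> carrier (cterm C i)"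
        using hom_closed[OF f1(1) x] hom_closed[OF g'(1) dx] hom_closed[OF C1(3)] by auto
      have "cdiff C (i - 1) (f (i - 1) x) = f i (cdiff T (i - 1) x)" using f1(3)[OF x] by simp
      also have "\<dots> = cdiff C (i - 1) (g' (cdiff T (i - 1) x))"
        using c(4) by (simp add: n[OF dx] T1(5)[OF x] hom_zero[OF T1(1) C1(1) g1(1)])
      finally show ?thesis using c by (simp add: hom_diff[OF C1(1) C1(1) C1(3)])
    qed
    then have "good (i - 1) g'" using g'(1) by (simp add: good_def)
    then show ?thesis using n by (auto simp: nxt_def)
  qed
  have "good m (\<lambda>x. \<zero>\<^bsub>cterm C m\<^esub>)"
    unfolding good_def
  proof (intro conjI ballI)
    interpret C: left_module R "cterm C m" by (rule C1)
    fix x assume x: "x \<in> carrier (cterm T m)"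
    have "f m x \<ominus>\<^bsub>cterm C m\<^esub> \<zero>\<^bsub>cterm C m\<^esub> \<in> carrier (cterm C m)" using hom_closed[OF f1(1) x] by simp
    from hom_closed[OF C1(2) this] show "cdiff C m (f m x \<ominus>\<^bsub>cterm C m\<^esub> \<zero>\<^bsub>cterm C m\<^esub>) = \<zero>\<^bsub>cterm C (m + 1)\<^esub>"
      using b[of "m + 1"] by simp
  qed (rule hom_zero_map[OF C1(1)])
  then have "\<exists>H. \<forall>k. good (m - int k) (H k) \<and> nxt (m - int k) (H k) (H (Suc k))"
    by (intro dependent_nat_choice) (use step[of "m - int _"] in \<open>auto simp: algebra_simps\<close>)
  then obtain H where H: "\<And>k. good (m - int k) (H k)" "\<And>k. nxt (m - int k) (H k) (H (Suc k))" by blast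
  \<comment> \<open>The k-th choice is the component in degree m + 1 - k: \<open>good i g\<close>
    speaks of a map g from degree i + 1.\<close>
  define h where "h i = (if i > m + 1 then (\<lambda>x. \<zero>\<^bsub>cterm C (i - 1)\<^esub>) else H (nat (m + 1 - i)))" for i
  have hh: "h i \<in> module_hom R (cterm T i) (cterm C (i - 1))" for i
    using H(1)[of "nat (m + 1 - i)"] hom_zero_map[OF C1(1)] by (auto simp: h_def good_def)
  show ?thesis
  proof (rule null_homotopicI[OF T C hh])
    fix i x assume x: "x \<in> carrier (cterm T i)"
    show "f i x = cdiff C (i - 1) (h i x) \<oplus>\<^bsub>cterm C i\<^esub> h (i + 1) (cdiff T i x)"
    proof (cases "i > m")
      case True
      interpret C: left_module R "cterm C i" by (rule C1)
      have "f i x \<in> carrier (cterm C i)" "cdiff C (i - 1) (h i x) \<oplus>\<^bsub>cterm C i\<^esub> h (i + 1) (cdiff T i x) \<in> carrier (cterm C i)"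
        using hom_closed[OF f1(1) x] hom_closed[OF C1(3) hom_closed[OF hh x]] hom_closed[OF hh hom_closed[OF T1(2) x]] by auto
      then show ?thesis using b[OF True] by simp
    next
      case False
      then have "nat (m + 1 - i) = Suc (nat (m - i))" "m - int (nat (m - i)) = i" by auto
      then show ?thesis using H(2)[of "nat (m - i)"] x False by (simp add: nxt_def h_def)
    qed
  qed
qed

end

subsection \<open>Mapping cones\<close>

lemma direct_sum_module_simps [simp]:
  "carrier (direct_sum_module M N) = carrier M \<times> carrier N"
  "\<zero>\<^bsub>direct_sum_module M N\<^esub> = (\<zero>\<^bsub>M\<^esub>, \<zero>\<^bsub>N\<^esub>)"
  "(x, y) \<oplus>\<^bsub>direct_sum_module M N\<^esub> (x', y') = (x \<oplus>\<^bsub>M\<^esub> x', y \<oplus>\<^bsub>N\<^esub> y')"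
  "r \<odot>\<^bsub>direct_sum_module M N\<^esub> (x, y) = (r \<odot>\<^bsub>M\<^esub> x, r \<odot>\<^bsub>N\<^esub> y)"
  by (simp_all add: direct_sum_module_def)

lemma left_module_direct_sum:
  assumes "left_module R M" "left_module R N"
  shows "left_module R (direct_sum_module M N)"
proof -
  interpret M: left_module R M by fact
  interpret N: left_module R N by fact
  show ?thesis
  proof (rule left_moduleI)
    show "abelian_group (direct_sum_module M N)"
    proof (rule abelian_groupI)
      show "\<exists>y\<in>carrier (direct_sum_module M N). y \<oplus>\<^bsub>direct_sum_module M N\<^esub> x = \<zero>\<^bsub>direct_sum_module M N\<^esub>"
        if "x \<in> carrier (direct_sum_module M N)" for x
        using that by (intro bexI[of _ "(\<ominus>\<^bsub>M\<^esub> fst x, \<ominus>\<^bsub>N\<^esub> snd x)"]) (auto simp: M.M.l_neg N.M.l_neg)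
    qed (auto simp: M.M.a_ac N.M.a_ac)
  qed (auto simp: M.A.ring_axioms M.lm_smult_l_distr M.lm_smult_r_distr M.lm_smult_assoc M.lm_smult_one
      N.lm_smult_l_distr N.lm_smult_r_distr N.lm_smult_assoc N.lm_smult_one)
qed

lemma hom_pair:
  assumes "f \<in> module_hom R X M" "g \<in> module_hom R X N"
  shows "(\<lambda>x. (f x, g x)) \<in> module_hom R X (direct_sum_module M N)"
  using assms by (intro module_homI) (auto simp: module_homD)

lemma hom_fst: "fst \<in> module_hom R (direct_sum_module M N) M"
  by (rule module_homI) auto

lemma hom_snd: "snd \<in> module_hom R (direct_sum_module M N) N"
  by (rule module_homI) auto

lemma mapping_cone_simps [simp]:
  "cterm (mapping_cone C D s) i = direct_sum_module (cterm C (i + 1)) (cterm D i)"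
  "cdiff (mapping_cone C D s) i (x, y) = (\<ominus>\<^bsub>cterm C (i + 1 + 1)\<^esub> cdiff C (i + 1) x,
                          s (i + 1) x \<oplus>\<^bsub>cterm D (i + 1)\<^esub> cdiff D i y)"
  by (simp_all add: mapping_cone_def)

lemma cplx_mapping_cone:
  assumes C: "cplx R C" and D: "cplx R D" and s: "chain_map R C D s"
  shows "cplx R (mapping_cone C D s)"
proof -
  note C1 = cplxD[OF C] and D1 = cplxD[OF D] and s1 = chain_mapD[OF s]
  have "cdiff (mapping_cone C D s) i \<in> module_hom R (cterm (mapping_cone C D s) i) (cterm (mapping_cone C D s) (i + 1))" for i
  proof -
    have "(\<lambda>z. (\<ominus>\<^bsub>cterm C (i + 1 + 1)\<^esub> cdiff C (i + 1) (fst z), s (i + 1) (fst z) \<oplus>\<^bsub>cterm D (i + 1)\<^esub> cdiff D i (snd z)))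
       \<in> module_hom R (cterm (mapping_cone C D s) i) (cterm (mapping_cone C D s) (i + 1))"
      unfolding mapping_cone_simps
      by (intro hom_pair hom_uminus hom_plus C1 D1 hom_comp[OF hom_fst C1(2)] hom_comp[OF hom_fst s1(1)] hom_comp[OF hom_snd D1(2)])
    then show ?thesis
      by (rule hom_cong) (auto simp: left_module_direct_sum C1 D1)
  qed
  moreover have "cdiff (mapping_cone C D s) (i + 1) (cdiff (mapping_cone C D s) i z) = \<zero>\<^bsub>cterm (mapping_cone C D s) (i + 1 + 1)\<^esub>"
    if z: "z \<in> carrier (cterm (mapping_cone C D s) i)" for i z
  proof -
    obtain x y where xy: "z = (x, y)" "x \<in> carrier (cterm C (i + 1))" "y \<in> carrier (cterm D i)" using z by (cases z) auto
    interpret C2: left_module R "cterm C (3 + i)" by (rule C1)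
    interpret D1': left_module R "cterm D (i + 1)" by (rule D1)
    interpret D2: left_module R "cterm D (2 + i)" by (rule D1)
    have dx: "cdiff C (i + 1) x \<in> carrier (cterm C (i + 1 + 1))" using hom_closed[OF C1(2) xy(2)] .
    have sx: "s (i + 1) x \<in> carrier (cterm D (i + 1))" using hom_closed[OF s1(1) xy(2)] .
    have dy: "cdiff D i y \<in> carrier (cterm D (i + 1))" using hom_closed[OF D1(2) xy(3)] .
    have "cdiff D (i + 1) (s (i + 1) x) \<in> carrier (cterm D (i + 1 + 1))" using hom_closed[OF D1(2) sx] .
    then show ?thesis
      using dx sx dy C1(4)[OF xy(2)] D1(4)[OF xy(3)] s1(2)[OF xy(2)]
      by (simp add: xy(1) hom_minus[OF C1(1) C1(1) C1(2)] hom_minus[OF C1(1) D1(1) s1(1)] hom_add[OF D1(2)]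
          D2.M.l_neg)
  qed
  ultimately show ?thesis
    unfolding cplx_def using C1 D1 by (auto simp: left_module_direct_sum)
qed

text \<open>A cocycle (x, y) of the cone satisfies d x = 0 and s x = - d y. Injectivity on
  cohomology gives x = d x'; then s x' + y is a cocycle, and surjectivity replaces it by s x'' up to
  a boundary.\<close>

lemma mapping_cone_acyclic:
  assumes C: "cplx R C" and D: "cplx R D" and s: "quasi_isomorphism R C D s"
    and z: "z \<in> carrier (cterm (mapping_cone C D s) i)" "cdiff (mapping_cone C D s) i z = \<zero>\<^bsub>cterm (mapping_cone C D s) (i + 1)\<^esub>"
  shows "z \<in> cdiff (mapping_cone C D s) (i - 1) ` carrier (cterm (mapping_cone C D s) (i - 1))"
proof -
  note C1 = cplxD[OF C] and D1 = cplxD[OF D]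
  have s1: "chain_map R C D s" and inj: "\<And>i x. x \<in> cocycles C i \<Longrightarrow> s i x \<in> coboundaries D i \<Longrightarrow> x \<in> coboundaries C i"
    and sur: "\<And>i y. y \<in> cocycles D i \<Longrightarrow> \<exists>x\<in>cocycles C i. y \<ominus>\<^bsub>cterm D i\<^esub> s i x \<in> coboundaries D i"
    using s by (auto simp: quasi_isomorphism_def)
  note s1 = chain_mapD[OF s1]
  obtain x y where xy: "z = (x, y)" "x \<in> carrier (cterm C (i + 1))" "y \<in> carrier (cterm D i)" using z(1) by (cases z) auto
  interpret Ci: left_module R "cterm C i" by (rule C1)
  interpret C2: left_module R "cterm C (i + 1)" by (rule C1)
  interpret C3: left_module R "cterm C (i + 1 + 1)" by (rule C1)
  interpret D1': left_module R "cterm D (i + 1)" by (rule D1)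
  interpret Di: left_module R "cterm D i" by (rule D1)
  have dx: "cdiff C (i + 1) x \<in> carrier (cterm C (i + 1 + 1))" using hom_closed[OF C1(2) xy(2)] .
  have sx: "s (i + 1) x \<in> carrier (cterm D (i + 1))" using hom_closed[OF s1(1) xy(2)] .
  have dy: "cdiff D i y \<in> carrier (cterm D (i + 1))" using hom_closed[OF D1(2) xy(3)] .
  have "\<ominus>\<^bsub>cterm C (i + 1 + 1)\<^esub> cdiff C (i + 1) x = \<zero>\<^bsub>cterm C (i + 1 + 1)\<^esub>"
    and e: "s (i + 1) x \<oplus>\<^bsub>cterm D (i + 1)\<^esub> cdiff D i y = \<zero>\<^bsub>cterm D (i + 1)\<^esub>"
    using z(2) xy(1) by auto
  then have "cdiff C (i + 1) x = \<zero>\<^bsub>cterm C (i + 1 + 1)\<^esub>"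
    using dx C3.M.minus_minus C3.M.add.inv_one by (metis a_inv_def)
  then have "x \<in> cocycles C (i + 1)" using xy by (simp add: cocycles_def)
  moreover have "s (i + 1) x = cdiff D i (\<ominus>\<^bsub>cterm D i\<^esub> y)"
    using D1'.M.minus_equality[OF e dy sx] hom_minus[OF D1(1) D1(1) D1(2) xy(3)]
    by (metis D1'.M.minus_equality D1'.M.minus_minus dy e sx)
  then have "s (i + 1) x \<in> coboundaries D (i + 1)"
    using xy(3) by (simp add: coboundaries_def)
  ultimately have "x \<in> coboundaries C (i + 1)" by (rule inj)
  then obtain x' where x': "x' \<in> carrier (cterm C i)" "x = cdiff C i x'" by (auto simp: coboundaries_def)
  have sx': "s i x' \<in> carrier (cterm D i)" using hom_closed[OF s1(1) x'(1)] .
  have "cdiff D i (s i x' \<oplus>\<^bsub>cterm D i\<^esub> y) = \<zero>\<^bsub>cterm D (i + 1)\<^esub>"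
    using e s1(2)[OF x'(1)] by (simp add: hom_add[OF D1(2) sx' xy(3)] x'(2))
  then have "s i x' \<oplus>\<^bsub>cterm D i\<^esub> y \<in> cocycles D i" using sx' xy by (simp add: cocycles_def)
  from sur[OF this] obtain x'' y' where x'': "x'' \<in> cocycles C i" and y': "y' \<in> carrier (cterm D (i - 1))"
     "(s i x' \<oplus>\<^bsub>cterm D i\<^esub> y) \<ominus>\<^bsub>cterm D i\<^esub> s i x'' = cdiff D (i - 1) y'"
    by (auto simp: coboundaries_def)
  have x''c: "x'' \<in> carrier (cterm C i)" "cdiff C i x'' = \<zero>\<^bsub>cterm C (i + 1)\<^esub>" using x'' by (auto simp: cocycles_def)
  have sx'': "s i x'' \<in> carrier (cterm D i)" using hom_closed[OF s1(1) x''c(1)] .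
  \<comment> \<open>The order of the difference is dictated by the minus sign in the differential of
    the cone: - d u = d x' = x, since x'' is a cocycle.\<close>
  define u where "u = x'' \<ominus>\<^bsub>cterm C i\<^esub> x'"
  have u: "u \<in> carrier (cterm C i)" using x' x''c by (simp add: u_def)
  have xc: "cdiff C i x' \<in> carrier (cterm C (i + 1))" using hom_closed[OF C1(2) x'(1)] .
  have "cdiff C i u = \<zero>\<^bsub>cterm C (i + 1)\<^esub> \<ominus>\<^bsub>cterm C (i + 1)\<^esub> cdiff C i x'"
    using x' x''c by (simp add: u_def hom_diff[OF C1(1) C1(1) C1(2)])
  then have "\<ominus>\<^bsub>cterm C (i + 1)\<^esub> cdiff C i u = x"
    using x'(2) xc by (simp add: a_minus_def)
  moreover have "s i u \<oplus>\<^bsub>cterm D i\<^esub> cdiff D (i - 1) y' = y"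
    unfolding y'(2)[symmetric] u_def hom_diff[OF C1(1) D1(1) s1(1) x''c(1) x'(1)] using sx' sx'' xy(3)
    by (simp add: a_minus_def Di.M.a_ac Di.M.r_neg Di.M.r_neg1 Di.M.r_neg2)
  ultimately have "z = cdiff (mapping_cone C D s) (i - 1) (u, y')"
    using mapping_cone_simps(2)[of C D s "i - 1" u y'] xy(1) by simp
  moreover have "(u, y') \<in> carrier (cterm (mapping_cone C D s) (i - 1))" using u y' by simp
  ultimately show ?thesis by blast
qed

context coacyclic
begin

lemma chain_map_to_cone:
  assumes C: "cplx R C" and D: "cplx R D" and s: "chain_map R C D s" and f: "chain_map R T D f"
  shows "chain_map R T (mapping_cone C D s) (\<lambda>i x. (\<zero>\<^bsub>cterm C (i + 1)\<^esub>, f i x))"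
proof -
  note C1 = cplxD[OF C] and D1 = cplxD[OF D] and s1 = chain_mapD[OF s] and f1 = chain_mapD[OF f]
  show ?thesis
  proof (rule chain_mapI)
    show "(\<lambda>x. (\<zero>\<^bsub>cterm C (i + 1)\<^esub>, f i x)) \<in> module_hom R (cterm T i) (cterm (mapping_cone C D s) i)" for i
      unfolding mapping_cone_simps by (intro hom_pair hom_zero_map C1 f1)
    fix i x assume x: "x \<in> carrier (cterm T i)"
    interpret C: left_module R "cterm C (i + 1 + 1)" by (rule C1)
    interpret D: left_module R "cterm D (i + 1)" by (rule D1)
    have "cdiff D i (f i x) \<in> carrier (cterm D (i + 1))" using hom_closed[OF D1(2) hom_closed[OF f1(1) x]] .
    then show "(\<zero>\<^bsub>cterm C (i + 1 + 1)\<^esub>, f (i + 1) (cdiff T i x)) = cdiff (mapping_cone C D s) i (\<zero>\<^bsub>cterm C (i + 1)\<^esub>, f i x)"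
      using C.M.add.inv_one
      by (simp add: f1(2)[OF x] hom_zero[OF C1(1) C1(1) C1(2)] hom_zero[OF C1(1) D1(1) s1(1)] a_inv_def)
  qed
qed

text \<open>Both results are read off from the components of a null-homotopy: the one in C is a
  chain map g, the one in D is a homotopy from f to s g.\<close>

lemma lift_of_null_in_cone:
  assumes C: "cplx R C" and D: "cplx R D" and s: "chain_map R C D s" and f: "chain_map R T D f"
    and n: "null_homotopic R T (mapping_cone C D s) (\<lambda>i x. (\<zero>\<^bsub>cterm C (i + 1)\<^esub>, f i x))"
  shows "\<exists>g. chain_map R T C g \<and> chain_homotopic R T D f (s \<circ>\<^sub>c g)"
proof -
  note C1 = cplxD[OF C] and D1 = cplxD[OF D] and s1 = chain_mapD[OF s] and T1 = cplxD[OF T]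
  obtain h where h: "\<And>i. h i \<in> module_hom R (cterm T i) (cterm (mapping_cone C D s) (i - 1))"
    and h': "\<And>i. h (i + 1) \<in> module_hom R (cterm T (i + 1)) (cterm (mapping_cone C D s) i)"
    and heq: "\<And>i x. x \<in> carrier (cterm T i) \<Longrightarrow> (\<zero>\<^bsub>cterm C (i + 1)\<^esub>, f i x) =
      cdiff (mapping_cone C D s) (i - 1) (h i x) \<oplus>\<^bsub>cterm (mapping_cone C D s) i\<^esub> h (i + 1) (cdiff T i x)"
    by (rule null_homotopicE[OF T cplx_mapping_cone[OF C D s] n]) rule
  define a where "a i x = fst (h i x)" for i x
  define b where "b i x = snd (h i x)" for i x
  have a: "a i \<in> module_hom R (cterm T i) (cterm C i)" for i
    using hom_comp[OF h[of i, unfolded mapping_cone_simps] hom_fst] by (simp add: a_def[abs_def])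
  have b: "b i \<in> module_hom R (cterm T i) (cterm D (i - 1))" for i
    using hom_comp[OF h[of i, unfolded mapping_cone_simps] hom_snd] by (simp add: b_def[abs_def])
  have eq: "\<zero>\<^bsub>cterm C (i + 1)\<^esub> = \<ominus>\<^bsub>cterm C (i + 1)\<^esub> cdiff C i (a i x) \<oplus>\<^bsub>cterm C (i + 1)\<^esub> a (i + 1) (cdiff T i x)"
    "f i x = (s i (a i x) \<oplus>\<^bsub>cterm D i\<^esub> cdiff D (i - 1) (b i x)) \<oplus>\<^bsub>cterm D i\<^esub> b (i + 1) (cdiff T i x)"
    if x: "x \<in> carrier (cterm T i)" for i x
  proof -
    have p: "h i x = (a i x, b i x)" "h (i + 1) (cdiff T i x) = (a (i + 1) (cdiff T i x), b (i + 1) (cdiff T i x))"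
      by (simp_all add: a_def b_def)
    show "\<zero>\<^bsub>cterm C (i + 1)\<^esub> = \<ominus>\<^bsub>cterm C (i + 1)\<^esub> cdiff C i (a i x) \<oplus>\<^bsub>cterm C (i + 1)\<^esub> a (i + 1) (cdiff T i x)"
      "f i x = (s i (a i x) \<oplus>\<^bsub>cterm D i\<^esub> cdiff D (i - 1) (b i x)) \<oplus>\<^bsub>cterm D i\<^esub> b (i + 1) (cdiff T i x)"
      using heq[OF x] unfolding p by (simp_all add: mapping_cone_simps(2)[of C D s "i - 1"])
  qed
  have "chain_map R T C a"
  proof (rule chain_mapI[OF a])
    fix i x assume x: "x \<in> carrier (cterm T i)"
    interpret C: left_module R "cterm C (i + 1)" by (rule C1)
    have c: "cdiff C i (a i x) \<in> carrier (cterm C (i + 1))" "a (i + 1) (cdiff T i x) \<in> carrier (cterm C (i + 1))"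
      using hom_closed[OF C1(2) hom_closed[OF a x]] hom_closed[OF a hom_closed[OF T1(2) x]] by auto
    show "a (i + 1) (cdiff T i x) = cdiff C i (a i x)"
      using C.neg_inject[OF c(2,1)] C.M.minus_equality[OF eq(1)[OF x, symmetric]] c by simp
  qed
  moreover have "chain_homotopic R T D f (s \<circ>\<^sub>c a)"
  proof (rule chain_homotopicI[OF b])
    fix i x assume x: "x \<in> carrier (cterm T i)"
    interpret D: left_module R "cterm D i" by (rule D1)
    have "s i (a i x) \<in> carrier (cterm D i)" "cdiff D (i - 1) (b i x) \<in> carrier (cterm D i)"
      "b (i + 1) (cdiff T i x) \<in> carrier (cterm D i)"
      using hom_closed[OF s1(1) hom_closed[OF a x]] hom_closed[OF D1(3) hom_closed[OF b x]]
        hom_closed[OF b hom_closed[OF T1(2) x]] by auto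
    then show "f i x = (s \<circ>\<^sub>c a) i x \<oplus>\<^bsub>cterm D i\<^esub> (cdiff D (i - 1) (b i x) \<oplus>\<^bsub>cterm D i\<^esub> b (i + 1) (cdiff T i x))"
      using eq(2)[OF x] by (simp add: chain_comp_def D.M.a_assoc)
  qed
  ultimately show ?thesis by blast
qed

text \<open>The cone of a quasi-isomorphism p from a bounded complex of projectives is bounded and
  acyclic, so the map into it is null and f lifts through p up to homotopy. The lift is null by the
  projective case.\<close>

lemma null_to_perfect:
  assumes C: "perfect_complex R C" and f: "chain_map R T C f"
  shows "null_homotopic R T C f"
proof -
  obtain P :: "('a, 'a univ) cochain_complex" and p where P: "bounded_complex R P"
      "\<And>i. fg_projective R (cterm P i)" "quasi_isomorphism R P C p" and C: "bounded_complex R C"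
    using C by (auto simp: perfect_complex_def)
  note P' = bounded_complex_cplx[OF P(1)] and C' = bounded_complex_cplx[OF C]
  have p: "chain_map R P C p" using P(3) by (simp add: quasi_isomorphism_def)
  obtain n where n: "\<And>i. \<bar>i\<bar> > n \<Longrightarrow> carrier (cterm P i) = {\<zero>\<^bsub>cterm P i\<^esub>}"
    using bounded_complex_bound[OF P(1)] by blast
  obtain m where m: "\<And>i. \<bar>i\<bar> > m \<Longrightarrow> carrier (cterm C i) = {\<zero>\<^bsub>cterm C i\<^esub>}"
    using bounded_complex_bound[OF C] by blast
  have "null_homotopic R T (mapping_cone P C p) (\<lambda>i x. (\<zero>\<^bsub>cterm P (i + 1)\<^esub>, f i x))"
  proof (rule null_to_acyclic[OF cplx_mapping_cone[OF P' C' p] mapping_cone_acyclic[OF P' C' P(3)] _ chain_map_to_cone[OF P' C' p f]])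
    show "carrier (cterm (mapping_cone P C p) i) = {\<zero>\<^bsub>cterm (mapping_cone P C p) i\<^esub>}" if "i > max \<bar>n\<bar> \<bar>m\<bar>" for i
    proof -
      have "n < \<bar>i + 1\<bar>" "m < \<bar>i\<bar>" using that by auto
      then show ?thesis using n[of "i + 1"] m[of i] by simp
    qed
  qed
  from lift_of_null_in_cone[OF P' C' p f this] obtain g where g: "chain_map R T P g" "chain_homotopic R T C f (p \<circ>\<^sub>c g)"
    by blast
  have "null_homotopic R T P g"
    by (rule null_to_projective[OF P' _ _ g(1), of "- \<bar>n\<bar>"]) (use P(2) n in \<open>auto simp: fg_projective_iff\<close>)
  then have "null_homotopic R T C (p \<circ>\<^sub>c g)" by (rule null_homotopic_post[OF T P' C' p])
  then show ?thesis
    by (rule homotopic_trans[OF T C' hom_zero_map[OF cplxD(1)[OF C']] g(2)])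
qed

text \<open>The obstruction to lifting is the composite T \<rightarrow> D \<rightarrow> cone of s, a
  map into a perfect complex.\<close>

lemma lift_along_denominator:
  assumes C: "cplx R C" and D: "cplx R D" and s: "sg_denominator R C D s" and f: "chain_map R T D f"
  shows "\<exists>g. chain_map R T C g \<and> chain_homotopic R T D f (s \<circ>\<^sub>c g)"
proof -
  have s': "chain_map R C D s" "perfect_complex R (mapping_cone C D s)" using s by (auto simp: sg_denominator_def)
  show ?thesis
    by (rule lift_of_null_in_cone[OF C D s'(1) f null_to_perfect[OF s'(2) chain_map_to_cone[OF C D s'(1) f]]])
qed

text \<open>The translate T[1] with the usual sign. Uniqueness of lifts along a denominator is a
  statement on maps from T[1] to its cone.\<close>

definition shifted :: "('a, 'u) cochain_complex" where
  "shifted = \<lparr>cterm = (\<lambda>i. cterm T (i + 1)), cdiff = (\<lambda>i x. \<ominus>\<^bsub>cterm T (i + 1 + 1)\<^esub> cdiff T (i + 1) x)\<rparr>"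

lemma coacyclic_shifted: "coacyclic R shifted"
proof (rule coacyclic.intro)
  note T1 = cplxD[OF T]
  show "cring R" by (rule R)
  have d: "(\<lambda>x. \<ominus>\<^bsub>cterm T (i + 1 + 1)\<^esub> cdiff T (i + 1) x) \<in> module_hom R (cterm T (i + 1)) (cterm T (i + 1 + 1))" for i
    by (rule hom_uminus[OF T1(1,2)])
  show "cplx R shifted"
    unfolding cplx_def shifted_def cochain_complex.simps
  proof (intro conjI allI ballI)
    show "(\<lambda>x. \<ominus>\<^bsub>cterm T (i + 1 + 1)\<^esub> cdiff T (i + 1) x) \<in> module_hom R (cterm T (i + 1)) (cterm T (i + 1 + 1))" for i
      by (rule d)
    fix i x assume x: "x \<in> carrier (cterm T (i + 1))"
    interpret T3: left_module R "cterm T (3 + i)" by (rule T1)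
    show "\<ominus>\<^bsub>cterm T (i + 1 + 1 + 1)\<^esub> cdiff T (i + 1 + 1) (\<ominus>\<^bsub>cterm T (i + 1 + 1)\<^esub> cdiff T (i + 1) x) = \<zero>\<^bsub>cterm T (i + 1 + 1 + 1)\<^esub>"
      using hom_closed[OF T1(2) x] T1(4)[OF x] by (simp add: hom_minus[OF T1(1) T1(1) T1(2)])
  qed (rule T1)
  show "fproj R (cterm shifted i)" for i by (simp add: shifted_def fproj_T)
  fix q i
  assume q: "q \<in> module_hom R (cterm shifted i) (regular_module R)"
    "\<And>x. x \<in> carrier (cterm shifted (i - 1)) \<Longrightarrow> q (cdiff shifted (i - 1) x) = \<zero>\<^bsub>R\<^esub>"
  interpret R: cring R by (rule R)
  note lR = left_module_regular[OF R.ring_axioms]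
  interpret lR: left_module R "regular_module R" by (rule lR)
  have q1: "q \<in> module_hom R (cterm T (i + 1)) (regular_module R)" using q(1) by (simp add: shifted_def)
  have "q (cdiff T i x) = \<zero>\<^bsub>R\<^esub>" if x: "x \<in> carrier (cterm T i)" for x
  proof -
    interpret Ti: left_module R "cterm T i" by (rule T1)
    interpret T2: left_module R "cterm T (i + 1)" by (rule T1)
    have "q (\<ominus>\<^bsub>cterm T (i + 1)\<^esub> cdiff T i (\<ominus>\<^bsub>cterm T i\<^esub> x)) = \<zero>\<^bsub>R\<^esub>"
      using q(2)[of "\<ominus>\<^bsub>cterm T i\<^esub> x"] x by (simp add: shifted_def add.commute)
    then show ?thesis using x hom_closed[OF T1(2) x] by (simp add: hom_minus[OF T1(1) T1(1) T1(2)])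
  qed
  then obtain q' where q': "q' \<in> module_hom R (cterm T (i + 1 + 1)) (regular_module R)"
      "\<And>x. x \<in> carrier (cterm T (i + 1)) \<Longrightarrow> q x = q' (cdiff T (i + 1) x)"
    using dual_exact[OF q1] by auto
  show "\<exists>q'\<in>module_hom R (cterm shifted (i + 1)) (regular_module R).
         \<forall>x\<in>carrier (cterm shifted i). q x = q' (cdiff shifted i x)"
    unfolding shifted_def cochain_complex.simps
  proof (intro bexI ballI)
    show "(\<lambda>x. \<ominus>\<^bsub>regular_module R\<^esub> q' x) \<in> module_hom R (cterm T (i + 1 + 1)) (regular_module R)"
      by (rule hom_uminus[OF lR q'(1)])
    fix x assume x: "x \<in> carrier (cterm T (i + 1))"
    show "q x = \<ominus>\<^bsub>regular_module R\<^esub> q' (\<ominus>\<^bsub>cterm T (i + 1 + 1)\<^esub> cdiff T (i + 1) x)"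
      using q'(2)[OF x] hom_minus[OF T1(1) lR q'(1) hom_closed[OF T1(2) x]]
        lR.M.minus_minus[OF hom_closed[OF q'(1) hom_closed[OF T1(2) x]]] by simp
  qed
qed

text \<open>If b is a null-homotopy of s f, then (f, - b) is a chain map from T[1] to the cone of s.
  The cone is perfect, so this map is null-homotopic, and the C-component of such a homotopy is, up
  to sign and shift, a null-homotopy of f.\<close>

lemma null_of_denominator_comp:
  assumes C: "cplx R C" and D: "cplx R D" and s: "sg_denominator R C D s" and f: "chain_map R T C f"
    and n: "null_homotopic R T D (s \<circ>\<^sub>c f)"
  shows "null_homotopic R T C f"
proof -
  note C1 = cplxD[OF C] and D1 = cplxD[OF D] and f1 = chain_mapD[OF f] and T1 = cplxD[OF T]
  have s': "chain_map R C D s" "perfect_complex R (mapping_cone C D s)" using s by (auto simp: sg_denominator_def)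
  note cone = cplx_mapping_cone[OF C D s'(1)]
  interpret S: coacyclic R shifted by (rule coacyclic_shifted)
  obtain b where b: "\<And>i. b i \<in> module_hom R (cterm T i) (cterm D (i - 1))"
    and b': "\<And>i. b (i + 1) \<in> module_hom R (cterm T (i + 1)) (cterm D i)"
    and beq: "\<And>i x. x \<in> carrier (cterm T i) \<Longrightarrow>
      (s \<circ>\<^sub>c f) i x = cdiff D (i - 1) (b i x) \<oplus>\<^bsub>cterm D i\<^esub> b (i + 1) (cdiff T i x)"
    by (rule null_homotopicE[OF T D n]) rule
  define g where "g i x = (f (i + 1) x, \<ominus>\<^bsub>cterm D i\<^esub> b (i + 1) x)" for i x
  have "chain_map R shifted (mapping_cone C D s) g"
  proof (rule chain_mapI)
    show "g i \<in> module_hom R (cterm shifted i) (cterm (mapping_cone C D s) i)" for i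
      using hom_pair[OF f1(1)[of "i + 1"] hom_uminus[OF D1(1) b']] by (simp add: shifted_def g_def[abs_def])
    fix i x assume "x \<in> carrier (cterm shifted i)"
    then have x: "x \<in> carrier (cterm T (i + 1))" by (simp add: shifted_def)
    interpret D: left_module R "cterm D (i + 1)" by (rule D1)
    have dx: "cdiff T (i + 1) x \<in> carrier (cterm T (i + 1 + 1))" using hom_closed[OF T1(2) x] .
    have c: "b (i + 1) x \<in> carrier (cterm D i)" "cdiff D i (b (i + 1) x) \<in> carrier (cterm D (i + 1))"
      "b (i + 1 + 1) (cdiff T (i + 1) x) \<in> carrier (cterm D (i + 1))"
      using hom_closed[OF b' x] hom_closed[OF D1(2)] hom_closed[OF b' dx] by auto
    have "s (i + 1) (f (i + 1) x) = cdiff D i (b (i + 1) x) \<oplus>\<^bsub>cterm D (i + 1)\<^esub> b (i + 1 + 1) (cdiff T (i + 1) x)"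
      using beq[OF x] by (simp add: chain_comp_def)
    then have "s (i + 1) (f (i + 1) x) \<oplus>\<^bsub>cterm D (i + 1)\<^esub> cdiff D i (\<ominus>\<^bsub>cterm D i\<^esub> b (i + 1) x) = b (i + 1 + 1) (cdiff T (i + 1) x)"
      using c by (simp add: hom_minus[OF D1(1) D1(1) D1(2)] D.M.a_ac D.M.r_neg1 D.M.r_neg2)
    moreover have "\<ominus>\<^bsub>cterm D (i + 1)\<^esub> b (i + 1 + 1) (\<ominus>\<^bsub>cterm T (i + 1 + 1)\<^esub> cdiff T (i + 1) x) = b (i + 1 + 1) (cdiff T (i + 1) x)"
      using c dx hom_minus[OF T1(1) D1(1) b'[of "i + 1"]] by simp
    moreover have "f (i + 1 + 1) (\<ominus>\<^bsub>cterm T (i + 1 + 1)\<^esub> cdiff T (i + 1) x) = \<ominus>\<^bsub>cterm C (i + 1 + 1)\<^esub> cdiff C (i + 1) (f (i + 1) x)"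
      using hom_minus[OF T1(1) C1(1) f1(1) dx] f1(2)[OF x] by simp
    ultimately show "g (i + 1) (cdiff shifted i x) = cdiff (mapping_cone C D s) i (g i x)"
      by (simp only: g_def mapping_cone_simps(2)) (simp add: shifted_def del: add.assoc)
  qed
  from S.null_to_perfect[OF s'(2) this]
  obtain h where h: "\<And>i. h i \<in> module_hom R (cterm shifted i) (cterm (mapping_cone C D s) (i - 1))"
    and h': "\<And>i. h (i + 1) \<in> module_hom R (cterm shifted (i + 1)) (cterm (mapping_cone C D s) i)"
    and heq: "\<And>i x. x \<in> carrier (cterm shifted i) \<Longrightarrow> g i x =
      cdiff (mapping_cone C D s) (i - 1) (h i x) \<oplus>\<^bsub>cterm (mapping_cone C D s) i\<^esub> h (i + 1) (cdiff shifted i x)"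
    by (rule null_homotopicE[OF S.T cone]) rule
  \<comment> \<open>T[1] has \<open>cterm T j\<close> in degree j - 1, hence the index; the sign
    undoes those of the cone and of the shifted differential.\<close>
  define a where "a j x = \<ominus>\<^bsub>cterm C (j - 1)\<^esub> fst (h (j - 1) x)" for j x
  have fh: "(\<lambda>x. fst (h i x)) \<in> module_hom R (cterm T (i + 1)) (cterm C i)" for i
    using hom_comp[OF h[of i, unfolded mapping_cone_simps] hom_fst] by (simp add: shifted_def)
  have a: "a j \<in> module_hom R (cterm T j) (cterm C (j - 1))" for j
    using hom_uminus[OF C1(1) fh[of "j - 1"]] by (simp add: a_def[abs_def])
  show ?thesis
  proof (rule null_homotopicI[OF T C a])
    fix j x assume x: "x \<in> carrier (cterm T j)"
    define i where "i = j - 1"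
    have j: "j = i + 1" by (simp add: i_def)
    have xi: "x \<in> carrier (cterm shifted i)" using x by (simp add: shifted_def j)
    have x1: "x \<in> carrier (cterm T (i + 1))" using x by (simp add: j)
    have dx: "cdiff T (i + 1) x \<in> carrier (cterm T (i + 1 + 1))" using hom_closed[OF T1(2) x1] .
    obtain u v where uv: "h i x = (u, v)" by (cases "h i x")
    obtain u' v' where uv': "h (i + 1) (cdiff shifted i x) = (u', v')" by (cases "h (i + 1) (cdiff shifted i x)")
    have uc: "u \<in> carrier (cterm C i)" using hom_closed[OF fh x1] uv by simp
    have "f (i + 1) x = \<ominus>\<^bsub>cterm C (i + 1)\<^esub> cdiff C i u \<oplus>\<^bsub>cterm C (i + 1)\<^esub> u'"
      using heq[OF xi] unfolding uv uv' g_def by (simp add: mapping_cone_simps(2)[of C D s "i - 1"])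
    moreover have "u' = a (i + 1 + 1) (cdiff T (i + 1) x)"
    proof -
      have "u' = fst (h (i + 1) (\<ominus>\<^bsub>cterm T (i + 1 + 1)\<^esub> cdiff T (i + 1) x))" using uv' by (simp add: shifted_def)
      then show ?thesis using hom_minus[OF T1(1) C1(1) fh dx] by (simp add: a_def add.commute)
    qed
    moreover have "\<ominus>\<^bsub>cterm C (i + 1)\<^esub> cdiff C i u = cdiff C i (a (i + 1) x)"
      using uv hom_minus[OF C1(1) C1(1) C1(2) uc] by (simp add: a_def)
    ultimately show "f j x = cdiff C (j - 1) (a j x) \<oplus>\<^bsub>cterm C j\<^esub> a (j + 1) (cdiff T j x)"
      by (simp add: j)
  qed
qed

end

subsection \<open>Duals\<close>

abbreviation dual where "dual R M \<equiv> Hom_module R M (regular_module R)"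

text \<open>Evaluation at n generators of Z embeds the dual in a free module of rank n, all of whose
  submodules are finitely generated.\<close>

lemma fg_dual:
  fixes R :: "('a, 'r) ring_scheme" and Z :: "('a, 'z) module"
  assumes N: "noetherian_ring R" "cring R" and Z: "fg_module R Z"
  shows "fg_module R (dual R Z)"
proof -
  interpret R: cring R by fact
  note lZ = fg_module_left_module[OF Z] and lR = left_module_regular[OF R.ring_axioms]
  interpret Z: left_module R Z by (rule lZ)
  interpret lR: left_module R "regular_module R" by (rule lR)
  note lD = left_module_Hom[OF N(2) lZ lR]
  obtain n x where x: "\<And>i. x i \<in> carrier Z" "(\<lambda>v. lincomb Z v x n) ` carrier (free_module R n) = carrier Z"
    using fg_module_generators[OF Z] by blast
  let ?F = "free_module R n"
  note F = left_module_free[OF R.ring_axioms, of n]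
  \<comment> \<open>Values at the generators, padded by zero as \<open>free_module\<close>
    requires.\<close>
  define k where "k q i = (if i < n then q (x i) else \<zero>\<^bsub>R\<^esub>)" for q :: "'z \<Rightarrow> 'a" and i
  have qc: "q z \<in> carrier R" if "q \<in> carrier (dual R Z)" "z \<in> carrier Z" for q z
    using that hom_closed[of q R Z "regular_module R"] by (simp add: carrier_Hom_module)
  have k: "k \<in> module_hom R (dual R Z) ?F"
    by (rule module_homI) (auto simp: k_def Hom_module_simps x(1) qc)
  have inj: "inj_on k (carrier (dual R Z))"
  proof (rule inj_onI)
    fix p q assume p: "p \<in> carrier (dual R Z)" and q: "q \<in> carrier (dual R Z)" and eq: "k p = k q"
    have p': "p \<in> module_hom R Z (regular_module R)" and q': "q \<in> module_hom R Z (regular_module R)"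
      using p q by (auto simp: carrier_Hom_module)
    have e: "p (x i) = q (x i)" if "i < n" for i using fun_cong[OF eq, of i] that by (simp add: k_def)
    have "p (lincomb Z v x m) = q (lincomb Z v x m)" if "m \<le> n" and v: "v \<in> carrier ?F" for m v
      using that(1)
    proof (induct m)
      case 0
      show ?case using hom_zero[OF lZ lR p'] hom_zero[OF lZ lR q'] by simp
    next
      case (Suc m)
      have c: "lincomb Z v x m \<in> carrier Z" "v m \<odot>\<^bsub>Z\<^esub> x m \<in> carrier Z" "v m \<in> carrier R"
        using hom_closed[OF lincomb_hom[of R Z x, OF lZ x(1)] v] v x(1) by auto
      then show ?case
        using Suc e[of m] x(1) by (simp add: hom_add[OF p'] hom_add[OF q'] hom_smult[OF p'] hom_smult[OF q'])
    qed
    note pq = this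
    have "p z = q z" if z: "z \<in> carrier Z" for z
    proof -
      obtain v where v: "v \<in> carrier ?F" "z = lincomb Z v x n" using z unfolding x(2)[symmetric] by (rule imageE)
      show ?thesis unfolding v(2) by (rule pq[OF order_refl v(1)])
    qed
    then show "p = q" using p q unfolding carrier_Hom_module by (blast intro: extensionalityI)
  qed
  let ?I = "?F\<lparr>carrier := k ` carrier (dual R Z)\<rparr>"
  note sub = submod_image[OF lD F k]
  have I: "fg_module R ?I" by (rule fg_module_submod[OF N fg_module_free[OF R.ring_axioms] sub])
  note lI = fg_module_left_module[OF I]
  have "(\<lambda>x. x) \<in> module_hom R ?I ?F"
    by (rule hom_from_submod[OF hom_id]) (use sub in \<open>auto simp: submod_def\<close>)
  from hom_corestrict_inj[OF lD F lI k inj this]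
  obtain g where g: "g \<in> module_hom R ?I (dual R Z)" "\<And>w. w \<in> k ` carrier (dual R Z) \<Longrightarrow> k (g w) = w"
    by auto
  have "g ` carrier ?I = carrier (dual R Z)"
  proof
    show "g ` carrier ?I \<subseteq> carrier (dual R Z)" using hom_closed[OF g(1)] by auto
    show "carrier (dual R Z) \<subseteq> g ` carrier ?I"
    proof
      fix q assume q: "q \<in> carrier (dual R Z)"
      have kq: "k q \<in> k ` carrier (dual R Z)" using q by blast
      have "g (k q) = q"
        using inj_onD[OF inj, of "g (k q)" q] g(2)[OF kq] hom_closed[OF g(1), of "k q"] kq q by simp
      then show "q \<in> g ` carrier ?I" using kq by force
    qed
  qed
  then show ?thesis by (rule fg_module_image[OF I lD g(1)])
qed

lemma dual_comp:
  assumes "left_module R G" "left_module R H" "k \<in> module_hom R G H" "q \<in> carrier (dual R H)"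
  shows "(\<lambda>x\<in>carrier G. q (k x)) \<in> carrier (dual R G)"
  by (rule restrict_hom[OF hom_comp[OF assms(3)] assms(1)]) (use assms in \<open>simp add: carrier_Hom_module\<close>)

lemma dual_eval_hom:
  assumes "y \<in> carrier G"
  shows "(\<lambda>q. q y) \<in> module_hom R (dual R G) (regular_module R)"
  by (rule module_homI) (use assms in \<open>auto simp: Hom_module_simps carrier_Hom_module hom_closed[where N = "regular_module R", simplified]\<close>)

lemma dual_comp_hom:
  assumes "left_module R G" "left_module R H" "k \<in> module_hom R G H"
  shows "(\<lambda>q. \<lambda>x\<in>carrier G. q (k x)) \<in> module_hom R (dual R H) (dual R G)"
proof (rule module_homI)
  show "(\<lambda>x\<in>carrier G. q (k x)) \<in> carrier (dual R G)" if "q \<in> carrier (dual R H)" for q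
    by (rule dual_comp[OF assms that])
qed (use hom_closed[OF assms(3)] in \<open>auto simp: Hom_module_simps intro!: restrict_ext\<close>)

text \<open>Transposing a finite rank expression exchanges roles: the functional p becomes a vector
  of the dual, and y becomes the functional that evaluates at y.\<close>

lemma fproj_dual:
  assumes R: "cring R" and G: "fproj R G"
  shows "fproj R (dual R G)"
proof -
  interpret R: cring R by fact
  note lG = fproj_left_module[OF G] and lR = left_module_regular[OF R.ring_axioms]
  note lD = left_module_Hom[OF R lG lR]
  have "fin_rank R (dual R G) (dual R G) (\<lambda>q. \<lambda>x\<in>carrier G. q (g x))" if "fin_rank R G G g" for g
    using that
  proof induct
    case (zero g)
    show ?case
    proof (rule fin_rank.zero)
      fix q assume "q \<in> carrier (dual R G)"
      then have "q \<in> module_hom R G (regular_module R)" by (simp add: carrier_Hom_module)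
      then show "(\<lambda>x\<in>carrier G. q (g x)) = \<zero>\<^bsub>dual R G\<^esub>"
        using zero hom_zero[OF lG lR] by (auto simp: Hom_module_simps intro!: restrict_ext)
    qed
  next
    case (step g p y g')
    interpret G: left_module R G by (rule lG)
    have p: "(\<lambda>x\<in>carrier G. p x) \<in> carrier (dual R G)" by (rule restrict_hom[OF step(3) lG])
    show ?case
    proof (rule fin_rank.step[OF step(2) dual_eval_hom[OF step(4)] p])
      fix q assume "q \<in> carrier (dual R G)"
      then have q: "q \<in> module_hom R G (regular_module R)" by (simp add: carrier_Hom_module)
      have "q (g' x) = q (g x) \<oplus>\<^bsub>R\<^esub> q y \<otimes>\<^bsub>R\<^esub> p x" if x: "x \<in> carrier G" for x
      proof -
        have c: "p x \<in> carrier R" "g x \<in> carrier G" "q y \<in> carrier R"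
          using hom_closed[OF step(3) x] hom_closed[OF fin_rank_hom[OF lG lG step(1)] x] hom_closed[OF q step(4)] by auto
        then show ?thesis using step(5)[OF x] step(4) by (simp add: hom_add[OF q] hom_smult[OF q] R.m_comm)
      qed
      then show "(\<lambda>x\<in>carrier G. q (g' x)) = (\<lambda>x\<in>carrier G. q (g x)) \<oplus>\<^bsub>dual R G\<^esub> q y \<odot>\<^bsub>dual R G\<^esub> (\<lambda>x\<in>carrier G. p x)"
        by (auto simp: Hom_module_simps intro!: restrict_ext)
    qed
  qed
  from fin_rank_cong[OF this lD lD, of "\<lambda>x. x" "\<lambda>q. q"] G have "fin_rank R (dual R G) (dual R G) (\<lambda>q. q)"
    by (auto simp: fproj_def carrier_Hom_module extensional_restrict)
  then show ?thesis using lD by (simp add: fproj_def)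
qed

text \<open>If g is the sum of terms \<open>p x \<odot> y\<close>, then q sends c g to the sum of
  the c y multiplied by q p, that is, to the value of c at the sum of the vectors y scaled by q p.
  The identity of G is such a g.\<close>

lemma fproj_reflexive:
  assumes R: "cring R" and G: "fproj R G" and q: "q \<in> module_hom R (dual R G) (regular_module R)"
  shows "\<exists>y\<in>carrier G. \<forall>c\<in>carrier (dual R G). q c = c y"
proof -
  interpret R: cring R by fact
  note lG = fproj_left_module[OF G] and lR = left_module_regular[OF R.ring_axioms]
  interpret G: left_module R G by (rule lG)
  note lD = left_module_Hom[OF R lG lR]
  have "\<exists>y\<in>carrier G. \<forall>c\<in>carrier (dual R G). q (\<lambda>x\<in>carrier G. c (g x)) = c y" if "fin_rank R G G g" for g
    using that
  proof induct
    case (zero g)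
    show ?case
    proof (intro bexI[of _ "\<zero>\<^bsub>G\<^esub>"] ballI)
      fix c assume "c \<in> carrier (dual R G)"
      then have c0: "c \<zero>\<^bsub>G\<^esub> = \<zero>\<^bsub>R\<^esub>" using hom_zero[OF lG lR, of c] by (simp add: carrier_Hom_module)
      then have "(\<lambda>x\<in>carrier G. c (g x)) = \<zero>\<^bsub>dual R G\<^esub>"
        using zero by (auto simp: Hom_module_simps intro!: restrict_ext)
      then show "q (\<lambda>x\<in>carrier G. c (g x)) = c \<zero>\<^bsub>G\<^esub>" using hom_zero[OF lD lR q] c0 by simp
    qed simp
  next
    case (step g p y g')
    from step obtain z where z: "z \<in> carrier G" "\<forall>c\<in>carrier (dual R G). q (\<lambda>x\<in>carrier G. c (g x)) = c z" by blast
    have p: "(\<lambda>x\<in>carrier G. p x) \<in> carrier (dual R G)" by (rule restrict_hom[OF step(3) lG])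
    define a where "a = q (\<lambda>x\<in>carrier G. p x)"
    have a: "a \<in> carrier R" using hom_closed[OF q p] by (simp add: a_def)
    show ?case
    proof (intro bexI[of _ "z \<oplus>\<^bsub>G\<^esub> a \<odot>\<^bsub>G\<^esub> y"] ballI)
      fix c assume cD: "c \<in> carrier (dual R G)"
      then have c: "c \<in> module_hom R G (regular_module R)" by (simp add: carrier_Hom_module)
      have cy: "c y \<in> carrier R" using hom_closed[OF c step(4)] by simp
      have "c (g' x) = c (g x) \<oplus>\<^bsub>R\<^esub> c y \<otimes>\<^bsub>R\<^esub> p x" if x: "x \<in> carrier G" for x
      proof -
        have "p x \<in> carrier R" "g x \<in> carrier G"
          using hom_closed[OF step(3) x] hom_closed[OF fin_rank_hom[OF lG lG step(1)] x] by auto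
        then show ?thesis using cy step(5)[OF x] step(4) by (simp add: hom_add[OF c] hom_smult[OF c] R.m_comm)
      qed
      then have "(\<lambda>x\<in>carrier G. c (g' x)) = (\<lambda>x\<in>carrier G. c (g x)) \<oplus>\<^bsub>dual R G\<^esub> c y \<odot>\<^bsub>dual R G\<^esub> (\<lambda>x\<in>carrier G. p x)"
        by (auto simp: Hom_module_simps intro!: restrict_ext)
      moreover have "(\<lambda>x\<in>carrier G. c (g x)) \<in> carrier (dual R G)"
        by (rule dual_comp[OF lG lG fin_rank_hom[OF lG lG step(1)] cD])
      ultimately have "q (\<lambda>x\<in>carrier G. c (g' x)) = c z \<oplus>\<^bsub>R\<^esub> c y \<otimes>\<^bsub>R\<^esub> a"
        using z(2) cD hom_add[OF q] hom_smult[OF q cy p] left_module.lm_smult_closed[OF lD cy p] by (simp add: a_def)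
      then show "q (\<lambda>x\<in>carrier G. c (g' x)) = c (z \<oplus>\<^bsub>G\<^esub> a \<odot>\<^bsub>G\<^esub> y)"
        using z(1) a step(4) cy by (simp add: hom_add[OF c] hom_smult[OF c] R.m_comm)
    qed (use z(1) a step(4) in simp)
  qed
  then obtain y where y: "y\<in>carrier G" "\<forall>c\<in>carrier (dual R G). q (\<lambda>x\<in>carrier G. c x) = c y"
    using G unfolding fproj_def by blast
  then show ?thesis by (intro bexI[OF _ y(1)]) (auto simp: carrier_Hom_module extensional_restrict)
qed

text \<open>Expanding the identity of G writes y as a combination of vectors with coefficients p y,
  and these all vanish.\<close>

lemma fproj_torsionless:
  assumes R: "cring R" and G: "fproj R G" and y: "y \<in> carrier G" "\<And>c. c \<in> carrier (dual R G) \<Longrightarrow> c y = \<zero>\<^bsub>R\<^esub>"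
  shows "y = \<zero>\<^bsub>G\<^esub>"
proof -
  note lG = fproj_left_module[OF G]
  interpret G: left_module R G by (rule lG)
  have gy: "g y = \<zero>\<^bsub>G\<^esub>" if "fin_rank R G G g" for g
    using that
  proof induct
    case (step g p z g')
    have "p y = \<zero>\<^bsub>R\<^esub>" using y(2)[OF restrict_hom[OF step(3) lG]] y(1) by simp
    then show ?case using step y(1) by simp
  qed (use y(1) in simp)
  show ?thesis using gy[of "\<lambda>x. x"] G by (simp add: fproj_def)
qed

subsection \<open>Complete resolutions\<close>

lemma int_trichotomy:
  obtains (neg) k where "i = - 1 - int k" | (zero) "i = 0" | (pos) k where "i = int k + 1"
proof -
  have "i = - 1 - int (nat (- 1 - i)) \<or> i = 0 \<or> i = int (nat (i - 1)) + 1" by linarith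
  then show thesis using that by blast
qed

text \<open>The conversions between \<open>nat\<close> and \<open>int\<close> indices are confined
  to \<open>glue_simps\<close>, whose equations are stated in the shapes of degrees that arise after
  a split by \<open>int_trichotomy\<close>.\<close>

definition glue where
  "glue P d m D e = \<lparr>cterm = (\<lambda>i. if i \<le> 0 then P (nat (- i)) else D (nat (i - 1))),
     cdiff = (\<lambda>i :: int. if i < 0 then d (nat (- i - 1)) else if i = 0 then m else e (nat (i - 1)))\<rparr>"

lemma glue_simps:
  "cterm (glue P d m D e) (- int k) = P k" "cterm (glue P d m D e) 0 = P 0"
  "cterm (glue P d m D e) (int k + 1) = D k"
  "cdiff (glue P d m D e) (- 1 - int k) = d k" "cdiff (glue P d m D e) 0 = m"
  "cdiff (glue P d m D e) (int k + 1) = e k"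
  "cterm (glue P d m D e) (- 1 - int k) = P (Suc k)"
  "cterm (glue P d m D e) (- 2 - int k) = P (Suc (Suc k))"
  "cdiff (glue P d m D e) (- 2 - int k) = d (Suc k)"
  "cterm (glue P d m D e) (int k + 2) = D (Suc k)"
  "cterm (glue P d m D e) (int k + 3) = D (Suc (Suc k))"
  "cdiff (glue P d m D e) (int k + 2) = e (Suc k)"
  "cdiff (glue P d m D e) (- 1) = d 0"
  "cterm (glue P d m D e) (- 1) = P (Suc 0)"
  "cterm (glue P d m D e) 1 = D 0" "cdiff (glue P d m D e) 1 = e 0" "cterm (glue P d m D e) 2 = D (Suc 0)"
  by (auto simp: glue_def nat_add_distrib eval_nat_numeral
      intro!: arg_cong[where f = P] arg_cong[where f = D] arg_cong[where f = d] arg_cong[where f = e])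

lemma coacyclic_glue:
  fixes P D :: "nat \<Rightarrow> ('a, 'u) module"
  assumes R: "cring R" and P: "\<And>i. fproj R (P i)" and D: "\<And>i. fproj R (D i)"
    and d: "\<And>i. d i \<in> module_hom R (P (Suc i)) (P i)" and e: "\<And>i. e i \<in> module_hom R (D i) (D (Suc i))"
    and m: "m \<in> module_hom R (P 0) (D 0)"
    and dd: "\<And>i x. x \<in> carrier (P (Suc (Suc i))) \<Longrightarrow> d i (d (Suc i) x) = \<zero>\<^bsub>P i\<^esub>"
    and ee: "\<And>i x. x \<in> carrier (D i) \<Longrightarrow> e (Suc i) (e i x) = \<zero>\<^bsub>D (Suc (Suc i))\<^esub>"
    and md: "\<And>x. x \<in> carrier (P (Suc 0)) \<Longrightarrow> m (d 0 x) = \<zero>\<^bsub>D 0\<^esub>"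
    and em: "\<And>x. x \<in> carrier (P 0) \<Longrightarrow> e 0 (m x) = \<zero>\<^bsub>D (Suc 0)\<^esub>"
    and xP: "\<And>k q. q \<in> module_hom R (P (Suc k)) (regular_module R) \<Longrightarrow>
      (\<And>x. x \<in> carrier (P (Suc (Suc k))) \<Longrightarrow> q (d (Suc k) x) = \<zero>\<^bsub>R\<^esub>) \<Longrightarrow>
      \<exists>q'\<in>module_hom R (P k) (regular_module R). \<forall>x\<in>carrier (P (Suc k)). q x = q' (d k x)"
    and x0: "\<And>q. q \<in> module_hom R (P 0) (regular_module R) \<Longrightarrow>
      (\<And>x. x \<in> carrier (P (Suc 0)) \<Longrightarrow> q (d 0 x) = \<zero>\<^bsub>R\<^esub>) \<Longrightarrow>
      \<exists>q'\<in>module_hom R (D 0) (regular_module R). \<forall>x\<in>carrier (P 0). q x = q' (m x)"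
    and xD0: "\<And>q. q \<in> module_hom R (D 0) (regular_module R) \<Longrightarrow>
      (\<And>x. x \<in> carrier (P 0) \<Longrightarrow> q (m x) = \<zero>\<^bsub>R\<^esub>) \<Longrightarrow>
      \<exists>q'\<in>module_hom R (D (Suc 0)) (regular_module R). \<forall>x\<in>carrier (D 0). q x = q' (e 0 x)"
    and xD: "\<And>k q. q \<in> module_hom R (D (Suc k)) (regular_module R) \<Longrightarrow>
      (\<And>x. x \<in> carrier (D k) \<Longrightarrow> q (e k x) = \<zero>\<^bsub>R\<^esub>) \<Longrightarrow>
      \<exists>q'\<in>module_hom R (D (Suc (Suc k))) (regular_module R). \<forall>x\<in>carrier (D (Suc k)). q x = q' (e (Suc k) x)"
  shows "coacyclic R (glue P d m D e)"
proof (rule coacyclic.intro)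
  let ?T = "glue P d m D e"
  have up: "- 1 - int k + 1 = - int k" "- 1 - int k + 1 + 1 = 1 - int k" "int k + 1 + 1 = int k + 2" "int k + 2 + 1 = int k + 3"
    "- 1 - int k - 1 = - 2 - int k" "int k + 1 - 1 = int k" "(0::int) + 1 = 1" "(0::int) - 1 = - 1" "(0::int) + 1 + 1 = 2" for k
    by simp_all
  show "fproj R (cterm ?T i)" for i
    by (cases i rule: int_trichotomy) (simp_all only: glue_simps P D)
  have dT: "cdiff ?T i \<in> module_hom R (cterm ?T i) (cterm ?T (i + 1))" for i
    by (cases i rule: int_trichotomy) (simp_all only: up glue_simps d e m)
  have "cdiff ?T (i + 1) (cdiff ?T i x) = \<zero>\<^bsub>cterm ?T (i + 1 + 1)\<^esub>" if x: "x \<in> carrier (cterm ?T i)" for i x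
  proof (cases i rule: int_trichotomy)
    case (neg k)
    show ?thesis
    proof (cases k)
      case 0
      then show ?thesis using x md unfolding neg by (simp add: glue_simps)
    next
      case (Suc j)
      have "i = - 2 - int j" "i + 1 = - 1 - int j" "i + 1 + 1 = - int j" using neg Suc by simp_all
      then show ?thesis using x dd by (simp only: glue_simps)
    qed
  next
    case zero
    then show ?thesis using x em by (simp add: glue_simps)
  next
    case (pos k)
    then show ?thesis using x ee by (simp only: up glue_simps)
  qed
  then show "cplx R ?T"
    unfolding cplx_def using dT \<open>\<And>i. fproj R (cterm ?T i)\<close> fproj_left_module by blast
  fix q i
  assume q: "q \<in> module_hom R (cterm ?T i) (regular_module R)"
    "\<And>x. x \<in> carrier (cterm ?T (i - 1)) \<Longrightarrow> q (cdiff ?T (i - 1) x) = \<zero>\<^bsub>R\<^esub>"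
  show "\<exists>q'\<in>module_hom R (cterm ?T (i + 1)) (regular_module R). \<forall>x\<in>carrier (cterm ?T i). q x = q' (cdiff ?T i x)"
  proof (cases i rule: int_trichotomy)
    case (neg k)
    show ?thesis using xP[of q k] q unfolding neg by (simp only: up glue_simps)
  next
    case zero
    show ?thesis using x0[of q] q unfolding zero by (simp only: up glue_simps)
  next
    case (pos k)
    show ?thesis
    proof (cases k)
      case 0
      then show ?thesis using xD0[of q] q unfolding pos by (simp add: glue_simps)
    next
      case (Suc j)
      have "i = int j + 2" "i + 1 = int j + 3" "i - 1 = int j + 1" using pos Suc by simp_all
      then show ?thesis using xD[of q j] q by (simp only: glue_simps)
    qed
  qed
qed (rule R)

text \<open>The dual of T is exact for different reasons in its three regions. On the side of P it
  is the vanishing of Ext(Z, R). On the side of E, reflexivity turns duals of duals back into G, and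
  a resolution is exact. At the junction, functionals on P 0 that kill the image of d 0 are
  functionals on Z, and G 0 covers these.\<close>

lemma coacyclic_exists:
  fixes R :: "('a, 'r) ring_scheme"
  assumes N: "noetherian_ring R" and R: "cring R" and Z: "mcm R Z"
  obtains T :: "('a, 'a univ) cochain_complex" and \<epsilon> where "coacyclic R T"
    "\<epsilon> \<in> module_hom R (cterm T 0) Z" "\<epsilon> ` carrier (cterm T 0) = carrier Z"
    "cdiff T (- 1) ` carrier (cterm T (- 1)) = hker (cterm T 0) Z \<epsilon>"
proof -
  interpret R: cring R by fact
  note lR = left_module_regular[OF R.ring_axioms]
  have fgZ: "fg_module R Z" using Z by (simp add: mcm_def)
  note lZ = fg_module_left_module[OF fgZ]
  obtain P d \<epsilon> where er: "ext_resolution R Z = (P, d)" and res: "projective_resolution R Z P d \<epsilon>"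
    using ext_resolution[OF N R fgZ] by blast
  note P = projective_resolutionD[OF res]
  have xP: "\<exists>q'\<in>module_hom R (P k) (regular_module R). \<forall>x\<in>carrier (P (Suc k)). q x = q' (d k x)"
    if "q \<in> module_hom R (P (Suc k)) (regular_module R)"
      "\<And>x. x \<in> carrier (P (Suc (Suc k))) \<Longrightarrow> q (d (Suc k) x) = \<zero>\<^bsub>R\<^esub>" for k q
  proof (rule Hom_cohomology_zero_Suc[where P = P and d = d, OF R P(2) lR P(4) P(9) R.zero_closed])
    show "carrier (Hom_cohomology R P d (regular_module R) (Suc k)) = {\<zero>\<^bsub>Hom_cohomology R P d (regular_module R) (Suc k)\<^esub>}"
      using Z unfolding mcm_def Ext_eq[OF er] by simp
  qed (use that in auto)
  obtain G b \<eta> where G: "projective_resolution R (dual R Z) G b \<eta>"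
    using projective_resolution_exists[OF N R fg_dual[OF N R fgZ]] by blast
  note G = projective_resolutionD[OF G]
  have "\<forall>i. \<exists>(E :: ('a, 'a univ) module) u w. module_iso R (dual R (G i)) E u w"
    using fg_module_copy[OF fg_dual[OF N R]] G(1) by (auto simp: fg_projective_iff)
  then obtain E :: "nat \<Rightarrow> ('a, 'a univ) module" and u w where E: "\<And>i. module_iso R (dual R (G i)) (E i) (u i) (w i)"
    by metis
  note I = module_isoD[OF E]
  have fE: "fproj R (E i)" for i by (rule fproj_iso[OF E fproj_dual[OF R G(3)]])
  \<comment> \<open>Under the identification of E i with the dual of G i, e i is the transpose of b
    i, and m is \<epsilon> followed by Z \<rightarrow> bidual of Z \<rightarrow> dual of G
    0.\<close>
  define e where "e i y = u (Suc i) (\<lambda>x\<in>carrier (G (Suc i)). w i y (b i x))" for i y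
  define m where "m x = u 0 (\<lambda>g\<in>carrier (G 0). \<eta> g (\<epsilon> x))" for x
  have e: "e i \<in> module_hom R (E i) (E (Suc i))" for i
    using hom_comp[OF hom_comp[OF I(4) dual_comp_hom[OF G(2) G(2) G(4)]] I(3)] by (simp add: e_def[abs_def])
  have eta: "\<eta> g \<in> module_hom R Z (regular_module R)" if "g \<in> carrier (G 0)" for g
    using hom_closed[OF G(5) that] by (simp add: carrier_Hom_module)
  have evz: "(\<lambda>g\<in>carrier (G 0). \<eta> g z) \<in> carrier (dual R (G 0))" if z: "z \<in> carrier Z" for z
    by (rule restrict_hom[OF hom_comp[OF G(5) dual_eval_hom[OF z]] G(2)])
  have "(\<lambda>z. \<lambda>g\<in>carrier (G 0). \<eta> g z) \<in> module_hom R Z (dual R (G 0))"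
  proof (rule module_homI)
    fix y z assume "y \<in> carrier Z" "z \<in> carrier Z"
    then show "(\<lambda>g\<in>carrier (G 0). \<eta> g (y \<oplus>\<^bsub>Z\<^esub> z)) =
      (\<lambda>g\<in>carrier (G 0). \<eta> g y) \<oplus>\<^bsub>dual R (G 0)\<^esub> (\<lambda>g\<in>carrier (G 0). \<eta> g z)"
      using hom_add[OF eta] by (auto simp: Hom_module_simps intro!: restrict_ext)
  next
    fix a z assume "a \<in> carrier R" "z \<in> carrier Z"
    then show "(\<lambda>g\<in>carrier (G 0). \<eta> g (a \<odot>\<^bsub>Z\<^esub> z)) = a \<odot>\<^bsub>dual R (G 0)\<^esub> (\<lambda>g\<in>carrier (G 0). \<eta> g z)"
      using hom_smult[OF eta] by (auto simp: Hom_module_simps intro!: restrict_ext)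
  qed (rule evz)
  from hom_comp[OF hom_comp[OF P(5) this] I(3)] have m: "m \<in> module_hom R (P 0) (E 0)"
    by (simp add: m_def[abs_def])
  have wc: "w i y \<in> carrier (dual R (G i))" if "y \<in> carrier (E i)" for i y using hom_closed[OF I(4) that] .
  have wh: "w i y \<in> module_hom R (G i) (regular_module R)" if "y \<in> carrier (E i)" for i y
    using wc[OF that] by (simp add: carrier_Hom_module)
  have bc: "b i x \<in> carrier (G i)" if "x \<in> carrier (G (Suc i))" for i x using hom_closed[OF G(4) that] .
  have epc: "\<epsilon> x \<in> carrier Z" if "x \<in> carrier (P 0)" for x using hom_closed[OF P(5) that] .
  have we: "w (Suc i) (e i y) = (\<lambda>x\<in>carrier (G (Suc i)). w i y (b i x))" if y: "y \<in> carrier (E i)" for i y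
    unfolding e_def by (rule I(5)[OF dual_comp[OF G(2) G(2) G(4) wc[OF y]]])
  have wm: "w 0 (m x) = (\<lambda>g\<in>carrier (G 0). \<eta> g (\<epsilon> x))" if x: "x \<in> carrier (P 0)" for x
    unfolding m_def by (rule I(5)[OF evz[OF epc[OF x]]])
  have uzero: "u i (\<lambda>x\<in>carrier (G i). c x) = \<zero>\<^bsub>E i\<^esub>" if "\<And>x. x \<in> carrier (G i) \<Longrightarrow> c x = \<zero>\<^bsub>R\<^esub>" for c i
  proof -
    have "(\<lambda>x\<in>carrier (G i). c x) = \<zero>\<^bsub>dual R (G i)\<^esub>"
      using that by (auto simp: Hom_module_simps intro!: restrict_ext)
    then show ?thesis using hom_zero[OF I(1,2,3)] by simp
  qed
  have refl: "\<exists>y\<in>carrier (G i). \<forall>z\<in>carrier (E i). q z = w i z y"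
    if q: "q \<in> module_hom R (E i) (regular_module R)" for q i
  proof -
    obtain y where y: "y \<in> carrier (G i)" "\<forall>c\<in>carrier (dual R (G i)). q (u i c) = c y"
      using fproj_reflexive[OF R G(3) hom_comp[OF I(3) q]] by blast
    then show ?thesis using wc I(6) by (metis)
  qed
  have weval: "(\<lambda>z. w i z y) \<in> module_hom R (E i) (regular_module R)" if "y \<in> carrier (G i)" for i y
    by (rule hom_comp[OF I(4) dual_eval_hom[OF that]])
  have "coacyclic R (glue P d m E e)"
  proof (rule coacyclic_glue[OF R P(3) fE P(4) e m P(9) _ _ _ xP])
    show "e (Suc i) (e i y) = \<zero>\<^bsub>E (Suc (Suc i))\<^esub>" if y: "y \<in> carrier (E i)" for i y
      unfolding e_def[of "Suc i"] we[OF y]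
      by (rule uzero) (use bc G(9) hom_zero[OF G(2) lR wh[OF y]] in auto)
    show "m (d 0 x) = \<zero>\<^bsub>E 0\<^esub>" if x: "x \<in> carrier (P (Suc 0))" for x
      unfolding m_def by (rule uzero) (use P(10)[OF x] hom_zero[OF lZ lR eta] in auto)
    show "e 0 (m x) = \<zero>\<^bsub>E (Suc 0)\<^esub>" if x: "x \<in> carrier (P 0)" for x
    proof -
      have "\<eta> (b 0 g) (\<epsilon> x) = \<zero>\<^bsub>R\<^esub>" if g: "g \<in> carrier (G (Suc 0))" for g
        using G(10)[OF g] epc[OF x] by (simp add: Hom_module_simps)
      then show ?thesis unfolding e_def wm[OF x] by (intro uzero) (use bc in auto)
    qed
  next
    \<comment> \<open>Exactness at P 0: q descends to a functional c on Z, c is the image under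
      \<eta> of some g, and evaluation at g extends q along m.\<close>
    fix q assume q: "q \<in> module_hom R (P 0) (regular_module R)" "\<And>x. x \<in> carrier (P (Suc 0)) \<Longrightarrow> q (d 0 x) = \<zero>\<^bsub>R\<^esub>"
    have "q x = \<zero>\<^bsub>regular_module R\<^esub>" if x: "x \<in> carrier (P 0)" "\<epsilon> x = \<zero>\<^bsub>Z\<^esub>" for x
    proof -
      have "x \<in> d 0 ` carrier (P (Suc 0))" using x unfolding P(7) by (simp add: hker_def)
      then show ?thesis using q(2) by auto
    qed
    then obtain c where c: "c \<in> module_hom R Z (regular_module R)" "\<And>x. x \<in> carrier (P 0) \<Longrightarrow> c (\<epsilon> x) = q x"
      using hom_factor[OF P(2) lZ lR P(5,6) q(1)] by blast
    have "(\<lambda>z\<in>carrier Z. c z) \<in> \<eta> ` carrier (G 0)" unfolding G(6) by (rule restrict_hom[OF c(1) lZ])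
    then obtain g where g: "g \<in> carrier (G 0)" "\<eta> g = (\<lambda>z\<in>carrier Z. c z)" by auto
    show "\<exists>q'\<in>module_hom R (E 0) (regular_module R). \<forall>x\<in>carrier (P 0). q x = q' (m x)"
      by (rule bexI[OF _ weval[OF g(1)]]) (use g epc c(2) in \<open>auto simp: wm\<close>)
  next
    fix q assume q: "q \<in> module_hom R (E 0) (regular_module R)" "\<And>x. x \<in> carrier (P 0) \<Longrightarrow> q (m x) = \<zero>\<^bsub>R\<^esub>"
    \<comment> \<open>By reflexivity q is evaluation at some g. Vanishing on the image of m says
      that \<eta> g is zero, and exactness of the resolution G provides a preimage of g.\<close>
    obtain g where g: "g \<in> carrier (G 0)" "\<And>z. z \<in> carrier (E 0) \<Longrightarrow> q z = w 0 z g" using refl[OF q(1)] by blast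
    have "\<eta> g (\<epsilon> x) = \<zero>\<^bsub>R\<^esub>" if x: "x \<in> carrier (P 0)" for x
      using q(2)[OF x] g(2)[OF hom_closed[OF m x]] g(1) by (simp add: wm[OF x])
    then have "\<eta> g z = \<zero>\<^bsub>R\<^esub>" if "z \<in> carrier Z" for z using that P(6) by (metis imageE)
    then have "\<eta> g = \<zero>\<^bsub>dual R Z\<^esub>"
      using hom_closed[OF G(5) g(1)] by (auto simp: Hom_module_simps carrier_Hom_module intro!: extensionalityI[of "\<eta> g" "carrier Z"])
    then have "g \<in> b 0 ` carrier (G (Suc 0))" unfolding G(7) using g(1) by (simp add: hker_def)
    then obtain g' where g': "g' \<in> carrier (G (Suc 0))" "g = b 0 g'" by blast
    show "\<exists>q'\<in>module_hom R (E (Suc 0)) (regular_module R). \<forall>x\<in>carrier (E 0). q x = q' (e 0 x)"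
      by (rule bexI[OF _ weval[OF g'(1)]]) (use g g' in \<open>auto simp: we\<close>)
  next
    fix k q assume q: "q \<in> module_hom R (E (Suc k)) (regular_module R)" "\<And>x. x \<in> carrier (E k) \<Longrightarrow> q (e k x) = \<zero>\<^bsub>R\<^esub>"
    obtain g where g: "g \<in> carrier (G (Suc k))" "\<And>z. z \<in> carrier (E (Suc k)) \<Longrightarrow> q z = w (Suc k) z g"
      using refl[OF q(1)] by blast
    \<comment> \<open>All functionals on G k vanish at b k g. Hence b k g is zero, as projectives
      are torsionless, and exactness of G applies again.\<close>
    have "c (b k g) = \<zero>\<^bsub>R\<^esub>" if c: "c \<in> carrier (dual R (G k))" for c
      using q(2)[OF hom_closed[OF I(3) c]] g(2)[OF hom_closed[OF e hom_closed[OF I(3) c]]] g(1)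
      by (simp add: we[OF hom_closed[OF I(3) c]] I(5)[OF c])
    then have "b k g = \<zero>\<^bsub>G k\<^esub>" by (rule fproj_torsionless[OF R G(3) bc[OF g(1)]])
    then have "g \<in> b (Suc k) ` carrier (G (Suc (Suc k)))" unfolding G(8) using g(1) by (simp add: hker_def)
    then obtain g' where g': "g' \<in> carrier (G (Suc (Suc k)))" "g = b (Suc k) g'" by blast
    show "\<exists>q'\<in>module_hom R (E (Suc (Suc k))) (regular_module R). \<forall>x\<in>carrier (E (Suc k)). q x = q' (e (Suc k) x)"
      by (rule bexI[OF _ weval[OF g'(1)]]) (use g g' in \<open>auto simp: we\<close>)
  qed
  then show thesis
    by (rule that[of _ \<epsilon>]) (simp_all add: glue_simps P)
qed

subsection \<open>Annihilation of maps out of a coacyclic complex\<close>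

context coacyclic
begin

text \<open>The common annihilator of the cohomology of Hom(T, X) in every degree, that is, of maps
  from T to the translates of X up to homotopy. All degrees are included because the connecting map
  in \<open>map_ann_step\<close> passes from degree i to degree i - 1.\<close>

definition map_ann :: "('a, 'm) module \<Rightarrow> 'a set" where
  "map_ann X = {a \<in> carrier R. \<forall>i. \<forall>f\<in>module_hom R (cterm T i) X.
     (\<forall>x\<in>carrier (cterm T (i - 1)). f (cdiff T (i - 1) x) = \<zero>\<^bsub>X\<^esub>) \<longrightarrow>
     (\<exists>h\<in>module_hom R (cterm T (i + 1)) X. \<forall>x\<in>carrier (cterm T i). a \<odot>\<^bsub>X\<^esub> f x = h (cdiff T i x))}"

lemma map_annD:
  assumes "a \<in> map_ann X" "f \<in> module_hom R (cterm T i) X"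
    "\<And>x. x \<in> carrier (cterm T (i - 1)) \<Longrightarrow> f (cdiff T (i - 1) x) = \<zero>\<^bsub>X\<^esub>"
  shows "\<exists>h\<in>module_hom R (cterm T (i + 1)) X. \<forall>x\<in>carrier (cterm T i). a \<odot>\<^bsub>X\<^esub> f x = h (cdiff T i x)"
  using assms unfolding map_ann_def by blast

lemma map_ann_add:
  assumes X: "left_module R X" and "a \<in> map_ann X" "b \<in> map_ann X"
  shows "a \<oplus>\<^bsub>R\<^esub> b \<in> map_ann X"
proof -
  interpret X: left_module R X by fact
  have c: "a \<in> carrier R" "b \<in> carrier R" using assms by (auto simp: map_ann_def)
  show ?thesis
    unfolding map_ann_def
  proof (intro CollectI conjI allI ballI impI)
    fix i f assume f: "f \<in> module_hom R (cterm T i) X"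
      "\<forall>x\<in>carrier (cterm T (i - 1)). f (cdiff T (i - 1) x) = \<zero>\<^bsub>X\<^esub>"
    obtain h where h: "h \<in> module_hom R (cterm T (i + 1)) X" "\<forall>x\<in>carrier (cterm T i). a \<odot>\<^bsub>X\<^esub> f x = h (cdiff T i x)"
      using assms(2) f unfolding map_ann_def by blast
    obtain h' where h': "h' \<in> module_hom R (cterm T (i + 1)) X" "\<forall>x\<in>carrier (cterm T i). b \<odot>\<^bsub>X\<^esub> f x = h' (cdiff T i x)"
      using assms(3) f unfolding map_ann_def by blast
    show "\<exists>h\<in>module_hom R (cterm T (i + 1)) X. \<forall>x\<in>carrier (cterm T i). (a \<oplus>\<^bsub>R\<^esub> b) \<odot>\<^bsub>X\<^esub> f x = h (cdiff T i x)"
      by (rule bexI[OF _ hom_plus[OF X h(1) h'(1)]])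
        (use h(2) h'(2) c hom_closed[OF f(1)] in \<open>auto simp: X.lm_smult_l_distr\<close>)
  qed (use c in simp)
qed

text \<open>The long exact sequence of K \<rightarrow> P \<rightarrow> X made explicit. Since s
  kills the image of f under the connecting map, s f lifts to a cocycle u with values in P, and r u
  is a coboundary because r has finite rank on P.\<close>

lemma map_ann_step:
  assumes M: "left_module R P" "left_module R X" and p: "p \<in> module_hom R P X" "p ` carrier P = carrier X"
    and s: "s \<in> map_ann (kermod P X p)" and r: "r \<in> fr_ann R P"
  shows "s \<otimes>\<^bsub>R\<^esub> r \<in> map_ann X"
proof -
  interpret R: cring R by (rule R)
  interpret P: left_module R P by fact
  interpret X: left_module R X by fact
  note T1 = cplxD[OF T]
  let ?K = "kermod P X p"
  have c: "s \<in> carrier R" "r \<in> carrier R" using s r by (auto simp: map_ann_def fr_ann_def)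
  show ?thesis
    unfolding map_ann_def
  proof (intro CollectI conjI allI ballI impI)
    fix i f assume f: "f \<in> module_hom R (cterm T i) X"
      "\<forall>x\<in>carrier (cterm T (i - 1)). f (cdiff T (i - 1) x) = \<zero>\<^bsub>X\<^esub>"
    obtain g where g: "g \<in> module_hom R (cterm T i) P" "\<And>x. x \<in> carrier (cterm T i) \<Longrightarrow> p (g x) = f x"
      using fproj_lift[OF fproj_T f(1) p(1) _ M(2,1)] hom_closed[OF f(1)] p(2) by auto
    have gdK: "g (cdiff T (i - 1) x) \<in> hker P X p" if x: "x \<in> carrier (cterm T (i - 1))" for x
      using hom_closed[OF T1(3) x] f(2) x g(2) hom_closed[OF g(1)] by (auto simp: hker_def)
    \<comment> \<open>The connecting map: the lift g of f need not be a cocycle, but its composite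
      with the differential takes values in the kernel of p.\<close>
    have gd: "(\<lambda>x. g (cdiff T (i - 1) x)) \<in> module_hom R (cterm T (i - 1)) ?K"
      by (rule hom_submod[OF hom_comp[OF T1(3) g(1)] gdK])
    have "g (cdiff T (i - 1) (cdiff T (i - 1 - 1) x)) = \<zero>\<^bsub>?K\<^esub>" if "x \<in> carrier (cterm T (i - 1 - 1))" for x
      using T1(5)[OF that] hom_zero[OF T1(1) M(1) g(1)] by simp
    from map_annD[OF s gd this]
    obtain h where h: "h \<in> module_hom R (cterm T i) ?K"
        "\<And>x. x \<in> carrier (cterm T (i - 1)) \<Longrightarrow> s \<odot>\<^bsub>P\<^esub> g (cdiff T (i - 1) x) = h (cdiff T (i - 1) x)" by auto
    have hP: "h \<in> module_hom R (cterm T i) P" by (rule hom_to_ambient[OF h(1)]) (auto simp: hker_def)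
    have ph: "p (h x) = \<zero>\<^bsub>X\<^esub>" if "x \<in> carrier (cterm T i)" for x using hom_closed[OF h(1) that] by (simp add: hker_def)
    define u where "u x = s \<odot>\<^bsub>P\<^esub> g x \<ominus>\<^bsub>P\<^esub> h x" for x
    have u: "u \<in> module_hom R (cterm T i) P"
      unfolding u_def by (intro hom_minus_map hom_scale R M g hP c)
    have "u (cdiff T (i - 1) x) = \<zero>\<^bsub>P\<^esub>" if x: "x \<in> carrier (cterm T (i - 1))" for x
      using h(2)[OF x] hom_closed[OF hP hom_closed[OF T1(3) x]] by (simp add: u_def)
    then obtain h' where h': "h' \<in> module_hom R (cterm T (i + 1)) P" "\<And>x. x \<in> carrier (cterm T i) \<Longrightarrow> r \<odot>\<^bsub>P\<^esub> u x = h' (cdiff T i x)"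
      using fin_rank_exact[OF fr_annD(2)[OF r] M(1,1) u] by blast
    show "\<exists>h\<in>module_hom R (cterm T (i + 1)) X. \<forall>x\<in>carrier (cterm T i). (s \<otimes>\<^bsub>R\<^esub> r) \<odot>\<^bsub>X\<^esub> f x = h (cdiff T i x)"
    proof (rule bexI[OF _ hom_comp[OF h'(1) p(1)]], intro ballI)
      fix x assume x: "x \<in> carrier (cterm T i)"
      have k: "g x \<in> carrier P" "h x \<in> carrier P" "u x \<in> carrier P" "f x \<in> carrier X"
        using hom_closed[OF g(1) x] hom_closed[OF hP x] hom_closed[OF u x] hom_closed[OF f(1) x] by auto
      have "p (u x) = s \<odot>\<^bsub>X\<^esub> f x \<ominus>\<^bsub>X\<^esub> \<zero>\<^bsub>X\<^esub>"
        using k c by (simp add: u_def hom_diff[OF M p(1)] hom_smult[OF p(1)] g(2)[OF x] ph[OF x])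
      also have "\<dots> = s \<odot>\<^bsub>X\<^esub> f x" using k c by (simp add: a_minus_def)
      finally have pu: "p (u x) = s \<odot>\<^bsub>X\<^esub> f x" .
      have "p (h' (cdiff T i x)) = r \<odot>\<^bsub>X\<^esub> (s \<odot>\<^bsub>X\<^esub> f x)"
        using k c pu by (simp add: hom_smult[OF p(1)] flip: h'(2)[OF x])
      also have "\<dots> = (s \<otimes>\<^bsub>R\<^esub> r) \<odot>\<^bsub>X\<^esub> f x"
        using k c X.lm_smult_assoc[of r s "f x"] by (simp add: R.m_comm)
      finally show "(s \<otimes>\<^bsub>R\<^esub> r) \<odot>\<^bsub>X\<^esub> f x = p (h' (cdiff T i x))" by simp
    qed
  qed (use c in simp)
qed

text \<open>Kept apart from the induction in \<open>map_ann_resolution\<close>: the module resolved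
  first, M \<otimes> \<Lambda>, has a type of its own, whereas all further kernels live in
  \<open>'l univ\<close>.\<close>

lemma map_ann_resolution_step:
  assumes fin: "finite_algebra R \<phi> L" and X: "left_module R (restrict_scalars \<phi> X)"
    and res: "projective_resolution (opposite_ring L) X P d \<epsilon>"
    and K: "\<And>s. s \<in> fr_ann R (algebra_module \<phi> L) [^]\<^bsub>ideals_set R\<^esub> n \<Longrightarrow> s \<in> map_ann (restrict_scalars \<phi> (kermod (P 0) X \<epsilon>))"
    and a: "a \<in> fr_ann R (algebra_module \<phi> L) [^]\<^bsub>ideals_set R\<^esub> (Suc n)"
  shows "a \<in> map_ann (restrict_scalars \<phi> X)"
proof -
  note D = projective_resolutionD[OF res]
  let ?rP = "restrict_scalars \<phi> (P 0)" and ?rX = "restrict_scalars \<phi> X"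
  note lP = left_module_restrict_scalars[OF fin D(2)]
  have e: "\<epsilon> \<in> module_hom R ?rP ?rX" "\<epsilon> ` carrier ?rP = carrier ?rX"
    using hom_restrict_scalars[OF fin D(5)] D(6) by auto
  show ?thesis using a unfolding ideals_pow_Suc
  proof induct
    case (prod s t)
    show ?case
      by (rule map_ann_step[OF lP X e _ fr_ann_restrict_fproj[OF fin D(3) prod(2)]])
        (use K[OF prod(1)] in \<open>simp add: kermod_restrict_scalars\<close>)
  next
    case (sum s t)
    then show ?case using map_ann_add[OF X] by blast
  qed
qed

lemma map_ann_resolution:
  fixes L :: "('l, 's) ring_scheme" and X :: "('l, 'l univ) module"
  assumes fin: "finite_algebra R \<phi> L" and "left_module R (restrict_scalars \<phi> X)"
    and "projective_resolution (opposite_ring L) X P d \<epsilon>"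
    and "\<And>i. i \<ge> n \<Longrightarrow> carrier (P i) = {\<zero>\<^bsub>P i\<^esub>}"
    and "a \<in> fr_ann R (algebra_module \<phi> L) [^]\<^bsub>ideals_set R\<^esub> n"
  shows "a \<in> map_ann (restrict_scalars \<phi> X)"
  using assms(2-)
proof (induct n arbitrary: X P d \<epsilon> a)
  case 0
  note D = projective_resolutionD[OF 0(2)]
  interpret X: left_module R "restrict_scalars \<phi> X" by (rule 0)
  have "carrier X = {\<epsilon> \<zero>\<^bsub>P 0\<^esub>}" using D(6) 0(3)[of 0] by simp
  then have X0: "carrier X = {\<zero>\<^bsub>X\<^esub>}" using X.M.zero_closed by auto
  have a: "a \<in> carrier R" using 0(4) unfolding ideals_pow_0 .
  show ?case
    unfolding map_ann_def
  proof (intro CollectI conjI allI ballI impI)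
    fix i f assume f: "f \<in> module_hom R (cterm T i) (restrict_scalars \<phi> X)"
    show "\<exists>h\<in>module_hom R (cterm T (i + 1)) (restrict_scalars \<phi> X).
       \<forall>x\<in>carrier (cterm T i). a \<odot>\<^bsub>restrict_scalars \<phi> X\<^esub> f x = h (cdiff T i x)"
      by (rule bexI[OF _ hom_zero_map[OF 0(1)]])
        (use hom_closed[OF f] X.smult_r_null[OF a] X0 in auto)
  qed (rule a)
next
  case (Suc n)
  note D = projective_resolutionD[OF Suc(3)]
  have e: "\<epsilon> \<in> module_hom R (restrict_scalars \<phi> (P 0)) (restrict_scalars \<phi> X)"
    by (rule hom_restrict_scalars[OF fin D(5)])
  have lK: "left_module R (restrict_scalars \<phi> (kermod (P 0) X \<epsilon>))"
    using left_module_kermod[OF left_module_restrict_scalars[OF fin D(2)] Suc(2) e] by (simp add: kermod_restrict_scalars)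
  show ?case
    by (rule map_ann_resolution_step[OF fin Suc(2,3) _ Suc(5)])
      (rule Suc(1)[OF lK projective_resolution_shift[OF Suc(3)]], use Suc(4) in auto)
qed

end

section \<open>From maps out of T to finite rank on the stabilization\<close>

lemma chain_comp_assoc: "(h \<circ>\<^sub>c g) \<circ>\<^sub>c f = h \<circ>\<^sub>c (g \<circ>\<^sub>c f)"
  by (simp add: chain_comp_def comp_assoc)

lemma stalk_complex_simps:
  "cterm (stalk_complex M) i = (if i = 0 then M else M\<lparr>carrier := {\<zero>\<^bsub>M\<^esub>}\<rparr>)"
  "cdiff (stalk_complex M) i x = \<zero>\<^bsub>M\<^esub>"
  by (simp_all add: stalk_complex_def)

lemma stabilization_fr_ann:
  fixes R :: "('a, 'r) ring_scheme" and T :: "('a, 'a univ) cochain_complex"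
  assumes Tc: "coacyclic R T" and e: "\<epsilon> \<in> module_hom R (cterm T 0) Z" "\<epsilon> ` carrier (cterm T 0) = carrier Z"
    "cdiff T (- 1) ` carrier (cterm T (- 1)) = hker (cterm T 0) Z \<epsilon>"
    and iso: "sg_isomorphic R (stalk_complex Z) (stalk_complex Y)"
    and a: "a \<in> coacyclic.map_ann R T Y"
  shows "a \<in> fr_ann R Z"
proof -
  interpret coacyclic R T by fact
  have ac: "a \<in> carrier R" using a by (simp add: map_ann_def)
  let ?Z = "stalk_complex Z" and ?Y = "stalk_complex Y"
  obtain W s f W' t g where bd: "bounded_complex R ?Z" "bounded_complex R ?Y"
    and r1: "sg_roof R ?Z ?Y W s f" and r2: "sg_roof R ?Y ?Z W' t g"
    and cm: "sg_composite_is_id R ?Z ?Y W s f W' t g"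
    using iso unfolding sg_isomorphic_def by blast
  obtain V :: "('a, 'a univ) cochain_complex" and u v where V: "bounded_complex R V" "sg_denominator R V W u" "chain_map R V W' v"
    "chain_homotopic R V ?Z (g \<circ>\<^sub>c v) (s \<circ>\<^sub>c u)"
    using cm unfolding sg_composite_is_id_def by blast
  have W: "bounded_complex R W" "sg_denominator R W ?Z s" and W': "bounded_complex R W'" "sg_denominator R W' ?Y t" "chain_map R W' ?Z g"
    using r1 r2 by (auto simp: sg_roof_def)
  note cx = bounded_complex_cplx[OF bd(1)] bounded_complex_cplx[OF bd(2)] bounded_complex_cplx[OF V(1)]
    bounded_complex_cplx[OF W(1)] bounded_complex_cplx[OF W'(1)]
  have sm: "chain_map R W ?Z s" and tm: "chain_map R W' ?Y t" and um: "chain_map R V W u"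
    using W W' V by (auto simp: sg_denominator_def)
  have lZ: "left_module R Z" and lY: "left_module R Y"
    using cplxD(1)[OF cx(1), of 0] cplxD(1)[OF cx(2), of 0] by (simp_all add: stalk_complex_simps)
  interpret Z: left_module R Z by (rule lZ)
  interpret Y: left_module R Y by (rule lY)
  note T1 = cplxD[OF T]
  \<comment> \<open>The augmentation, as a chain map from T to Z placed in degree 0.\<close>
  define E where "E i = (if i = 0 then \<epsilon> else (\<lambda>x. \<zero>\<^bsub>Z\<^esub>))" for i :: int
  have E: "chain_map R T ?Z E"
  proof (rule chain_mapI)
    show "E i \<in> module_hom R (cterm T i) (cterm ?Z i)" for i
      using e(1) hom_zero_map[OF cplxD(1)[OF cx(1)], of i "cterm T i"] by (cases "i = 0") (simp_all add: E_def stalk_complex_simps)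
    show "E (i + 1) (cdiff T i x) = cdiff ?Z i (E i x)" if x: "x \<in> carrier (cterm T i)" for i x
    proof (cases "i = - 1")
      case True
      then have "cdiff T (- 1) x \<in> hker (cterm T 0) Z \<epsilon>" using x e(3) by auto
      then show ?thesis using True by (simp add: E_def stalk_complex_simps hker_def)
    qed (simp add: E_def stalk_complex_simps)
  qed
  \<comment> \<open>The augmentation is lifted through the denominator s of the roof and then
    through the denominator u that witnesses the composition of the two roofs.\<close>
  obtain p1 where p1: "chain_map R T W p1" "chain_homotopic R T ?Z E (s \<circ>\<^sub>c p1)"
    using lift_along_denominator[OF cx(4) cx(1) W(2) E] by blast
  obtain p2 where p2: "chain_map R T V p2" "chain_homotopic R T W p1 (u \<circ>\<^sub>c p2)"
    using lift_along_denominator[OF cx(3) cx(4) V(2) p1(1)] by blast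
  define q where "q = v \<circ>\<^sub>c p2"
  have q: "chain_map R T W' q" unfolding q_def by (rule chain_map_comp[OF p2(1) V(3)])
  \<comment> \<open>The composite of the roofs is the identity of Z, in the form g v \<simeq> s u.
    So the augmentation factors, up to homotopy, through W' and then through g.\<close>
  have gq: "chain_homotopic R T ?Z E (g \<circ>\<^sub>c q)"
  proof -
    have 1: "chain_homotopic R T ?Z (g \<circ>\<^sub>c q) (s \<circ>\<^sub>c (u \<circ>\<^sub>c p2))"
      using homotopic_pre[OF T cx(3) p2(1) V(4)] by (simp add: q_def chain_comp_assoc)
    have 2: "chain_homotopic R T ?Z (s \<circ>\<^sub>c p1) (s \<circ>\<^sub>c (u \<circ>\<^sub>c p2))"
      by (rule homotopic_post[OF T cx(4) cx(1) sm chain_mapD(1)[OF chain_map_comp[OF p2(1) um]] p2(2)])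
    have 3: "chain_homotopic R T ?Z E (s \<circ>\<^sub>c (u \<circ>\<^sub>c p2))"
      by (rule homotopic_trans[OF T cx(1) chain_mapD(1)[OF chain_map_comp[OF chain_map_comp[OF p2(1) um] sm]] p1(2) 2])
    have 4: "chain_homotopic R T ?Z (s \<circ>\<^sub>c (u \<circ>\<^sub>c p2)) (g \<circ>\<^sub>c q)"
      by (rule homotopic_sym[OF T cx(1) chain_mapD(1)[OF chain_map_comp[OF chain_map_comp[OF p2(1) um] sm]] 1])
    show ?thesis
      by (rule homotopic_trans[OF T cx(1) chain_mapD(1)[OF chain_map_comp[OF q W'(3)]] 3 4])
  qed
  note tq = chain_map_comp[OF q tm]
  have "null_homotopic R T ?Y (chain_scale ?Y a \<circ>\<^sub>c (t \<circ>\<^sub>c q))"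
  proof -
    \<comment> \<open>A chain map from T to a complex concentrated in degree 0 is a single map k
      that kills boundaries, which is what \<open>map_ann\<close> speaks of.\<close>
    define k where "k = (t \<circ>\<^sub>c q) 0"
    have k: "k \<in> module_hom R (cterm T 0) Y"
      using chain_mapD(1)[OF tq, of 0] by (simp add: k_def stalk_complex_simps)
    have "k (cdiff T (0 - 1) x) = \<zero>\<^bsub>Y\<^esub>" if "x \<in> carrier (cterm T (0 - 1))" for x
      using chain_mapD(3)[OF tq that] by (simp add: k_def stalk_complex_simps)
    from map_annD[OF a k this]
    obtain h where h: "h\<in>module_hom R (cterm T 1) Y" "\<And>x. x\<in>carrier (cterm T 0) \<Longrightarrow> a \<odot>\<^bsub>Y\<^esub> k x = h (cdiff T 0 x)" by auto
    show ?thesis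
    proof (rule null_homotopicI[OF T cx(2)])
      show "(if i = 1 then h else (\<lambda>x. \<zero>\<^bsub>Y\<^esub>)) \<in> module_hom R (cterm T i) (cterm ?Y (i - 1))" for i :: int
        using h(1) hom_zero_map[OF cplxD(1)[OF cx(2)], of "i - 1" "cterm T i"]
        by (cases "i = 1") (simp_all add: stalk_complex_simps)
      fix i x assume x: "x \<in> carrier (cterm T i)"
      show "(chain_scale ?Y a \<circ>\<^sub>c (t \<circ>\<^sub>c q)) i x =
         cdiff ?Y (i - 1) ((if i = 1 then h else (\<lambda>x. \<zero>\<^bsub>Y\<^esub>)) x) \<oplus>\<^bsub>cterm ?Y i\<^esub>
           (if i + 1 = 1 then h else (\<lambda>x. \<zero>\<^bsub>Y\<^esub>)) (cdiff T i x)"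
      proof (cases "i = 0")
        case True
        have "h (cdiff T 0 x) \<in> carrier Y" using hom_closed[OF h(1)] hom_closed[OF T1(2)[of 0]] x True by simp
        moreover have "(chain_scale ?Y a \<circ>\<^sub>c (t \<circ>\<^sub>c q)) 0 x = a \<odot>\<^bsub>Y\<^esub> k x"
          by (simp add: chain_comp_def chain_scale_def k_def stalk_complex_simps)
        ultimately show ?thesis using h(2) x True by (simp add: stalk_complex_simps)
      next
        case False
        have "(t \<circ>\<^sub>c q) i x = \<zero>\<^bsub>Y\<^esub>" using hom_closed[OF chain_mapD(1)[OF tq] x] False by (simp add: stalk_complex_simps)
        then have "(chain_scale ?Y a \<circ>\<^sub>c (t \<circ>\<^sub>c q)) i x = \<zero>\<^bsub>Y\<^esub>"
          using False ac by (simp add: chain_comp_def chain_scale_def stalk_complex_simps)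
        then show ?thesis using False by (simp add: stalk_complex_simps)
      qed
    qed
  qed
  note n1 = this
  note sW = chain_map_scale[OF R cx(5) ac] and sZ = chain_map_scale[OF R cx(1) ac]
  note aq = chain_map_comp[OF q sW]
  have "chain_homotopic R T ?Y (t \<circ>\<^sub>c (chain_scale W' a \<circ>\<^sub>c q)) (chain_scale ?Y a \<circ>\<^sub>c (t \<circ>\<^sub>c q))"
  proof (rule homotopic_cong[OF T cx(2) chain_mapD(1)[OF chain_map_comp[OF aq tm]]])
    show "(t \<circ>\<^sub>c (chain_scale W' a \<circ>\<^sub>c q)) i x = (chain_scale ?Y a \<circ>\<^sub>c (t \<circ>\<^sub>c q)) i x" if x: "x \<in> carrier (cterm T i)" for i x
      using hom_smult[OF chain_mapD(1)[OF tm] ac hom_closed[OF chain_mapD(1)[OF q] x]]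
      by (simp add: chain_comp_def chain_scale_def)
  qed
  from homotopic_trans[OF T cx(2) hom_zero_map[OF cplxD(1)[OF cx(2)]] this n1]
  have "null_homotopic R T W' (chain_scale W' a \<circ>\<^sub>c q)"
    by (rule null_of_denominator_comp[OF cx(5) cx(2) W'(2) aq])
  then have n2: "null_homotopic R T ?Z (g \<circ>\<^sub>c (chain_scale W' a \<circ>\<^sub>c q))"
    by (rule null_homotopic_post[OF T cx(5) cx(1) W'(3)])
  have "chain_homotopic R T ?Z (chain_scale ?Z a \<circ>\<^sub>c (g \<circ>\<^sub>c q)) (g \<circ>\<^sub>c (chain_scale W' a \<circ>\<^sub>c q))"
  proof (rule homotopic_cong[OF T cx(1) chain_mapD(1)[OF chain_map_comp[OF chain_map_comp[OF q W'(3)] sZ]]])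
    show "(chain_scale ?Z a \<circ>\<^sub>c (g \<circ>\<^sub>c q)) i x = (g \<circ>\<^sub>c (chain_scale W' a \<circ>\<^sub>c q)) i x" if x: "x \<in> carrier (cterm T i)" for i x
      using hom_smult[OF chain_mapD(1)[OF W'(3)] ac hom_closed[OF chain_mapD(1)[OF q] x]]
      by (simp add: chain_comp_def chain_scale_def)
  qed
  from homotopic_trans[OF T cx(1) hom_zero_map[OF cplxD(1)[OF cx(1)]] this n2]
  have n3: "null_homotopic R T ?Z (chain_scale ?Z a \<circ>\<^sub>c (g \<circ>\<^sub>c q))" .
  have "chain_homotopic R T ?Z (chain_scale ?Z a \<circ>\<^sub>c E) (chain_scale ?Z a \<circ>\<^sub>c (g \<circ>\<^sub>c q))"
    by (rule homotopic_post[OF T cx(1) cx(1) sZ chain_mapD(1)[OF chain_map_comp[OF q W'(3)]] gq])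
  from homotopic_trans[OF T cx(1) hom_zero_map[OF cplxD(1)[OF cx(1)]] this n3]
  obtain h where h: "\<And>i. h i \<in> module_hom R (cterm T i) (cterm ?Z (i - 1))"
    "\<And>i. h (i + 1) \<in> module_hom R (cterm T (i + 1)) (cterm ?Z i)"
    "\<And>i x. x \<in> carrier (cterm T i) \<Longrightarrow> (chain_scale ?Z a \<circ>\<^sub>c E) i x =
       cdiff ?Z (i - 1) (h i x) \<oplus>\<^bsub>cterm ?Z i\<^esub> h (i + 1) (cdiff T i x)"
    by (rule null_homotopicE[OF T cx(1)]) rule
  \<comment> \<open>In degree 0 the other part of the homotopy equation vanishes, since stalk
    complexes have zero differential: a \<epsilon> is h 1 after the differential of T.\<close>
  have h1: "h 1 \<in> module_hom R (cterm T 1) Z" using h(1)[of 1] by (simp add: stalk_complex_simps)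
  have d0: "cdiff T 0 \<in> module_hom R (cterm T 0) (cterm T 1)" using T1(2)[of 0] by simp
  have ae: "a \<odot>\<^bsub>Z\<^esub> \<epsilon> x = h 1 (cdiff T 0 x)" if x: "x \<in> carrier (cterm T 0)" for x
    using h(3)[OF x] hom_closed[OF h1 hom_closed[OF d0 x]]
    by (simp add: chain_comp_def chain_scale_def stalk_complex_simps E_def)
  \<comment> \<open>The kernel of \<epsilon> is the image of the preceding differential, so the
    differential out of degree 0 descends to Z, and multiplication by a on Z factors through the
    projective in degree 1.\<close>
  have "cdiff T 0 x = \<zero>\<^bsub>cterm T 1\<^esub>" if "x \<in> carrier (cterm T 0)" "\<epsilon> x = \<zero>\<^bsub>Z\<^esub>" for x
  proof -
    have "x \<in> cdiff T (- 1) ` carrier (cterm T (- 1))" unfolding e(3) using that by (simp add: hker_def)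
    then show ?thesis using T1(5)[of _ 0] by auto
  qed
  then obtain j where j: "j \<in> module_hom R Z (cterm T 1)" "\<And>x. x \<in> carrier (cterm T 0) \<Longrightarrow> j (\<epsilon> x) = cdiff T 0 x"
    using hom_factor[OF T1(1) lZ T1(1) e(1,2) d0] by blast
  have "fin_rank R Z Z (\<lambda>z. h 1 (j z))"
    by (rule fin_rank_comp_right[OF fin_rank_fproj_source[OF fproj_T h1 lZ] j(1)])
  then have "fin_rank R Z Z (\<lambda>z. a \<odot>\<^bsub>Z\<^esub> z)"
  proof (rule fin_rank_cong[OF _ lZ lZ])
    fix z assume "z \<in> carrier Z"
    then obtain x where "x \<in> carrier (cterm T 0)" "z = \<epsilon> x" using e(2) by auto
    then show "a \<odot>\<^bsub>Z\<^esub> z = h 1 (j z)" using ae j(2) by simp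
  qed
  then show ?thesis using ac by (simp add: fr_ann_def)
qed

subsection \<open>The cohomology annihilator\<close>

text \<open>A nonempty set in \<open>enat\<close> contains its infimum, and the empty set has
  infimum \<infinity>, which the hypothesis excludes. The bound is given as \<open>Suc n\<close>,
  the number of terms that may be nonzero.\<close>

lemma proj_dim_attained:
  assumes "proj_dim A M = enat n"
  obtains P d \<epsilon> where "projective_resolution A M P d \<epsilon>" "\<And>i. i \<ge> Suc n \<Longrightarrow> carrier (P i) = {\<zero>\<^bsub>P i\<^esub>}"
proof -
  define S where "S = {enat n | n. \<exists>P d \<epsilon>. projective_resolution A M P d \<epsilon> \<and> (\<forall>i>n. carrier (P i) = {\<zero>\<^bsub>P i\<^esub>})}"
  have I: "Inf S = enat n" using assms by (simp add: proj_dim_def S_def)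
  then obtain m where m: "m \<in> S" by (cases "S = {}") (auto simp: Inf_enat_def)
  then have "Inf S \<in> S"
    unfolding Inf_enat_def using LeastI[of "\<lambda>x. x \<in> S" m] by auto
  then have "enat n \<in> S" unfolding I .
  then obtain P d \<epsilon> where "projective_resolution A M P d \<epsilon>" "\<forall>i>n. carrier (P i) = {\<zero>\<^bsub>P i\<^esub>}"
    unfolding S_def by auto
  then show thesis using that by (simp add: Suc_le_eq)
qed

lemma projective_resolution_iso:
  assumes "module_iso R M M' f g" "projective_resolution R M P d \<epsilon>"
  shows "projective_resolution R M' P d (\<lambda>x. f (\<epsilon> x))"
proof -
  note I = module_isoD[OF assms(1)]
  have "f (\<epsilon> x) = \<zero>\<^bsub>M'\<^esub> \<longleftrightarrow> \<epsilon> x = \<zero>\<^bsub>M\<^esub>" if "x \<in> carrier (P 0)" for x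
  proof -
    have "\<epsilon> x \<in> carrier M" using projective_resolutionD(5)[OF assms(2)] that by (auto dest: hom_closed)
    then show ?thesis using I(5) hom_zero[OF I(1,2,3)] hom_zero[OF I(2,1,4)] by metis
  qed
  then have "{x \<in> carrier (P 0). f (\<epsilon> x) = \<zero>\<^bsub>M'\<^esub>} = {x \<in> carrier (P 0). \<epsilon> x = \<zero>\<^bsub>M\<^esub>}" by blast
  moreover have "(\<lambda>x. f (\<epsilon> x)) ` carrier (P 0) = carrier M'"
    using projective_resolutionD(6)[OF assms(2)] I(7) by (simp flip: image_image)
  ultimately show ?thesis
    using assms(2) hom_comp[OF projective_resolutionD(5)[OF assms(2)] I(3)] unfolding projective_resolution_def by simp
qed

text \<open>The choice inside \<open>Ext\<close> depends on the module only through the set of pairs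
  (P, d) that resolve it, and isomorphic modules have the same set. So vanishing of Ext for a module
  passes to its copy without comparing resolutions.\<close>

lemma ext_resolution_iso:
  assumes "module_iso R M M' f g"
  shows "ext_resolution R M = ext_resolution R M'"
proof -
  have "(\<exists>\<epsilon>. projective_resolution R M P d \<epsilon>) \<longleftrightarrow> (\<exists>\<epsilon>. projective_resolution R M' P d \<epsilon>)" for P d
    using projective_resolution_iso[OF assms] projective_resolution_iso[OF module_iso_sym[OF assms]] by blast
  then show ?thesis by (simp add: ext_resolution_def)
qed

lemma syz_ann_in_ca:
  fixes R :: "('a, 'r) ring_scheme"
  assumes N: "noetherian_ring R" and R: "cring R"
    and r: "r \<in> carrier R" "\<And>M :: ('a, 'a univ) module. fg_module R M \<Longrightarrow> r \<in> syz_ann R k M"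
  shows "r \<in> ca_n R (Suc k)"
  unfolding ca_n_def
proof (intro CollectI conjI allI impI r)
  fix M Y :: "('a, 'a univ) module"
  assume fg: "fg_module R M \<and> fg_module R Y"
    obtain P d \<epsilon> where er: "ext_resolution R M = (P, d)" and res: "projective_resolution R M P d \<epsilon>"
    using ext_resolution[OF N R, of M] fg by blast
  note D = projective_resolutionD[OF res]
  have lY: "left_module R Y" using fg fg_module_left_module by blast
  have fgM: "fg_module R M" using fg by blast
  show "r \<in> annihilator R (Ext R (Suc k) M Y)"
    unfolding Ext_eq[OF er]
  proof (rule iffD2[OF Hom_cohomology_ann_Suc[where P = P and d = d, OF R D(2) lY D(4) D(9) r(1)]], assumption, intro ballI impI)
    fix f assume f: "f \<in> module_hom R (P (Suc k)) Y" "\<forall>x\<in>carrier (P (Suc (Suc k))). f (d (Suc k) x) = \<zero>\<^bsub>Y\<^esub>"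
    show "\<exists>g\<in>module_hom R (P k) Y. \<forall>x\<in>carrier (P (Suc k)). r \<odot>\<^bsub>Y\<^esub> f x = g (d k x)"
      by (rule syz_ann_ext[OF N R fgM res r(2)[OF fgM] lY f(1)]) (use f(2) in simp)
  qed
qed

text \<open>\<open>ca\<close> quantifies over modules in \<open>'a univ\<close> only, so X is
  replaced by a copy M. Elements that kill Ext(M, -) have finite rank on M by
  \<open>ext_ann_fr_ann\<close>, whose condition on functionals is the vanishing of Ext(X,
  R).\<close>

lemma ca_subset_fr_ann:
  fixes R :: "('a, 'r) ring_scheme"
  assumes N: "noetherian_ring R" and R: "cring R" and X: "mcm R X"
  shows "ca R \<subseteq> fr_ann R X"
proof
  fix r assume "r \<in> ca R"
  then obtain n where r: "r \<in> ca_n R n" by (auto simp: ca_def)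
  interpret R: cring R by fact
  note lR = left_module_regular[OF R.ring_axioms]
  have rc: "r \<in> carrier R" using r by (simp add: ca_n_def)
  have fgX: "fg_module R X" using X by (simp add: mcm_def)
  obtain M :: "('a, 'a univ) module" and f g where M: "module_iso R X M f g" using fg_module_copy[OF fgX] by blast
  note fgM = fg_module_iso[OF M fgX] and I = module_isoD[OF M]
  obtain P d \<epsilon> where er: "ext_resolution R M = (P, d)" and res: "projective_resolution R M P d \<epsilon>"
    using ext_resolution[OF N R fgM] by blast
  note D = projective_resolutionD[OF res]
  note er' = er[folded ext_resolution_iso[OF M]]
  have "r \<in> fr_ann R M"
  proof (cases n)
    case (Suc k)
    show ?thesis
    proof (rule ext_ann_fr_ann[OF N R fgM res rc])
      fix Y :: "('a, 'a univ) module" and h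
      assume Y: "fg_module R Y" and h: "h \<in> module_hom R (P (Suc k)) Y"
        "\<And>x. x \<in> carrier (P (Suc (Suc k))) \<Longrightarrow> h (d (Suc k) x) = \<zero>\<^bsub>Y\<^esub>"
      have "r \<in> annihilator R (Ext R (Suc k) M Y)" using r Suc fgM Y by (auto simp: ca_n_def)
      then have "r \<in> annihilator R (Hom_cohomology R P d Y (Suc k))" unfolding Ext_eq[OF er] .
      then have "\<forall>f\<in>module_hom R (P (Suc k)) Y. (\<forall>x\<in>carrier (P (Suc (Suc k))). f (d (Suc k) x) = \<zero>\<^bsub>Y\<^esub>) \<longrightarrow>
        (\<exists>g\<in>module_hom R (P k) Y. \<forall>x\<in>carrier (P (Suc k)). r \<odot>\<^bsub>Y\<^esub> f x = g (d k x))"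
        by (rule iffD1[OF Hom_cohomology_ann_Suc[where P = P and d = d,
            OF R D(2) fg_module_left_module[OF Y] D(4) D(9) rc], rotated])
      from bspec[OF this h(1)] h(2)
      show "\<exists>g\<in>module_hom R (P k) Y. \<forall>x\<in>carrier (P (Suc k)). r \<odot>\<^bsub>Y\<^esub> h x = g (d k x)" by simp
    next
      fix i q assume q: "q \<in> module_hom R (P (Suc i)) (regular_module R)"
        "\<And>x. x \<in> carrier (P (Suc (Suc i))) \<Longrightarrow> q (d (Suc i) x) = \<zero>\<^bsub>R\<^esub>"
      show "\<exists>g\<in>module_hom R (P i) (regular_module R). \<forall>x\<in>carrier (P (Suc i)). q x = g (d i x)"
      proof (rule Hom_cohomology_zero_Suc[where P = P and d = d, OF R D(2) lR D(4) D(9) R.zero_closed])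
        show "carrier (Hom_cohomology R P d (regular_module R) (Suc i)) = {\<zero>\<^bsub>Hom_cohomology R P d (regular_module R) (Suc i)\<^esub>}"
          using X unfolding mcm_def Ext_eq[OF er'] by simp
      qed (use q in auto)
    qed
  next
    \<comment> \<open>Ext in degree 0 is Hom: r kills the augmentation, which is a cocycle with
      values in M, and therefore all of M.\<close>
    case 0
    interpret M: left_module R M by (rule I)
    have "r \<in> annihilator R (Ext R 0 M M)" using r 0 fgM by (auto simp: ca_n_def)
    then have r0: "r \<in> annihilator R (Hom_cohomology R P d M 0)" unfolding Ext_eq[OF er] .
    have "r \<odot>\<^bsub>M\<^esub> \<epsilon> x = \<zero>\<^bsub>M\<^esub>" if x: "x \<in> carrier (P 0)" for x
      by (rule Hom_cohomology_ann_0[where P = P and d = d, OF R D(2) I(2) D(4) D(9) rc r0 D(5) D(10) x])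
    then have "r \<odot>\<^bsub>M\<^esub> z = \<zero>\<^bsub>M\<^esub>" if "z \<in> carrier M" for z using that D(6) by (metis imageE)
    then show ?thesis using rc by (auto simp: fr_ann_def intro: fin_rank.zero)
  qed
  then show "r \<in> fr_ann R X" by (rule fr_ann_iso[OF R module_iso_sym[OF M]])
qed

theorem proposition6p5:
  fixes R :: "('a, 'r) ring_scheme" and L :: "('l, 's) ring_scheme"
    and \<phi> :: "'a \<Rightarrow> 'l" and \<delta> :: nat
  assumes "gorenstein R"
    and "finite_algebra R \<phi> L"
    and "gl_dim (opposite_ring L) = enat \<delta>"
    and "inj_on \<phi> (carrier R)"
    and "mcm R (algebra_module \<phi> L)"
  shows "(\<forall>(M :: ('a, 'm) module) (Z :: ('a, 'z) module) (e :: nat).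
            fg_module R M \<and>
            proj_dim (opposite_ring L) (base_change R \<phi> L M) = enat e \<and>
            is_stabilization R (restrict_scalars \<phi> (base_change R \<phi> L M)) Z \<longrightarrow>
            stable_ann R (algebra_module \<phi> L) [^]\<^bsub>ideals_set R\<^esub> (e + 1) \<subseteq> stable_ann R Z) \<and>
         (split_mono R (regular_module R) (algebra_module \<phi> L) \<phi> \<longrightarrow>
            stable_ann R (algebra_module \<phi> L) [^]\<^bsub>ideals_set R\<^esub> (\<delta> + 1) \<subseteq> ca R \<and>
            ca R \<subseteq> stable_ann R (algebra_module \<phi> L))"
proof -
  have N: "noetherian_ring R" and R: "cring R" using assms(1) by (auto simp: gorenstein_def)
  interpret R: cring R by (rule R)
  note fin = assms(2)
  let ?I = "fr_ann R (algebra_module \<phi> L)"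
  have I: "stable_ann R (algebra_module \<phi> L) = ?I"
    by (rule stable_ann_eq[OF R finite_algebraD(5)[OF fin]])
  have 1: "?I [^]\<^bsub>ideals_set R\<^esub> (Suc e) \<subseteq> stable_ann R Z"
    if pd: "proj_dim (opposite_ring L) (base_change R \<phi> L M) = enat e"
      and st: "is_stabilization R (restrict_scalars \<phi> (base_change R \<phi> L M)) Z"
    for M :: "('a, 'm) module" and Z :: "('a, 'z) module" and e
  proof
    fix a assume a: "a \<in> ?I [^]\<^bsub>ideals_set R\<^esub> (Suc e)"
    let ?B = "base_change R \<phi> L M"
    have Z: "mcm R Z" and iso: "sg_isomorphic R (stalk_complex Z) (stalk_complex (restrict_scalars \<phi> ?B))"
      using st by (auto simp: is_stabilization_def)
    obtain T :: "('a, 'a univ) cochain_complex" and \<epsilon> where T: "coacyclic R T"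
      "\<epsilon> \<in> module_hom R (cterm T 0) Z" "\<epsilon> ` carrier (cterm T 0) = carrier Z"
      "cdiff T (- 1) ` carrier (cterm T (- 1)) = hker (cterm T 0) Z \<epsilon>"
      by (rule coacyclic_exists[OF N R Z])
    interpret T: coacyclic R T by (rule T)
    \<comment> \<open>The module axioms for M \<otimes> \<Lambda> over R are read off from
      \<open>sg_isomorphic\<close>, which includes that both complexes consist of finitely generated
      modules.\<close>
    have "bounded_complex R (stalk_complex (restrict_scalars \<phi> ?B))" using iso by (simp add: sg_isomorphic_def)
    from cplxD(1)[OF bounded_complex_cplx[OF this], of 0]
    have lB: "left_module R (restrict_scalars \<phi> ?B)" by (simp add: stalk_complex_simps)
    obtain P d \<eta> where P: "projective_resolution (opposite_ring L) ?B P d \<eta>"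
      "\<And>i. i \<ge> Suc e \<Longrightarrow> carrier (P i) = {\<zero>\<^bsub>P i\<^esub>}"
      by (rule proj_dim_attained[OF pd]) rule
    note D = projective_resolutionD[OF P(1)]
    have lK: "left_module R (restrict_scalars \<phi> (kermod (P 0) ?B \<eta>))"
      using left_module_kermod[OF left_module_restrict_scalars[OF fin D(2)] lB hom_restrict_scalars[OF fin D(5)]]
      by (simp add: kermod_restrict_scalars)
    have "a \<in> T.map_ann (restrict_scalars \<phi> ?B)"
      by (rule T.map_ann_resolution_step[OF fin lB P(1) _ a])
        (rule T.map_ann_resolution[OF fin lK projective_resolution_shift[OF P(1)]], use P(2) in auto)
    then have "a \<in> fr_ann R Z" by (rule stabilization_fr_ann[OF T iso])
    then show "a \<in> stable_ann R Z" using stable_ann_eq[OF R, of Z] Z by (simp add: mcm_def)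
  qed
  have 2: "?I [^]\<^bsub>ideals_set R\<^esub> (Suc \<delta>) \<subseteq> ca R"
    if split: "split_mono R (regular_module R) (algebra_module \<phi> L) \<phi>"
  proof
    fix a assume a: "a \<in> ?I [^]\<^bsub>ideals_set R\<^esub> (Suc \<delta>)"
    have ac: "a \<in> carrier R" by (rule ideals_pow_carrier[OF R.ring_axioms _ a]) (auto simp: fr_ann_def)
    have "a \<in> syz_ann R (2 * Suc \<delta>) M" if fgM: "fg_module R M" for M :: "('a, 'a univ) module"
    proof -
      obtain X :: "('l, 'l univ) module" where X: "fg_module (opposite_ring L) X"
        "stable_retract R M (restrict_scalars \<phi> X)"
        using split_retract[OF fin split fgM] by blast
      have "proj_dim (opposite_ring L) X \<le> enat \<delta>"
        unfolding assms(3)[symmetric] gl_dim_def by (rule Sup_upper) (use X in blast)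
      then obtain k where k: "proj_dim (opposite_ring L) X = enat k" "k \<le> \<delta>" by (cases "proj_dim (opposite_ring L) X") auto
      obtain P d \<eta> where P: "projective_resolution (opposite_ring L) X P d \<eta>"
        "\<And>i. i \<ge> Suc k \<Longrightarrow> carrier (P i) = {\<zero>\<^bsub>P i\<^esub>}"
        by (rule proj_dim_attained[OF k(1)]) rule
      have fgX: "fg_module R (restrict_scalars \<phi> X)" by (rule fg_module_restrict_scalars[OF fin X(1)])
      obtain X' :: "('a, 'a univ) module" and f g where X': "module_iso R (restrict_scalars \<phi> X) X' f g"
        using fg_module_copy[OF fgX] by blast
      note I' = module_isoD[OF X']
      \<comment> \<open>The resolution of X may be shorter than \<delta>. The global bound is used
        throughout, so that one degree of Ext serves all modules M at once.\<close>
      have "a \<in> syz_ann R (2 * Suc \<delta>) X'"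
        by (rule projective_resolution_syz_ann[OF fin N I'(1) P(1) _ X' a]) (use P(2) k(2) in simp)
      moreover have "stable_retract R M X'"
      proof -
        obtain i p t where h: "i \<in> module_hom R M (restrict_scalars \<phi> X)" "p \<in> module_hom R (restrict_scalars \<phi> X) M"
          "fin_rank R M M t" "\<forall>x\<in>carrier M. x = p (i x) \<oplus>\<^bsub>M\<^esub> t x"
          using X(2) unfolding stable_retract_def by blast
        show ?thesis
          unfolding stable_retract_def
          by (rule bexI[OF _ hom_comp[OF h(1) I'(3)]], rule bexI[OF _ hom_comp[OF I'(4) h(2)]], rule exI[of _ t])
            (use h I'(5) hom_closed[OF h(1)] in auto)
      qed
      ultimately show ?thesis
        using syz_ann_stable_retract[OF N R fgM fg_module_iso[OF X' fgX]] by blast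
    qed
    \<comment> \<open>Finite rank on an n-th syzygy kills Ext in degree n + 1, hence the
      successor.\<close>
    then have "a \<in> ca_n R (Suc (2 * Suc \<delta>))" by (rule syz_ann_in_ca[OF N R ac])
    then show "a \<in> ca R" unfolding ca_def by blast
  qed
  have 3: "ca R \<subseteq> ?I" by (rule ca_subset_fr_ann[OF N R assms(5)])
  show ?thesis
    unfolding I Suc_eq_plus1[symmetric]
  proof (intro conjI allI impI)
    fix M :: "('a, 'm) module" and Z :: "('a, 'z) module" and e
    assume "fg_module R M \<and> proj_dim (opposite_ring L) (base_change R \<phi> L M) = enat e \<and>
      is_stabilization R (restrict_scalars \<phi> (base_change R \<phi> L M)) Z"
    then show "?I [^]\<^bsub>ideals_set R\<^esub> (Suc e) \<subseteq> stable_ann R Z" using 1 by blast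
  qed (rule 2 3, assumption?)+
qed

end
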